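(* Let $\Lambda$ be a $d$-dimensional lattice, let $\bm x \in\mathbb{R}^d$, let $\bm y \in (\mathbb{R}^d\setminus\Lambda^* )\cup\{\bm 0\}$, let $\nu \in \mathbb{C}$ and let $\bm\alpha\in\mathbb{N}^d$. Then for $\lambda > 0$ it holds that $$ Z^{\rm reg}_{\Lambda,\nu,\bm\alpha}(\bm x,\bm y) = \sum_{k=0}^{\lfloor |\bm\alpha|/2\rfloor} \frac{(\pi/\lambda^2)^{\nu/2-k}}{\Gamma(\nu/2-k)} \Bigg[ \sum_{\bm z\in \Lambda-\bm x} h_{k,\bm\alpha}(\bm z)G_{\nu-2k}(\bm{z}/\lambda)e^{-2\pi i\bm y\cdot \bm z} +(-1)^k \frac{\lambda^{d}}{i^{|\bm\alpha|}V_{\Lambda}} \bigg[ h_{k,\bm\alpha}(\bm y)G^{\mathrm{reg}}_{d-\nu,\lambda,k,|\bm\alpha|}(\bm y) +\lambda^{2|\bm\alpha|-4k}\sum_{\substack{\bm p\in\Lambda^{*}+\bm y\\ \bm p\neq \bm y}} h_{k,\bm\alpha}(\bm p)G_{d-\nu+2(|\bm\alpha|-k)} (\lambda \bm p)e^{-2\pi i\bm x\cdot(\bm p-\bm y)} \bigg] \Bigg]. $$ Here $G^{\mathrm{reg}}_{t,\lambda,k,n}$ is defined as follows. If $t\in\mathbb{C}\setminus(-2\mathbb{N})$, or $t=-2\ell$ with $\ell\in\mathbb{N}$ and $\ell<n-k$, then $$ G^{\mathrm{reg}}_{t,\lambda,k,n}(\bm y) =-\lambda^{2n-4k}g_{t+2(n-k)}(\lambda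 \bm y). $$ If $\ell\in\mathbb{N}$, $\ell\ge n-k$, then (for $\bm y\neq\bm 0$) $$ G^{\mathrm{reg}}_{-2\ell,\lambda,k,n}(\bm y) = \lambda^{2n-4k} G_{2(n-\ell-k)}(\lambda \bm y) + \lambda^{2(\ell-k)} \frac{ (- \pi \bm y^2 )^{\ell+k-n} }{(\ell+k-n)!} \Big( \log (\pi \bm y^{2}) + H_{\ell,k,n,d}\Big), $$ which admits the following representation, also providing its value at $\bm y=\bm 0$: $$ G^{\mathrm{reg}}_{-2\ell,\lambda,k,n}(\bm y) = \lambda^{2(\ell-k)} \frac{(-\pi\bm y^2)^{\ell+k-n}}{(\ell+k-n)!}H'_{\ell,\lambda,k,d} -\lambda^{2n-4k}\sum_{\substack{j=0 \\ j\neq \ell+k-n}}^{\infty}\frac{(-\pi\lambda^2 \bm y^2)^j}{(j+n-\ell-k)\,j!}. $$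
   Context: $\mathbb{N}=\{0,1,2,\dots\}$, $d\ge 1$ is an integer, $0^0=1$. For $\bm\alpha\in\mathbb{N}^d$: $|\bm\alpha|=\sum_j\alpha^{(j)}$, $\bm z^{\bm\alpha}=\prod_j (z^{(j)})^{\alpha^{(j)}}$; for vectors $|\cdot|$ is the Euclidean norm and $\bm y^2=|\bm y|^2$ for $\bm y\in\mathbb{R}^d$. A $d$-dimensional lattice is $\Lambda=A\mathbb{Z}^d$, $A\in\mathbb{R}^{d\times d}$ regular; $V_\Lambda=|\det A|$, $\Lambda^*=A^{-T}\mathbb{Z}^d$. Anisotropic Epstein zeta function: $Z_{\Lambda,\nu,\bm\alpha}(\bm x,\bm y)$ is the meromorphic continuation in $\nu$ to $\mathbb{C}$ of $\sum_{\bm z\in\Lambda,\,\bm z\ne\bm x} e^{-2\pi i\bm y\cdot\bm z}(\bm z-\bm x)^{\bm\alpha}|\bm z-\bm x|^{-\nu}$, $\mathrm{Re}(\nu)>d+|\bm\alpha|$. Regularized anisotropic Epstein zeta function: $$Z_{\Lambda, \nu,\bm\alpha}^{\mathrm{reg}}(\bm x,\bm y) =e^{2\pi i\bm x\cdot\bm y} Z_{\Lambda,\nu,\bm\alpha}(\bm x,\bm y) -\frac{\hat s^{(\bm\alpha)}_{\nu}(\bm y)}{(-2\pi i)^{|\bm\alpha|}V_{\Lambda}},\qquad \bm y\neq \bm 0,$$ continuously extended to $\bm y=\bm 0$, where $\hat s^{(\bm\alpha)}_\nu$ is the $\bm\alpha$-th partial derivative of $\hat s_\nu$, with $\hat{s}_\nu(\bm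 y) = \frac{\pi^{\nu/2}}{\Gamma(\nu/2)}\Gamma((d-\nu)/2)(\pi \bm y^2)^{(\nu - d)/2}$ for $\nu\notin d+2\mathbb{N}$, and $\hat s_{d+2\ell}(\bm y)= \frac{\pi^{\ell+d/2}}{\Gamma(\ell+d/2)}\frac{(-1)^{\ell+1}}{\ell!} ( \pi \bm y^2 )^{\ell} \log (\pi \bm y^{2})$ for $\ell\in\mathbb{N}$. Upper Crandall function: $G_\nu(\bm z)=\Gamma(\nu/2,\pi\bm z^2)/(\pi\bm z^2)^{\nu/2}$ for $\bm z\in\mathbb{R}^d\setminus\{\bm 0\}$, $\nu\in\mathbb{C}$, with $\Gamma(s,x)$ the upper incomplete Gamma function, and $G_\nu(\bm 0)=-2/\nu$. Lower Crandall function: for $\nu\in\mathbb{C}\setminus(-2\mathbb{N})$, $g_\nu(\bm z)=\gamma(\nu/2,\pi\bm z^2)/(\pi\bm z^2)^{\nu/2}$ for $\bm z\ne\bm 0$ and $g_\nu(\bm 0)=2/\nu$, with $\gamma(s,x)$ the lower incomplete Gamma function ($\int_0^xt^{s-1}e^{-t}dt$ for $\mathrm{Re}(s)>0$, continued holomorphically to $s\in\mathbb{C}\setminus(-\mathbb{N})$). $1/\Gamma$ is the entire reciprocal Gamma function; summands in which $h_{k,\bm\alpha}$ vanishes are zero, and if $\nu=2k$ the product $G_{\nu-2k}(\bm 0)/\Gamma(\nu/2-k)$ is understood as its limit $-1$. Harmonic polynomials $h_{k,\bm\alpha}$: the uniquely determined harmonic polynomials, homogeneous of degree $|\bm\alpha|-2k$,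 $0\le k\le\lfloor|\bm\alpha|/2\rfloor$, with $\bm y^{\bm\alpha}=\sum_{k=0}^{\lfloor|\bm\alpha|/2\rfloor}|\bm y|^{2k}h_{k,\bm\alpha}(\bm y)$ for all $\bm y\in\mathbb{R}^d$. Constants: $H_{\ell,k,n,d}=H_{\ell}-H_{\ell+k-n}+\psi(\ell+d/2)-\psi(\ell+d/2-k)$ and $H'_{\ell,\lambda,k,d}=H_{\ell}+\psi(\ell+d/2)-\psi(\ell+d/2-k)-\gamma -2\log\lambda$, with $H_\ell$ the $\ell$-th harmonic number, $\psi=\Gamma'/\Gamma$ the digamma function, and $\gamma$ the Euler–Mascheroni constant. *)

theory Defs
  imports "HOL-Complex_Analysis.Complex_Analysis"
begin

text \<open>
  The dimension is \<open>d = CARD('n)\<close>, and \<open>y\<^sup>2\<close> for a vector \<open>y\<close> is \<open>(norm y)\<^sup>2\<close>. Complex powers of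
  positive reals are written \<open>of_real r powr s\<close>, and \<open>1/\<Gamma>\<close> is the entire function \<open>rGamma\<close>.
\<close>

section \<open>Lattices\<close>

text \<open>\<open>lattice_of A\<close> is \<open>A \<int>\<^sup>d\<close>; it is only used for invertible \<open>A\<close>.\<close>

definition lattice_of :: "real^'n^'n \<Rightarrow> (real^'n) set" where
  "lattice_of A = (\<lambda>m. A *v m) ` {m. \<forall>j. m $ j \<in> \<int>}"

definition dual_lattice_of :: "real^'n^'n \<Rightarrow> (real^'n) set" where
  "dual_lattice_of A = lattice_of (transpose (matrix_inv A))"

definition covolume :: "real^'n^'n \<Rightarrow> real" where
  "covolume A = \<bar>det A\<bar>"

section \<open>Multi-indices, partial derivatives, harmonic polynomials\<close>

definition mi_size :: "nat^'n \<Rightarrow> nat" where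
  "mi_size \<alpha> = (\<Sum>j\<in>UNIV. \<alpha> $ j)"

definition mi_power :: "real^'n \<Rightarrow> nat^'n \<Rightarrow> real" where
  "mi_power z \<alpha> = (\<Prod>j\<in>UNIV. (z $ j) ^ (\<alpha> $ j))"

definition partial_derivative ::
    "'n \<Rightarrow> (real^'n \<Rightarrow> 'b::real_normed_vector) \<Rightarrow> real^'n \<Rightarrow> 'b" where
  "partial_derivative j f y = vector_derivative (\<lambda>t. f (y + t *\<^sub>R axis j 1)) (at 0)"

text \<open>
  The index type carries no order, so the order in which the \<open>\<alpha> $ j\<close> differentiations in each
  coordinate \<open>j\<close> are carried out is chosen arbitrarily. Only smooth functions are
  differentiated below, for which it is irrelevant.
\<close>

definition mi_derivative ::
    "nat^'n \<Rightarrow> (real^'n \<Rightarrow> 'b::real_normed_vector) \<Rightarrow> real^'n \<Rightarrow> 'b" where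
  "mi_derivative \<alpha> f = foldr partial_derivative (SOME js. \<forall>j. count_list js j = \<alpha> $ j) f"

definition harmonic :: "(real^'n \<Rightarrow> real) \<Rightarrow> bool" where
  "harmonic h \<longleftrightarrow> (\<forall>y. (\<Sum>j\<in>UNIV. partial_derivative j (partial_derivative j h) y) = 0)"

definition homogeneous_polynomial :: "nat \<Rightarrow> (real^'n \<Rightarrow> real) \<Rightarrow> bool" where
  "homogeneous_polynomial m h \<longleftrightarrow>
     real_polynomial_function h \<and> (\<forall>c y. h (c *\<^sub>R y) = c ^ m * h y)"

text \<open>
  \<open>harmonic_part \<alpha> k\<close> is \<open>h\<^bsub>k,\<alpha>\<^esub>\<close>. It is set to \<open>0\<close> outside \<open>0 \<le> k \<le> \<lfloor>|\<alpha>|/2\<rfloor>\<close>, so that the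
  family is unique as a function on all of \<open>nat\<close>.
\<close>

definition harmonic_part :: "nat^'n \<Rightarrow> nat \<Rightarrow> real^'n \<Rightarrow> real" where
  "harmonic_part \<alpha> = (THE h.
     (\<forall>k \<le> mi_size \<alpha> div 2.
        homogeneous_polynomial (mi_size \<alpha> - 2 * k) (h k) \<and> harmonic (h k)) \<and>
     (\<forall>k > mi_size \<alpha> div 2. h k = (\<lambda>y. 0)) \<and>
     (\<forall>y. mi_power y \<alpha> = (\<Sum>k = 0..mi_size \<alpha> div 2. norm y ^ (2 * k) * h k y)))"

section \<open>Crandall functions\<close>

text \<open>\<open>\<Gamma>(s,x)\<close>, for \<open>x > 0\<close> and every complex \<open>s\<close>.\<close>

definition upper_inc_Gamma :: "complex \<Rightarrow> real \<Rightarrow> complex" where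
  "upper_inc_Gamma s x =
     integral {x..} (\<lambda>t. of_real t powr (s - 1) * of_real (exp (- t)))"

text \<open>
  \<open>\<gamma>(s,x)\<close>, for \<open>x > 0\<close> and \<open>s \<notin> \<int>\<^sub>\<le>\<^sub>0\<close>, as the holomorphic continuation from \<open>Re s > 0\<close>;
  the value \<open>0\<close> at \<open>s \<in> \<int>\<^sub>\<le>\<^sub>0\<close> only serves to make the continuation a unique total function.
\<close>

definition lower_inc_Gamma :: "complex \<Rightarrow> real \<Rightarrow> complex" where
  "lower_inc_Gamma s x = (THE F.
     F holomorphic_on (- \<int>\<^sub>\<le>\<^sub>0) \<and> (\<forall>s\<in>\<int>\<^sub>\<le>\<^sub>0. F s = 0) \<and>
     (\<forall>s. Re s > 0 \<longrightarrow>
        F s = integral {0..x} (\<lambda>t. of_real t powr (s - 1) * of_real (exp (- t))))) s"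

definition upper_Crandall :: "complex \<Rightarrow> real^'n \<Rightarrow> complex" where
  "upper_Crandall \<nu> z =
     (if z = 0 then - 2 / \<nu>
      else upper_inc_Gamma (\<nu> / 2) (pi * (norm z)\<^sup>2) / of_real (pi * (norm z)\<^sup>2) powr (\<nu> / 2))"

definition lower_Crandall :: "complex \<Rightarrow> real^'n \<Rightarrow> complex" where
  "lower_Crandall \<nu> z =
     (if z = 0 then 2 / \<nu>
      else lower_inc_Gamma (\<nu> / 2) (pi * (norm z)\<^sup>2) / of_real (pi * (norm z)\<^sup>2) powr (\<nu> / 2))"

text \<open>
  The product \<open>G\<^sub>\<mu>(z) / \<Gamma>(\<mu>/2)\<close>. At \<open>z = 0\<close> it equals \<open>-1 / \<Gamma>(\<mu>/2 + 1)\<close> for \<open>\<mu> \<noteq> 0\<close>, and is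
  replaced by its limit \<open>-1\<close> at \<open>\<mu> = 0\<close>, where \<open>G\<^sub>\<mu>(0)\<close> has a pole.
\<close>

definition upper_Crandall_over_Gamma :: "complex \<Rightarrow> real^'n \<Rightarrow> complex" where
  "upper_Crandall_over_Gamma \<mu> z =
     (if \<mu> = 0 \<and> z = 0 then - 1 else upper_Crandall \<mu> z * rGamma (\<mu> / 2))"

section \<open>Regularized upper Crandall function\<close>

definition H_const :: "nat \<Rightarrow> nat \<Rightarrow> nat \<Rightarrow> nat \<Rightarrow> real" where
  "H_const l k n d = harm l - harm (l + k - n)
     + Digamma (real l + real d / 2) - Digamma (real l + real d / 2 - real k)"

definition H'_const :: "nat \<Rightarrow> real \<Rightarrow> nat \<Rightarrow> nat \<Rightarrow> real" where
  "H'_const l lam k d = harm l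
     + Digamma (real l + real d / 2) - Digamma (real l + real d / 2 - real k)
     - euler_mascheroni - 2 * ln lam"

text \<open>
  The two representations of the regularized function at \<open>t = -2l\<close>, where \<open>l \<ge> n - k\<close> and
  \<open>2k \<le> n\<close>; the first one is for \<open>y \<noteq> 0\<close>, the second one for all \<open>y\<close>.
\<close>

definition Crandall_reg_log :: "nat \<Rightarrow> real \<Rightarrow> nat \<Rightarrow> nat \<Rightarrow> real^'n \<Rightarrow> complex" where
  "Crandall_reg_log l lam k n y =
     of_real (lam powi (2 * int n - 4 * int k))
       * upper_Crandall (2 * (of_nat n - of_nat l - of_nat k)) (lam *\<^sub>R y)
     + of_real (lam powi (2 * (int l - int k))
       * ((- pi * (norm y)\<^sup>2) ^ (l + k - n) / fact (l + k - n))
       * (ln (pi * (norm y)\<^sup>2) + H_const l k n CARD('n)))"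

definition Crandall_reg_series :: "nat \<Rightarrow> real \<Rightarrow> nat \<Rightarrow> nat \<Rightarrow> real^'n \<Rightarrow> real" where
  "Crandall_reg_series l lam k n y =
     lam powi (2 * (int l - int k))
       * ((- pi * (norm y)\<^sup>2) ^ (l + k - n) / fact (l + k - n)) * H'_const l lam k CARD('n)
     - lam powi (2 * int n - 4 * int k)
       * (\<Sum>\<^sub>\<infinity>j\<in>- {l + k - n}. (- pi * lam\<^sup>2 * (norm y)\<^sup>2) ^ j
             / ((real j + real n - real l - real k) * fact j))"

definition Crandall_reg :: "complex \<Rightarrow> real \<Rightarrow> nat \<Rightarrow> nat \<Rightarrow> real^'n \<Rightarrow> complex" where
  "Crandall_reg t lam k n y =
     (if \<exists>l::nat. t = - 2 * of_nat l \<and> n \<le> l + k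
      then let l = (THE l::nat. t = - 2 * of_nat l) in
        (if y = 0 then of_real (Crandall_reg_series l lam k n y)
         else Crandall_reg_log l lam k n y)
      else - of_real (lam powi (2 * int n - 4 * int k))
             * lower_Crandall (t + 2 * (of_nat n - of_nat k)) (lam *\<^sub>R y))"

section \<open>Epstein zeta functions\<close>

text \<open>
  The meromorphic continuation in \<open>\<nu>\<close> of the lattice sum, normalized so that removable
  singularities are removed and the value at a pole is \<open>0\<close>.
\<close>

definition epstein_zeta ::
    "(real^'n) set \<Rightarrow> complex \<Rightarrow> nat^'n \<Rightarrow> real^'n \<Rightarrow> real^'n \<Rightarrow> complex" where
  "epstein_zeta \<Lambda> \<nu> \<alpha> x y = (THE F.
     F nicely_meromorphic_on UNIV \<and>
     (\<forall>\<nu>. Re \<nu> > real (CARD('n) + mi_size \<alpha>) \<longrightarrow>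
        ((\<lambda>z. exp (- 2 * of_real pi * \<i> * of_real (y \<bullet> z)) * of_real (mi_power (z - x) \<alpha>)
               * of_real (norm (z - x)) powr (- \<nu>)) has_sum F \<nu>) (\<Lambda> - {x}))) \<nu>"

definition s_hat :: "complex \<Rightarrow> real^'n \<Rightarrow> complex" where
  "s_hat \<nu> y =
     (if \<exists>l::nat. \<nu> = of_nat CARD('n) + 2 * of_nat l
      then let l = (THE l::nat. \<nu> = of_nat CARD('n) + 2 * of_nat l) in
        of_real (pi powr (real l + real CARD('n) / 2) / Gamma (real l + real CARD('n) / 2)
          * ((- 1) ^ (l + 1) / fact l) * (pi * (norm y)\<^sup>2) ^ l * ln (pi * (norm y)\<^sup>2))
      else of_real pi powr (\<nu> / 2) * rGamma (\<nu> / 2) * Gamma ((of_nat CARD('n) - \<nu>) / 2)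
          * of_real (pi * (norm y)\<^sup>2) powr ((\<nu> - of_nat CARD('n)) / 2))"

text \<open>The regularized function away from \<open>y = 0\<close>, and its continuous extension to \<open>y = 0\<close>.\<close>

definition epstein_zeta_reg_nz ::
    "real^'n^'n \<Rightarrow> complex \<Rightarrow> nat^'n \<Rightarrow> real^'n \<Rightarrow> real^'n \<Rightarrow> complex" where
  "epstein_zeta_reg_nz A \<nu> \<alpha> x y =
     exp (2 * of_real pi * \<i> * of_real (x \<bullet> y)) * epstein_zeta (lattice_of A) \<nu> \<alpha> x y
     - mi_derivative \<alpha> (s_hat \<nu>) y
         / ((- 2 * of_real pi * \<i>) ^ mi_size \<alpha> * of_real (covolume A))"

definition epstein_zeta_reg ::
    "real^'n^'n \<Rightarrow> complex \<Rightarrow> nat^'n \<Rightarrow> real^'n \<Rightarrow> real^'n \<Rightarrow> complex" where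
  "epstein_zeta_reg A \<nu> \<alpha> x y =
     (if y = 0 then Lim (at 0) (epstein_zeta_reg_nz A \<nu> \<alpha> x) else epstein_zeta_reg_nz A \<nu> \<alpha> x y)"

end

theory Submission
  imports Defs "HOL-Library.Multiset" "HOL-Probability.Characteristic_Functions" "HOL-Real_Asymp.Real_Asymp"
begin

text \<open>
  The monomial \<open>(z - x)\<^sup>\<alpha>\<close> is split into its harmonic parts \<open>|z - x|\<^sup>2\<^sup>k h\<^bsub>k,\<alpha>\<^esub>(z - x)\<close>. For a harmonic homogeneous \<open>h\<close>
  the theta series \<open>\<Sum>\<^sub>z h(z - x) exp(-\<pi>t|z - x|\<^sup>2) e(-y(z - x))\<close>, where \<open>e(s) = exp(2\<pi>is)\<close>, satisfies Hecke's functional equation, which follows from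
  Poisson summation for Gaussians by differentiating in \<open>y\<close>. Splitting its Mellin integral at \<open>t = \<lambda>\<^sup>-\<^sup>2\<close> and transforming
  the part over \<open>t < \<lambda>\<^sup>-\<^sup>2\<close> gives two rapidly convergent sums, entire in \<open>\<nu>\<close> for \<open>y\<close> outside the dual lattice, hence the
  continuation. Differentiating the radial function \<open>s\<close> produces the same harmonic parts, and its contribution
  cancels the singularity at \<open>y = 0\<close> of the term \<open>p = y\<close> of the dual sum: what remains is a convergent power series in
  \<open>|y|\<^sup>2\<close>, so that everything extends continuously to \<open>y = 0\<close>.
\<close>

text \<open>All incomplete Gamma functions are reduced to one integral, \<open>gexp_int s r\<close>,
  equal to \<Gamma>(s, r) / r^s for r > 0: it is entire in s, and G_\<nu>(z) is its value at s =
  \<nu>/2, r = \<pi> |z|^2. With s = \<nu>/2 - k and degree m = |\<alpha>| - 2k, Hecke's identity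
  sends s to d/2 + m - s = (d - \<nu>)/2 + |\<alpha>| - k, which is half the index of the dual
  Crandall function. The delicate values are \<nu> = d + 2l, where \<Gamma>((d - \<nu>)/2) has a
  pole and a logarithm replaces it. The harmonic numbers in \<open>H_const\<close> record how
  differentiation acts on |y|^(2j) log |y|^2; its digamma part compensates the factor \<nu>/2 - k -
  1 that 1/\<Gamma> yields when k is raised. Agreement of the logarithmic form with the power series
  is a finite-part computation at a pole of \<Gamma>, and this is where the Euler-Mascheroni
  constant enters. A second obstacle is low dimension: d + 2m - 2 can vanish or be negative for m =
  0, so constant harmonic parts are treated apart.\<close>

no_notation fps_nth (infixl \<open>$\<close> 75)

section \<open>Harmonic decomposition and radial functions\<close>

lemmas rpf_linear = real_polynomial_function.intros(1)
lemmas rpf_const = real_polynomial_function.intros(2)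
lemmas rpf_add = real_polynomial_function.intros(3)
lemmas rpf_mult = real_polynomial_function.intros(4)

lemma partial_derivative_eq:
  assumes "(f has_derivative f') (at y)"
  shows "partial_derivative j f y = f' (axis j 1)"
proof -
  have 1: "((\<lambda>t. y + t *\<^sub>R axis j 1) has_derivative (\<lambda>t. t *\<^sub>R axis j (1::real))) (at (0::real))"
    by (auto intro!: derivative_eq_intros)
  have 2: "(f has_derivative f') (at (y + 0 *\<^sub>R axis j 1))"
    using assms by simp
  have "((\<lambda>t. f (y + t *\<^sub>R axis j 1)) has_derivative (\<lambda>t. f' (t *\<^sub>R axis j 1))) (at (0::real))"
    by (rule has_derivative_compose[OF 1 2])
  moreover have "(\<lambda>t. f' (t *\<^sub>R axis j 1)) = (\<lambda>t. t *\<^sub>R f' (axis j 1))"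
    using linear_scale[OF has_derivative_linear[OF assms]] by (simp add: fun_eq_iff)
  ultimately have "((\<lambda>t. f (y + t *\<^sub>R axis j 1)) has_vector_derivative f' (axis j 1)) (at 0)"
    by (simp add: has_vector_derivative_def)
  then show ?thesis
    unfolding partial_derivative_def by (rule vector_derivative_at)
qed

text \<open>Structural induction also yields that the derivative in each fixed direction is again
  polynomial. This closure lets the derivative rules below carry polynomiality as their only
  hypothesis.\<close>

lemma real_polynomial_function_has_derivative:
  fixes p :: "'a::real_normed_vector \<Rightarrow> real"
  assumes "real_polynomial_function p"
  obtains p' where "\<And>x. (p has_derivative p' x) (at x)" "\<And>v. real_polynomial_function (\<lambda>x. p' x v)"
proof -
  have "\<exists>p'. (\<forall>x. (p has_derivative p' x) (at x)) \<and> (\<forall>v. real_polynomial_function (\<lambda>x. p' x v))"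
    using assms
  proof induction
    case (linear f)
    then show ?case
      by (intro exI[of _ "\<lambda>x. f"]) (simp add: bounded_linear_imp_has_derivative rpf_const)
  next
    case (const c)
    then show ?case by (intro exI[of _ "\<lambda>x v. 0"]) auto
  next
    case (add f g)
    then obtain f' g' where "\<And>x. (f has_derivative f' x) (at x)" "\<And>v. real_polynomial_function (\<lambda>x. f' x v)"
      "\<And>x. (g has_derivative g' x) (at x)" "\<And>v. real_polynomial_function (\<lambda>x. g' x v)" by metis
    then show ?case
      by (intro exI[of _ "\<lambda>x v. f' x v + g' x v"]) (auto intro: has_derivative_add)
  next
    case (mult f g)
    then obtain f' g' where "\<And>x. (f has_derivative f' x) (at x)" "\<And>v. real_polynomial_function (\<lambda>x. f' x v)"
      "\<And>x. (g has_derivative g' x) (at x)" "\<And>v. real_polynomial_function (\<lambda>x. g' x v)" by metis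
    then show ?case
      using mult.hyps
      by (intro exI[of _ "\<lambda>x v. f x * g' x v + f' x v * g x"] conjI allI has_derivative_mult rpf_add rpf_mult) auto
  qed
  then show ?thesis using that by blast
qed

lemma real_polynomial_function_frechet_derivative:
  "real_polynomial_function p \<Longrightarrow> (p has_derivative frechet_derivative p (at x)) (at x)"
  by (metis real_polynomial_function_has_derivative differentiableI frechet_derivative_works)

lemma real_polynomial_function_coord [intro]: "real_polynomial_function (\<lambda>y::real^'n. y $ j)"
  by (rule rpf_linear) (rule bounded_linear_vec_nth)

lemma real_polynomial_function_norm_sq [intro]: "real_polynomial_function (\<lambda>y::real^'n. (norm y)\<^sup>2)"
proof -
  have "(\<lambda>y::real^'n. (norm y)\<^sup>2) = (\<lambda>y. \<Sum>j\<in>UNIV. (y $ j)^2)"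
    by (simp add: norm_vec_def L2_set_def sum_nonneg)
  then show ?thesis by (auto intro!: real_polynomial_function_sum real_polynomial_function_power)
qed

lemma real_polynomial_function_cmult [intro]:
  "real_polynomial_function f \<Longrightarrow> real_polynomial_function (\<lambda>x. c * f x)"
  by (intro rpf_mult rpf_const)

lemma real_polynomial_function_partial [intro]:
  fixes p :: "real^'n \<Rightarrow> real"
  assumes "real_polynomial_function p"
  shows "real_polynomial_function (partial_derivative j p)"
proof -
  obtain p' where "\<And>x. (p has_derivative p' x) (at x)" "\<And>v. real_polynomial_function (\<lambda>x. p' x v)"
    using real_polynomial_function_has_derivative[OF assms] by blast
  moreover have "partial_derivative j p = (\<lambda>x. p' x (axis j 1))"
    using calculation(1) partial_derivative_eq by blast
  ultimately show ?thesis by simp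
qed

lemma partial_derivative_const [simp]: "partial_derivative j (\<lambda>y. c) = (\<lambda>y. 0)"
  by (rule ext, rule partial_derivative_eq[OF has_derivative_const])

lemma partial_derivative_add:
  fixes f g :: "real^'n \<Rightarrow> real"
  assumes "real_polynomial_function f" "real_polynomial_function g"
  shows "partial_derivative j (\<lambda>y. f y + g y) = (\<lambda>y. partial_derivative j f y + partial_derivative j g y)"
proof -
  define f' where "f' x = frechet_derivative f (at x)" for x
  have f': "(f has_derivative f' x) (at x)" for x
    unfolding f'_def by (rule real_polynomial_function_frechet_derivative[OF assms(1)])
  define g' where "g' x = frechet_derivative g (at x)" for x
  have g': "(g has_derivative g' x) (at x)" for x
    unfolding g'_def by (rule real_polynomial_function_frechet_derivative[OF assms(2)])
  show ?thesis
    unfolding fun_eq_iff partial_derivative_eq[OF has_derivative_add[OF f' g']]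
      partial_derivative_eq[OF f'] partial_derivative_eq[OF g'] by simp
qed

lemma partial_derivative_mult:
  fixes f g :: "real^'n \<Rightarrow> real"
  assumes "real_polynomial_function f" "real_polynomial_function g"
  shows "partial_derivative j (\<lambda>y. f y * g y)
    = (\<lambda>y. f y * partial_derivative j g y + partial_derivative j f y * g y)"
proof -
  define f' where "f' x = frechet_derivative f (at x)" for x
  have f': "(f has_derivative f' x) (at x)" for x
    unfolding f'_def by (rule real_polynomial_function_frechet_derivative[OF assms(1)])
  define g' where "g' x = frechet_derivative g (at x)" for x
  have g': "(g has_derivative g' x) (at x)" for x
    unfolding g'_def by (rule real_polynomial_function_frechet_derivative[OF assms(2)])
  show ?thesis
    unfolding fun_eq_iff partial_derivative_eq[OF has_derivative_mult[OF f' g']]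
      partial_derivative_eq[OF f'] partial_derivative_eq[OF g'] by simp
qed

lemma partial_derivative_cmult:
  fixes f :: "real^'n \<Rightarrow> real"
  assumes "real_polynomial_function f"
  shows "partial_derivative j (\<lambda>y. c * f y) = (\<lambda>y. c * partial_derivative j f y)"
  using partial_derivative_mult[OF rpf_const assms] by simp

lemma partial_derivative_diff:
  fixes f g :: "real^'n \<Rightarrow> real"
  assumes "real_polynomial_function f" "real_polynomial_function g"
  shows "partial_derivative j (\<lambda>y. f y - g y) = (\<lambda>y. partial_derivative j f y - partial_derivative j g y)"
  using partial_derivative_add[OF assms(1) real_polynomial_function_cmult[OF assms(2), of "-1"], of j]
  by (simp add: partial_derivative_cmult[OF assms(2), of _ "-1", simplified])

lemma partial_derivative_linear:
  assumes "bounded_linear f"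
  shows "partial_derivative j f = (\<lambda>y. f (axis j 1))"
  by (rule ext, rule partial_derivative_eq) (rule bounded_linear_imp_has_derivative[OF assms])

lemma partial_derivative_coord:
  "partial_derivative j (\<lambda>y::real^'n. y $ i) = (\<lambda>y. if i = j then 1 else 0)"
  by (subst partial_derivative_linear[OF bounded_linear_vec_nth]) (auto simp: axis_def)

lemma partial_derivative_norm_sq:
  "partial_derivative j (\<lambda>y::real^'n. (norm y)\<^sup>2) = (\<lambda>y. 2 * y $ j)"
proof
  fix y :: "real^'n"
  have "((\<lambda>y::real^'n. y \<bullet> y) has_derivative (\<lambda>h. y \<bullet> h + h \<bullet> y)) (at y)"
    by (auto intro!: derivative_eq_intros)
  then have "((\<lambda>y::real^'n. (norm y)\<^sup>2) has_derivative (\<lambda>h. y \<bullet> h + h \<bullet> y)) (at y)"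
    by (simp add: power2_norm_eq_inner)
  from partial_derivative_eq[OF this]
  show "partial_derivative j (\<lambda>y::real^'n. (norm y)\<^sup>2) y = 2 * y $ j"
    by (simp add: inner_axis inner_commute)
qed

text \<open>Structural induction: a linear function has constant partial derivatives, and for a
  product both iterated derivatives expand into the same four terms.\<close>

lemma partial_derivative_commute:
  fixes f :: "real^'n \<Rightarrow> real"
  assumes "real_polynomial_function f"
  shows "partial_derivative i (partial_derivative j f) = partial_derivative j (partial_derivative i f)"
  using assms
proof induction
  case (linear f)
  then show ?case by (simp add: partial_derivative_linear)
next
  case (const c)
  then show ?case by simp
next
  case (add f g)
  then show ?case by (simp add: partial_derivative_add real_polynomial_function_partial)
next
  case (mult f g)
  then show ?case
    by (simp add: partial_derivative_mult partial_derivative_add real_polynomial_function_partial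
        rpf_mult algebra_simps)
qed

section \<open>The Laplacian on homogeneous polynomials\<close>

definition laplacian :: "(real^'n \<Rightarrow> real) \<Rightarrow> real^'n \<Rightarrow> real" where
  "laplacian h y = (\<Sum>j\<in>UNIV. partial_derivative j (partial_derivative j h) y)"

lemma harmonic_iff_laplacian: "harmonic h \<longleftrightarrow> laplacian h = (\<lambda>y. 0)"
  by (auto simp: harmonic_def laplacian_def fun_eq_iff)

lemma laplacian_add:
  assumes "real_polynomial_function f" "real_polynomial_function g"
  shows "laplacian (\<lambda>y. f y + g y) = (\<lambda>y. laplacian f y + laplacian g y)"
  by (simp add: fun_eq_iff laplacian_def partial_derivative_add assms real_polynomial_function_partial sum.distrib)

lemma laplacian_cmult:
  assumes "real_polynomial_function f"
  shows "laplacian (\<lambda>y. c * f y) = (\<lambda>y. c * laplacian f y)"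
  by (simp add: fun_eq_iff laplacian_def partial_derivative_cmult assms real_polynomial_function_partial sum_distrib_left)

lemma laplacian_diff:
  assumes "real_polynomial_function f" "real_polynomial_function g"
  shows "laplacian (\<lambda>y. f y - g y) = (\<lambda>y. laplacian f y - laplacian g y)"
  by (simp add: fun_eq_iff laplacian_def partial_derivative_diff assms real_polynomial_function_partial sum_subtractf)

lemma laplacian_sum:
  assumes "finite K" "\<And>k. k \<in> K \<Longrightarrow> real_polynomial_function (f k)"
  shows "laplacian (\<lambda>y. \<Sum>k\<in>K. f k y) = (\<lambda>y. \<Sum>k\<in>K. laplacian (f k) y)"
  using assms
proof (induction K)
  case empty
  then show ?case by (simp add: laplacian_def fun_eq_iff)
next
  case (insert k K)
  then show ?case by (simp add: laplacian_add real_polynomial_function_sum)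
qed

lemma laplacian_mult:
  assumes "real_polynomial_function f" "real_polynomial_function g"
  shows "laplacian (\<lambda>y. f y * g y) = (\<lambda>y. f y * laplacian g y
    + 2 * (\<Sum>j\<in>UNIV. partial_derivative j f y * partial_derivative j g y) + laplacian f y * g y)"
proof -
  have "partial_derivative j (partial_derivative j (\<lambda>y. f y * g y))
     = (\<lambda>y. f y * partial_derivative j (partial_derivative j g) y + 2 * (partial_derivative j f y * partial_derivative j g y)
         + partial_derivative j (partial_derivative j f) y * g y)" for j
    by (simp add: partial_derivative_mult partial_derivative_add real_polynomial_function_partial assms
        rpf_mult algebra_simps)
  then show ?thesis
    by (simp add: fun_eq_iff laplacian_def sum.distrib sum_distrib_left sum_distrib_right)
qed

lemma homogeneous_polynomialD:
  assumes "homogeneous_polynomial m h"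
  shows "real_polynomial_function h" "h (c *\<^sub>R y) = c ^ m * h y"
  using assms by (auto simp: homogeneous_polynomial_def)

text \<open>Differentiating h(c y) = c^(m+1) h(y) in y and dividing by c settles c \<noteq> 0; for c
  = 0 both sides are continuous in c.\<close>

lemma homogeneous_partial_derivative:
  assumes "homogeneous_polynomial (Suc m) h"
  shows "homogeneous_polynomial m (partial_derivative j h)"
proof -
  note hD = homogeneous_polynomialD[OF assms]
  define h' where "h' x = frechet_derivative h (at x)" for x
  have h': "(h has_derivative h' x) (at x)" for x
    unfolding h'_def by (rule real_polynomial_function_frechet_derivative[OF hD(1)])
  have ne: "partial_derivative j h (c *\<^sub>R y) = c ^ m * partial_derivative j h y" if "c \<noteq> 0" for c y
  proof -
    have sc: "((\<lambda>y. c *\<^sub>R y) has_derivative (\<lambda>v. c *\<^sub>R v)) (at y)"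
      by (auto intro!: derivative_eq_intros)
    have "((\<lambda>y. h (c *\<^sub>R y)) has_derivative (\<lambda>v. h' (c *\<^sub>R y) (c *\<^sub>R v))) (at y)"
      using has_derivative_compose[OF sc h'] .
    moreover have "((\<lambda>y. c ^ Suc m * h y) has_derivative (\<lambda>v. c ^ Suc m * h' y v)) (at y)"
      by (intro has_derivative_mult_right h')
    ultimately have "h' (c *\<^sub>R y) (c *\<^sub>R axis j 1) = c ^ Suc m * h' y (axis j 1)"
      using fun_cong[OF has_derivative_unique, of _ _ _ _ "axis j 1"] unfolding hD(2) by blast
    moreover have "h' (c *\<^sub>R y) (c *\<^sub>R axis j 1) = c * h' (c *\<^sub>R y) (axis j 1)"
      using linear_scale[OF has_derivative_linear[OF h']] by simp
    ultimately show ?thesis using that by (simp add: partial_derivative_eq[OF h'])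
  qed
  have "partial_derivative j h (c *\<^sub>R y) = c ^ m * partial_derivative j h y" for c y
  proof (cases "c = 0")
    case True
    have c: "continuous_on UNIV (partial_derivative j h)"
      using hD(1) by (intro continuous_on_polymonial_function)
        (auto simp: real_polynomial_function_eq[symmetric])
    have "isCont (partial_derivative j h) x" for x
      using c by (simp add: continuous_on_eq_continuous_at)
    then have 1: "((\<lambda>c. partial_derivative j h (c *\<^sub>R y)) \<longlongrightarrow> partial_derivative j h (0 *\<^sub>R y)) (at (0::real))"
      by (intro isCont_tendsto_compose[of _ "partial_derivative j h"] tendsto_intros) auto
    have 2: "((\<lambda>c. c ^ m * partial_derivative j h y) \<longlongrightarrow> 0 ^ m * partial_derivative j h y) (at (0::real))"
      by (intro tendsto_intros)
    have "((\<lambda>c. partial_derivative j h (c *\<^sub>R y)) \<longlongrightarrow> 0 ^ m * partial_derivative j h y) (at (0::real))"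
      by (rule Lim_transform_eventually[OF 2]) (auto simp: eventually_at ne intro!: exI[of _ 1])
    from tendsto_unique[OF _ 1 this] True show ?thesis by simp
  qed (rule ne)
  then show ?thesis using hD by (auto simp: homogeneous_polynomial_def)
qed

lemma homogeneous_degree_zero:
  assumes "homogeneous_polynomial 0 h"
  shows "h = (\<lambda>y. h 0)"
  using homogeneous_polynomialD(2)[OF assms, of 0] by (metis mult_1 power_0 scaleR_zero_left)

text \<open>Euler's formula, obtained by differentiating h(c y) = c^m h(y) in c at c = 1.\<close>

lemma euler_homogeneous:
  fixes h :: "real^'n \<Rightarrow> real"
  assumes "homogeneous_polynomial m h"
  shows "(\<Sum>j\<in>UNIV. y $ j * partial_derivative j h y) = real m * h y"
proof -
  note hD = homogeneous_polynomialD[OF assms]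
  define h' where "h' x = frechet_derivative h (at x)" for x
  have h': "(h has_derivative h' x) (at x)" for x
    unfolding h'_def by (rule real_polynomial_function_frechet_derivative[OF hD(1)])
  have lin: "linear (h' y)" using h' has_derivative_linear by blast
  have sc: "((\<lambda>c. c *\<^sub>R y) has_derivative (\<lambda>v. v *\<^sub>R y)) (at (1::real))"
    by (auto intro!: derivative_eq_intros)
  have "((\<lambda>c. h (c *\<^sub>R y)) has_derivative (\<lambda>v. h' (1 *\<^sub>R y) (v *\<^sub>R y))) (at (1::real))"
    using has_derivative_compose[OF sc h'] .
  moreover have "((\<lambda>c. c ^ m * h y) has_derivative (\<lambda>v. v * (real m * h y))) (at (1::real))"
    by (auto intro!: derivative_eq_intros)
  ultimately have "(\<lambda>v. h' (1 *\<^sub>R y) (v *\<^sub>R y)) = (\<lambda>v. v * (real m * h y))"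
    unfolding hD(2) by (rule has_derivative_unique)
  from fun_cong[OF this, of 1] have eq: "h' y y = real m * h y" by simp
  have "y = (\<Sum>j\<in>UNIV. (y $ j) *\<^sub>R axis j 1)"
    by (simp add: vec_eq_iff axis_def if_distrib cong: if_cong)
  then have "h' y y = (\<Sum>j\<in>UNIV. y $ j * h' y (axis j 1))"
    using linear_sum[OF lin, of "\<lambda>j. (y $ j) *\<^sub>R axis j 1" UNIV] by (simp add: linear_scale[OF lin])
  with eq show ?thesis by (simp add: partial_derivative_eq[OF h'])
qed

lemma harmonic_partial_derivative:
  assumes "real_polynomial_function h" "harmonic h"
  shows "harmonic (partial_derivative j h)"
proof -
  have "partial_derivative i (partial_derivative i (partial_derivative j h))
     = partial_derivative j (partial_derivative i (partial_derivative i h))" for i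
    using assms(1) by (metis partial_derivative_commute real_polynomial_function_partial)
  moreover have "partial_derivative j (\<lambda>y. \<Sum>i\<in>I. f i y) = (\<lambda>y. \<Sum>i\<in>I. partial_derivative j (f i) y)"
    if "finite I" "\<And>i. i \<in> I \<Longrightarrow> real_polynomial_function (f i)" for I and f :: "'a \<Rightarrow> real^'a \<Rightarrow> real"
    using that by (induction I) (simp_all add: partial_derivative_add real_polynomial_function_sum)
  ultimately have "laplacian (partial_derivative j h) = partial_derivative j (laplacian h)"
    using assms(1) unfolding laplacian_def[abs_def]
    by (simp add: fun_eq_iff real_polynomial_function_partial)
  then show ?thesis using assms(2) by (simp add: harmonic_iff_laplacian)
qed

lemma partial_derivative_norm_power:
  "partial_derivative j (\<lambda>y::real^'n. ((norm y)\<^sup>2) ^ k) = (\<lambda>y. 2 * real k * y $ j * ((norm y)\<^sup>2) ^ (k - 1))"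
proof (induction k)
  case (Suc k)
  show ?case
    using partial_derivative_mult[OF real_polynomial_function_norm_sq real_polynomial_function_power[OF real_polynomial_function_norm_sq], of j k] Suc
    by (cases k) (simp_all add: partial_derivative_norm_sq fun_eq_iff algebra_simps)
qed simp

lemma laplacian_norm_power:
  "laplacian (\<lambda>y::real^'n. ((norm y)\<^sup>2) ^ k)
     = (\<lambda>y. 2 * real k * (2 * real k + real CARD('n) - 2) * ((norm y)\<^sup>2) ^ (k - 1))"
proof
  fix y :: "real^'n"
  have eq: "partial_derivative j (partial_derivative j (\<lambda>y::real^'n. ((norm y)\<^sup>2) ^ k)) y
      = 2 * real k * ((norm y)\<^sup>2) ^ (k - 1) + 4 * real k * real (k - 1) * (y $ j)\<^sup>2 * ((norm y)\<^sup>2) ^ (k - 2)" for j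
  proof -
    have "(\<lambda>y::real^'n. 2 * real k * y $ j * ((norm y)\<^sup>2) ^ (k - 1)) = (\<lambda>y. (2 * real k) * (y $ j * ((norm y)\<^sup>2) ^ (k - 1)))"
      by (simp add: fun_eq_iff)
    then show ?thesis
      by (simp add: partial_derivative_norm_power partial_derivative_cmult partial_derivative_mult
          rpf_mult real_polynomial_function_coord real_polynomial_function_power
          real_polynomial_function_norm_sq partial_derivative_coord)
        (simp add: power2_eq_square numeral_2_eq_2 algebra_simps)
  qed
  have "(\<Sum>j\<in>UNIV. (y $ j)\<^sup>2) = (norm y)\<^sup>2"
    by (simp add: norm_vec_def L2_set_def sum_nonneg)
  then have "laplacian (\<lambda>y::real^'n. ((norm y)\<^sup>2) ^ k) y
     = real CARD('n) * (2 * real k * ((norm y)\<^sup>2) ^ (k - 1)) + 4 * real k * real (k - 1) * (norm y)\<^sup>2 * ((norm y)\<^sup>2) ^ (k - 2)"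
    unfolding laplacian_def eq sum.distrib by (simp add: sum_distrib_left[symmetric] sum_distrib_right[symmetric])
  \<comment> \<open>Truncated subtraction in the exponents does no harm: the coefficient vanishes
    for k = 0 and for k = 1.\<close>
  moreover have "real k * real (k - 1) * (norm y)\<^sup>2 * ((norm y)\<^sup>2) ^ (k - 2) = real k * (real k - 1) * ((norm y)\<^sup>2) ^ (k - 1)"
  proof (cases k)
    case (Suc k')
    then show ?thesis by (cases k') simp_all
  qed simp
  ultimately show "laplacian (\<lambda>y::real^'n. ((norm y)\<^sup>2) ^ k) y
     = 2 * real k * (2 * real k + real CARD('n) - 2) * ((norm y)\<^sup>2) ^ (k - 1)"
    by (simp add: algebra_simps)
qed

text \<open>The mixed term of the product rule is a multiple of y . grad h, which Euler's formula
  turns into m h. So the Laplacian maps |y|^(2k) h to a multiple of |y|^(2k-2) h.\<close>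

lemma laplacian_norm_power_harmonic:
  fixes h :: "real^'n \<Rightarrow> real"
  assumes "homogeneous_polynomial m h" "harmonic h"
  shows "laplacian (\<lambda>y. ((norm y)\<^sup>2) ^ k * h y)
     = (\<lambda>y. 2 * real k * (2 * real k + 2 * real m + real CARD('n) - 2) * (((norm y)\<^sup>2) ^ (k - 1) * h y))"
proof
  fix y
  note hD = homogeneous_polynomialD[OF assms(1)]
  have "(\<Sum>j\<in>UNIV. 2 * real k * y $ j * ((norm y)\<^sup>2) ^ (k - 1) * partial_derivative j h y)
     = 2 * real k * ((norm y)\<^sup>2) ^ (k - 1) * (\<Sum>j\<in>UNIV. y $ j * partial_derivative j h y)"
    by (simp add: sum_distrib_left sum_distrib_right mult_ac)
  also have "\<dots> = 2 * real k * ((norm y)\<^sup>2) ^ (k - 1) * (real m * h y)"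
    by (simp add: euler_homogeneous[OF assms(1)])
  finally show "laplacian (\<lambda>y. ((norm y)\<^sup>2) ^ k * h y) y
     = 2 * real k * (2 * real k + 2 * real m + real CARD('n) - 2) * (((norm y)\<^sup>2) ^ (k - 1) * h y)"
    using assms(2)
    by (simp add: laplacian_mult hD(1) real_polynomial_function_power real_polynomial_function_norm_sq
        laplacian_norm_power partial_derivative_norm_power harmonic_iff_laplacian algebra_simps)
qed

text \<open>This number is the divisor in \<open>lower\<close>. For m = 0 it would be 0 in dimension
  2 and negative in dimension 1.\<close>

lemma card_factor_pos: "m > 0 \<Longrightarrow> real CARD('n::finite) + 2 * real m - 2 > 0"
proof -
  assume "m > 0"
  moreover have "real CARD('n) > 0" by simp
  ultimately show ?thesis by linarith
qed

section \<open>Existence and uniqueness of the harmonic decomposition\<close>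

lemma homogeneous_cmult:
  "homogeneous_polynomial m h \<Longrightarrow> homogeneous_polynomial m (\<lambda>y. c * h y)"
  by (auto simp: homogeneous_polynomial_def)

lemma harmonic_cmult:
  "real_polynomial_function h \<Longrightarrow> harmonic h \<Longrightarrow> harmonic (\<lambda>y. c * h y)"
  by (simp add: harmonic_iff_laplacian laplacian_cmult)

text \<open>Applying the Laplacian removes the term \<open>k = 0\<close> and multiplies the others by positive factors.\<close>

lemma harmonic_decomposition_unique:
  fixes g :: "nat \<Rightarrow> real^'n \<Rightarrow> real"
  assumes "\<And>k. k \<le> K \<Longrightarrow> homogeneous_polynomial (n - 2 * k) (g k)"
    and "\<And>k. k \<le> K \<Longrightarrow> harmonic (g k)"
    and "\<And>y. (\<Sum>k\<le>K. ((norm y)\<^sup>2) ^ k * g k y) = 0"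
    and "k \<le> K"
  shows "g k = (\<lambda>y. 0)"
  using assms
proof (induction K arbitrary: n g k)
  case 0
  then show ?case by auto
next
  case (Suc K)
  define c where "c k = 2 * real k * (2 * real k + 2 * real (n - 2 * k) + real CARD('n) - 2)" for k
  \<comment> \<open>Positive whatever the degree is, since already 2 (k + 1) + d - 2 > 0; hence
    these factors can be divided out at the end.\<close>
  have cpos: "c (Suc k) > 0" for k
  proof -
    show ?thesis unfolding c_def using card_factor_pos[where ?'n='n, of "Suc k"]
      by (intro mult_pos_pos) linarith+
  qed
  have rp: "real_polynomial_function (\<lambda>y. ((norm y)\<^sup>2) ^ k * g k y)" if "k \<le> Suc K" for k
    using homogeneous_polynomialD(1)[OF Suc.prems(1)[OF that]]
    by (intro rpf_mult) auto
  have "(\<Sum>k\<le>Suc K. c k * (((norm y)\<^sup>2) ^ (k - 1) * g k y)) = 0" for y :: "real^'n"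
  proof -
    have "(\<Sum>k\<le>Suc K. c k * (((norm y)\<^sup>2) ^ (k - 1) * g k y)) = (\<Sum>k\<le>Suc K. laplacian (\<lambda>y. ((norm y)\<^sup>2) ^ k * g k y) y)"
      by (intro sum.cong refl) (subst laplacian_norm_power_harmonic[OF Suc.prems(1,2)], auto simp: c_def)
    also have "\<dots> = laplacian (\<lambda>y. \<Sum>k\<le>Suc K. ((norm y)\<^sup>2) ^ k * g k y) y"
      using rp by (subst laplacian_sum) auto
    also have "\<dots> = 0" by (simp only: Suc.prems(3)) (simp add: laplacian_def)
    finally show ?thesis .
  qed
  then have "(\<Sum>k\<le>K. ((norm y)\<^sup>2) ^ k * (c (Suc k) * g (Suc k) y)) = 0" for y :: "real^'n"
    unfolding sum.atMost_Suc_shift by (simp add: c_def[of 0] mult_ac)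
  \<comment> \<open>The functions \<open>c (Suc k) * g (Suc k)\<close> again decompose zero, now for
    the total degree n - 2 and with one term less.\<close>
  then have "(\<lambda>y. c (Suc k) * g (Suc k) y) = (\<lambda>y. 0)" if "k \<le> K" for k
    using that Suc.prems(1,2)[of "Suc _"]
    by (intro Suc.IH[of "n - 2" "\<lambda>k y. c (Suc k) * g (Suc k) y"])
      (auto intro!: homogeneous_cmult harmonic_cmult homogeneous_polynomialD(1))
  then have "c (Suc k) * g (Suc k) y = 0" if "k \<le> K" for k y
    using fun_cong that by metis
  then have pos: "g (Suc k) = (\<lambda>y. 0)" if "k \<le> K" for k
    using that cpos[of k] by (metis ext less_irrefl mult_eq_0_iff)
  have "g 0 y = 0" for y
    using Suc.prems(3)[of y] unfolding sum.atMost_Suc_shift by (simp add: pos)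
  then have "g 0 = (\<lambda>y. 0)" by blast
  with pos Suc.prems(4) show ?case by (cases k) auto
qed

text \<open>The divisor is chosen such that |y|^2 \<open>lower j m h\<close> has the same Laplacian
  2 d_j h as y_j h when h is harmonic of degree m > 0; this is what makes \<open>raise j m h\<close>
  harmonic. In degree zero the derivative vanishes, so the value is 0 whatever the divisor.\<close>

definition lower :: "'n \<Rightarrow> nat \<Rightarrow> (real^'n \<Rightarrow> real) \<Rightarrow> real^'n \<Rightarrow> real" where
  "lower j m h y = partial_derivative j h y / (real CARD('n) + 2 * real m - 2)"

definition raise :: "'n \<Rightarrow> nat \<Rightarrow> (real^'n \<Rightarrow> real) \<Rightarrow> real^'n \<Rightarrow> real" where
  "raise j m h y = y $ j * h y - (norm y)\<^sup>2 * lower j m h y"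

lemma lower_zero_degree: "homogeneous_polynomial 0 h \<Longrightarrow> lower j m h = (\<lambda>y. 0)"
  by (subst homogeneous_degree_zero, assumption) (simp add: lower_def fun_eq_iff)

lemma lower_zero [simp]: "lower j m (\<lambda>y. 0) = (\<lambda>y. 0)"
  by (simp add: lower_def fun_eq_iff)

lemma raise_zero [simp]: "raise j m (\<lambda>y. 0) = (\<lambda>y. 0)"
  by (simp add: raise_def fun_eq_iff)

lemma lower_altdef: "lower j m h = (\<lambda>y. (1 / (real CARD('n) + 2 * real m - 2)) * partial_derivative j (h::real^'n\<Rightarrow>real) y)"
  by (simp add: lower_def fun_eq_iff)

lemma homogeneous_lower:
  assumes "homogeneous_polynomial (Suc m) h"
  shows "homogeneous_polynomial m (lower j k h)"
  unfolding lower_altdef by (intro homogeneous_cmult homogeneous_partial_derivative assms)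

lemma harmonic_lower:
  assumes "homogeneous_polynomial m h" "harmonic h"
  shows "harmonic (lower j k h)"
  unfolding lower_altdef using homogeneous_polynomialD(1)[OF assms(1)] assms(2)
  by (intro harmonic_cmult harmonic_partial_derivative) auto

lemma real_polynomial_lower: "real_polynomial_function h \<Longrightarrow> real_polynomial_function (lower j m h)"
  unfolding lower_altdef by auto

lemma homogeneous_raise:
  assumes "homogeneous_polynomial m h"
  shows "homogeneous_polynomial (Suc m) (raise j m h)"
proof -
  note hD = homogeneous_polynomialD[OF assms]
  have rp: "real_polynomial_function (raise j m h)"
    unfolding raise_def[abs_def] using hD(1)
    by (intro real_polynomial_function_diff rpf_mult real_polynomial_lower) auto
  have "raise j m h (c *\<^sub>R y) = c ^ Suc m * raise j m h y" for c y
  proof (cases m)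
    case 0
    then show ?thesis using assms by (simp add: raise_def lower_zero_degree hD(2))
  next
    case (Suc m')
    then have "homogeneous_polynomial m' (lower j m h)"
      using assms homogeneous_lower by blast
    from homogeneous_polynomialD(2)[OF this] Suc show ?thesis
      by (simp add: raise_def hD(2) power_mult_distrib algebra_simps power2_eq_square)
  qed
  with rp show ?thesis by (simp add: homogeneous_polynomial_def)
qed

lemma laplacian_coord_mult:
  fixes h :: "real^'n \<Rightarrow> real"
  assumes "real_polynomial_function h"
  shows "laplacian (\<lambda>y. y $ j * h y) = (\<lambda>y. y $ j * laplacian h y + 2 * partial_derivative j h y)"
proof -
  have 1: "laplacian (\<lambda>y. y $ j) y = 0" for y :: "real^'n"
    by (simp add: laplacian_def partial_derivative_coord)
  have 2: "(\<Sum>i\<in>UNIV. (if j = i then 1 else 0) * partial_derivative i h y) = partial_derivative j h y" for y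
  proof -
    have "(\<Sum>i\<in>UNIV. (if j = i then 1 else 0) * partial_derivative i h y) = (\<Sum>i\<in>UNIV. if j = i then partial_derivative i h y else 0)"
      by (intro sum.cong) auto
    then show ?thesis by simp
  qed
  show ?thesis
    unfolding laplacian_mult[OF real_polynomial_function_coord assms] partial_derivative_coord 1 2 by simp
qed

lemma harmonic_raise:
  fixes h :: "real^'n \<Rightarrow> real"
  assumes "homogeneous_polynomial m h" "harmonic h"
  shows "harmonic (raise j m h)"
proof (cases m)
  case 0
  then have "raise j m h = (\<lambda>y. y $ j * h y)"
    using assms by (simp add: raise_def[abs_def] lower_zero_degree)
  moreover have "partial_derivative j h = (\<lambda>y. 0)"
    by (subst homogeneous_degree_zero) (use assms 0 in auto)
  ultimately show ?thesis
    using assms laplacian_coord_mult[OF homogeneous_polynomialD(1)[OF assms(1)]]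
    by (simp add: harmonic_iff_laplacian)
next
  case (Suc m')
  note hD = homogeneous_polynomialD[OF assms(1)]
  let ?l = "lower j m h"
  have "laplacian (\<lambda>y. (norm y)\<^sup>2 * ?l y) = (\<lambda>y. 2 * partial_derivative j h y)"
  proof -
    have "homogeneous_polynomial m' ?l" "harmonic ?l"
      using assms Suc homogeneous_lower harmonic_lower by blast+
    from laplacian_norm_power_harmonic[OF this, of 1]
    have "laplacian (\<lambda>y. (norm y)\<^sup>2 * ?l y) = (\<lambda>y. 2 * ((real CARD('n) + 2 * real m - 2) * ?l y))"
      using Suc by (simp add: fun_eq_iff algebra_simps)
    then show ?thesis using card_factor_pos[where ?'n='n, of m] Suc by (simp add: lower_def fun_eq_iff)
  qed
  moreover have "laplacian (raise j m h) = (\<lambda>y. laplacian (\<lambda>y. y $ j * h y) y - laplacian (\<lambda>y. (norm y)\<^sup>2 * ?l y) y)"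
    unfolding raise_def[abs_def] using hD(1)
    by (intro laplacian_diff rpf_mult real_polynomial_lower) auto
  ultimately show ?thesis
    using assms(2) by (simp add: harmonic_iff_laplacian laplacian_coord_mult hD(1))
qed

text \<open>The list enumerates the multi-index, \<open>j\<close> occurring \<open>\<alpha> $ j\<close> times; each step multiplies by
  one coordinate and uses \<open>y\<^sub>j h = raise j m h + |y|\<^sup>2 lower j m h\<close>.\<close>

fun harm_comp :: "'n list \<Rightarrow> nat \<Rightarrow> real^'n \<Rightarrow> real" where
  "harm_comp [] k = (\<lambda>y. if k = 0 then 1 else 0)"
| "harm_comp (j # js) k = (\<lambda>y. raise j (length js - 2 * k) (harm_comp js k) y
     + (if k = 0 then 0 else lower j (length js - 2 * (k - 1)) (harm_comp js (k - 1)) y))"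

lemma homogeneous_add:
  "homogeneous_polynomial m f \<Longrightarrow> homogeneous_polynomial m g \<Longrightarrow> homogeneous_polynomial m (\<lambda>y. f y + g y)"
  by (auto simp: homogeneous_polynomial_def algebra_simps)

lemma harmonic_add:
  "real_polynomial_function f \<Longrightarrow> real_polynomial_function g \<Longrightarrow> harmonic f \<Longrightarrow> harmonic g \<Longrightarrow> harmonic (\<lambda>y. f y + g y)"
  by (simp add: harmonic_iff_laplacian laplacian_add)

lemma homogeneous_0: "homogeneous_polynomial m (\<lambda>y. 0)"
  by (auto simp: homogeneous_polynomial_def)

lemma harmonic_const: "harmonic (\<lambda>y. c)"
  by (simp add: harmonic_def)

text \<open>Vanishing beyond half the length belongs to the induction: a component of degree 0 is
  constant, so lowering it contributes nothing to the next index.\<close>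

lemma harm_comp_props:
  "(2 * k \<le> length js \<longrightarrow> homogeneous_polynomial (length js - 2 * k) (harm_comp js k) \<and> harmonic (harm_comp js k))
   \<and> (2 * k > length js \<longrightarrow> harm_comp js k = (\<lambda>y. 0))"
proof (induction js arbitrary: k)
  case Nil
  then show ?case by (auto simp: homogeneous_polynomial_def harmonic_const)
next
  case (Cons j js)
  let ?n = "length js"
  define A where "A = raise j (?n - 2 * k) (harm_comp js k)"
  define B where "B = (\<lambda>y. if k = 0 then 0 else lower j (?n - 2 * (k - 1)) (harm_comp js (k - 1)) y)"
  have eq: "harm_comp (j # js) k = (\<lambda>y. A y + B y)" by (simp add: A_def B_def)
  have A0: "A = (\<lambda>y. 0)" if "2 * k > ?n"
    using Cons.IH[of k] that by (simp add: A_def)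
  have A1: "homogeneous_polynomial (Suc ?n - 2 * k) A \<and> harmonic A" if "2 * k \<le> Suc ?n"
  proof (cases "2 * k \<le> ?n")
    case True
    then show ?thesis using Cons.IH[of k] homogeneous_raise harmonic_raise
      by (auto simp: A_def Suc_diff_le)
  next
    case False
    then show ?thesis using A0 by (simp add: homogeneous_0 harmonic_const)
  qed
  have B0: "B = (\<lambda>y. 0)" if "2 * k > Suc ?n"
  proof (cases "2 * (k - 1) = ?n")
    case True
    then have "homogeneous_polynomial 0 (harm_comp js (k - 1))"
      using Cons.IH[of "k - 1"] by simp
    from lower_zero_degree[OF this] show ?thesis by (simp add: B_def fun_eq_iff)
  next
    case False
    then have "harm_comp js (k - 1) = (\<lambda>y. 0)"
      using that Cons.IH[of "k - 1"] by auto
    then have "lower j m (harm_comp js (k - 1)) = (\<lambda>y. 0)" for m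
      by (simp only: lower_zero)
    then show ?thesis by (simp add: B_def fun_eq_iff)
  qed
  have B1: "homogeneous_polynomial (Suc ?n - 2 * k) B \<and> harmonic B" if "2 * k \<le> Suc ?n"
  proof (cases "k = 0")
    case True
    then show ?thesis by (simp add: B_def homogeneous_0 harmonic_const)
  next
    case False
    then have "homogeneous_polynomial (Suc (Suc ?n - 2 * k)) (harm_comp js (k - 1))" "harmonic (harm_comp js (k - 1))"
      using that Cons.IH[of "k - 1"] by (auto simp: Suc_diff_le[symmetric] diff_mult_distrib2)
    then show ?thesis using False homogeneous_lower harmonic_lower by (auto simp: B_def)
  qed
  show ?case
    unfolding eq length_Cons using A0 A1 B0 B1
    by (auto intro!: homogeneous_add harmonic_add homogeneous_polynomialD(1))
qed

text \<open>The bound N only has to be large enough, so that the same N can be used for the list and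
  for its tail in the induction.\<close>

lemma prod_list_eq_harm_comp:
  assumes "N \<ge> length js"
  shows "(\<Prod>j\<leftarrow>js. y $ j) = (\<Sum>k\<le>N. ((norm y)\<^sup>2) ^ k * harm_comp js k y)"
  using assms
proof (induction js)
  case Nil
  have "(\<Sum>k\<le>N. ((norm y)\<^sup>2) ^ k * harm_comp [] k y) = (\<Sum>k\<le>N. if k = 0 then 1 else 0)"
    by (intro sum.cong) auto
  then show ?case by simp
next
  case (Cons j js)
  define A where "A k = raise j (length js - 2 * k) (harm_comp js k) y" for k
  define B where "B k = lower j (length js - 2 * k) (harm_comp js k) y" for k
  obtain N' where N': "N = Suc N'" using Cons.prems by (cases N) auto
  \<comment> \<open>Shifting k to k + 1 would push this one term past N; it vanishes because 2 N
    exceeds the length of \<open>js\<close>.\<close>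
  have BN: "B N = 0"
    using harm_comp_props[of N js] Cons.prems by (simp add: B_def)
  have AB: "y $ j * harm_comp js k y = A k + (norm y)\<^sup>2 * B k" for k
    by (simp add: A_def B_def raise_def)
  have "(\<Prod>j\<leftarrow>j # js. y $ j) = (\<Sum>k\<le>N. ((norm y)\<^sup>2) ^ k * (y $ j * harm_comp js k y))"
    using Cons by (simp add: sum_distrib_left mult_ac)
  also have "\<dots> = (\<Sum>k\<le>N. ((norm y)\<^sup>2) ^ k * A k) + (\<Sum>k\<le>N. ((norm y)\<^sup>2) ^ Suc k * B k)"
    by (simp add: AB algebra_simps sum.distrib)
  also have "(\<Sum>k\<le>N. ((norm y)\<^sup>2) ^ Suc k * B k) = (\<Sum>k\<le>N'. ((norm y)\<^sup>2) ^ Suc k * B k)"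
    using BN by (simp add: N')
  also have "\<dots> = (\<Sum>k\<le>N. ((norm y)\<^sup>2) ^ k * (if k = 0 then 0 else B (k - 1)))"
    unfolding N' sum.atMost_Suc_shift by simp
  also have "(\<Sum>k\<le>N. ((norm y)\<^sup>2) ^ k * A k) + \<dots> = (\<Sum>k\<le>N. ((norm y)\<^sup>2) ^ k * harm_comp (j # js) k y)"
    unfolding sum.distrib[symmetric] by (intro sum.cong refl) (simp add: A_def B_def algebra_simps)
  finally show ?case .
qed

text \<open>Ensures that the \<open>SOME\<close> in \<open>mi_derivative\<close> really selects an
  enumeration of \<alpha>: list the multiset in which j has multiplicity
  \<open>\<alpha> $ j\<close>.\<close>

lemma exists_list_counts: "\<exists>js. \<forall>j::'n::finite. count_list js j = \<alpha> $ j"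
proof -
  have "finite {j. 0 < \<alpha> $ j}" by simp
  then have M: "count (Abs_multiset (\<lambda>j. \<alpha> $ j)) = (\<lambda>j. \<alpha> $ j)" (is "count ?M = _")
    by (intro Abs_multiset_inverse) simp
  obtain js where "mset js = ?M" using ex_mset by blast
  with M show ?thesis by (metis count_mset)
qed

lemma length_eq_mi_size:
  assumes "\<And>j. count_list js j = \<alpha> $ j"
  shows "length js = mi_size \<alpha>"
proof -
  have "sum (count_list js) UNIV = length js" by (intro sum_count_set) auto
  then show ?thesis using assms by (simp add: mi_size_def)
qed

lemma mi_power_eq_prod_list:
  assumes "\<And>j. count_list js j = \<alpha> $ j"
  shows "mi_power y \<alpha> = (\<Prod>j\<leftarrow>js. y $ j)"
proof -
  have "(\<Prod>j\<leftarrow>js. y $ j) = (\<Prod>j\<in>UNIV. (y $ j) ^ count_list js j)"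
  proof (induction js)
    case (Cons i js)
    have "(\<Prod>j\<in>UNIV. (y $ j) ^ count_list (i # js) j)
       = (\<Prod>j\<in>UNIV. (if i = j then y $ j else 1) * (y $ j) ^ count_list js j)"
      by (intro prod.cong) auto
    then show ?case using Cons by (simp add: prod.distrib)
  qed simp
  then show ?thesis using assms by (simp add: mi_power_def)
qed

text \<open>The recursion supplies existence, and uniqueness is applied to the difference of two
  decompositions. As a consequence \<open>harm_comp js\<close> depends on the list only through its
  counts.\<close>

lemma harmonic_part_eq:
  fixes \<alpha> :: "nat^'n"
  assumes cnt: "\<And>j. count_list js j = \<alpha> $ j"
  shows "harmonic_part \<alpha> = harm_comp js"
proof -
  let ?n = "mi_size \<alpha>"
  let ?P = "\<lambda>h. (\<forall>k \<le> ?n div 2. homogeneous_polynomial (?n - 2 * k) (h k) \<and> harmonic (h k)) \<and>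
     (\<forall>k > ?n div 2. h k = (\<lambda>y. 0)) \<and>
     (\<forall>y. mi_power y \<alpha> = (\<Sum>k = 0..?n div 2. norm y ^ (2 * k) * h k y))"
  have n: "length js = ?n" by (rule length_eq_mi_size[OF cnt])
  have P: "?P (harm_comp js)"
  proof (intro conjI allI impI)
    fix y
    have "mi_power y \<alpha> = (\<Sum>k\<le>?n. ((norm y)\<^sup>2) ^ k * harm_comp js k y)"
      using prod_list_eq_harm_comp[of js ?n] n by (simp add: mi_power_eq_prod_list[OF cnt])
    also have "\<dots> = (\<Sum>k = 0..?n div 2. ((norm y)\<^sup>2) ^ k * harm_comp js k y)"
      using harm_comp_props[of _ js] n by (intro sum.mono_neutral_right) auto
    finally show "mi_power y \<alpha> = (\<Sum>k = 0..?n div 2. norm y ^ (2 * k) * harm_comp js k y)"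
      by (simp add: power_mult)
  qed (use harm_comp_props[of _ js] n in auto)
  have "h = harm_comp js" if h: "?P h" for h
  proof
    fix k
    show "h k = harm_comp js k"
    proof (cases "k \<le> ?n div 2")
      case True
      have "(\<lambda>y. h k y - harm_comp js k y) = (\<lambda>y. 0)"
      proof (rule harmonic_decomposition_unique[where n="?n" and K="?n div 2" and g="\<lambda>k y. h k y - harm_comp js k y"])
        fix k assume k: "k \<le> ?n div 2"
        show "homogeneous_polynomial (?n - 2 * k) (\<lambda>y. h k y - harm_comp js k y)"
          using h P k by (auto simp: homogeneous_polynomial_def algebra_simps)
        show "harmonic (\<lambda>y. h k y - harm_comp js k y)"
          using h P k laplacian_diff[of "h k" "harm_comp js k"]
          by (auto simp: harmonic_iff_laplacian homogeneous_polynomial_def)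
      next
        fix y
        have "(\<Sum>k\<le>?n div 2. norm y ^ (2 * k) * h k y) = (\<Sum>k\<le>?n div 2. norm y ^ (2 * k) * harm_comp js k y)"
          using h P by (simp add: atMost_atLeast0)
        then show "(\<Sum>k\<le>?n div 2. ((norm y)\<^sup>2) ^ k * (h k y - harm_comp js k y)) = 0"
          by (simp add: power_mult[symmetric] right_diff_distrib sum_subtractf)
      qed (use True in auto)
      then show ?thesis by (simp add: fun_eq_iff)
    next
      case False
      then show ?thesis using h P by auto
    qed
  qed
  with P show ?thesis unfolding harmonic_part_def by (intro the_equality) blast+
qed

lemma harmonic_part_props:
  assumes "k \<le> mi_size \<alpha> div 2"
  shows "homogeneous_polynomial (mi_size \<alpha> - 2 * k) (harmonic_part \<alpha> k)" "harmonic (harmonic_part \<alpha> k)"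
proof -
  obtain js where js: "\<And>j. count_list js j = \<alpha> $ j" using exists_list_counts by blast
  show "homogeneous_polynomial (mi_size \<alpha> - 2 * k) (harmonic_part \<alpha> k)" "harmonic (harmonic_part \<alpha> k)"
    using harm_comp_props[of k js] assms length_eq_mi_size[OF js] by (simp_all add: harmonic_part_eq[OF js])
qed

lemma mi_power_eq_harmonic_parts:
  "mi_power y \<alpha> = (\<Sum>k = 0..mi_size \<alpha> div 2. norm y ^ (2 * k) * harmonic_part \<alpha> k y)"
proof -
  obtain js where js: "\<And>j. count_list js j = \<alpha> $ j" using exists_list_counts by blast
  have "mi_power y \<alpha> = (\<Sum>k\<le>mi_size \<alpha>. ((norm y)\<^sup>2) ^ k * harm_comp js k y)"
    using prod_list_eq_harm_comp[of js "mi_size \<alpha>"] length_eq_mi_size[OF js] by (simp add: mi_power_eq_prod_list[OF js])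
  also have "\<dots> = (\<Sum>k = 0..mi_size \<alpha> div 2. ((norm y)\<^sup>2) ^ k * harm_comp js k y)"
    using harm_comp_props[of _ js] length_eq_mi_size[OF js] by (intro sum.mono_neutral_right) auto
  finally show ?thesis by (simp add: power_mult harmonic_part_eq[OF js])
qed

section \<open>Iterated derivatives of radial functions\<close>

lemma partial_derivative_cong_open:
  assumes "open U" "y \<in> U" "\<And>z. z \<in> U \<Longrightarrow> f z = g z"
  shows "partial_derivative j f y = partial_derivative j g y"
proof -
  have "open ((\<lambda>t. y + t *\<^sub>R axis j 1) -` U)"
    using assms(1) by (intro open_vimage) (auto intro!: continuous_intros)
  moreover have "0 \<in> (\<lambda>t. y + t *\<^sub>R axis j 1) -` U" using assms(2) by simp
  ultimately have "eventually (\<lambda>t. y + t *\<^sub>R axis j 1 \<in> U) (nhds (0::real))"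
    unfolding eventually_nhds by blast
  then have "eventually (\<lambda>t. f (y + t *\<^sub>R axis j 1) = g (y + t *\<^sub>R axis j 1)) (nhds (0::real))"
    by eventually_elim (rule assms(3))
  then show ?thesis
    unfolding partial_derivative_def by (intro vector_derivative_cong_eq) auto
qed

text \<open>With \<open>m = n - 2k\<close>, the two recursions for \<open>\<Phi>\<close> come from
  \<open>\<partial>\<^sub>j (h \<Phi>(|y|\<^sup>2)) = 2 \<Phi>'(|y|\<^sup>2) raise j m h + ((d + 2m - 2) \<Phi> + 2 |y|\<^sup>2 \<Phi>')(|y|\<^sup>2) lower j m h\<close>.\<close>

lemma iterated_partial_derivative_radial:
  fixes \<Phi> \<Phi>' :: "nat \<Rightarrow> nat \<Rightarrow> real \<Rightarrow> complex" and js :: "'n::finite list" and y :: "real^'n"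
  assumes der: "\<And>n k r. r > 0 \<Longrightarrow> 2 * k \<le> n \<Longrightarrow> (\<Phi> n k has_vector_derivative \<Phi>' n k r) (at r)"
    and raise: "\<And>n k r. r > 0 \<Longrightarrow> 2 * k \<le> n \<Longrightarrow> \<Phi> (Suc n) k r = 2 * \<Phi>' n k r"
    and lower: "\<And>n k r. r > 0 \<Longrightarrow> 2 * k < n \<Longrightarrow> \<Phi> (Suc n) (Suc k) r
      = of_real (real CARD('n) + 2 * real (n - 2 * k) - 2) * \<Phi> n k r + 2 * of_real r * \<Phi>' n k r"
    and "y \<noteq> 0"
  shows "foldr partial_derivative js (\<lambda>y. \<Phi> 0 0 ((norm y)\<^sup>2)) y
    = (\<Sum>k\<le>length js. of_real (harm_comp js k y) * \<Phi> (length js) k ((norm y)\<^sup>2))"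
  using \<open>y \<noteq> 0\<close>
proof (induction js arbitrary: y)
  case Nil
  then show ?case by simp
next
  case (Cons j js)
  let ?n = "length js" and ?r = "(norm y)\<^sup>2" and ?h = "harm_comp js"
  have r: "?r > 0" using Cons.prems by simp
  define A where "A k = raise j (?n - 2 * k) (?h k) y" for k
  define B where "B k = lower j (?n - 2 * k) (?h k) y" for k
  define S where "S y = (\<Sum>k\<le>?n. of_real (?h k y) * \<Phi> ?n k ((norm y)\<^sup>2))" for y
  have deriv: "((\<lambda>y. of_real (?h k y) * \<Phi> ?n k ((norm y)\<^sup>2)) has_derivative
      (\<lambda>v. of_real (?h k y) * of_real (2 * (y \<bullet> v)) * \<Phi>' ?n k ?r
          + of_real (frechet_derivative (?h k) (at y) v) * \<Phi> ?n k ?r)) (at y)" for k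
  proof (cases "2 * k \<le> ?n")
    case True
    then have "real_polynomial_function (?h k)"
      using harm_comp_props[of k js] homogeneous_polynomialD(1) by blast
    from real_polynomial_function_frechet_derivative[OF this]
    have 1: "((\<lambda>y. complex_of_real (?h k y)) has_derivative (\<lambda>v. of_real (frechet_derivative (?h k) (at y) v))) (at y)"
      by (rule has_derivative_of_real)
    have "((\<lambda>y::real^'n. y \<bullet> y) has_derivative (\<lambda>v. y \<bullet> v + v \<bullet> y)) (at y)"
      by (auto intro!: derivative_eq_intros)
    then have 2: "((\<lambda>y::real^'n. (norm y)\<^sup>2) has_derivative (\<lambda>v. 2 * (y \<bullet> v))) (at y)"
      by (simp add: power2_norm_eq_inner inner_commute)
    have 3: "(\<Phi> ?n k has_derivative (\<lambda>t. t *\<^sub>R \<Phi>' ?n k ?r)) (at ?r)"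
      using der[OF r True] by (simp add: has_vector_derivative_def)
    show ?thesis
      using has_derivative_mult[OF 1 has_derivative_compose[OF 2 3]] by (simp add: scaleR_conv_of_real mult_ac)
  next
    case False
    then have "?h k = (\<lambda>y. 0)" using harm_comp_props[of k js] by simp
    then show ?thesis by simp
  qed
  have "(S has_derivative (\<lambda>v. \<Sum>k\<le>?n. of_real (?h k y) * of_real (2 * (y \<bullet> v)) * \<Phi>' ?n k ?r
          + of_real (frechet_derivative (?h k) (at y) v) * \<Phi> ?n k ?r)) (at y)"
    unfolding S_def[abs_def] by (intro has_derivative_sum deriv)
  from partial_derivative_eq[OF this]
  have "partial_derivative j S y = (\<Sum>k\<le>?n. of_real (y $ j * ?h k y) * (2 * \<Phi>' ?n k ?r)
          + of_real (frechet_derivative (?h k) (at y) (axis j 1)) * \<Phi> ?n k ?r)"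
    by (simp add: inner_axis mult_ac)
  also have "\<dots> = (\<Sum>k\<le>?n. of_real (A k) * \<Phi> (Suc ?n) k ?r + of_real (B k) * \<Phi> (Suc ?n) (Suc k) ?r)"
  proof (intro sum.cong refl)
    fix k
    have yh: "y $ j * ?h k y = A k + ?r * B k"
      by (simp add: A_def B_def raise_def)
    show "of_real (y $ j * ?h k y) * (2 * \<Phi>' ?n k ?r) + of_real (frechet_derivative (?h k) (at y) (axis j 1)) * \<Phi> ?n k ?r
      = of_real (A k) * \<Phi> (Suc ?n) k ?r + of_real (B k) * \<Phi> (Suc ?n) (Suc k) ?r"
    proof (cases "2 * k \<le> ?n")
      case True
      then have hom: "homogeneous_polynomial (?n - 2 * k) (?h k)"
        using harm_comp_props[of k js] by blast
      have fd: "frechet_derivative (?h k) (at y) (axis j 1) = partial_derivative j (?h k) y"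
        by (rule partial_derivative_eq[symmetric, OF real_polynomial_function_frechet_derivative[OF homogeneous_polynomialD(1)[OF hom]]])
      show ?thesis
      \<comment> \<open>In the top case 2 k = n the component is constant and has no lowered part,
        so the first recursion alone gives the claim.\<close>
      proof (cases "2 * k = ?n")
        case True
        then have "?h k = (\<lambda>y. ?h k 0)" using hom homogeneous_degree_zero by auto
        then have p: "partial_derivative j (?h k) y = 0" by (metis partial_derivative_const)
        then have "B k = 0" by (simp add: B_def lower_def)
        then show ?thesis using raise[OF r, of k ?n] True fd p yh by simp
      next
        case False
        with True have k: "2 * k < ?n" by simp
        define c where "c = real CARD('n) + 2 * real (?n - 2 * k) - 2"
        have p: "partial_derivative j (?h k) y = c * B k"
          using card_factor_pos[where ?'n='n, of "?n - 2 * k"] k by (simp add: B_def lower_def c_def)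
        show ?thesis
          unfolding raise[OF r True] lower[OF r k] fd p yh c_def[symmetric] by (simp add: algebra_simps)
      qed
    next
      case False
      then have "?h k = (\<lambda>y. 0)" using harm_comp_props[of k js] by simp
      then have "A k = 0" "B k = 0" "?h k = (\<lambda>y. 0)" by (simp_all add: A_def B_def)
      then show ?thesis by simp
    qed
  qed
  also have "\<dots> = (\<Sum>k\<le>Suc ?n. of_real (harm_comp (j # js) k y) * \<Phi> (Suc ?n) k ?r)"
  proof -
    have "harm_comp js (Suc ?n) = (\<lambda>y. 0)" using harm_comp_props[of "Suc ?n" js] by simp
    then have "A (Suc ?n) = 0" by (simp add: A_def)
    then have "(\<Sum>k\<le>?n. of_real (A k) * \<Phi> (Suc ?n) k ?r) = (\<Sum>k\<le>Suc ?n. of_real (A k) * \<Phi> (Suc ?n) k ?r)"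
      by simp
    moreover have "(\<Sum>k\<le>?n. of_real (B k) * \<Phi> (Suc ?n) (Suc k) ?r)
       = (\<Sum>k\<le>Suc ?n. of_real (if k = 0 then 0 else B (k - 1)) * \<Phi> (Suc ?n) k ?r)"
      unfolding sum.atMost_Suc_shift by simp
    ultimately show ?thesis
      unfolding sum.distrib
      by (simp only: sum.distrib[symmetric] distrib_right[symmetric] of_real_add[symmetric])
        (intro sum.cong refl, simp add: A_def B_def)
  qed
  finally have "partial_derivative j S y = (\<Sum>k\<le>Suc ?n. of_real (harm_comp (j # js) k y) * \<Phi> (Suc ?n) k ?r)" .
  \<comment> \<open>The induction hypothesis holds off the origin only, so the two functions are
    compared on the open set \<open>- {0}\<close>.\<close>
  moreover have "partial_derivative j (foldr partial_derivative js (\<lambda>y. \<Phi> 0 0 ((norm y)\<^sup>2))) y = partial_derivative j S y"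
    using Cons by (intro partial_derivative_cong_open[of "- {0}"]) (auto simp: S_def)
  ultimately show ?case by simp
qed

section \<open>Series of functions\<close>

lemma summable_on_norm_bound:
  fixes f :: "'i \<Rightarrow> 'b::banach"
  assumes "M summable_on I" "\<And>i. i \<in> I \<Longrightarrow> norm (f i) \<le> M i"
  shows "f summable_on I"
  using Infinite_Sum.abs_summable_on_comparison_test'[OF assms] by (rule abs_summable_summable)

lemma continuous_on_infsum:
  fixes f :: "'i \<Rightarrow> 'a::topological_space \<Rightarrow> 'b::banach"
  assumes "\<And>i. i \<in> I \<Longrightarrow> continuous_on S (f i)"
    and "\<And>i x. i \<in> I \<Longrightarrow> x \<in> S \<Longrightarrow> norm (f i x) \<le> M i" and "M summable_on I"
  shows "continuous_on S (\<lambda>x. \<Sum>\<^sub>\<infinity>i\<in>I. f i x)"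
proof (rule uniform_limit_theorem)
  show "uniform_limit S (\<lambda>X y. \<Sum>x\<in>X. f x y) (\<lambda>y. \<Sum>\<^sub>\<infinity>x\<in>I. f x y) (finite_subsets_at_top I)"
    by (rule Weierstrass_m_test_general[OF assms(2,3)])
  show "\<forall>\<^sub>F X in finite_subsets_at_top I. continuous_on S (\<lambda>y. \<Sum>x\<in>X. f x y)"
    by (intro eventually_finite_subsets_at_top_weakI continuous_on_sum) (use assms(1) in auto)
qed simp

text \<open>Only local majorants are demanded: the lattice sums below are dominated uniformly on
  left half planes in s, and the power series away from its poles, but neither globally.\<close>

lemma holomorphic_on_infsum:
  fixes f :: "'i \<Rightarrow> complex \<Rightarrow> complex"
  assumes "open U" "\<And>i. i \<in> I \<Longrightarrow> f i holomorphic_on U"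
    and bd: "\<And>z. z \<in> U \<Longrightarrow> \<exists>\<epsilon> M. \<epsilon> > 0 \<and> M summable_on I \<and> cball z \<epsilon> \<subseteq> U
       \<and> (\<forall>i\<in>I. \<forall>w\<in>cball z \<epsilon>. norm (f i w) \<le> M i)"
  shows "(\<lambda>z. \<Sum>\<^sub>\<infinity>i\<in>I. f i z) holomorphic_on U"
proof -
  have "(\<lambda>z. \<Sum>\<^sub>\<infinity>i\<in>I. f i z) field_differentiable at z" if zU: "z \<in> U" for z
  proof -
    obtain \<epsilon> M where M: "\<epsilon> > 0" "M summable_on I" "cball z \<epsilon> \<subseteq> U"
       "\<And>i w. i \<in> I \<Longrightarrow> w \<in> cball z \<epsilon> \<Longrightarrow> norm (f i w) \<le> M i"
      using bd[OF zU] by blast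
    have ul: "uniform_limit (cball z \<epsilon>) (\<lambda>X y. \<Sum>x\<in>X. f x y) (\<lambda>y. \<Sum>\<^sub>\<infinity>x\<in>I. f x y) (finite_subsets_at_top I)"
      by (rule Weierstrass_m_test_general[OF M(4,2)])
    have hol: "f i holomorphic_on cball z \<epsilon>" if "i \<in> I" for i
      using assms(2)[OF that] M(3) holomorphic_on_subset by blast
    have "\<forall>\<^sub>F X in finite_subsets_at_top I. continuous_on (cball z \<epsilon>) (\<lambda>y. \<Sum>x\<in>X. f x y)
        \<and> (\<lambda>y. \<Sum>x\<in>X. f x y) holomorphic_on ball z \<epsilon>"
    proof (intro eventually_finite_subsets_at_top_weakI conjI)
      fix X assume "finite X" "X \<subseteq> I"
      then have h: "(\<lambda>y. \<Sum>x\<in>X. f x y) holomorphic_on cball z \<epsilon>"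
        using hol by (intro holomorphic_intros) auto
      then show "continuous_on (cball z \<epsilon>) (\<lambda>y. \<Sum>x\<in>X. f x y)"
        by (rule holomorphic_on_imp_continuous_on)
      show "(\<lambda>y. \<Sum>x\<in>X. f x y) holomorphic_on ball z \<epsilon>"
        by (rule holomorphic_on_subset[OF h]) auto
    qed
    from holomorphic_uniform_limit[OF this ul]
    have "(\<lambda>z. \<Sum>\<^sub>\<infinity>i\<in>I. f i z) holomorphic_on ball z \<epsilon>" by auto
    then show ?thesis
      using M(1) by (intro holomorphic_on_imp_differentiable_at[of _ "ball z \<epsilon>"]) auto
  qed
  then show ?thesis
    by (simp add: holomorphic_on_def field_differentiable_at_within)
qed

text \<open>The difference quotients form a continuous, uniformly dominated family.\<close>

lemma has_vector_derivative_infsum: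
  fixes f :: "'i \<Rightarrow> real \<Rightarrow> 'b::banach"
  assumes der: "\<And>i s. i \<in> I \<Longrightarrow> s \<in> {-1..1} \<Longrightarrow> (f i has_vector_derivative f' i s) (at s within {-1..1})"
    and bd: "\<And>i s. i \<in> I \<Longrightarrow> s \<in> {-1..1} \<Longrightarrow> norm (f' i s) \<le> M i" and M: "M summable_on I"
    and sm: "(\<lambda>i. f i 0) summable_on I"
  shows "((\<lambda>s. \<Sum>\<^sub>\<infinity>i\<in>I. f i s) has_vector_derivative (\<Sum>\<^sub>\<infinity>i\<in>I. f' i 0)) (at 0)"
proof -
  \<comment> \<open>The difference quotient is completed by the derivative at s = 0, so that the
    bound \<open>M i\<close> holds on the whole interval and the limit s -> 0 can be taken
    termwise.\<close>
  define g where "g i s = (if s = 0 then f' i 0 else (f i s - f i 0) /\<^sub>R s)" for i s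
  have lip: "norm (f i s - f i 0) \<le> M i * \<bar>s\<bar>" if "i \<in> I" "s \<in> {-1..1}" for i s
  proof -
    have "norm (f i s - f i 0) \<le> M i * norm (s - 0)"
    proof (rule differentiable_bound[of "{-1..1}" "f i" "\<lambda>s v. v *\<^sub>R f' i s"])
      show "(f i has_derivative (\<lambda>v. v *\<^sub>R f' i x)) (at x within {- 1..1})" if "x \<in> {-1..1}" for x
        using der[OF \<open>i \<in> I\<close> that] by (simp add: has_vector_derivative_def)
      show "onorm (\<lambda>v. v *\<^sub>R f' i x) \<le> M i" if "x \<in> {-1..1}" for x
        using bd[OF \<open>i \<in> I\<close> that] by (intro onorm_le) (simp add: mult.commute mult_left_mono)
    qed (use that in auto)
    then show ?thesis by simp
  qed
  have gb: "norm (g i s) \<le> M i" if "i \<in> I" "s \<in> {-1..1}" for i s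
    using lip[OF that] bd[OF that(1), of 0] by (auto simp: g_def divide_simps mult.commute)
  have gc: "(\<lambda>s. g i s) \<midarrow>0\<rightarrow> g i 0" if "i \<in> I" for i
  proof -
    have "(f i has_vector_derivative f' i 0) (at 0)"
      using der[OF that, of 0] by (simp add: at_within_Icc_at)
    then have "(\<lambda>h. norm (f i h - f i 0 - h *\<^sub>R f' i 0) / norm h) \<midarrow>0\<rightarrow> 0"
      by (simp add: has_vector_derivative_def has_derivative_at)
    then have "(\<lambda>h. norm ((f i h - f i 0) /\<^sub>R h - f' i 0)) \<midarrow>0\<rightarrow> 0"
    proof (rule Lim_transform_eventually)
      have "norm (f i h - f i 0 - h *\<^sub>R f' i 0) / norm h = norm ((f i h - f i 0) /\<^sub>R h - f' i 0)" if "h \<noteq> 0" for h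
      proof -
        have "(f i h - f i 0) /\<^sub>R h - f' i 0 = (f i h - f i 0 - h *\<^sub>R f' i 0) /\<^sub>R h"
          using that by (simp add: scaleR_diff_right)
        then show ?thesis by (simp add: divide_inverse mult.commute)
      qed
      then show "\<forall>\<^sub>F h in at 0. norm (f i h - f i 0 - h *\<^sub>R f' i 0) / norm h = norm ((f i h - f i 0) /\<^sub>R h - f' i 0)"
        by (auto simp: eventually_at intro!: exI[of _ 1])
    qed
    then have "(\<lambda>h. (f i h - f i 0) /\<^sub>R h) \<midarrow>0\<rightarrow> f' i 0"
      using tendsto_norm_zero_iff LIM_zero_cancel by blast
    then have "(\<lambda>s. g i s) \<midarrow>0\<rightarrow> f' i 0"
      by (rule Lim_transform_eventually) (auto simp: g_def eventually_at intro!: exI[of _ 1])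
    then show ?thesis by (simp add: g_def)
  qed
  have "((\<lambda>s. \<Sum>\<^sub>\<infinity>i\<in>I. g i s) \<longlongrightarrow> (\<Sum>\<^sub>\<infinity>i\<in>I. g i 0)) (at 0)"
  proof -
    have ul: "uniform_limit {-1..1} (\<lambda>X y. \<Sum>x\<in>X. g x y) (\<lambda>y. \<Sum>\<^sub>\<infinity>x\<in>I. g x y) (finite_subsets_at_top I)"
      by (rule Weierstrass_m_test_general[OF gb M])
    have "((\<lambda>s. \<Sum>\<^sub>\<infinity>i\<in>I. g i s) \<longlongrightarrow> (\<Sum>\<^sub>\<infinity>i\<in>I. g i 0)) (at 0 within {-1..1})"
    proof (rule swap_uniform_limit[OF _ _ ul])
      show "\<forall>\<^sub>F X in finite_subsets_at_top I. ((\<lambda>y. \<Sum>x\<in>X. g x y) \<longlongrightarrow> (\<Sum>x\<in>X. g x 0)) (at 0 within {-1..1})"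
        by (intro eventually_finite_subsets_at_top_weakI tendsto_sum)
          (use gc in \<open>auto intro: tendsto_within_subset[of _ _ _ UNIV]\<close>)
      have "(\<lambda>i. g i 0) summable_on I"
        by (rule summable_on_norm_bound[OF M]) (rule gb, auto)
      then show "((\<lambda>X. \<Sum>x\<in>X. g x 0) \<longlongrightarrow> (\<Sum>\<^sub>\<infinity>i\<in>I. g i 0)) (finite_subsets_at_top I)"
        using has_sum_infsum has_sum_def by blast
    qed (auto)
    then show ?thesis by (simp add: at_within_Icc_at)
  qed
  moreover have "\<forall>\<^sub>F s in at 0. (\<Sum>\<^sub>\<infinity>i\<in>I. g i s) = ((\<Sum>\<^sub>\<infinity>i\<in>I. f i s) - (\<Sum>\<^sub>\<infinity>i\<in>I. f i 0)) /\<^sub>R s"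
  proof -
    have "\<forall>\<^sub>F s in at (0::real). s \<in> {-1<..<1} - {0}"
      by (intro eventually_at_in_open) auto
    then show ?thesis
    proof eventually_elim
      fix s :: real assume s: "s \<in> {-1<..<1} - {0}"
      have d: "(\<lambda>i. f i s - f i 0) summable_on I"
        by (rule summable_on_norm_bound[OF summable_on_cmult_left[OF M, of "\<bar>s\<bar>"]]) (use s lip in auto)
      have "(\<Sum>\<^sub>\<infinity>i\<in>I. g i s) = (\<Sum>\<^sub>\<infinity>i\<in>I. (f i s - f i 0) /\<^sub>R s)"
        using s by (simp add: g_def)
      also have "\<dots> = (\<Sum>\<^sub>\<infinity>i\<in>I. f i s - f i 0) /\<^sub>R s"
        by (rule infsum_scaleR_right)
      also have "\<dots> = ((\<Sum>\<^sub>\<infinity>i\<in>I. f i s) - (\<Sum>\<^sub>\<infinity>i\<in>I. f i 0)) /\<^sub>R s"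
        using infsum_add[OF d sm] by simp
      finally show "(\<Sum>\<^sub>\<infinity>i\<in>I. g i s) = ((\<Sum>\<^sub>\<infinity>i\<in>I. f i s) - (\<Sum>\<^sub>\<infinity>i\<in>I. f i 0)) /\<^sub>R s" .
    qed
  qed
  ultimately have "((\<lambda>s. ((\<Sum>\<^sub>\<infinity>i\<in>I. f i s) - (\<Sum>\<^sub>\<infinity>i\<in>I. f i 0)) /\<^sub>R s) \<longlongrightarrow> (\<Sum>\<^sub>\<infinity>i\<in>I. g i 0)) (at 0)"
    by (rule Lim_transform_eventually)
  then have "((\<lambda>s. norm (((\<Sum>\<^sub>\<infinity>i\<in>I. f i s) - (\<Sum>\<^sub>\<infinity>i\<in>I. f i 0)) /\<^sub>R s - (\<Sum>\<^sub>\<infinity>i\<in>I. f' i 0))) \<longlongrightarrow> 0) (at 0)"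
    unfolding g_def by (simp add: LIM_zero_iff tendsto_norm_zero_iff)
  then have "((\<lambda>s. norm ((\<Sum>\<^sub>\<infinity>i\<in>I. f i s) - (\<Sum>\<^sub>\<infinity>i\<in>I. f i 0) - s *\<^sub>R (\<Sum>\<^sub>\<infinity>i\<in>I. f' i 0)) / norm s) \<longlongrightarrow> 0) (at 0)"
  proof (rule Lim_transform_eventually)
    show "\<forall>\<^sub>F s in at 0. norm (((\<Sum>\<^sub>\<infinity>i\<in>I. f i s) - (\<Sum>\<^sub>\<infinity>i\<in>I. f i 0)) /\<^sub>R s - (\<Sum>\<^sub>\<infinity>i\<in>I. f' i 0))
       = norm ((\<Sum>\<^sub>\<infinity>i\<in>I. f i s) - (\<Sum>\<^sub>\<infinity>i\<in>I. f i 0) - s *\<^sub>R (\<Sum>\<^sub>\<infinity>i\<in>I. f' i 0)) / norm s"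
    proof (rule eventually_at_ball'[THEN eventually_mono, of 1])
      fix s :: real assume "s \<in> ball 0 1 \<and> s \<noteq> 0 \<and> s \<in> UNIV"
      then have "s \<noteq> 0" by simp
      then have "((\<Sum>\<^sub>\<infinity>i\<in>I. f i s) - (\<Sum>\<^sub>\<infinity>i\<in>I. f i 0)) /\<^sub>R s - (\<Sum>\<^sub>\<infinity>i\<in>I. f' i 0)
        = ((\<Sum>\<^sub>\<infinity>i\<in>I. f i s) - (\<Sum>\<^sub>\<infinity>i\<in>I. f i 0) - s *\<^sub>R (\<Sum>\<^sub>\<infinity>i\<in>I. f' i 0)) /\<^sub>R s"
        by (simp add: scaleR_diff_right)
      then show "norm (((\<Sum>\<^sub>\<infinity>i\<in>I. f i s) - (\<Sum>\<^sub>\<infinity>i\<in>I. f i 0)) /\<^sub>R s - (\<Sum>\<^sub>\<infinity>i\<in>I. f' i 0))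
       = norm ((\<Sum>\<^sub>\<infinity>i\<in>I. f i s) - (\<Sum>\<^sub>\<infinity>i\<in>I. f i 0) - s *\<^sub>R (\<Sum>\<^sub>\<infinity>i\<in>I. f' i 0)) / norm s"
        by (simp add: divide_inverse mult.commute)
    qed simp
  qed
  then show ?thesis
    unfolding has_vector_derivative_def has_derivative_at
    by (auto simp: bounded_linear_scaleR_left)
qed

text \<open>The countable index set is embedded into the naturals and padded with zero functions,
  which reduces the interchange to the theorem on integrals of absolutely convergent series.\<close>

lemma has_sum_integral_swap:
  fixes f :: "'i \<Rightarrow> 'a::euclidean_space \<Rightarrow> complex"
  assumes I: "countable I" and S: "S \<in> sets lebesgue"
    and int: "\<And>i. i \<in> I \<Longrightarrow> f i absolutely_integrable_on S"
    and sm: "(\<lambda>i. integral S (\<lambda>t. norm (f i t))) summable_on I"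
    and hs: "\<And>t. t \<in> S \<Longrightarrow> ((\<lambda>i. f i t) has_sum g t) I"
  shows "g absolutely_integrable_on S" "((\<lambda>i. integral S (f i)) has_sum integral S g) I"
proof -
  define b where "b = to_nat_on I"
  have binj: "inj_on b I" unfolding b_def using I by (rule inj_on_to_nat_on)
  define F where "F n = (if n \<in> b ` I then f (inv_into I b n) else (\<lambda>t. 0))" for n
  have Fb: "F (b i) = f i" if "i \<in> I" for i
    using that binj by (simp add: F_def)
  have Fint: "integrable (lebesgue_on S) (F n)" for n
    using int S by (auto simp: F_def absolutely_integrable_on_def integrable_restrict_space set_integrable_def inv_into_into)
  have Lint: "integral\<^sup>L (lebesgue_on S) (F n) = integral S (F n)" for n
    using Fint S by (intro lebesgue_integral_eq_integral) auto
  have Lnint: "integral\<^sup>L (lebesgue_on S) (\<lambda>t. norm (F n t)) = integral S (\<lambda>t. norm (F n t))" for n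
    using Fint S by (intro lebesgue_integral_eq_integral) auto
  have ext: "(G has_sum s) UNIV" if "((\<lambda>i. G (b i)) has_sum s) I" "\<And>n. n \<notin> b ` I \<Longrightarrow> G n = 0"
    for G :: "nat \<Rightarrow> 'c::{comm_monoid_add,topological_space}" and s
  proof -
    have "(G has_sum s) (b ` I)"
      using that(1) by (subst has_sum_reindex[OF binj]) (simp add: o_def)
    then show ?thesis using that(2) by (subst has_sum_cong_neutral[of "b ` I" _ _ G]) auto
  qed
  have hsF: "((\<lambda>n. F n t) has_sum g t) UNIV" if "t \<in> S" for t
    using hs[OF that] by (intro ext) (simp add: Fb cong: has_sum_cong, simp add: F_def)
  have smF: "summable (\<lambda>n. integral S (\<lambda>t. norm (F n t)))"
  proof -
    obtain s where "((\<lambda>i. integral S (\<lambda>t. norm (f i t))) has_sum s) I" using sm by (auto simp: summable_on_def)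
    then have "((\<lambda>n. integral S (\<lambda>t. norm (F n t))) has_sum s) UNIV"
      by (intro ext) (simp add: Fb cong: has_sum_cong, simp add: F_def)
    then show ?thesis using has_sum_imp_sums sums_summable by blast
  qed
  have abs: "summable (\<lambda>n. norm (F n t))" if "t \<in> S" for t
  proof -
    have "(\<lambda>n. F n t) summable_on UNIV" using hsF[OF that] by (auto simp: summable_on_def)
    then have "(\<lambda>n. norm (F n t)) summable_on UNIV" by (simp add: summable_on_iff_abs_summable_on_complex)
    then show ?thesis using summable_on_imp_summable by blast
  qed
  have sm_eq: "(\<Sum>n. F n t) = g t" if "t \<in> S" for t
    using has_sum_imp_sums[OF hsF[OF that]] by (simp add: sums_iff)
  have 1: "integrable (lebesgue_on S) (\<lambda>t. \<Sum>n. F n t)"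
    and 2: "(\<lambda>n. integral\<^sup>L (lebesgue_on S) (F n)) sums (integral\<^sup>L (lebesgue_on S) (\<lambda>t. \<Sum>n. F n t))"
    by (rule integrable_suminf sums_integral; use Fint abs smF Lnint in \<open>auto intro!: AE_I2\<close>)+
  have 3: "integrable (lebesgue_on S) g"
    by (rule Bochner_Integration.integrable_cong[THEN iffD1, OF refl _ 1]) (simp add: sm_eq)
  then show "g absolutely_integrable_on S"
    using S by (simp add: absolutely_integrable_on_def integrable_restrict_space set_integrable_def)
  have "integral\<^sup>L (lebesgue_on S) (\<lambda>t. \<Sum>n. F n t) = integral S g"
    using 3 S sm_eq by (subst lebesgue_integral_eq_integral[symmetric]) (auto intro!: Bochner_Integration.integral_cong)
  then have "(\<lambda>n. integral S (F n)) sums integral S g" using 2 by (simp add: Lint)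
  moreover have "summable (\<lambda>n. norm (integral S (F n)))"
  proof (rule summable_comparison_test'[OF smF])
    show "norm (norm (integral S (F n))) \<le> integral S (\<lambda>t. norm (F n t))" for n
      unfolding Lint[symmetric] Lnint[symmetric] by (simp add: integral_norm_bound)
  qed
  ultimately have "((\<lambda>n. integral S (F n)) has_sum integral S g) UNIV"
    by (metis norm_summable_imp_has_sum)
  then have "((\<lambda>n. integral S (F n)) has_sum integral S g) (b ` I)"
    by (rule has_sum_cong_neutral[THEN iffD1, rotated -1]) (auto simp: F_def)
  then show "((\<lambda>i. integral S (f i)) has_sum integral S g) I"
    unfolding has_sum_reindex[OF binj] by (simp add: o_def Fb cong: has_sum_cong)
qed

section \<open>Lattice sums\<close>

lemma matrix_inv:
  fixes A :: "real^'n^'n"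
  assumes "invertible A"
  shows "A ** matrix_inv A = mat 1" "matrix_inv A ** A = mat 1"
proof -
  have "A ** matrix_inv A = mat 1 \<and> matrix_inv A ** A = mat 1"
    using assms unfolding invertible_def matrix_inv_def by (rule someI_ex)
  then show "A ** matrix_inv A = mat 1" "matrix_inv A ** A = mat 1" by auto
qed

lemma summable_on_int_powr:
  assumes "p > 1"
  shows "(\<lambda>m::int. (1 + real_of_int \<bar>m\<bar>) powr (-p)) summable_on UNIV"
proof -
  have "summable (\<lambda>n. real (Suc n) powr (-p))"
    using assms by (subst summable_Suc_iff) (simp add: summable_real_powr_iff)
  then have n: "(\<lambda>n. (1 + real n) powr (-p)) summable_on UNIV"
    by (intro summable_nonneg_imp_summable_on) (auto simp: add.commute)
  have "(\<lambda>m::int. (1 + real_of_int \<bar>m\<bar>) powr (-p)) summable_on (range int)"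
    by (subst summable_on_reindex) (use n in \<open>auto simp: o_def\<close>)
  moreover have "(\<lambda>m::int. (1 + real_of_int \<bar>m\<bar>) powr (-p)) summable_on (range (\<lambda>n. - int n))"
    by (subst summable_on_reindex) (use n in \<open>auto simp: o_def inj_on_def\<close>)
  ultimately have "(\<lambda>m::int. (1 + real_of_int \<bar>m\<bar>) powr (-p)) summable_on (range int \<union> range (\<lambda>n. - int n))"
    by (rule summable_on_union)
  moreover have eq: "(UNIV::int set) = range int \<union> range (\<lambda>n. - int n)"
  proof (intro equalityI subsetI)
    fix m :: int
    show "m \<in> range int \<union> range (\<lambda>n. - int n)"
      by (cases m rule: int_cases2) auto
  qed auto
  ultimately show ?thesis by (subst eq)
qed

definition int_vecs :: "(real^'n) set" where
  "int_vecs = {m. \<forall>j. m $ j \<in> \<int>}"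

lemma lattice_of_eq: "lattice_of A = (\<lambda>m. A *v m) ` int_vecs"
  by (simp add: lattice_of_def int_vecs_def)

lemma bij_betw_int_vecs: "bij_betw (\<lambda>f. \<chi> j. real_of_int (f j)) (UNIV :: ('n::finite \<Rightarrow> int) set) (int_vecs :: (real^'n) set)"
  unfolding bij_betw_def
proof
  show "inj (\<lambda>f::'n\<Rightarrow>int. \<chi> j. real_of_int (f j))"
    by (auto simp: inj_def vec_eq_iff)
  show "range (\<lambda>f::'n\<Rightarrow>int. \<chi> j. real_of_int (f j)) = int_vecs"
  proof (intro equalityI subsetI)
    fix m :: "real^'n" assume "m \<in> int_vecs"
    show "m \<in> range (\<lambda>f::'n\<Rightarrow>int. \<chi> j. real_of_int (f j))"
    proof (rule image_eqI[where x="\<lambda>j. \<lfloor>m $ j\<rfloor>"])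
      show "m = (\<chi> j. real_of_int \<lfloor>m $ j\<rfloor>)"
        using \<open>m \<in> int_vecs\<close> by (auto simp: int_vecs_def vec_eq_iff Ints_def)
    qed simp
  qed (auto simp: int_vecs_def)
qed

text \<open>Every coordinate is bounded by the norm. Splitting the exponent into d equal parts
  therefore bounds the term by a product of one-dimensional terms with exponent \<tau> / d >
  1.\<close>

lemma summable_on_int_vecs_powr:
  assumes "\<tau> > real CARD('n)"
  shows "(\<lambda>m. (1 + norm m) powr (-\<tau>)) summable_on (int_vecs :: (real^'n) set)"
proof -
  define p where "p = \<tau> / real CARD('n)"
  have p: "p > 1" using assms by (simp add: p_def field_simps)
  define g where "g f = (\<Prod>j\<in>UNIV. (1 + real_of_int \<bar>f j\<bar>) powr (-p))" for f :: "'n \<Rightarrow> int"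
  have "(\<lambda>m::int. norm ((1 + real_of_int \<bar>m\<bar>) powr (-p))) summable_on UNIV"
    using summable_on_int_powr[OF p] by (simp only: summable_on_iff_abs_summable_on_real[symmetric])
  then have "Infinite_Set_Sum.abs_summable_on (\<lambda>m::int. (1 + real_of_int \<bar>m\<bar>) powr (-p)) UNIV"
    by (simp only: abs_summable_equivalent)
  then have "Infinite_Set_Sum.abs_summable_on g (PiE (UNIV::'n set) (\<lambda>_. UNIV))"
    unfolding g_def[abs_def] by (intro abs_summable_on_prod_PiE) auto
  then have "(\<lambda>f. norm (g f)) summable_on UNIV"
    by (simp only: abs_summable_equivalent[symmetric] PiE_UNIV)
  then have g: "g summable_on UNIV"
    by (simp only: summable_on_iff_abs_summable_on_real[symmetric])
  have "(\<lambda>f::'n\<Rightarrow>int. (1 + norm (\<chi> j. real_of_int (f j))) powr (-\<tau>)) summable_on UNIV"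
  proof (rule summable_on_comparison_test[OF g])
    fix f :: "'n \<Rightarrow> int"
    let ?m = "\<chi> j. real_of_int (f j)"
    have "1 + norm ?m \<noteq> 0" using norm_ge_zero[of ?m] by linarith
    then have "(1 + norm ?m) powr (-\<tau>) = (\<Prod>j\<in>(UNIV::'n set). (1 + norm ?m) powr (-p))"
      by (simp add: powr_power p_def)
    also have "\<dots> \<le> g f"
      unfolding g_def
    proof (intro prod_mono conjI)
      fix j
      have "real_of_int \<bar>f j\<bar> \<le> norm ?m"
        using component_le_norm_cart[of ?m j] by simp
      then show "(1 + norm ?m) powr (-p) \<le> (1 + real_of_int \<bar>f j\<bar>) powr (-p)"
        using p by (intro powr_mono2') auto
    qed simp
    finally show "(1 + norm ?m) powr (-\<tau>) \<le> g f" .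
  qed simp
  then show ?thesis
    using summable_on_reindex_bij_betw[OF bij_betw_int_vecs, of "\<lambda>m::real^'n. (1 + norm m) powr (-\<tau>)"] by simp
qed

lemma invertible_norm_bound:
  fixes A :: "real^'n^'n"
  assumes "invertible A"
  obtains K where "K \<ge> 1" "\<And>m. norm m \<le> K * norm (A *v m)"
proof -
  define B where "B = matrix_inv A"
  have BA: "B *v (A *v m) = m" for m
    using matrix_inv(2)[OF assms] by (simp add: B_def matrix_vector_mul_assoc)
  have "bounded_linear ((*v) B)" by (rule matrix_vector_mul_bounded_linear)
  then obtain K where K: "\<And>v. norm (B *v v) \<le> norm v * K" using bounded_linear.bounded by blast
  show ?thesis
  proof
    show "max K 1 \<ge> 1" by simp
    show "norm m \<le> max K 1 * norm (A *v m)" for m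
      using K[of "A *v m"] mult_right_mono[of K "max K 1" "norm (A *v m)"] by (simp add: BA mult.commute)
  qed
qed

lemma inj_matrix_vector_mult:
  fixes A :: "real^'n^'n"
  shows "invertible A \<Longrightarrow> inj ((*v) A)"
  by (metis injI matrix_inv(2) matrix_vector_mul_assoc matrix_vector_mul_lid)

lemma summable_on_lattice_powr:
  fixes A :: "real^'n^'n"
  assumes "invertible A" "\<tau> > real CARD('n)"
  shows "(\<lambda>z. (1 + norm z) powr (-\<tau>)) summable_on lattice_of A"
proof -
  obtain K where K: "K \<ge> 1" "\<And>m. norm m \<le> K * norm (A *v m)"
    using invertible_norm_bound[OF assms(1)] by blast
  have \<tau>: "\<tau> \<ge> 0" using assms(2) by (meson less_imp_le of_nat_0_le_iff order_trans)
  have "(\<lambda>m. K powr \<tau> * (1 + norm m) powr (-\<tau>)) summable_on (int_vecs :: (real^'n) set)"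
    by (intro summable_on_cmult_right summable_on_int_vecs_powr assms)
  then have "(\<lambda>m. (1 + norm (A *v m)) powr (-\<tau>)) summable_on int_vecs"
  proof (rule summable_on_comparison_test)
    fix m :: "real^'n"
    have "1 + norm m \<le> K * (1 + norm (A *v m))"
      using K(1) K(2)[of m] by (simp add: algebra_simps)
    then have "(K * (1 + norm (A *v m))) powr (-\<tau>) \<le> (1 + norm m) powr (-\<tau>)"
      using \<tau> by (intro powr_mono2') (auto simp: add_pos_nonneg)
    then have "K powr (-\<tau>) * (1 + norm (A *v m)) powr (-\<tau>) \<le> (1 + norm m) powr (-\<tau>)"
      using K(1) by (simp add: powr_mult)
    then have "K powr \<tau> * (K powr (-\<tau>) * (1 + norm (A *v m)) powr (-\<tau>)) \<le> K powr \<tau> * (1 + norm m) powr (-\<tau>)"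
      by (intro mult_left_mono) auto
    then show "(1 + norm (A *v m)) powr (-\<tau>) \<le> K powr \<tau> * (1 + norm m) powr (-\<tau>)"
      using K(1) by (simp add: mult.assoc[symmetric] powr_add[symmetric])
  qed simp
  then show ?thesis
    unfolding lattice_of_eq using inj_matrix_vector_mult[OF assms(1)]
    by (subst summable_on_reindex) (auto simp: o_def inj_on_def)
qed

text \<open>From 1 + |z| \<le> (1 + |x|) (1 + |z + x|). It makes summability statements stable under
  shifts of the lattice.\<close>

lemma shift_powr_bound:
  fixes z x :: "'a::real_normed_vector"
  assumes "\<tau> \<ge> 0"
  shows "(1 + norm (z + x)) powr (-\<tau>) \<le> (1 + norm x) powr \<tau> * (1 + norm z) powr (-\<tau>)"
proof -
  have "norm z \<le> norm (z + x) + norm x" by (metis add_diff_cancel norm_triangle_ineq4)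
  then have "1 + norm z \<le> (1 + norm x) * (1 + norm (z + x))"
    using mult_nonneg_nonneg[OF norm_ge_zero[of x] norm_ge_zero[of "z + x"]]
    by (simp only: distrib_left distrib_right mult_1 mult_1_right)
  then have "((1 + norm x) * (1 + norm (z + x))) powr (-\<tau>) \<le> (1 + norm z) powr (-\<tau>)"
    using assms by (intro powr_mono2') (auto simp: add_pos_nonneg)
  then have "(1 + norm x) powr (-\<tau>) * (1 + norm (z + x)) powr (-\<tau>) \<le> (1 + norm z) powr (-\<tau>)"
    by (simp add: powr_mult)
  then have "(1 + norm x) powr \<tau> * ((1 + norm x) powr (-\<tau>) * (1 + norm (z + x)) powr (-\<tau>))
      \<le> (1 + norm x) powr \<tau> * (1 + norm z) powr (-\<tau>)"
    by (intro mult_left_mono) auto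
  moreover have "(1 + norm x) powr \<tau> * (1 + norm x) powr (-\<tau>) = 1"
    by (simp add: powr_add[symmetric] add_pos_nonneg less_imp_neq[THEN not_sym])
  ultimately show ?thesis by (simp add: mult.assoc[symmetric])
qed

lemma summable_on_shifted_lattice_powr:
  fixes A :: "real^'n^'n"
  assumes "invertible A" "\<tau> > real CARD('n)"
  shows "(\<lambda>z. (1 + norm (z + x)) powr (-\<tau>)) summable_on lattice_of A"
proof (rule summable_on_comparison_test)
  have \<tau>: "\<tau> \<ge> 0" using assms(2) by (meson less_imp_le of_nat_0_le_iff order_trans)
  show "(\<lambda>z. (1 + norm x) powr \<tau> * (1 + norm z) powr (-\<tau>)) summable_on lattice_of A"
    by (intro summable_on_cmult_right summable_on_lattice_powr assms)
  show "(1 + norm (z + x)) powr (-\<tau>) \<le> (1 + norm x) powr \<tau> * (1 + norm z) powr (-\<tau>)" for z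
    by (rule shift_powr_bound[OF \<tau>])
qed simp

lemma countable_lattice: "countable (lattice_of A)"
proof -
  have "countable (int_vecs :: (real^'n) set)"
    using bij_betw_int_vecs by (metis bij_betw_def countable_image countableI_type)
  then show ?thesis unfolding lattice_of_eq by (rule countable_image)
qed

lemma int_vec_norm_ge_1:
  assumes "m \<in> int_vecs" "m \<noteq> 0"
  shows "norm m \<ge> 1"
proof -
  obtain j where "m $ j \<noteq> 0" using assms(2) by (auto simp: vec_eq_iff)
  moreover have "m $ j \<in> \<int>" using assms(1) by (auto simp: int_vecs_def)
  ultimately have "\<bar>m $ j\<bar> \<ge> 1" by (simp add: Ints_nonzero_abs_ge1)
  then show ?thesis using component_le_norm_cart[of m j] by linarith
qed

lemma int_vecs_diff: "m \<in> int_vecs \<Longrightarrow> m' \<in> int_vecs \<Longrightarrow> m - m' \<in> int_vecs"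
  by (auto simp: int_vecs_def)

text \<open>Distinct lattice points are at distance at least 1 / K, so at most one shifted point
  lies closer to the origin than 1 / (2 K). If such a point exists and is nonzero, its norm serves
  as \<epsilon>; otherwise 1 / (2 K) does.\<close>

lemma lattice_shift_discrete:
  fixes A :: "real^'n^'n"
  assumes "invertible A"
  obtains \<epsilon> where "\<epsilon> > 0" "\<And>z. z \<in> lattice_of A \<Longrightarrow> z + x \<noteq> 0 \<Longrightarrow> norm (z + x) \<ge> \<epsilon>"
proof -
  obtain K where K: "K \<ge> 1" "\<And>m. norm m \<le> K * norm (A *v m)"
    using invertible_norm_bound[OF assms(1)] by blast
  have sep: "norm (z - z') \<ge> 1 / K" if zz: "z \<in> lattice_of A" "z' \<in> lattice_of A" "z \<noteq> z'" for z z'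
  proof -
    obtain m m' where m: "m \<in> int_vecs" "m' \<in> int_vecs" "z = A *v m" "z' = A *v m'"
      using zz(1,2) unfolding lattice_of_eq by blast
    then have "norm (m - m') \<ge> 1" using that by (intro int_vec_norm_ge_1 int_vecs_diff) auto
    moreover have "norm (m - m') \<le> K * norm (z - z')"
      using K(2)[of "m - m'"] by (simp add: m matrix_vector_mult_diff_distrib)
    ultimately show ?thesis using K(1) by (simp add: field_simps)
  qed
  show ?thesis
  proof (cases "\<exists>z\<in>lattice_of A. z + x \<noteq> 0 \<and> norm (z + x) < 1 / (2 * K)")
    case False
    then show ?thesis using that[of "1 / (2 * K)"] K(1) by (auto simp: not_less)
  next
    case True
    then obtain w where w: "w \<in> lattice_of A" "w + x \<noteq> 0" "norm (w + x) < 1 / (2 * K)" by blast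
    show ?thesis
    proof (rule that[of "norm (w + x)"])
      show "norm (w + x) > 0" using w by simp
      fix z assume z: "z \<in> lattice_of A" "z + x \<noteq> 0"
      show "norm (w + x) \<le> norm (z + x)"
      proof (rule ccontr)
        assume *: "\<not> ?thesis"
        then have "z \<noteq> w" by auto
        then have "1 / K \<le> norm (z - w)" using sep z w by blast
        also have "z - w = (z + x) - (w + x)" by simp
        also have "norm \<dots> \<le> norm (z + x) + norm (w + x)" by (rule norm_triangle_ineq4)
        also have "\<dots> < 1 / (2 * K) + 1 / (2 * K)" using * w by linarith
        finally show False by (simp add: field_simps)
      qed
    qed
  qed
qed

lemma dual_lattice_invertible:
  "invertible (A::real^'n^'n) \<Longrightarrow> invertible (transpose (matrix_inv A))"
  unfolding invertible_def by (metis matrix_inv invertible_def matrix_transpose_mul transpose_mat)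

section \<open>Incomplete Gamma functions\<close>

text \<open>For t > 0 this is t^(s-1) e^(-r t). In exponential form it is visibly entire in s and
  continuous in t > 0, and products of powers become sums of exponents.\<close>

definition gamma_kernel :: "complex \<Rightarrow> real \<Rightarrow> real \<Rightarrow> complex" where
  "gamma_kernel s r t = exp ((s - 1) * of_real (ln t) - of_real (r * t))"

text \<open>The generalized exponential integral E_(1-s)(r), which for r > 0 equals \<Gamma>(s, r) /
  r^s.\<close>

definition gexp_int :: "complex \<Rightarrow> real \<Rightarrow> complex" where
  "gexp_int s r = integral {1..} (gamma_kernel s r)"

lemma powr_eq_exp: "t > 0 \<Longrightarrow> of_real t powr s = exp (s * of_real (ln t))" for s :: complex
  by (simp add: powr_def Ln_of_real)

lemma gamma_kernel_eq:
  "t > 0 \<Longrightarrow> gamma_kernel s r t = of_real t powr (s - 1) * of_real (exp (- (r * t)))"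
  by (simp only: gamma_kernel_def powr_eq_exp exp_of_real[symmetric] exp_add[symmetric]) simp

lemma norm_gamma_kernel: "norm (gamma_kernel s r t) = exp ((Re s - 1) * ln t - r * t)"
  by (simp add: gamma_kernel_def)

lemma norm_gamma_kernel': "complex_of_real (norm (gamma_kernel s r t)) = gamma_kernel (of_real (Re s)) r t"
  by (simp add: norm_gamma_kernel gamma_kernel_def exp_of_real[symmetric])

lemma continuous_on_gamma_kernel: "S \<subseteq> {0<..} \<Longrightarrow> continuous_on S (gamma_kernel s r)"
  unfolding gamma_kernel_def[abs_def] by (intro continuous_intros) auto

lemma ln_le_linear:
  assumes "b > 0"
  obtains C where "\<And>t. t \<ge> (1::real) \<Longrightarrow> a * ln t \<le> C + b * t"
proof -
  \<comment> \<open>A positive a' \<ge> a may replace a since ln t \<ge> 0 for t \<ge> 1; with c = b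
    / a' the inequality ln(c t) \<le> c t - 1 produces the slope b.\<close>
  define a' c where "a' = max a 1" and "c = b / a'"
  have a': "a' > 0" "a \<le> a'" by (auto simp: a'_def)
  then have c: "c > 0" using assms by (simp add: c_def)
  show ?thesis
  proof (rule that[of "a' * (- 1 - ln c)"])
    fix t :: real assume t: "t \<ge> 1"
    have "ln (c * t) \<le> c * t - 1" using c t by (intro ln_le_minus_one) auto
    then have "ln t \<le> c * t - 1 - ln c" using c t by (simp add: ln_mult)
    then have "a' * ln t \<le> a' * (c * t - 1 - ln c)" using a' by (intro mult_left_mono) auto
    also have "\<dots> = a' * (- 1 - ln c) + b * t" using a' by (simp add: c_def algebra_simps)
    moreover have "a * ln t \<le> a' * ln t" using a' t by (intro mult_right_mono) auto
    ultimately show "a * ln t \<le> a' * (- 1 - ln c) + b * t" by linarith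
  qed
qed

text \<open>The decay e^(-r t) is shared out: half of it yields e^(-r/2), which later makes sums
  over lattice points converge; a quarter absorbs t^(\<sigma>-1); the last quarter keeps the
  integral over t finite. All is uniform in Re s \<le> \<sigma> and r \<ge> r0.\<close>

lemma gamma_kernel_bound:
  assumes "r0 > 0"
  obtains C where "C > 0" "\<And>s r t. Re s \<le> \<sigma> \<Longrightarrow> r \<ge> r0 \<Longrightarrow> t \<ge> 1 \<Longrightarrow>
    norm (gamma_kernel s r t) \<le> C * exp (- r / 2) * exp (- (r0 / 4) * t)"
proof -
  obtain C where C: "\<And>t. t \<ge> (1::real) \<Longrightarrow> (\<sigma> - 1) * ln t \<le> C + (r0 / 4) * t"
    using ln_le_linear[of "r0 / 4" "\<sigma> - 1"] assms by auto
  show ?thesis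
  proof (rule that[of "exp C"])
    fix s r t assume *: "Re s \<le> \<sigma>" "r \<ge> r0" "t \<ge> (1::real)"
    have "(Re s - 1) * ln t \<le> (\<sigma> - 1) * ln t" using * by (intro mult_right_mono) auto
    moreover have "r0 * t \<le> r * t" using * by (intro mult_right_mono) auto
    moreover have "r \<le> r * t" using * assms by simp
    ultimately have "(Re s - 1) * ln t - r * t \<le> C + (- r / 2) + (- (r0 / 4) * t)"
      using C[OF *(3)] by linarith
    then show "norm (gamma_kernel s r t) \<le> exp C * exp (- r / 2) * exp (- (r0 / 4) * t)"
      by (simp add: norm_gamma_kernel exp_add[symmetric])
  qed simp
qed

lemma gamma_kernel_absolutely_integrable:
  assumes "r > 0" "a \<ge> 1"
  shows "gamma_kernel s r absolutely_integrable_on {a..}"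
proof -
  obtain C where C: "\<And>t. t \<ge> 1 \<Longrightarrow> norm (gamma_kernel s r t) \<le> C * exp (- r / 2) * exp (- (r / 4) * t)"
    using gamma_kernel_bound[OF assms(1), of "Re s"] by (metis order_refl)
  show ?thesis
  proof (rule measurable_bounded_by_integrable_imp_absolutely_integrable)
    show "gamma_kernel s r \<in> borel_measurable (lebesgue_on {a..})"
      using assms by (intro continuous_imp_measurable_on_sets_lebesgue continuous_on_gamma_kernel) auto
    show "(\<lambda>t. (C * exp (- r / 2)) * exp (- (r / 4) * t)) integrable_on {a..}"
      using has_integral_mult_right[OF has_integral_exp_minus_to_infinity[of "r / 4" a], of "C * exp (- r / 2)"] assms
      by (auto simp: integrable_on_def)
  qed (use C assms in auto)
qed

text \<open>The decay in a serves the uniform convergence of truncated integrals in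
  \<open>gexp_int_holomorphic\<close>, the decay in r the summability over lattices.\<close>

lemma gexp_tail_bound:
  assumes "r0 > 0"
  obtains C where "C > 0" "\<And>s r a. Re s \<le> \<sigma> \<Longrightarrow> r \<ge> r0 \<Longrightarrow> a \<ge> 1 \<Longrightarrow>
    norm (integral {a..} (gamma_kernel s r)) \<le> C * exp (- r / 2) * exp (- (r0 / 4) * a)"
proof -
  obtain C where C: "C > 0" "\<And>s r t. Re s \<le> \<sigma> \<Longrightarrow> r \<ge> r0 \<Longrightarrow> t \<ge> 1 \<Longrightarrow>
    norm (gamma_kernel s r t) \<le> C * exp (- r / 2) * exp (- (r0 / 4) * t)"
    using gamma_kernel_bound[OF assms] by blast
  show ?thesis
  proof (rule that[of "C / (r0 / 4)"])
    fix s r a assume *: "Re s \<le> \<sigma>" "r \<ge> r0" "a \<ge> (1::real)"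
    have hi: "((\<lambda>t. C * exp (- r / 2) * exp (- (r0 / 4) * t)) has_integral
        C * exp (- r / 2) * (exp (- (r0 / 4) * a) / (r0 / 4))) {a..}"
      using has_integral_exp_minus_to_infinity[of "r0 / 4" a] assms
      by (intro has_integral_mult_right) auto
    have "norm (integral {a..} (gamma_kernel s r)) \<le> integral {a..} (\<lambda>t. C * exp (- r / 2) * exp (- (r0 / 4) * t))"
    proof (rule integral_norm_bound_integral)
      show "gamma_kernel s r integrable_on {a..}"
        using gamma_kernel_absolutely_integrable[of r a s] * assms
        by (simp add: absolutely_integrable_on_def)
      show "(\<lambda>t. C * exp (- r / 2) * exp (- (r0 / 4) * t)) integrable_on {a..}"
        using hi by (auto simp: integrable_on_def)
      show "norm (gamma_kernel s r t) \<le> C * exp (- r / 2) * exp (- (r0 / 4) * t)" if "t \<in> {a..}" for t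
        using that * by (intro C) auto
    qed
    also have "\<dots> = C / (r0 / 4) * exp (- r / 2) * exp (- (r0 / 4) * a)"
      using integral_unique[OF hi] by (simp add: field_simps)
    finally show "norm (integral {a..} (gamma_kernel s r)) \<le> C / (r0 / 4) * exp (- r / 2) * exp (- (r0 / 4) * a)" .
  qed (use C assms in auto)
qed

lemma gexp_int_bound:
  assumes "r0 > 0"
  obtains C where "C > 0" "\<And>s r. Re s \<le> \<sigma> \<Longrightarrow> r \<ge> r0 \<Longrightarrow> norm (gexp_int s r) \<le> C * exp (- r / 2)"
proof -
  obtain C where C: "C > 0" "\<And>s r a. Re s \<le> \<sigma> \<Longrightarrow> r \<ge> r0 \<Longrightarrow> a \<ge> 1 \<Longrightarrow>
    norm (integral {a..} (gamma_kernel s r)) \<le> C * exp (- r / 2) * exp (- (r0 / 4) * a)"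
    using gexp_tail_bound[OF assms] by blast
  show ?thesis
  proof (rule that[of "C * exp (- (r0 / 4) * 1)"])
    show "norm (gexp_int s r) \<le> C * exp (- (r0 / 4) * 1) * exp (- r / 2)" if "Re s \<le> \<sigma>" "r \<ge> r0" for s r
      using C(2)[OF that, of 1] by (simp add: gexp_int_def mult_ac)
  qed (use C in auto)
qed

text \<open>Integrals over compact intervals are holomorphic by the Leibniz rule, and the tail bound
  makes them converge locally uniformly in s.\<close>

lemma gexp_int_holomorphic:
  assumes "r > 0"
  shows "(\<lambda>s. gexp_int s r) holomorphic_on UNIV"
proof -
  define F where "F n s = integral (cbox 1 (1 + real n)) (gamma_kernel s r)" for n s
  have hol: "F n holomorphic_on UNIV" for n
    unfolding F_def
  proof (rule leibniz_rule_holomorphic[where fx="\<lambda>s t. of_real (ln t) * gamma_kernel s r t"])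
    fix s t assume "t \<in> cbox 1 (1 + real n)"
    show "((\<lambda>s. gamma_kernel s r t) has_field_derivative of_real (ln t) * gamma_kernel s r t) (at s within UNIV)"
      unfolding gamma_kernel_def by (auto intro!: derivative_eq_intros)
  next
    fix s show "gamma_kernel s r integrable_on cbox 1 (1 + real n)"
      by (intro integrable_continuous continuous_on_gamma_kernel) auto
  next
    show "continuous_on (UNIV \<times> cbox 1 (1 + real n)) (\<lambda>(s, t). of_real (ln t) * gamma_kernel s r t)"
      unfolding gamma_kernel_def case_prod_unfold by (intro continuous_intros) auto
  qed simp
  have "(\<lambda>s. gexp_int s r) field_differentiable at z" for z
  proof -
    obtain C where C: "C > 0" "\<And>s r' a. Re s \<le> Re z + 1 \<Longrightarrow> r' \<ge> r \<Longrightarrow> a \<ge> 1 \<Longrightarrow>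
      norm (integral {a..} (gamma_kernel s r')) \<le> C * exp (- r' / 2) * exp (- (r / 4) * a)"
      using gexp_tail_bound[OF assms] by blast
    have diff: "gexp_int s r - F n s = integral {1 + real n..} (gamma_kernel s r)" for s n
    proof -
      have "integral ({1..1 + real n} \<union> {1 + real n..}) (gamma_kernel s r) = F n s + integral {1 + real n..} (gamma_kernel s r)"
      proof -
        have "{1..1 + real n} \<inter> {1 + real n..} = {1 + real n}" by auto
        then show ?thesis
          unfolding F_def box_real
          using gamma_kernel_absolutely_integrable[of r "1 + real n" s] assms
          by (intro integral_Un) (auto simp: absolutely_integrable_on_def intro!: integrable_continuous_real continuous_on_gamma_kernel)
      qed
      moreover have "{1..1 + real n} \<union> {1 + real n..} = {1..}" by auto
      ultimately show ?thesis by (simp add: gexp_int_def)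
    qed
    have "uniform_limit (cball z 1) F (\<lambda>s. gexp_int s r) sequentially"
    proof (rule uniform_limitI)
      fix e :: real assume e: "e > 0"
      have "((\<lambda>n. C * exp (- r / 2) * exp (- (r / 4) * (1 + real n))) \<longlongrightarrow> 0) sequentially"
        using assms by real_asymp
      then have "\<forall>\<^sub>F n in sequentially. C * exp (- r / 2) * exp (- (r / 4) * (1 + real n)) < e"
        using e by (simp add: order_tendsto_iff)
      then show "\<forall>\<^sub>F n in sequentially. \<forall>s\<in>cball z 1. dist (F n s) (gexp_int s r) < e"
      proof eventually_elim
        fix n assume n: "C * exp (- r / 2) * exp (- (r / 4) * (1 + real n)) < e"
        show "\<forall>s\<in>cball z 1. dist (F n s) (gexp_int s r) < e"
        proof
          fix s assume "s \<in> cball z 1"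
          then have "Re s \<le> Re z + 1"
            using abs_Re_le_cmod[of "s - z"] by (auto simp: dist_norm norm_minus_commute)
          from C(2)[OF this order_refl, of "1 + real n"] n
          show "dist (F n s) (gexp_int s r) < e"
            unfolding dist_norm norm_minus_commute[of "F n s"] diff by linarith
        qed
      qed
    qed
    from holomorphic_uniform_limit[OF _ this]
    have "(\<lambda>s. gexp_int s r) holomorphic_on ball z 1"
      using hol holomorphic_on_imp_continuous_on holomorphic_on_subset
      by (metis (no_types, lifting) always_eventually subset_UNIV trivial_limit_sequentially)
    then show ?thesis
      by (intro holomorphic_on_imp_differentiable_at[of _ "ball z 1"]) auto
  qed
  then show ?thesis
    by (simp add: holomorphic_on_def field_differentiable_at_within)
qed

text \<open>Under t -> c t the Jacobian c and the factor c^(s-1) combine to c^s, written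
  \<open>exp (s * of_real (ln c))\<close>.\<close>

lemma gamma_kernel_scale:
  assumes "c > 0" "S \<in> sets lebesgue" "S \<subseteq> {0<..}"
  shows "gamma_kernel s r absolutely_integrable_on ((*) c ` S) \<longleftrightarrow> gamma_kernel s (r * c) absolutely_integrable_on S"
    and "gamma_kernel s (r * c) absolutely_integrable_on S \<Longrightarrow>
      integral ((*) c ` S) (gamma_kernel s r) = exp (s * of_real (ln c)) * integral S (gamma_kernel s (r * c))"
proof -
  let ?f = "\<lambda>t. \<bar>c\<bar> *\<^sub>R gamma_kernel s r (c * t)" and ?g = "\<lambda>t. exp (s * of_real (ln c)) * gamma_kernel s (r * c) t"
  have eq: "?f t = ?g t" if "t \<in> S" for t
  proof -
    have t: "t > 0" using that assms by auto
    have "complex_of_real c = exp (of_real (ln c))" using assms(1) by (simp add: exp_of_real)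
    then have "?f t = exp (of_real (ln c)) * gamma_kernel s r (c * t)"
      using assms(1) by (simp add: scaleR_conv_of_real)
    also have "\<dots> = ?g t"
      using t assms(1) by (simp add: gamma_kernel_def exp_add[symmetric] ln_mult algebra_simps)
    finally show ?thesis .
  qed
  note cov = has_absolute_integral_change_of_variables_real[OF assms(2), of "(*) c" "\<lambda>_. c" "gamma_kernel s r"]
  have 1: "?f absolutely_integrable_on S \<and> integral S ?f = b \<longleftrightarrow>
      gamma_kernel s r absolutely_integrable_on (*) c ` S \<and> integral ((*) c ` S) (gamma_kernel s r) = b" for b
    using assms(1) by (intro cov) (auto intro!: derivative_eq_intros simp: inj_on_def)
  have fg: "?f absolutely_integrable_on S \<longleftrightarrow> ?g absolutely_integrable_on S" "integral S ?f = integral S ?g"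
    by (rule set_integrable_cong[OF refl refl eq], assumption)
      (rule Henstock_Kurzweil_Integration.integral_cong[OF eq])
  have gg: "?g absolutely_integrable_on S \<longleftrightarrow> gamma_kernel s (r * c) absolutely_integrable_on S"
    by simp
  show "gamma_kernel s r absolutely_integrable_on ((*) c ` S) \<longleftrightarrow> gamma_kernel s (r * c) absolutely_integrable_on S"
    using 1 fg gg by metis
  assume "gamma_kernel s (r * c) absolutely_integrable_on S"
  then have "integral ((*) c ` S) (gamma_kernel s r) = integral S ?g" using 1 fg gg by metis
  then show "integral ((*) c ` S) (gamma_kernel s r) = exp (s * of_real (ln c)) * integral S (gamma_kernel s (r * c))"
    by simp
qed

lemma image_mult_atLeast: "c > 0 \<Longrightarrow> (*) c ` {a..} = {c * a :: real..}"
  by (auto simp: image_iff field_simps intro!: bexI[of _ "_ / c"])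

lemma image_mult_greaterThan: "c > 0 \<Longrightarrow> (*) c ` {0<..} = {0 :: real<..}"
  by (auto simp: image_iff field_simps intro!: bexI[of _ "_ / c"])

lemma integral_gamma_kernel_atLeast:
  assumes "a > 0" "r > 0"
  shows "gamma_kernel s r absolutely_integrable_on {a..}"
    "integral {a..} (gamma_kernel s r) = exp (s * of_real (ln a)) * gexp_int s (r * a)"
proof -
  have S: "{1::real..} \<in> sets lebesgue" "{1::real..} \<subseteq> {0<..}" by auto
  note sc = gamma_kernel_scale[OF assms(1) S, of s r, unfolded image_mult_atLeast[OF assms(1)] mult_1_right]
  have ra: "gamma_kernel s (r * a) absolutely_integrable_on {1..}"
    using gamma_kernel_absolutely_integrable[of "r * a" 1 s] assms by simp
  then show "gamma_kernel s r absolutely_integrable_on {a..}" using sc(1) by blast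
  show "integral {a..} (gamma_kernel s r) = exp (s * of_real (ln a)) * gexp_int s (r * a)"
    unfolding gexp_int_def by (rule sc(2)[OF ra])
qed

lemma upper_inc_Gamma_eq:
  assumes "x > 0"
  shows "upper_inc_Gamma s x = exp (s * of_real (ln x)) * gexp_int s x"
proof -
  have "upper_inc_Gamma s x = integral {x..} (gamma_kernel s 1)"
    unfolding upper_inc_Gamma_def using assms
    by (intro Henstock_Kurzweil_Integration.integral_cong) (simp add: gamma_kernel_eq)
  then show ?thesis using integral_gamma_kernel_atLeast(2)[OF assms, of 1 s] by simp
qed

lemma upper_Crandall_eq:
  assumes "z \<noteq> 0"
  shows "upper_Crandall \<nu> z = gexp_int (\<nu> / 2) (pi * (norm z)\<^sup>2)"
proof -
  have x: "pi * (norm z)\<^sup>2 > 0" using assms by simp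
  show ?thesis
    unfolding upper_Crandall_def upper_inc_Gamma_eq[OF x] powr_eq_exp[OF x] using assms by simp
qed

lemma integral_gamma_kernel_pos:
  assumes "Re s > 0" "r > 0"
  shows "gamma_kernel s r absolutely_integrable_on {0<..}"
    "integral {0<..} (gamma_kernel s r) = exp (- s * of_real (ln r)) * Gamma s"
proof -
  have eq: "gamma_kernel s 1 t = of_real t powr (s - 1) / of_real (exp t)" if "t > 0" for t
    using that by (simp add: gamma_kernel_eq exp_minus field_simps)
  have a1: "gamma_kernel s 1 absolutely_integrable_on {0<..}"
    using absolutely_integrable_Gamma_integral'[OF assms(1)] eq by (subst set_integrable_cong[OF refl refl eq]) auto
  have "integral {0<..} (gamma_kernel s 1) = integral {0<..} (\<lambda>t. of_real t powr (s - 1) / of_real (exp t))"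
    by (intro Henstock_Kurzweil_Integration.integral_cong) (simp add: eq)
  also have "\<dots> = integral {0..} (\<lambda>t. of_real t powr (s - 1) / of_real (exp t))"
    by (intro integral_spike_set) (auto intro: negligible_subset[of "{0}"])
  also have "\<dots> = Gamma s" using Gamma_integral_complex[OF assms(1)] by (rule integral_unique)
  finally have i1: "integral {0<..} (gamma_kernel s 1) = Gamma s" .
  have r: "1 / r > 0" using assms by simp
  note sc = gamma_kernel_scale[OF r, of "{0<..}" s r, unfolded image_mult_greaterThan[OF r]]
  have rr: "r * (1 / r) = 1" using assms by simp
  show "gamma_kernel s r absolutely_integrable_on {0<..}"
    using sc(1) a1 unfolding rr by auto
  have "integral {0<..} (gamma_kernel s r) = exp (s * of_real (ln (1 / r))) * integral {0<..} (gamma_kernel s (r * (1 / r)))"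
    by (rule sc(2)) (use a1 rr in auto)
  then show "integral {0<..} (gamma_kernel s r) = exp (- s * of_real (ln r)) * Gamma s"
    using assms by (simp add: i1 ln_div)
qed

lemma integral_gamma_kernel_Ioc:
  assumes "Re s > 0" "r > 0" "a > 0"
  shows "gamma_kernel s r absolutely_integrable_on {0<..a}"
    "integral {0<..a} (gamma_kernel s r) = exp (- s * of_real (ln r)) * Gamma s - exp (s * of_real (ln a)) * gexp_int s (r * a)"
proof -
  show ai: "gamma_kernel s r absolutely_integrable_on {0<..a}"
    by (rule set_integrable_subset[OF integral_gamma_kernel_pos(1)[OF assms(1,2)]]) auto
  have "{0<..a} \<inter> {a..} = {a}" using assms by auto
  then have "integral ({0<..a} \<union> {a..}) (gamma_kernel s r) = integral {0<..a} (gamma_kernel s r) + integral {a..} (gamma_kernel s r)"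
    using ai integral_gamma_kernel_atLeast(1)[OF assms(3,2), of s]
    by (intro integral_Un) (auto simp: absolutely_integrable_on_def)
  moreover have "{0<..a} \<union> {a..} = {0<..}" using assms by auto
  ultimately show "integral {0<..a} (gamma_kernel s r) = exp (- s * of_real (ln r)) * Gamma s - exp (s * of_real (ln a)) * gexp_int s (r * a)"
    using integral_gamma_kernel_pos(2)[OF assms(1,2)] integral_gamma_kernel_atLeast(2)[OF assms(3,2), of s]
    by (simp add: algebra_simps)
qed

text \<open>The substitution t = a / u carries (0, a] to [1, \<infinity>) and e^(-r/t) to e^(-(r/a)
  u). In this way the small-t part of the Mellin integral becomes an incomplete Gamma function of
  parameter -w, and it converges for every w because r > 0.\<close>

lemma integral_reciprocal_kernel:
  fixes w :: complex
  assumes "r > 0" "a > 0"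
  defines "f \<equiv> \<lambda>t. exp ((w - 1) * of_real (ln t) - of_real (r / t))"
  shows "f absolutely_integrable_on {0<..a}"
    "integral {0<..a} f = exp (w * of_real (ln a)) * gexp_int (- w) (r / a)"
proof -
  let ?S = "{1::real..}" and ?h = "\<lambda>u. - a / u\<^sup>2" and ?g = "\<lambda>u. a / u"
  let ?G = "\<lambda>u. exp (w * of_real (ln a)) * gamma_kernel (- w) (r / a) u"
  have img: "?g ` ?S = {0<..a}"
  proof (intro equalityI subsetI)
    fix x assume "x \<in> {0<..a}"
    then show "x \<in> ?g ` ?S"
      using assms(2) by (intro image_eqI[of _ _ "a / x"]) auto
  qed (use assms(2) in \<open>auto simp: field_simps\<close>)
  have eq: "\<bar>?h u\<bar> *\<^sub>R f (?g u) = ?G u" if "u \<in> ?S" for u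
  proof -
    have u: "u > 0" using that by auto
    have "\<bar>?h u\<bar> = exp (ln a - 2 * ln u)"
      using u assms(2) by (simp add: exp_diff exp_double)
    then have "\<bar>?h u\<bar> *\<^sub>R f (?g u) = exp (of_real (ln a - 2 * ln u)) * f (?g u)"
      by (simp only: scaleR_conv_of_real exp_of_real)
    also have "\<dots> = ?G u"
      using u assms(2) by (simp add: f_def gamma_kernel_def exp_add[symmetric] ln_div algebra_simps)
    finally show ?thesis .
  qed
  have 1: "(\<lambda>u. \<bar>?h u\<bar> *\<^sub>R f (?g u)) absolutely_integrable_on ?S \<and> integral ?S (\<lambda>u. \<bar>?h u\<bar> *\<^sub>R f (?g u)) = b \<longleftrightarrow>
      f absolutely_integrable_on ?g ` ?S \<and> integral (?g ` ?S) f = b" for b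
  proof (rule has_absolute_integral_change_of_variables_real)
    fix x :: real assume "x \<in> ?S"
    then show "(?g has_field_derivative ?h x) (at x within ?S)"
      by (auto intro!: derivative_eq_intros simp: power2_eq_square)
  qed (use assms(2) in \<open>auto simp: inj_on_def field_simps\<close>)
  have G: "?G absolutely_integrable_on ?S"
    using gamma_kernel_absolutely_integrable[of "r / a" 1 "- w"] assms by simp
  have "(\<lambda>u. \<bar>?h u\<bar> *\<^sub>R f (?g u)) absolutely_integrable_on ?S \<longleftrightarrow> ?G absolutely_integrable_on ?S"
    by (intro set_integrable_cong refl eq)
  moreover have "integral ?S (\<lambda>u. \<bar>?h u\<bar> *\<^sub>R f (?g u)) = integral ?S ?G"
    by (intro Henstock_Kurzweil_Integration.integral_cong eq)
  ultimately show "f absolutely_integrable_on {0<..a}"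
    "integral {0<..a} f = exp (w * of_real (ln a)) * gexp_int (- w) (r / a)"
    using 1[of "integral ?S ?G"] G unfolding img by (simp_all add: gexp_int_def)
qed

section \<open>The lower incomplete Gamma function and its power series\<close>

lemma connected_compl_nonpos_Ints: "connected (- \<int>\<^sub>\<le>\<^sub>0 :: complex set)"
proof -
  have "countable (\<int>\<^sub>\<le>\<^sub>0 :: complex set)"
    by (rule countable_subset[of _ "range of_int"]) (auto elim!: nonpos_Ints_cases)
  then show ?thesis
    by (intro path_connected_imp_connected path_connected_complement_countable) auto
qed

text \<open>\<Gamma>(s) - \<Gamma>(s, x) is one continuation of the integral, and the identity
  theorem on the connected complement of the poles shows that there is no other.\<close>

lemma lower_inc_Gamma_eq:
  assumes "x > 0" "s \<notin> \<int>\<^sub>\<le>\<^sub>0"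
  shows "lower_inc_Gamma s x = Gamma s - exp (s * of_real (ln x)) * gexp_int s x"
proof -
  let ?I = "\<lambda>s. integral {0..x} (\<lambda>t. of_real t powr (s - 1) * of_real (exp (- t))) :: complex"
  let ?P = "\<lambda>F. F holomorphic_on (- \<int>\<^sub>\<le>\<^sub>0) \<and> (\<forall>s\<in>\<int>\<^sub>\<le>\<^sub>0. F s = 0) \<and> (\<forall>s. Re s > 0 \<longrightarrow> F s = ?I s)"
  define F where "F s = (if s \<in> \<int>\<^sub>\<le>\<^sub>0 then 0 else Gamma s - exp (s * of_real (ln x)) * gexp_int s x)" for s
  have "(\<lambda>s. Gamma s - exp (s * of_real (ln x)) * gexp_int s x) holomorphic_on (- \<int>\<^sub>\<le>\<^sub>0)"
    by (intro holomorphic_intros holomorphic_on_subset[OF gexp_int_holomorphic[OF assms(1)]]) auto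
  then have hol: "F holomorphic_on (- \<int>\<^sub>\<le>\<^sub>0)"
    by (rule holomorphic_transform) (simp add: F_def)
  have re: "F s = ?I s" if s: "Re s > 0" for s
  proof -
    have "s \<notin> \<int>\<^sub>\<le>\<^sub>0" using s by (auto elim!: nonpos_Ints_cases)
    moreover have "?I s = integral {0<..x} (gamma_kernel s 1)"
    proof -
      have "?I s = integral {0<..x} (\<lambda>t. of_real t powr (s - 1) * of_real (exp (- t)))"
        by (intro integral_spike_set) (auto intro: negligible_subset[of "{0}"])
      also have "\<dots> = integral {0<..x} (gamma_kernel s 1)"
        by (intro Henstock_Kurzweil_Integration.integral_cong) (simp add: gamma_kernel_eq)
      finally show ?thesis .
    qed
    ultimately show ?thesis
      using integral_gamma_kernel_Ioc(2)[OF s zero_less_one assms(1)] by (simp add: F_def)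
  qed
  have P: "?P F" using hol re by (auto simp: F_def)
  have "G = F" if G: "?P G" for G
  proof
    fix z
    show "G z = F z"
    proof (cases "z \<in> \<int>\<^sub>\<le>\<^sub>0")
      case False
      show ?thesis
      proof (rule analytic_continuation_open[of "{s. Re s > 0}" "- \<int>\<^sub>\<le>\<^sub>0" G F])
        show "open {s. Re s > 0}" by (rule open_halfspace_Re_gt)
        show "{s. Re s > 0} \<noteq> {}" by (auto intro: exI[of _ 1])
        show "{s. Re s > 0} \<subseteq> - \<int>\<^sub>\<le>\<^sub>0" by (auto elim!: nonpos_Ints_cases)
      qed (use P G False connected_compl_nonpos_Ints in auto)
    qed (use P G in auto)
  qed
  then have "(THE F. ?P F) = F" using P by (intro the_equality) blast+
  then show ?thesis using assms(2) unfolding lower_inc_Gamma_def by (simp add: F_def)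
qed

lemma integral_powr_kernel:
  fixes s :: complex
  assumes "Re s > 0" "a > 0"
  shows "gamma_kernel s 0 absolutely_integrable_on {0<..a}"
    "integral {0<..a} (gamma_kernel s 0) = exp (s * of_real (ln a)) / s"
proof -
  have s0: "s \<noteq> 0" using assms(1) by auto
  \<comment> \<open>Stated for every exponent with positive real part, because absolute
    integrability at s is read off from plain integrability at Re s.\<close>
  have hi: "((\<lambda>t. of_real t powr (s - 1)) has_integral (of_real a powr s / s - of_real 0 powr s / s)) {0..a}"
    if s: "Re s > 0" for s :: complex
  proof (rule fundamental_theorem_of_calculus_interior)
    show "continuous_on {0..a} (\<lambda>t. of_real t powr s / s)"
      using s by (intro continuous_intros) auto
    fix t assume t: "t \<in> {0<..<a}"
    then have "complex_of_real t \<notin> \<real>\<^sub>\<le>\<^sub>0" by (simp add: complex_nonpos_Reals_iff)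
    then have "((\<lambda>z. z powr s / s) has_field_derivative s * of_real t powr (s - 1) / s) (at (of_real t))"
      by (intro DERIV_cdivide has_field_derivative_powr)
    from has_vector_derivative_real_field[OF this, of UNIV]
    show "((\<lambda>t. of_real t powr s / s) has_vector_derivative of_real t powr (s - 1)) (at t)"
      using s by (cases "s = 0") auto
  qed (use assms in auto)
  have g: "gamma_kernel s 0 t = of_real t powr (s - 1)" if "t > 0" for s t
    using that by (simp add: gamma_kernel_eq)
  have hi': "(gamma_kernel s 0 has_integral exp (s * of_real (ln a)) / s) {0<..a}" if s: "Re s > 0" for s
  proof -
    have "((\<lambda>t. of_real t powr (s - 1)) has_integral exp (s * of_real (ln a)) / s) {0<..a}"
      using hi[OF s] assms(2)
      by (subst has_integral_spike_set_eq[of _ "{0..a}"]) (auto intro: negligible_subset[of "{0}"] simp: powr_eq_exp)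
    then show ?thesis by (rule has_integral_eq[rotated]) (simp add: g)
  qed
  show "integral {0<..a} (gamma_kernel s 0) = exp (s * of_real (ln a)) / s"
    using hi'[OF assms(1)] by (rule integral_unique)
  have "gamma_kernel s 0 integrable_on {0<..a}" using hi'[OF assms(1)] by blast
  moreover have "(\<lambda>t. norm (gamma_kernel s 0 t)) integrable_on {0<..a}"
  proof -
    have "gamma_kernel (of_real (Re s)) 0 integrable_on {0<..a}"
      using hi'[of "of_real (Re s)"] assms(1) by auto
    then have "(\<lambda>t. Re (complex_of_real (norm (gamma_kernel s 0 t)))) integrable_on {0<..a}"
      unfolding norm_gamma_kernel' by (rule integrable_linear[OF _ bounded_linear_Re, unfolded o_def])
    then show ?thesis by simp
  qed
  ultimately show "gamma_kernel s 0 absolutely_integrable_on {0<..a}"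
    by (rule absolutely_integrable_onI)
qed

lemma integral_norm_powr_kernel:
  assumes "Re s > 0" "a > 0"
  shows "integral {0<..a} (\<lambda>t. norm (gamma_kernel s 0 t)) = exp (Re s * ln a) / Re s"
proof -
  have "complex_of_real (integral {0<..a} (\<lambda>t. norm (gamma_kernel s 0 t)))
     = integral {0<..a} (\<lambda>t. of_real (norm (gamma_kernel s 0 t)))"
    by (rule integral_linear[OF _ bounded_linear_of_real, unfolded o_def, symmetric])
      (use integral_powr_kernel(1)[OF assms] in \<open>auto simp: absolutely_integrable_on_def\<close>)
  also have "\<dots> = of_real (exp (Re s * ln a) / Re s)"
    unfolding norm_gamma_kernel' using integral_powr_kernel(2)[of "of_real (Re s)" a] assms
    by (simp add: exp_of_real[symmetric])
  finally show ?thesis using of_real_eq_iff by blast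
qed

text \<open>For J = \<open>UNIV\<close> and x > 0 this is \<gamma>(s, x) / x^s off the poles.
  Leaving an index n out of J gives a function regular at s = -n, which is the finite part that
  survives there.\<close>

definition lower_series :: "nat set \<Rightarrow> complex \<Rightarrow> real \<Rightarrow> complex" where
  "lower_series J s x = (\<Sum>\<^sub>\<infinity>j\<in>J. of_real ((- x) ^ j) / ((s + of_nat j) * fact j))"

lemma summable_on_power_fact: "(\<lambda>j. C * \<bar>x\<bar> ^ j / fact j) summable_on (J :: nat set)" for x :: real
proof -
  have "(\<lambda>j. \<bar>x\<bar> ^ j / fact j) summable_on UNIV"
    using summable_exp[of "\<bar>x\<bar>"] by (intro summable_nonneg_imp_summable_on) (auto simp: field_simps)
  then have "(\<lambda>j. \<bar>x\<bar> ^ j / fact j) summable_on J" by (rule summable_on_subset_banach) auto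
  from summable_on_cmult_right[OF this, of C] show ?thesis by simp
qed

lemma open_lower_series_domain: "open (- ((\<lambda>j. - of_nat j) ` J) :: complex set)"
  by (intro open_Compl closed_subset_Ints) auto

text \<open>With twice the radius free of poles, every w in the smaller ball keeps distance
  \<epsilon> from all the points -j at once. The bound is uniform in |x| \<le> X as well, so that it
  yields both holomorphy in s and continuity in x.\<close>

lemma lower_series_term_bound:
  fixes s w :: complex
  assumes "\<epsilon> > 0" "cball s (2 * \<epsilon>) \<subseteq> - ((\<lambda>j. - of_nat j) ` J)" "j \<in> J" "w \<in> cball s \<epsilon>" "\<bar>x\<bar> \<le> X"
  shows "norm (of_real ((- x) ^ j) / ((w + of_nat j) * fact j)) \<le> (1 / \<epsilon>) * \<bar>X\<bar> ^ j / fact j"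
proof -
  have "- of_nat j \<notin> cball s (2 * \<epsilon>)" using assms(2,3) by auto
  then have "dist s (- of_nat j) > 2 * \<epsilon>" by simp
  moreover have "dist s w \<le> \<epsilon>" using assms(4) by simp
  ultimately have "dist w (- of_nat j) \<ge> \<epsilon>"
    using dist_triangle[of s "- of_nat j" w] by linarith
  then have n: "norm (w + of_nat j) \<ge> \<epsilon>" by (simp add: dist_norm)
  have "norm (of_real ((- x) ^ j) / ((w + of_nat j) * fact j)) = \<bar>x\<bar> ^ j / (norm (w + of_nat j) * fact j)"
    by (simp add: norm_divide norm_mult norm_power)
  also have "\<dots> \<le> \<bar>X\<bar> ^ j / (\<epsilon> * fact j)"
    using n assms(1,5) by (intro frac_le mult_right_mono power_mono) auto
  finally show ?thesis by simp
qed

lemma lower_series_holomorphic: "(\<lambda>s. lower_series J s x) holomorphic_on - ((\<lambda>j. - of_nat j) ` J)"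
  unfolding lower_series_def
proof (rule holomorphic_on_infsum[OF open_lower_series_domain])
  fix j assume "j \<in> J"
  then show "(\<lambda>s. of_real ((- x) ^ j) / ((s + of_nat j) * fact j)) holomorphic_on - ((\<lambda>j. - of_nat j) ` J)"
    by (intro holomorphic_intros) (auto simp: eq_neg_iff_add_eq_0[symmetric])
next
  fix z :: complex assume "z \<in> - ((\<lambda>j. - of_nat j) ` J)"
  then obtain e where e: "e > 0" "cball z e \<subseteq> - ((\<lambda>j. - of_nat j) ` J)"
    using open_lower_series_domain open_contains_cball by metis
  show "\<exists>\<epsilon> M. \<epsilon> > 0 \<and> M summable_on J \<and> cball z \<epsilon> \<subseteq> - ((\<lambda>j. - of_nat j) ` J)
       \<and> (\<forall>i\<in>J. \<forall>w\<in>cball z \<epsilon>. norm (of_real ((- x) ^ i) / ((w + of_nat i) * fact i)) \<le> M i)"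
  proof (intro exI conjI ballI)
    show "e / 2 > 0" using e by simp
    show "(\<lambda>j. 1 / (e / 2) * \<bar>x\<bar> ^ j / fact j) summable_on J" by (rule summable_on_power_fact)
    show "cball z (e / 2) \<subseteq> - ((\<lambda>j. - of_nat j) ` J)" using e by (auto simp: subset_iff)
    fix j w assume "j \<in> J" "w \<in> cball z (e / 2)"
    with e show "norm (of_real ((- x) ^ j) / ((w + of_nat j) * fact j)) \<le> 1 / (e / 2) * \<bar>x\<bar> ^ j / fact j"
      using lower_series_term_bound[of "e / 2" z J j w x "\<bar>x\<bar>"] by simp
  qed
qed

lemma lower_series_summable:
  fixes s :: complex
  assumes "s \<notin> (\<lambda>j. - of_nat j) ` J"
  shows "(\<lambda>j. of_real ((- x) ^ j) / ((s + of_nat j) * fact j)) summable_on J"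
proof -
  obtain e where e: "e > 0" "cball s e \<subseteq> - ((\<lambda>j. - of_nat j) ` J)"
    using assms open_lower_series_domain[of J] open_contains_cball by blast
  show ?thesis
    by (rule summable_on_norm_bound[OF summable_on_power_fact[of "1 / (e / 2)" x J]])
      (use lower_series_term_bound[of "e / 2" s J _ s x "\<bar>x\<bar>"] e in auto)
qed

text \<open>Needed for the limit y -> 0, where the argument x is a multiple of |y|^2.\<close>

lemma lower_series_continuous:
  assumes "s \<notin> (\<lambda>j. - of_nat j) ` J"
  shows "isCont (\<lambda>x. lower_series J s x) 0"
proof -
  obtain e where e: "e > 0" "cball s e \<subseteq> - ((\<lambda>j. - of_nat j) ` J)"
    using assms open_lower_series_domain[of J] open_contains_cball by blast
  have "continuous_on {-1<..<1} (\<lambda>x. lower_series J s x)"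
    unfolding lower_series_def
  proof (rule continuous_on_infsum)
    show "continuous_on {-1<..<1} (\<lambda>x. of_real ((- x) ^ j) / ((s + of_nat j) * fact j))" for j
      by (cases "s + of_nat j = 0") (auto intro!: continuous_intros)
    show "(\<lambda>j. 1 / (e / 2) * \<bar>1\<bar> ^ j / fact j) summable_on J" by (rule summable_on_power_fact)
    show "norm (of_real ((- x) ^ j) / ((s + of_nat j) * fact j)) \<le> 1 / (e / 2) * \<bar>1\<bar> ^ j / fact j"
      if "j \<in> J" "x \<in> {-1<..<1}" for j x
      using that e by (intro lower_series_term_bound) auto
  qed
  then show ?thesis by (simp add: continuous_on_eq_continuous_at)
qed

lemma lower_series_0:
  assumes "s \<notin> (\<lambda>j. - of_nat j) ` UNIV"
  shows "lower_series UNIV s 0 = 1 / s"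
proof -
  have "lower_series UNIV s 0 = (\<Sum>\<^sub>\<infinity>j\<in>{0}. of_real ((- 0) ^ j) / ((s + of_nat j) * fact j))"
    unfolding lower_series_def by (rule infsum_cong_neutral) auto
  then show ?thesis by simp
qed

lemma range_neg_nat: "range (\<lambda>j. - of_nat j :: complex) = \<int>\<^sub>\<le>\<^sub>0"
proof (intro equalityI subsetI)
  fix z :: complex assume "z \<in> \<int>\<^sub>\<le>\<^sub>0"
  then obtain n where "z = of_int n" "n \<le> 0" by (auto elim!: nonpos_Ints_cases)
  then have "z = - of_nat (nat (- n))" by simp
  then show "z \<in> range (\<lambda>j. - of_nat j)" by blast
qed auto

text \<open>For Re s > 0 the exponential series is integrated termwise over (0, x]. Both sides are
  holomorphic off the nonpositive integers, so the identity extends.\<close>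

lemma lower_series_eq:
  assumes "x > 0" "s \<notin> \<int>\<^sub>\<le>\<^sub>0"
  shows "Gamma s - exp (s * of_real (ln x)) * gexp_int s x = exp (s * of_real (ln x)) * lower_series UNIV s x"
proof (rule analytic_continuation_open[of "{s. Re s > 0}" "- \<int>\<^sub>\<le>\<^sub>0" 
      "\<lambda>s. Gamma s - exp (s * of_real (ln x)) * gexp_int s x" "\<lambda>s. exp (s * of_real (ln x)) * lower_series UNIV s x"])
  show "open {s. Re s > 0}" by (rule open_halfspace_Re_gt)
  show "{s. Re s > 0} \<noteq> {}" by (auto intro: exI[of _ 1])
  show "{s. Re s > 0} \<subseteq> - \<int>\<^sub>\<le>\<^sub>0" by (auto elim!: nonpos_Ints_cases)
  show "(\<lambda>s. Gamma s - exp (s * of_real (ln x)) * gexp_int s x) holomorphic_on - \<int>\<^sub>\<le>\<^sub>0"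
    by (intro holomorphic_intros holomorphic_on_subset[OF gexp_int_holomorphic[OF assms(1)]]) auto
  show "(\<lambda>s. exp (s * of_real (ln x)) * lower_series UNIV s x) holomorphic_on - \<int>\<^sub>\<le>\<^sub>0"
    using lower_series_holomorphic[of UNIV x] by (intro holomorphic_intros) (simp add: range_neg_nat)
  fix s assume "s \<in> {s. Re s > 0}"
  then have s: "Re s > 0" by simp
  define f where "f j t = of_real ((- 1) ^ j / fact j) * gamma_kernel (s + of_nat j) 0 t" for j t
  have sj: "Re (s + of_nat j) > 0" for j using s by (simp add: add_pos_nonneg)
  have lnx: "exp (of_nat j * complex_of_real (ln x)) = of_real (x ^ j)" for j
    using assms(1) by (simp add: exp_of_nat_mult exp_of_real)
  have "((\<lambda>j. integral {0<..x} (f j)) has_sum integral {0<..x} (gamma_kernel s 1)) UNIV"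
  proof (rule has_sum_integral_swap)
    show "f j absolutely_integrable_on {0<..x}" for j
      using integral_powr_kernel(1)[OF sj assms(1)] unfolding f_def[abs_def] by simp
    have "integral {0<..x} (\<lambda>t. norm (f j t)) = \<bar>1 / fact j\<bar> * (exp ((Re s + real j) * ln x) / (Re s + real j))" for j
      unfolding f_def norm_mult using integral_norm_powr_kernel[OF sj assms(1)]
      by (simp add: norm_divide norm_power mult.commute)
    moreover have "norm (\<bar>1 / fact j\<bar> * (exp ((Re s + real j) * ln x) / (Re s + real j))) \<le> (exp (Re s * ln x) / Re s) * \<bar>x\<bar> ^ j / fact j" for j
    proof -
      have "exp ((Re s + real j) * ln x) = exp (Re s * ln x) * x ^ j"
        using assms(1) by (simp add: distrib_right exp_add exp_of_nat_mult)
      moreover have "exp (Re s * ln x) * x ^ j / (Re s + real j) / fact j \<le> exp (Re s * ln x) * x ^ j / Re s / fact j"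
        using s assms(1) by (intro divide_right_mono divide_left_mono mult_pos_pos) (auto simp: add_pos_nonneg)
      ultimately show ?thesis using s assms(1) by (simp add: mult.commute)
    qed
    ultimately show "(\<lambda>j. integral {0<..x} (\<lambda>t. norm (f j t))) summable_on UNIV"
      by (intro summable_on_norm_bound[OF summable_on_power_fact[of "exp (Re s * ln x) / Re s" x UNIV]]) simp
    fix t assume "t \<in> {0<..x}"
    then have t: "t > 0" by simp
    have "((\<lambda>j. (of_real (- t)) ^ j /\<^sub>R fact j) has_sum exp (complex_of_real (- t))) UNIV"
      using exp_converges[of "complex_of_real (- t)"] summable_norm_exp[of "complex_of_real (- t)"]
      by (metis norm_summable_imp_has_sum)
    then have "((\<lambda>j. gamma_kernel s 0 t * ((of_real (- t)) ^ j /\<^sub>R fact j)) has_sum gamma_kernel s 0 t * exp (complex_of_real (- t))) UNIV"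
      by (rule has_sum_cmult_right)
    moreover have "gamma_kernel s 0 t * exp (complex_of_real (- t)) = gamma_kernel s 1 t"
      by (simp add: gamma_kernel_def exp_add[symmetric])
    moreover have "gamma_kernel s 0 t * ((of_real (- t)) ^ j /\<^sub>R fact j) = f j t" for j
    proof -
      have "exp (of_nat j * complex_of_real (ln t)) = of_real (t ^ j)"
        using t by (simp add: exp_of_nat_mult exp_of_real)
      moreover have "gamma_kernel (s + of_nat j) 0 t = exp ((s - 1) * of_real (ln t) + of_nat j * of_real (ln t))"
        by (simp add: gamma_kernel_def algebra_simps)
      ultimately have "gamma_kernel (s + of_nat j) 0 t = gamma_kernel s 0 t * of_real (t ^ j)"
        by (simp add: gamma_kernel_def exp_add)
      then show ?thesis by (simp add: f_def scaleR_conv_of_real power_minus[of "complex_of_real t"] field_simps)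
    qed
    ultimately show "((\<lambda>j. f j t) has_sum gamma_kernel s 1 t) UNIV" by simp
  qed auto
  moreover have "integral {0<..x} (f j) = exp (s * of_real (ln x)) * (of_real ((- x) ^ j) / ((s + of_nat j) * fact j))" for j
  proof -
    have "integral {0<..x} (f j) = of_real ((- 1) ^ j / fact j) * (exp ((s + of_nat j) * of_real (ln x)) / (s + of_nat j))"
      unfolding f_def using integral_powr_kernel(2)[OF sj assms(1)] by simp
    also have "exp ((s + of_nat j) * of_real (ln x)) = exp (s * of_real (ln x)) * of_real (x ^ j)"
      by (simp only: distrib_right exp_add lnx)
    finally show ?thesis by (simp add: power_minus[of x] field_simps)
  qed
  ultimately have hs: "((\<lambda>j. exp (s * of_real (ln x)) * (of_real ((- x) ^ j) / ((s + of_nat j) * fact j))) has_sum integral {0<..x} (gamma_kernel s 1)) UNIV"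
    by simp
  have "s \<notin> range (\<lambda>j. - of_nat j)"
    using s unfolding range_neg_nat by (auto elim!: nonpos_Ints_cases)
  then have "((\<lambda>j. exp (s * of_real (ln x)) * (of_real ((- x) ^ j) / ((s + of_nat j) * fact j))) has_sum
      exp (s * of_real (ln x)) * lower_series UNIV s x) UNIV"
    unfolding lower_series_def by (intro has_sum_cmult_right has_sum_infsum lower_series_summable)
  from has_sum_unique[OF hs this]
  show "Gamma s - exp (s * of_real (ln x)) * gexp_int s x = exp (s * of_real (ln x)) * lower_series UNIV s x"
    using integral_gamma_kernel_Ioc(2)[OF s zero_less_one assms(1)] by simp
qed (use assms connected_compl_nonpos_Ints in auto)

section \<open>Crandall functions, generic and at the poles of Gamma\<close>

lemma lower_Crandall_eq:
  assumes "\<nu> / 2 \<notin> \<int>\<^sub>\<le>\<^sub>0"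
  shows "lower_Crandall \<nu> z = lower_series UNIV (\<nu> / 2) (pi * (norm z)\<^sup>2)"
proof (cases "z = 0")
  case True
  then show ?thesis using lower_series_0[of "\<nu> / 2"] assms by (simp add: lower_Crandall_def range_neg_nat)
next
  case False
  then have x: "pi * (norm z)\<^sup>2 > 0" by simp
  show ?thesis
    unfolding lower_Crandall_def lower_inc_Gamma_eq[OF x assms] lower_series_eq[OF x assms] powr_eq_exp[OF x]
    using False by simp
qed

text \<open>This is \<delta> \<Gamma>(\<delta> - n) continued to \<delta> = 0: the functional
  equation takes \<Gamma>(1 + \<delta>) = \<delta> \<Gamma>(\<delta>) down by n steps. Its value at
  0 is the residue of \<Gamma> at -n.\<close>

fun gamma_residue :: "nat \<Rightarrow> complex \<Rightarrow> complex" where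
  "gamma_residue 0 \<delta> = Gamma (1 + \<delta>)"
| "gamma_residue (Suc n) \<delta> = gamma_residue n \<delta> / (\<delta> - of_nat (Suc n))"

lemma gamma_residue_0: "gamma_residue n 0 = (- 1) ^ n / fact n"
proof (induction n)
  case (Suc n)
  show ?case unfolding gamma_residue.simps Suc by (simp del: of_nat_Suc add: mult.commute)
qed simp

text \<open>Logarithmic derivative at 0: the factor \<Gamma>(1 + \<delta>) contributes minus the
  Euler-Mascheroni constant, and each divisor \<delta> - j contributes 1 / j.\<close>

lemma gamma_residue_derivative:
  "(gamma_residue n has_field_derivative gamma_residue n 0 * (harm n - euler_mascheroni)) (at 0)"
proof (induction n)
  case 0
  have "(Gamma has_field_derivative Gamma 1 * Digamma 1) (at (0 + 1 :: complex))"
    using has_field_derivative_Gamma[of "1 :: complex"] by simp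
  then have "((\<lambda>\<delta>. Gamma (\<delta> + 1)) has_field_derivative Gamma 1 * Digamma 1) (at (0 :: complex))"
    by (simp only: DERIV_shift)
  then show ?case by (simp add: harm_def add.commute[of _ "1 :: complex"])
next
  case (Suc n)
  have n0: "(0 :: complex) - of_nat (Suc n) \<noteq> 0" by (simp del: of_nat_Suc)
  have "((\<lambda>\<delta>. \<delta> - of_nat (Suc n)) has_field_derivative 1) (at (0 :: complex))"
    by (auto intro!: derivative_eq_intros)
  from DERIV_divide[OF Suc.IH this n0]
  have d: "((\<lambda>\<delta>. gamma_residue n \<delta> / (\<delta> - of_nat (Suc n))) has_field_derivative
     (gamma_residue n 0 * (harm n - euler_mascheroni) * (0 - of_nat (Suc n)) - gamma_residue n 0 * 1) /
     ((0 - of_nat (Suc n)) * (0 - of_nat (Suc n)))) (at 0)" .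
  have "(gamma_residue n 0 * (harm n - euler_mascheroni) * (0 - of_nat (Suc n)) - gamma_residue n 0 * 1) /
     ((0 - of_nat (Suc n)) * (0 - of_nat (Suc n))) = gamma_residue (Suc n) 0 * (harm (Suc n) - euler_mascheroni)"
    using n0 unfolding harm_Suc gamma_residue.simps by (simp add: divide_simps del: of_nat_Suc) (simp add: algebra_simps del: of_nat_Suc)
  with d show ?case by simp
qed

lemma shifted_not_nonpos_Int:
  fixes \<delta> :: complex
  assumes "norm \<delta> < 1" "\<delta> \<noteq> 0"
  shows "\<delta> - of_nat n \<notin> \<int>\<^sub>\<le>\<^sub>0"
proof
  assume "\<delta> - of_nat n \<in> \<int>\<^sub>\<le>\<^sub>0"
  then obtain m where "\<delta> - of_nat n = of_int m" by (auto elim!: nonpos_Ints_cases)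
  then have "\<delta> = of_int (m + int n)" by (simp add: algebra_simps)
  then obtain q where q: "\<delta> = of_int q" by blast
  then have "\<bar>q\<bar> < 1" using assms(1) by (simp add: norm_of_int)
  then have "q = 0" by simp
  with q assms(2) show False by simp
qed

lemma gamma_residue_eq:
  assumes "norm \<delta> < 1" "\<delta> \<noteq> 0"
  shows "Gamma (\<delta> - of_nat n) = gamma_residue n \<delta> / \<delta>"
proof (induction n)
  case 0
  show ?case
    using Gamma_plus1[of \<delta>] shifted_not_nonpos_Int[OF assms, of 0] assms(2) by (simp add: add.commute)
next
  case (Suc n)
  let ?z = "\<delta> - of_nat (Suc n)"
  have z: "?z \<notin> \<int>\<^sub>\<le>\<^sub>0" by (rule shifted_not_nonpos_Int[OF assms])
  then have z0: "?z \<noteq> 0" by auto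
  have "?z + 1 = \<delta> - of_nat n" by simp
  then have eq: "?z * Gamma ?z = gamma_residue n \<delta> / \<delta>"
    using Gamma_plus1[OF z] Suc.IH by metis
  have "Gamma ?z = (?z * Gamma ?z) / ?z" using z0 by (simp del: of_nat_Suc)
  also have "\<dots> = gamma_residue n \<delta> / \<delta> / ?z" by (simp only: eq)
  finally show ?case by (simp add: mult.commute del: of_nat_Suc)
qed

text \<open>At \<open>s = -n\<close> the pole of \<open>\<Gamma>\<close> cancels the singular term of the series; the finite part is a derivative.\<close>

lemma gexp_int_neg_nat:
  assumes "r > 0"
  shows "gexp_int (- of_nat n) r = of_real ((- r) ^ n / fact n * (harm n - euler_mascheroni - ln r))
    - lower_series (- {n}) (- of_nat n) r"
proof -
  \<comment> \<open>With s = \<delta> - n one has \<Gamma>(s) / r^s = r^n \<open>g \<delta>\<close>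
    / \<delta>, while the term j = n of the series is r^n \<open>g 0\<close> / \<delta>. Their
    difference tends to r^n times the derivative \<open>D\<close> of \<open>g\<close> at 0.\<close>
  define g where "g \<delta> = exp (- \<delta> * of_real (ln r)) * gamma_residue n \<delta>" for \<delta>
  define D where "D = gamma_residue n 0 * (harm n - euler_mascheroni) - of_real (ln r) * gamma_residue n 0"
  have nin: "- of_nat n \<notin> (\<lambda>j. - of_nat j :: complex) ` (- {n})" by auto
  have g0: "g 0 = (- 1) ^ n / fact n" by (simp add: g_def gamma_residue_0)
  have "(g has_field_derivative D) (at 0)"
    unfolding g_def[abs_def] D_def by (rule derivative_eq_intros gamma_residue_derivative refl | simp)+
  then have lim1: "((\<lambda>\<delta>. (g \<delta> - g 0) / \<delta>) \<longlongrightarrow> D) (at 0)"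
    by (simp add: has_field_derivative_iff)
  have sh: "((\<lambda>\<delta>. \<delta> - of_nat n) \<longlongrightarrow> (- of_nat n :: complex)) (at 0)"
    by (auto intro!: tendsto_eq_intros)
  have "(\<lambda>s. lower_series (- {n}) s r) field_differentiable at (- of_nat n)"
    using lower_series_holomorphic nin open_lower_series_domain
    by (metis ComplI holomorphic_on_imp_differentiable_at)
  then have c2: "isCont (\<lambda>s. lower_series (- {n}) s r) (- of_nat n)"
    by (rule field_differentiable_imp_continuous_at)
  have lim2: "((\<lambda>\<delta>. lower_series (- {n}) (\<delta> - of_nat n) r) \<longlongrightarrow> lower_series (- {n}) (- of_nat n) r) (at 0)"
    by (rule isCont_tendsto_compose[OF c2 sh])
  have "isCont (\<lambda>s. gexp_int s r) (- of_nat n)"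
    using holomorphic_on_imp_continuous_on[OF gexp_int_holomorphic[OF assms]] by (simp add: continuous_on_eq_continuous_at)
  then have lim3: "((\<lambda>\<delta>. gexp_int (\<delta> - of_nat n) r) \<longlongrightarrow> gexp_int (- of_nat n) r) (at 0)"
    by (rule isCont_tendsto_compose[OF _ sh])
  have eq: "of_real (r ^ n) * ((g \<delta> - g 0) / \<delta>) - lower_series (- {n}) (\<delta> - of_nat n) r = gexp_int (\<delta> - of_nat n) r"
    if \<delta>: "norm \<delta> < 1" "\<delta> \<noteq> 0" for \<delta>
  proof -
    let ?s = "\<delta> - of_nat n" and ?f = "\<lambda>j. of_real ((- r) ^ j) / ((\<delta> - of_nat n + of_nat j) * fact j)"
    have s: "?s \<notin> \<int>\<^sub>\<le>\<^sub>0" by (rule shifted_not_nonpos_Int[OF \<delta>])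
    then have "?s \<notin> (\<lambda>j. - of_nat j) ` (- {n})" using range_neg_nat by blast
    then have sm: "?f summable_on (- {n})" by (rule lower_series_summable)
    have "lower_series UNIV ?s r = infsum ?f (insert n (- {n}))"
      unfolding lower_series_def by (rule infsum_cong_neutral) auto
    also have "\<dots> = ?f n + infsum ?f (- {n})" by (rule infsum_insert[OF sm]) simp
    finally have ls: "lower_series UNIV ?s r = of_real ((- r) ^ n) / (\<delta> * fact n) + lower_series (- {n}) ?s r"
      by (simp add: lower_series_def)
    have e: "exp (?s * of_real (ln r)) \<noteq> 0" by simp
    have "gexp_int ?s r = Gamma ?s / exp (?s * of_real (ln r)) - lower_series UNIV ?s r"
      using lower_series_eq[OF assms s] e by (simp add: field_simps)
    also have "Gamma ?s / exp (?s * of_real (ln r)) = of_real (r ^ n) * (g \<delta> / \<delta>)"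
    proof -
      have "exp (of_nat n * complex_of_real (ln r)) = of_real (r ^ n)"
        using assms by (simp add: exp_of_nat_mult exp_of_real)
      moreover have "1 / exp (?s * of_real (ln r)) = exp (of_nat n * complex_of_real (ln r)) * exp (- \<delta> * of_real (ln r))"
        by (simp add: exp_minus[symmetric] inverse_eq_divide[symmetric] exp_add[symmetric] algebra_simps)
      ultimately show ?thesis
        unfolding gamma_residue_eq[OF \<delta>] g_def by (simp add: divide_inverse mult_ac)
    qed
    finally show ?thesis
      unfolding ls g0 using \<delta>(2) by (simp add: diff_divide_distrib right_diff_distrib power_minus[of r] mult_ac)
  qed
  have "((\<lambda>\<delta>. of_real (r ^ n) * ((g \<delta> - g 0) / \<delta>) - lower_series (- {n}) (\<delta> - of_nat n) r) \<longlongrightarrow>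
      of_real (r ^ n) * D - lower_series (- {n}) (- of_nat n) r) (at 0)"
    by (intro tendsto_intros lim1 lim2)
  then have "((\<lambda>\<delta>. gexp_int (\<delta> - of_nat n) r) \<longlongrightarrow> of_real (r ^ n) * D - lower_series (- {n}) (- of_nat n) r) (at 0)"
  proof (rule Lim_transform_eventually)
    have "\<forall>\<^sub>F \<delta> in at (0::complex). norm \<delta> < 1 \<and> \<delta> \<noteq> 0"
      by (auto simp: eventually_at intro!: exI[of _ 1])
    then show "\<forall>\<^sub>F \<delta> in at 0. of_real (r ^ n) * ((g \<delta> - g 0) / \<delta>) - lower_series (- {n}) (\<delta> - of_nat n) r = gexp_int (\<delta> - of_nat n) r"
      by (rule eventually_mono) (rule eq, auto)
  qed
  from tendsto_unique[OF _ lim3 this]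
  have "gexp_int (- of_nat n) r = of_real (r ^ n) * D - lower_series (- {n}) (- of_nat n) r" by simp
  moreover have "of_real (r ^ n) * D = of_real ((- r) ^ n / fact n * (harm n - euler_mascheroni - ln r))"
  proof -
    have "complex_of_real (harm n) = harm n" by (simp add: harm_def)
    then show ?thesis
      by (simp add: D_def gamma_residue_0 power_minus[of r] of_real_harm algebra_simps
          diff_divide_distrib add_divide_distrib)
  qed
  ultimately show ?thesis by simp
qed

text \<open>The real series is compared with \<open>lower_series\<close> at s = -(l + k - n), whose
  only singular index is the one left out.\<close>

lemma Crandall_reg_series_summable:
  assumes "n \<le> l + k"
  shows "(\<lambda>j::nat. (- pi * lam\<^sup>2 * (norm v)\<^sup>2) ^ j / ((real j + real n - real l - real k) * fact j)) summable_on (- {l + k - n})"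
    and "of_real (\<Sum>\<^sub>\<infinity>j\<in>- {l + k - n}. (- pi * lam\<^sup>2 * (norm v)\<^sup>2) ^ j / ((real j + real n - real l - real k) * fact j))
      = lower_series (- {l + k - n}) (- of_nat (l + k - n)) (pi * lam\<^sup>2 * (norm v)\<^sup>2)"
proof -
  let ?f = "\<lambda>j::nat. (- pi * lam\<^sup>2 * (norm v)\<^sup>2) ^ j / ((real j + real n - real l - real k) * fact j)"
  let ?x = "pi * lam\<^sup>2 * (norm v)\<^sup>2" and ?j = "l + k - n"
  have "- of_nat ?j \<notin> (\<lambda>j. - of_nat j :: complex) ` (- {?j})" by auto
  from lower_series_summable[OF this, of ?x]
  have cs: "(\<lambda>j. of_real ((- ?x) ^ j) / ((- of_nat ?j + of_nat j) * fact j) :: complex) summable_on (- {?j})" .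
  have eq: "of_real ((- ?x) ^ j) / ((- of_nat ?j + of_nat j) * fact j) = complex_of_real (?f j)" for j
    using assms by (simp add: of_nat_diff algebra_simps)
  have cs': "(\<lambda>j. complex_of_real (?f j)) summable_on (- {?j})" using cs by (simp only: eq)
  from summable_on_bounded_linear[OF bounded_linear_Re this]
  show sm: "?f summable_on (- {?j})" by (simp only: Re_complex_of_real)
  have "((\<lambda>j. complex_of_real (?f j)) has_sum of_real (infsum ?f (- {?j}))) (- {?j})"
    by (intro has_sum_of_real has_sum_infsum sm)
  then show "of_real (infsum ?f (- {?j})) = lower_series (- {?j}) (- of_nat ?j) ?x"
    unfolding lower_series_def eq by (rule infsumI[symmetric])
qed

text \<open>For v \<noteq> 0 the expansion of \<open>gexp_int\<close> at -j is inserted, where j = l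
  + k - n. The logarithms of \<pi> |v|^2 cancel up to -2 ln \<open>lam\<close>, the harmonic number
  of index j cancels the one inside \<open>H_const\<close>, and what is left is
  \<open>H'_const\<close>.\<close>

lemma Crandall_reg_eq_series:
  fixes v :: "real^'n"
  assumes "n \<le> l + k" "lam > 0"
  shows "Crandall_reg (- 2 * of_nat l) lam k n v = of_real (Crandall_reg_series l lam k n v)"
proof -
  have the: "(THE l'::nat. - 2 * of_nat l = - 2 * (of_nat l' :: complex)) = l"
    by (rule the_equality) auto
  have ex: "\<exists>l'::nat. - 2 * of_nat l = - 2 * (of_nat l' :: complex) \<and> n \<le> l' + k" using assms by auto
  have 1: "Crandall_reg (- 2 * of_nat l) lam k n v =
     (if v = 0 then of_real (Crandall_reg_series l lam k n v) else Crandall_reg_log l lam k n v)"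
    unfolding Crandall_reg_def the using ex by simp
  have "Crandall_reg_log l lam k n v = of_real (Crandall_reg_series l lam k n v)" if v: "v \<noteq> 0"
  proof -
    define j where "j = l + k - n"
    define x where "x = pi * lam\<^sup>2 * (norm v)\<^sup>2"
    define B where "B = lower_series (- {j}) (- of_nat j) x"
    have x: "x > 0" using v assms by (simp add: x_def)
    have "upper_Crandall (2 * (of_nat n - of_nat l - of_nat k)) (lam *\<^sub>R v) = gexp_int (- of_nat j) x"
    proof -
      have 1: "2 * (of_nat n - of_nat l - of_nat k) / 2 = (- of_nat j :: complex)"
        using assms by (simp add: j_def of_nat_diff)
      have 2: "pi * (norm (lam *\<^sub>R v))\<^sup>2 = x" by (simp add: x_def power_mult_distrib)
      have 3: "lam *\<^sub>R v \<noteq> 0" using v assms by simp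
      show ?thesis unfolding upper_Crandall_eq[OF 3] 1 2 ..
    qed
    also have "\<dots> = of_real ((- x) ^ j / fact j * (harm j - euler_mascheroni - ln x)) - B"
      unfolding B_def by (rule gexp_int_neg_nat[OF x])
    finally have u: "upper_Crandall (2 * (of_nat n - of_nat l - of_nat k)) (lam *\<^sub>R v)
      = of_real ((- x) ^ j / fact j * (harm j - euler_mascheroni - ln x)) - B" .
    define P where "P = (- pi * (norm v)\<^sup>2) ^ j / fact j"
    have "lam powi (2 * int n - 4 * int k) * lam ^ (2 * j) = lam powi (2 * (int l - int k))"
    proof -
      have "lam ^ (2 * j) = lam powi (2 * (int l + int k - int n))"
      proof -
        have "int (2 * j) = 2 * (int l + int k - int n)"
          using assms by (simp add: j_def of_nat_diff)
        then show ?thesis by (metis power_int_of_nat)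
      qed
      then show ?thesis using assms(2) by (simp add: power_int_add[symmetric] algebra_simps)
    qed
    moreover have "(- x) ^ j / fact j = lam ^ (2 * j) * P"
      by (simp add: x_def P_def power_mult_distrib power_mult[symmetric] power_minus' mult_ac flip: power_mult)
    ultimately have pw: "lam powi (2 * int n - 4 * int k) * ((- x) ^ j / fact j) = lam powi (2 * (int l - int k)) * P"
      by (metis mult.assoc)
    have lnx: "ln x = ln (pi * (norm v)\<^sup>2) + 2 * ln lam"
    proof -
      have "x = (pi * (norm v)\<^sup>2) * lam\<^sup>2" by (simp add: x_def)
      then show ?thesis using v assms by (simp add: ln_mult ln_realpow)
    qed
    have S: "complex_of_real (Crandall_reg_series l lam k n v) = of_real (lam powi (2 * (int l - int k)) * P * H'_const l lam k CARD('n))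
       - of_real (lam powi (2 * int n - 4 * int k)) * B"
      unfolding Crandall_reg_series_def B_def x_def P_def j_def
      by (simp only: of_real_diff of_real_mult Crandall_reg_series_summable(2)[OF assms(1)])
    have "Crandall_reg_log l lam k n v = of_real (lam powi (2 * int n - 4 * int k) * ((- x) ^ j / fact j) * (harm j - euler_mascheroni - ln x))
       - of_real (lam powi (2 * int n - 4 * int k)) * B
       + of_real (lam powi (2 * (int l - int k)) * P * (ln (pi * (norm v)\<^sup>2) + H_const l k n CARD('n)))"
      unfolding Crandall_reg_log_def u P_def j_def by (simp add: algebra_simps)
    also have "\<dots> = of_real (lam powi (2 * (int l - int k)) * P * (harm j - euler_mascheroni - ln x + ln (pi * (norm v)\<^sup>2) + H_const l k n CARD('n)))
        - of_real (lam powi (2 * int n - 4 * int k)) * B"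
      unfolding pw by (simp add: distrib_left)
    also have "harm j - euler_mascheroni - ln x + ln (pi * (norm v)\<^sup>2) + H_const l k n CARD('n) = H'_const l lam k CARD('n)"
      by (simp add: lnx H_const_def H'_const_def j_def)
    finally show ?thesis unfolding S .
  qed
  with 1 show ?thesis by simp
qed

section \<open>Poisson summation for Gaussians\<close>

text \<open>The change of variables formula of the library is stated for well-ordered index types only.
  \<open>'a idx\<close> is a copy of \<open>'a\<close> with an arbitrary order.\<close>

typedef (overloaded) 'a idx = "UNIV :: 'a::finite set" ..

lemma bij_Rep_idx: "bij Rep_idx"
  by (metis Abs_idx_inverse Rep_idx_inverse UNIV_I bijI')

lemma bij_Abs_idx: "bij Abs_idx"
  by (rule bijI', metis Abs_idx_inverse UNIV_I, metis Rep_idx_inverse UNIV_I)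

lemma inv_idx: "inv Rep_idx = Abs_idx" "inv Abs_idx = Rep_idx"
  by (rule inv_equality; simp add: Abs_idx_inverse Rep_idx_inverse)+

instance idx :: (finite) finite
proof
  have "inj (Rep_idx :: 'a idx \<Rightarrow> 'a)" by (simp add: bij_Rep_idx bij_is_inj)
  then show "finite (UNIV :: 'a idx set)" by (rule inj_on_finite[where B="UNIV"]) auto
qed

instantiation idx :: (finite) wellorder
begin

definition less_eq_idx :: "'a idx \<Rightarrow> 'a idx \<Rightarrow> bool" where
  "x \<le> y \<longleftrightarrow> to_nat (Rep_idx x) \<le> to_nat (Rep_idx y)"

definition less_idx :: "'a idx \<Rightarrow> 'a idx \<Rightarrow> bool" where
  "x < y \<longleftrightarrow> to_nat (Rep_idx x) < to_nat (Rep_idx y)"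

instance
proof
  fix P :: "'a idx \<Rightarrow> bool" and a
  assume *: "\<And>x. (\<And>y. y < x \<Longrightarrow> P y) \<Longrightarrow> P x"
  show "P a"
    by (induction "to_nat (Rep_idx a)" arbitrary: a rule: less_induct) (auto intro: * simp: less_idx_def)
qed (auto simp: less_eq_idx_def less_idx_def Rep_idx_inject)

end

text \<open>The rescaled image measure is shown to give every box its volume, and this characterizes
  Lebesgue measure.\<close>

lemma lborel_linear_wellorder:
  fixes A :: "real^'m::{finite,wellorder}^'m::_"
  assumes "invertible A" "B \<in> sets borel"
  shows "emeasure lborel B = ennreal \<bar>det A\<bar> * emeasure lborel ((\<lambda>v. A *v v) -` B)"
proof -
  have cont: "continuous_on UNIV ((*v) A)" by (intro linear_continuous_on matrix_vector_mul_bounded_linear)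
  have meas: "(*v) A \<in> borel_measurable borel" using cont by (simp add: borel_measurable_continuous_onI)
  define M where "M = density (distr lborel borel ((*v) A)) (\<lambda>_. ennreal \<bar>det A\<bar>)"
  have M: "emeasure M B = ennreal \<bar>det A\<bar> * emeasure lborel ((\<lambda>v. A *v v) -` B)" if "B \<in> sets borel" for B
    using that meas unfolding M_def
    by (subst emeasure_density_const) (auto simp: emeasure_distr)
  have "lborel = M"
  proof (rule lborel_eqI)
    show "sets M = sets borel" by (simp add: M_def)
    fix l u :: "real^'m::_" assume lu: "\<And>b. b \<in> Basis \<Longrightarrow> l \<bullet> b \<le> u \<bullet> b"
    define S where "S = (\<lambda>v. A *v v) -` box l u"
    have img: "(*v) A ` S = box l u"
    proof (intro equalityI subsetI)
      fix z assume "z \<in> box l u"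
      moreover have "A *v (matrix_inv A *v z) = z"
        using matrix_inv[OF assms(1)] by (simp add: matrix_vector_mul_assoc)
      ultimately show "z \<in> (*v) A ` S" unfolding S_def by (metis image_eqI vimageI)
    qed (auto simp: S_def)
    have Sb: "S \<in> sets borel" unfolding S_def
      by (rule measurable_sets_borel[OF meas]) simp
    then have Sl: "S \<in> sets lebesgue" by simp
    have "S = (*v) (matrix_inv A) ` box l u"
    proof (intro equalityI subsetI)
      fix v assume "v \<in> S"
      moreover have "matrix_inv A *v (A *v v) = v"
        using matrix_inv[OF assms(1)] by (simp add: matrix_vector_mul_assoc)
      ultimately show "v \<in> (*v) (matrix_inv A) ` box l u" unfolding S_def by (metis image_eqI vimageE)
    next
      fix v assume "v \<in> (*v) (matrix_inv A) ` box l u"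
      then obtain w where "v = matrix_inv A *v w" "w \<in> box l u" by blast
      moreover have "A *v (matrix_inv A *v w) = w" for w
        using matrix_inv[OF assms(1)] by (simp add: matrix_vector_mul_assoc)
      ultimately show "v \<in> S" unfolding S_def by simp
    qed
    then have "bounded S" using bounded_linear_image[OF bounded_box matrix_vector_mul_bounded_linear] by metis
    then have Sm: "S \<in> lmeasurable" using Sl by (rule bounded_set_imp_lmeasurable)
    have "measure lebesgue (box l u) = \<bar>det A\<bar> * measure lebesgue S"
      using measure_linear_image[OF matrix_vector_mul_linear Sm, of A] by (simp add: img)
    moreover have "emeasure lborel S = ennreal (measure lebesgue S)"
    proof -
      have "emeasure lebesgue S = emeasure lborel S" using Sb by (simp add: main_part_sets)
      then show ?thesis using emeasure_eq_measure2[OF Sm] by simp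
    qed
    moreover have "emeasure lborel (box l u) = ennreal (measure lebesgue (box l u))"
      using lu by (simp add: emeasure_lborel_box measure_completion measure_lborel_box)
    ultimately have "emeasure lborel (box l u) = ennreal \<bar>det A\<bar> * emeasure lborel S"
      by (simp add: ennreal_mult)
    then show "emeasure M (box l u) = (\<Prod>b\<in>Basis. (u - l) \<bullet> b)"
      using lu M[of "box l u"] by (simp add: S_def emeasure_lborel_box)
  qed
  then show ?thesis using M[OF assms(2)] by simp
qed

definition relabel :: "real^('a::finite) idx \<Rightarrow> real^'a" where
  "relabel v = (\<chi> i. v $ Abs_idx i)"

definition unlabel :: "real^('a::finite) \<Rightarrow> real^'a idx" where
  "unlabel w = (\<chi> i. w $ Rep_idx i)"

lemma relabel_unlabel [simp]: "relabel (unlabel w) = w" "unlabel (relabel v) = v"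
  by (simp_all add: relabel_def unlabel_def vec_eq_iff Abs_idx_inverse Rep_idx_inverse)

lemma relabel_measurable: "relabel \<in> borel_measurable borel" "unlabel \<in> borel_measurable borel"
  unfolding relabel_def[abs_def] unlabel_def[abs_def]
  by (intro borel_measurable_continuous_onI continuous_intros)+

lemma Basis_vec_eq: "(Basis :: (real^'n) set) = range (\<lambda>i. axis i 1)"
  by (auto simp: Basis_vec_def)

lemma prod_Basis_vec: "(\<Prod>b\<in>Basis. f (b :: real^'n)) = (\<Prod>i\<in>UNIV. f (axis i 1))"
  unfolding Basis_vec_eq by (subst prod.reindex) (auto simp: inj_on_def axis_eq_axis)

lemma emeasure_relabel:
  fixes B :: "(real^'a::finite) set"
  assumes "B \<in> sets borel"
  shows "emeasure lborel B = emeasure lborel (relabel -` B)"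
proof -
  have "lborel = distr lborel borel (relabel :: real^'a idx \<Rightarrow> _)"
  proof (rule lborel_eqI)
    fix l u :: "real^'a" assume lu: "\<And>b. b \<in> Basis \<Longrightarrow> l \<bullet> b \<le> u \<bullet> b"
    have vi: "relabel -` box l u = box (unlabel l) (unlabel u)"
    proof (intro equalityI subsetI)
      fix v assume "v \<in> box (unlabel l) (unlabel u)"
      then have "unlabel l $ i < v $ i \<and> v $ i < unlabel u $ i" for i by (simp add: mem_box_cart)
      from this[of "Abs_idx _"] show "v \<in> relabel -` box l u"
        by (simp add: mem_box_cart relabel_def unlabel_def Abs_idx_inverse)
    next
      fix v assume "v \<in> relabel -` box l u"
      then have "l $ i < relabel v $ i \<and> relabel v $ i < u $ i" for i by (simp add: mem_box_cart)
      from this[of "Rep_idx _"] show "v \<in> box (unlabel l) (unlabel u)"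
        by (simp add: mem_box_cart relabel_def unlabel_def Rep_idx_inverse)
    qed
    have lu': "l $ i \<le> u $ i" for i using lu[of "axis i 1"] by (simp add: Basis_vec_eq inner_axis)
    have "emeasure (distr lborel borel relabel) (box l u) = emeasure lborel (box (unlabel l) (unlabel u))"
      using relabel_measurable by (subst emeasure_distr) (auto simp: vi)
    also have "\<dots> = ennreal (\<Prod>b\<in>Basis. (unlabel u - unlabel l) \<bullet> b)"
      using lu' by (intro emeasure_lborel_box) (auto simp: Basis_vec_eq inner_axis unlabel_def)
    also have "(\<Prod>b\<in>Basis. (unlabel u - unlabel l) \<bullet> b) = (\<Prod>i\<in>UNIV. u $ Rep_idx i - l $ Rep_idx i)"
      unfolding prod_Basis_vec by (simp add: inner_axis unlabel_def)
    also have "\<dots> = (\<Prod>i\<in>UNIV. u $ i - l $ i)"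
      by (rule prod.reindex_bij_betw[OF bij_Rep_idx])
    also have "\<dots> = (\<Prod>b\<in>Basis. (u - l) \<bullet> b)"
      unfolding prod_Basis_vec by (simp add: inner_axis)
    finally show "emeasure (distr lborel borel relabel) (box l u) = (\<Prod>b\<in>Basis. (u - l) \<bullet> b)" .
  qed simp
  then have "emeasure lborel B = emeasure (distr lborel borel (relabel :: real^'a idx \<Rightarrow> _)) B" by simp
  also have "\<dots> = emeasure lborel (relabel -` B)"
    using assms relabel_measurable by (subst emeasure_distr) auto
  finally show ?thesis .
qed

text \<open>In the Leibniz formula the permutations are conjugated with \<open>Rep_idx\<close>,
  which preserves their signs.\<close>

lemma det_relabel:
  fixes A :: "real^'a::finite^'a::_"
  defines "A' \<equiv> \<chi> i j. A $ Rep_idx i $ Rep_idx j"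
  shows "det A' = det A"
proof -
  have bij: "bij_betw (\<lambda>p. map_permutation UNIV Rep_idx p) {p. p permutes (UNIV :: 'a idx set)} {p. p permutes UNIV}"
  proof (rule bij_betwI[where g="\<lambda>p. map_permutation UNIV Abs_idx p"])
    note b = bij_Rep_idx bij_Abs_idx
    show "(\<lambda>p. map_permutation UNIV Rep_idx p) \<in> {p. p permutes UNIV} \<rightarrow> {p. p permutes UNIV}"
      using map_permutation_permutes[OF b(1)] by auto
    show "(\<lambda>p. map_permutation UNIV Abs_idx p) \<in> {p. p permutes UNIV} \<rightarrow> {p. p permutes UNIV}"
      using map_permutation_permutes[OF b(2)] by auto
    have mR: "map_permutation UNIV Rep_idx p = Rep_idx \<circ> p \<circ> Abs_idx" for p
      unfolding map_permutation_def restrict_id_def inv_idx bij_is_surj[OF b(1)] by (simp add: comp_def)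
    have mA: "map_permutation UNIV Abs_idx p = Abs_idx \<circ> p \<circ> Rep_idx" for p
      unfolding map_permutation_def restrict_id_def inv_idx bij_is_surj[OF b(2)] by (simp add: comp_def)
    show "map_permutation UNIV Abs_idx (map_permutation UNIV Rep_idx p) = p"
       "map_permutation UNIV Rep_idx (map_permutation UNIV Abs_idx q) = q" for p q
      unfolding mR mA by (auto simp: fun_eq_iff Abs_idx_inverse Rep_idx_inverse)
  qed
  have mp: "map_permutation UNIV Rep_idx p (Rep_idx i) = Rep_idx (p i)" for p i
    by (rule map_permutation_apply) (auto simp: bij_is_inj bij_Rep_idx)
  have "det A = (\<Sum>p\<in>{p. p permutes (UNIV :: 'a idx set)}. of_int (sign (map_permutation UNIV Rep_idx p))
      * (\<Prod>i\<in>UNIV. A $ i $ map_permutation UNIV Rep_idx p i))"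
    unfolding det_def by (rule sum.reindex_bij_betw[OF bij, symmetric])
  also have "\<dots> = det A'"
    unfolding det_def
  proof (rule sum.cong[OF refl])
    fix p assume p: "p \<in> {p. p permutes (UNIV :: 'a idx set)}"
    have "(\<Prod>i\<in>UNIV. A $ i $ map_permutation UNIV Rep_idx p i) = (\<Prod>i\<in>UNIV. A $ Rep_idx i $ Rep_idx (p i))"
      by (subst prod.reindex_bij_betw[OF bij_Rep_idx, symmetric]) (simp add: mp)
    moreover have "sign (map_permutation UNIV Rep_idx p) = sign p"
      using p by (intro sign_map_permutation) (auto simp: bij_is_inj bij_Rep_idx)
    ultimately show "of_int (sign (map_permutation UNIV Rep_idx p)) * (\<Prod>i\<in>UNIV. A $ i $ map_permutation UNIV Rep_idx p i)
       = of_int (sign p) * (\<Prod>i\<in>UNIV. A' $ i $ p i)"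
      by (simp add: A'_def)
  qed
  finally show ?thesis by simp
qed

text \<open>Conjugation with \<open>relabel\<close>, which preserves volumes and determinants,
  transfers the change of variables to an arbitrary finite index type.\<close>

lemma lborel_linear:
  fixes A :: "real^'n^'n"
  assumes "invertible A"
  shows "lborel = density (distr lborel borel ((*v) A)) (\<lambda>_. ennreal \<bar>det A\<bar>)"
proof (rule measure_eqI)
  fix B :: "(real^'n) set" assume "B \<in> sets lborel"
  then have B: "B \<in> sets borel" by simp
  define A' :: "real^'n idx^'n idx" where "A' = (\<chi> i j. A $ Rep_idx i $ Rep_idx j)"
  have det: "det A' = det A" unfolding A'_def by (rule det_relabel)
  then have inv: "invertible A'" using assms by (simp add: invertible_det_nz)
  have meas: "(*v) A \<in> borel_measurable borel"
    by (intro borel_measurable_continuous_onI linear_continuous_on matrix_vector_mul_bounded_linear)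
  have AA: "A *v relabel v = relabel (A' *v v)" for v
  proof -
    have "(\<Sum>j\<in>UNIV. A $ i $ j * v $ Abs_idx j) = (\<Sum>j\<in>UNIV. A $ i $ Rep_idx j * v $ j)" for i
      by (subst sum.reindex_bij_betw[OF bij_Rep_idx, symmetric]) (simp add: Rep_idx_inverse)
    then show ?thesis
      by (simp add: vec_eq_iff matrix_vector_mult_def relabel_def A'_def Abs_idx_inverse)
  qed
  have AB: "(*v) A -` B \<in> sets borel" using measurable_sets[OF meas B] by simp
  have RB: "relabel -` B \<in> sets borel" using measurable_sets[OF relabel_measurable(1) B] by simp
  have "emeasure lborel B = ennreal \<bar>det A\<bar> * emeasure lborel ((*v) A' -` (relabel -` B))"
    unfolding emeasure_relabel[OF B] lborel_linear_wellorder[OF inv RB] det ..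
  also have "(*v) A' -` (relabel -` B) = relabel -` ((*v) A -` B)"
    by (auto simp: AA)
  also have "emeasure lborel (relabel -` ((*v) A -` B)) = emeasure lborel ((*v) A -` B)"
    using emeasure_relabel[OF AB] by simp
  finally show "emeasure lborel B = emeasure (density (distr lborel borel ((*v) A)) (\<lambda>_. ennreal \<bar>det A\<bar>)) B"
    using B meas by (subst emeasure_density_const) (auto simp: emeasure_distr)
qed simp

lemma integrable_scaleR_right_iff:
  fixes f :: "_ \<Rightarrow> complex"
  assumes "c \<noteq> 0"
  shows "integrable M (\<lambda>x. c *\<^sub>R f x) \<longleftrightarrow> integrable M f"
proof
  assume "integrable M (\<lambda>x. c *\<^sub>R f x)"
  then have "integrable M (\<lambda>x. (1 / c) *\<^sub>R (c *\<^sub>R f x))" by (rule integrable_scaleR_right)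
  then show "integrable M f" using assms by simp
qed (rule integrable_scaleR_right)

lemma lborel_integral_linear:
  fixes A :: "real^'n^'n" and f :: "real^'n \<Rightarrow> complex"
  assumes "invertible A" "f \<in> borel_measurable borel"
  shows "integral\<^sup>L lborel (\<lambda>v. f (A *v v)) = integral\<^sup>L lborel f / of_real \<bar>det A\<bar>"
    and "integrable lborel (\<lambda>v. f (A *v v)) \<longleftrightarrow> integrable lborel f"
proof -
  have meas: "(*v) A \<in> borel_measurable borel"
    by (intro borel_measurable_continuous_onI linear_continuous_on matrix_vector_mul_bounded_linear)
  have d0: "\<bar>det A\<bar> > 0" using assms(1) by (simp add: invertible_det_nz)
  have "integral\<^sup>L lborel f = integral\<^sup>L (density (distr lborel borel ((*v) A)) (\<lambda>_. ennreal \<bar>det A\<bar>)) f"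
    using lborel_linear[OF assms(1)] by simp
  also have "\<dots> = \<bar>det A\<bar> *\<^sub>R integral\<^sup>L lborel (\<lambda>v. f (A *v v))"
    using assms(2) meas by (subst integral_density) (auto simp: integral_distr)
  finally show "integral\<^sup>L lborel (\<lambda>v. f (A *v v)) = integral\<^sup>L lborel f / of_real \<bar>det A\<bar>"
    using d0 by (simp add: scaleR_conv_of_real field_simps)
  have "integrable lborel f \<longleftrightarrow> integrable (density (distr lborel borel ((*v) A)) (\<lambda>_. ennreal \<bar>det A\<bar>)) f"
    using lborel_linear[OF assms(1)] by simp
  also have "\<dots> \<longleftrightarrow> integrable lborel (\<lambda>v. f (A *v v))"
    using assms(2) meas d0
    by (subst integrable_density) (auto simp: integrable_distr_eq integrable_scaleR_right_iff)
  finally show "integrable lborel (\<lambda>v. f (A *v v)) \<longleftrightarrow> integrable lborel f" by simp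
qed

section \<open>Fourier transform of Gaussians\<close>

lemma lborel_prod_Basis:
  fixes g :: "'a::euclidean_space \<Rightarrow> real \<Rightarrow> complex"
  assumes "\<And>b. b \<in> Basis \<Longrightarrow> integrable lborel (g b)"
  shows "integrable lborel (\<lambda>v::'a. \<Prod>b\<in>Basis. g b (v \<bullet> b))"
    "integral\<^sup>L lborel (\<lambda>v::'a. \<Prod>b\<in>Basis. g b (v \<bullet> b)) = (\<Prod>b\<in>Basis. integral\<^sup>L lborel (g b))"
proof -
  interpret product_sigma_finite "\<lambda>b::'a. lborel :: real measure"
    by (simp add: product_sigma_finite_def sigma_finite_lborel)
  let ?T = "\<lambda>f::'a \<Rightarrow> real. \<Sum>b\<in>Basis. f b *\<^sub>R b"
  let ?F = "\<lambda>v::'a. \<Prod>b\<in>Basis. g b (v \<bullet> b)"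
  have gm: "g b \<in> borel_measurable borel" if "b \<in> Basis" for b
    using assms[OF that] by (simp add: borel_measurable_integrable[of lborel, simplified])
  have Fm: "?F \<in> borel_measurable borel"
  proof (rule borel_measurable_prod)
    fix b :: 'a assume "b \<in> Basis"
    have "(\<lambda>v::'a. v \<bullet> b) \<in> borel_measurable borel" by simp
    from measurable_compose[OF this gm[OF \<open>b \<in> Basis\<close>]]
    show "(\<lambda>v. g b (v \<bullet> b)) \<in> borel_measurable borel" .
  qed
  have Tm: "?T \<in> measurable (\<Pi>\<^sub>M b\<in>Basis. lborel) borel"
    by measurable
  have FT: "?F (?T f) = (\<Prod>b\<in>Basis. g b (f b))" for f
    by (intro prod.cong refl) (simp add: inner_sum_left inner_Basis if_distrib sum.delta cong: if_cong)
  show "integrable lborel ?F"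
    by (subst lborel_eq, subst integrable_distr_eq[OF Tm Fm], unfold FT)
      (rule product_integrable_prod[OF finite_Basis assms])
  have "integral\<^sup>L lborel ?F = integral\<^sup>L (\<Pi>\<^sub>M b\<in>Basis. lborel) (\<lambda>f. ?F (?T f))"
    by (subst lborel_eq) (rule integral_distr[OF Tm Fm])
  also have "\<dots> = (\<Prod>b\<in>Basis. integral\<^sup>L lborel (g b))"
    unfolding FT using assms by (intro product_integral_prod) auto
  finally show "integral\<^sup>L lborel ?F = (\<Prod>b\<in>Basis. integral\<^sup>L lborel (g b))" .
qed

text \<open>After rescaling by c = sqrt(2 \<pi> t) the integrand is the standard normal density
  times a character, so its integral is a value of the characteristic function of the normal
  distribution.\<close>

lemma gauss_fourier_1d:
  fixes t \<xi> :: real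
  assumes "t > 0"
  defines "f \<equiv> \<lambda>u. exp (of_real (- (pi * t * u\<^sup>2)) - 2 * of_real pi * \<i> * of_real (\<xi> * u)) :: complex"
  shows "integrable lborel f" "integral\<^sup>L lborel f = of_real (t powr (-1/2) * exp (- pi * \<xi>\<^sup>2 / t))"
proof -
  define c where "c = sqrt (2 * pi * t)"
  have c: "c > 0" "c\<^sup>2 = 2 * pi * t" using assms by (auto simp: c_def)
  define \<tau> where "\<tau> = - 2 * pi * \<xi> / c"
  define h where "h x = of_real (std_normal_density x) * iexp (\<tau> * x)" for x
  have hf: "h (0 + c * u) = of_real (1 / sqrt (2 * pi)) * f u" for u
  proof -
    have "std_normal_density (c * u) = 1 / sqrt (2 * pi) * exp (- (pi * t * u\<^sup>2))"
      using c(2) by (simp add: std_normal_density_def power_mult_distrib)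
    moreover have "\<tau> * (c * u) = - 2 * pi * \<xi> * u" using c(1) by (simp add: \<tau>_def)
    ultimately have "h (c * u) = of_real (1 / sqrt (2 * pi)) * (exp (of_real (- (pi * t * u\<^sup>2))) * exp (\<i> * of_real (- 2 * pi * \<xi> * u)))"
      unfolding h_def by (simp add: exp_of_real[symmetric])
    also have "exp (of_real (- (pi * t * u\<^sup>2))) * exp (\<i> * of_real (- 2 * pi * \<xi> * u)) = f u"
      unfolding f_def exp_add[symmetric] by (simp add: algebra_simps)
    finally show ?thesis by simp
  qed
  have hi: "integrable lborel h"
  proof (rule Bochner_Integration.integrable_bound[OF integrable_normal_density[of 1 0]])
    show "h \<in> borel_measurable lborel" unfolding h_def[abs_def] by measurable
    show "AE x in lborel. norm (h x) \<le> norm (std_normal_density x)" by (simp add: h_def norm_mult)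
  qed simp
  have "integral\<^sup>L lborel h = char std_normal_distribution \<tau>"
    unfolding char_def h_def by (subst integral_density) (auto simp: scaleR_conv_of_real)
  then have hI: "integral\<^sup>L lborel h = of_real (exp (- (\<tau>\<^sup>2) / 2))"
    by (simp add: char_std_normal_distribution)
  have "integrable lborel (\<lambda>u. h (0 + c * u))"
    using lborel_integrable_real_affine[OF hi, of c 0] c by simp
  then have "integrable lborel (\<lambda>u. of_real (sqrt (2 * pi)) * h (0 + c * u))" by simp
  moreover have sq: "of_real (sqrt (2 * pi)) * h (0 + c * u) = f u" for u
    unfolding hf by (simp add: real_sqrt_mult[symmetric])
  ultimately show "integrable lborel f" by simp
  have "integral\<^sup>L lborel h = \<bar>c\<bar> *\<^sub>R integral\<^sup>L lborel (\<lambda>u. h (0 + c * u))"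
    using c by (intro lborel_integral_real_affine) auto
  then have "of_real (exp (- (\<tau>\<^sup>2) / 2)) = of_real c * (of_real (1 / sqrt (2 * pi)) * integral\<^sup>L lborel f)"
    unfolding hI hf using c by (simp add: scaleR_conv_of_real)
  moreover have "c * (1 / sqrt (2 * pi)) = sqrt t"
    using assms by (simp add: c_def real_sqrt_mult)
  ultimately have eq: "of_real (exp (- (\<tau>\<^sup>2) / 2)) = of_real (sqrt t) * integral\<^sup>L lborel f"
    by (metis mult.assoc of_real_mult)
  have "\<tau>\<^sup>2 / 2 = pi * \<xi>\<^sup>2 / t"
    unfolding \<tau>_def power_divide c(2) using assms(1) by (simp add: power2_eq_square field_simps)
  with eq have "integral\<^sup>L lborel f = of_real (exp (- pi * \<xi>\<^sup>2 / t)) / of_real (sqrt t)"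
    using assms by (simp add: field_simps)
  moreover have "t powr (-1/2) = 1 / sqrt t"
    using assms by (simp add: powr_minus_divide powr_half_sqrt)
  ultimately show "integral\<^sup>L lborel f = of_real (t powr (-1/2) * exp (- pi * \<xi>\<^sup>2 / t))"
    by simp
qed

lemma norm_sq_eq_sum_Basis: "(norm (v::'a::euclidean_space))\<^sup>2 = (\<Sum>b\<in>Basis. (v \<bullet> b)\<^sup>2)"
  by (simp add: norm_eq_sqrt_inner euclidean_inner[of v v] power2_eq_square sum_nonneg)

lemma gauss_fourier:
  fixes p :: "'a::euclidean_space"
  assumes "t > 0"
  defines "f \<equiv> \<lambda>v::'a. exp (of_real (- (pi * t * (norm v)\<^sup>2)) - 2 * of_real pi * \<i> * of_real (p \<bullet> v)) :: complex"
  shows "integrable lborel f"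
    "integral\<^sup>L lborel f = of_real (t powr (- real DIM('a) / 2) * exp (- pi * (norm p)\<^sup>2 / t))"
proof -
  define g where "g b u = exp (of_real (- (pi * t * u\<^sup>2)) - 2 * of_real pi * \<i> * of_real ((p \<bullet> b) * u) :: complex)" for b u
  have fg: "f = (\<lambda>v. \<Prod>b\<in>Basis. g b (v \<bullet> b))"
  proof
    fix v
    have "(\<Prod>b\<in>Basis. g b (v \<bullet> b)) = exp (\<Sum>b\<in>Basis. of_real (- (pi * t * (v \<bullet> b)\<^sup>2)) - 2 * of_real pi * \<i> * of_real ((p \<bullet> b) * (v \<bullet> b)))"
      unfolding g_def by (simp add: exp_sum)
    also have "\<dots> = f v"
      unfolding f_def norm_sq_eq_sum_Basis euclidean_inner[of p v]
      by (simp add: sum_subtractf sum_negf sum_distrib_left)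
    finally show "f v = (\<Prod>b\<in>Basis. g b (v \<bullet> b))" by simp
  qed
  have gi: "integrable lborel (g b)" "integral\<^sup>L lborel (g b) = of_real (t powr (-1/2) * exp (- pi * (p \<bullet> b)\<^sup>2 / t))" for b
    unfolding g_def[abs_def] by (rule gauss_fourier_1d[OF assms(1)])+
  show "integrable lborel f" unfolding fg by (rule lborel_prod_Basis(1)) (rule gi(1))
  have "integral\<^sup>L lborel f = (\<Prod>b\<in>Basis. of_real (t powr (-1/2) * exp (- pi * (p \<bullet> b)\<^sup>2 / t)))"
    unfolding fg using lborel_prod_Basis(2)[of g] gi by simp
  also have "\<dots> = of_real ((t powr (-1/2)) ^ DIM('a) * exp (\<Sum>b\<in>Basis. - pi * (p \<bullet> b)\<^sup>2 / t))"
    by (simp only: of_real_prod[symmetric] prod.distrib prod_constant exp_sum[OF finite_Basis])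
  also have "(\<Sum>b\<in>Basis. - pi * (p \<bullet> b)\<^sup>2 / t) = - pi * (norm p)\<^sup>2 / t"
    unfolding norm_sq_eq_sum_Basis by (simp add: sum_divide_distrib sum_distrib_left sum_negf)
  also have "(t powr (-1/2)) ^ DIM('a) = t powr (- real DIM('a) / 2)"
    using assms by (simp add: powr_power)
  finally show "integral\<^sup>L lborel f = of_real (t powr (- real DIM('a) / 2) * exp (- pi * (norm p)\<^sup>2 / t))" .
qed

section \<open>Characters, trigonometric polynomials and uniqueness of Fourier coefficients\<close>

definition ephase :: "real \<Rightarrow> complex" where
  "ephase s = exp (2 * of_real pi * \<i> * of_real s)"

lemma ephase_0 [simp]: "ephase 0 = 1"
  by (simp add: ephase_def)

lemma ephase_add: "ephase (a + b) = ephase a * ephase b"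
  by (simp add: ephase_def exp_add[symmetric] algebra_simps)

lemma norm_ephase [simp]: "norm (ephase s) = 1"
  by (simp add: ephase_def)

lemma ephase_nonzero [simp]: "ephase s \<noteq> 0"
  by (simp add: ephase_def)

lemma ephase_minus: "ephase (- s) = inverse (ephase s)"
  by (simp add: ephase_def exp_minus)

lemma cnj_ephase: "cnj (ephase s) = ephase (- s)"
  by (simp add: ephase_def exp_cnj)

lemma ephase_eq_iff: "ephase a = ephase b \<longleftrightarrow> a - b \<in> \<int>"
proof -
  have "ephase a = ephase b \<longleftrightarrow> (\<exists>n::int. 2 * of_real pi * \<i> * of_real a = 2 * of_real pi * \<i> * of_real b + (of_int (2 * n) * pi) * \<i>)"
    unfolding ephase_def by (rule exp_eq)
  also have "\<dots> \<longleftrightarrow> (\<exists>n::int. a = b + of_int n)"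
  proof (rule ex_cong1)
    fix n :: int
    have "2 * of_real pi * \<i> * of_real b + (of_int (2 * n) * pi) * \<i> = 2 * of_real pi * \<i> * complex_of_real (b + of_int n)"
      by (simp add: algebra_simps)
    then show "(2 * of_real pi * \<i> * of_real a = 2 * of_real pi * \<i> * of_real b + (of_int (2 * n) * pi) * \<i>) \<longleftrightarrow> a = b + of_int n"
      by (simp del: of_real_add)
  qed
  also have "\<dots> \<longleftrightarrow> a - b \<in> \<int>"
    by (metis Ints_cases Ints_of_int add_diff_cancel_left' diff_add_cancel add.commute)
  finally show ?thesis .
qed

lemma ephase_int [simp]: "s \<in> \<int> \<Longrightarrow> ephase s = 1"
  using ephase_eq_iff[of s 0] by simp

lemma continuous_ephase [continuous_intros]: "continuous_on S f \<Longrightarrow> continuous_on S (\<lambda>x. ephase (f x))"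
  unfolding ephase_def by (intro continuous_intros)

lemma ephase_Arg: "norm z = 1 \<Longrightarrow> ephase (Arg z / (2 * pi)) = z"
  using Arg_eq[of z] by (cases "z = 0") (auto simp: ephase_def mult_ac)

lemma Re_ephase: "of_real (Re (ephase s)) = (1 / 2) * ephase s + (1 / 2) * ephase (- s)"
  by (simp add: cnj_ephase[symmetric] complex_eq_iff)

lemma Im_ephase: "of_real (Im (ephase s)) = (- \<i> / 2) * ephase s + (\<i> / 2) * ephase (- s)"
  by (simp add: cnj_ephase[symmetric] complex_eq_iff)

lemma int_vecs_inner: "k \<in> int_vecs \<Longrightarrow> m \<in> int_vecs \<Longrightarrow> k \<bullet> m \<in> \<int>"
  unfolding int_vecs_def inner_vec_def by (auto intro!: Ints_sum Ints_mult)

lemma int_vecs_uminus: "k \<in> int_vecs \<Longrightarrow> - k \<in> int_vecs"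
  by (auto simp: int_vecs_def)

lemma int_vecs_add: "k \<in> int_vecs \<Longrightarrow> m \<in> int_vecs \<Longrightarrow> k + m \<in> int_vecs"
  by (auto simp: int_vecs_def)

lemma int_vecs_0: "0 \<in> int_vecs"
  by (auto simp: int_vecs_def)

lemma int_vecs_axis: "axis j 1 \<in> int_vecs"
  by (auto simp: int_vecs_def axis_def)

inductive trig_poly :: "(real^'n \<Rightarrow> complex) \<Rightarrow> bool" where
  mono: "k \<in> int_vecs \<Longrightarrow> trig_poly (\<lambda>u. c * ephase (k \<bullet> u))"
| add: "trig_poly f \<Longrightarrow> trig_poly g \<Longrightarrow> trig_poly (\<lambda>u. f u + g u)"

lemma trig_poly_const: "trig_poly (\<lambda>u. c)"
  using trig_poly.mono[OF int_vecs_0, of c] by simp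

lemma trig_poly_mult:
  assumes "trig_poly f" "trig_poly g"
  shows "trig_poly (\<lambda>u. f u * g u)"
  using assms
proof (induction rule: trig_poly.induct)
  case (mono k c)
  from mono.prems show ?case
  proof (induction rule: trig_poly.induct)
    case (mono k' c')
    have "(\<lambda>u. c * ephase (k \<bullet> u) * (c' * ephase (k' \<bullet> u))) = (\<lambda>u. (c * c') * ephase ((k + k') \<bullet> u))"
      by (simp add: fun_eq_iff inner_add_left ephase_add)
    then show ?case using trig_poly.mono[OF int_vecs_add[OF \<open>k \<in> int_vecs\<close> mono], of "c * c'"] by simp
  next
    case (add f g)
    then show ?case by (simp add: distrib_left trig_poly.add)
  qed
next
  case (add f g)
  then show ?case by (simp add: distrib_right trig_poly.add)
qed

lemma trig_poly_cmult: "trig_poly f \<Longrightarrow> trig_poly (\<lambda>u. c * f u)"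
  by (intro trig_poly_mult trig_poly_const)

lemma trig_poly_sum:
  assumes "finite I" "\<And>i. i \<in> I \<Longrightarrow> trig_poly (f i)"
  shows "trig_poly (\<lambda>u. \<Sum>i\<in>I. f i u)"
  using assms by (induction I) (auto intro: trig_poly.add trig_poly_const)

lemma trig_poly_cnj: "trig_poly f \<Longrightarrow> trig_poly (\<lambda>u. cnj (f u))"
proof (induction rule: trig_poly.induct)
  case (mono k c)
  have "(\<lambda>u. cnj (c * ephase (k \<bullet> u))) = (\<lambda>u. cnj c * ephase ((- k) \<bullet> u))"
    by (simp add: fun_eq_iff cnj_ephase)
  then show ?case using trig_poly.mono[OF int_vecs_uminus[OF mono], of "cnj c"] by simp
next
  case (add f g)
  then show ?case by (simp add: trig_poly.add)
qed

lemma trig_poly_continuous: "trig_poly f \<Longrightarrow> continuous_on S f"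
  by (induction rule: trig_poly.induct) (auto intro!: continuous_intros)

definition torus_point :: "real^'n \<Rightarrow> complex^'n" where
  "torus_point u = (\<chi> j. ephase (u $ j))"

text \<open>The real and imaginary parts of e(u_j) are combinations of e(u_j) and e(-u_j), and
  trigonometric polynomials form an algebra; so the induction over polynomials goes through.\<close>

lemma trig_poly_polynomial:
  fixes p :: "complex^'n \<Rightarrow> real"
  assumes "real_polynomial_function p"
  shows "trig_poly (\<lambda>u. of_real (p (torus_point u)))"
  using assms
proof induction
  case (linear f)
  have inn: "trig_poly (\<lambda>u. of_real (torus_point u \<bullet> b))" if "b \<in> Basis" for b :: "complex^'n"
  proof -
    from that have "\<exists>j c. b = axis j c \<and> c \<in> Basis" by (auto simp: Basis_vec_def)
    then obtain j c where b: "b = axis j c" "c \<in> Basis" by blast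
    have *: "ephase (u $ j) = ephase (axis j 1 \<bullet> u)" "ephase (- (u $ j)) = ephase ((- axis j 1) \<bullet> u)" for u
      by (simp_all add: inner_axis')
    consider "c = 1" | "c = \<i>" using b(2) by (auto simp: Basis_complex_def)
    then show ?thesis
    proof cases
      case 1
      then have "(\<lambda>u. complex_of_real (torus_point u \<bullet> b)) = (\<lambda>u. (1 / 2) * ephase (axis j 1 \<bullet> u) + (1 / 2) * ephase ((- axis j 1) \<bullet> u))"
        unfolding *[symmetric] Re_ephase[symmetric] by (simp add: b inner_axis torus_point_def)
      then show ?thesis
        by (simp only:) (intro trig_poly.add trig_poly.mono int_vecs_axis int_vecs_uminus)
    next
      case 2
      then have "(\<lambda>u. complex_of_real (torus_point u \<bullet> b)) = (\<lambda>u. (- \<i> / 2) * ephase (axis j 1 \<bullet> u) + (\<i> / 2) * ephase ((- axis j 1) \<bullet> u))"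
        unfolding *[symmetric] Im_ephase[symmetric] by (simp add: b inner_axis torus_point_def)
      then show ?thesis
        by (simp only:) (intro trig_poly.add trig_poly.mono int_vecs_axis int_vecs_uminus)
    qed
  qed
  have fz: "f z = (\<Sum>b\<in>Basis. (z \<bullet> b) * f b)" for z
  proof -
    have lin: "linear f" using linear by (rule bounded_linear.linear)
    have "f (\<Sum>b\<in>Basis. (z \<bullet> b) *\<^sub>R b) = (\<Sum>b\<in>Basis. (z \<bullet> b) * f b)"
      by (simp add: linear_sum[OF lin] linear_scale[OF lin])
    then show ?thesis by (simp add: euclidean_representation)
  qed
  have "(\<lambda>u. complex_of_real (f (torus_point u))) = (\<lambda>u. \<Sum>b\<in>Basis. of_real (f b) * of_real (torus_point u \<bullet> b))"
    by (rule ext, subst fz) (simp add: mult.commute)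
  then show ?case
    by (simp only:) (intro trig_poly_sum trig_poly_cmult inn; simp)
next
  case (const c)
  then show ?case by (rule trig_poly_const)
next
  case (add f g)
  then show ?case by (simp add: trig_poly.add)
next
  case (mult f g)
  then show ?case by (simp add: trig_poly_mult)
qed

lemma periodic_int_vecs_eq:
  assumes per: "\<And>u m. m \<in> int_vecs \<Longrightarrow> F (u + m) = F u"
    and "\<And>j. ephase (u $ j) = ephase (v $ j)"
  shows "F u = F v"
proof -
  have "u - v \<in> int_vecs" using assms(2) by (auto simp: int_vecs_def ephase_eq_iff)
  from per[OF this, of v] show ?thesis by simp
qed

text \<open>A continuous periodic function is a continuous function on the torus, where polynomials
  in the coordinates, i.e. trigonometric polynomials, are dense.\<close>

lemma periodic_trig_poly_approx:
  fixes F :: "real^'n \<Rightarrow> complex"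
  assumes cont: "continuous_on UNIV F" and per: "\<And>u m. m \<in> int_vecs \<Longrightarrow> F (u + m) = F u" and "\<epsilon> > 0"
  obtains P where "trig_poly P" "\<And>u. norm (F u - P u) < \<epsilon>"
proof -
  define T where "T = {z::complex^'n. \<forall>j. norm (z $ j) = 1}"
  define G where "G z = F (\<chi> j. Arg (z $ j) / (2 * pi))" for z
  have GF: "G (torus_point u) = F u" for u
    unfolding G_def by (rule periodic_int_vecs_eq[OF per]) (auto simp: ephase_Arg torus_point_def)
  have "closed T" unfolding T_def
    by (intro closed_Collect_all closed_Collect_eq continuous_intros)
  moreover have "bounded T"
  proof (rule boundedI)
    fix z assume z: "z \<in> T"
    have "norm z \<le> (\<Sum>j\<in>UNIV. norm (z $ j))" by (simp add: norm_vec_def L2_set_le_sum)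
    then show "norm z \<le> real CARD('n)" using z by (simp add: T_def)
  qed
  ultimately have T: "compact T" by (simp add: compact_eq_bounded_closed)
  have G: "continuous_on T G"
    unfolding continuous_on_def
  proof
    fix z0 assume z0: "z0 \<in> T"
    \<comment> \<open>The principal argument used in \<open>G\<close> jumps on the negative axis.
      Measured relative to z0 the argument is continuous near z0, and the lift \<open>L z\<close>
      differs from the one in \<open>G\<close> only by an integer vector, which \<open>F\<close>
      does not see.\<close>
    define L where "L z = (\<chi> j. Arg (z0 $ j) / (2 * pi) + Arg (z $ j / z0 $ j) / (2 * pi))" for z
    have n1: "norm (z0 $ j) = 1" for j using z0 by (simp add: T_def)
    have n0: "z0 $ j \<noteq> 0" for j using n1[of j] by auto
    have GL: "G z = F (L z)" if "z \<in> T" for z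
    proof -
      have "norm (z $ j / z0 $ j) = 1" "norm (z $ j) = 1" "norm (z0 $ j) = 1" for j
        using that z0 by (auto simp: T_def norm_divide)
      then show ?thesis
        unfolding G_def L_def using n0 by (intro periodic_int_vecs_eq[OF per]) (auto simp: ephase_add ephase_Arg)
    qed
    have arg: "((\<lambda>z. Arg (z $ j / z0 $ j)) \<longlongrightarrow> Arg (z0 $ j / z0 $ j)) (at z0 within T)" for j
    proof (rule isCont_tendsto_compose[of _ Arg])
      show "isCont Arg (z0 $ j / z0 $ j)" using n0 by (intro continuous_at_Arg) simp
      show "((\<lambda>z. z $ j / z0 $ j) \<longlongrightarrow> z0 $ j / z0 $ j) (at z0 within T)"
        using n0 by (intro tendsto_intros) auto
    qed
    have "(L \<longlongrightarrow> L z0) (at z0 within T)"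
      unfolding L_def by (intro tendsto_intros arg) auto
    moreover have "isCont F (L z0)" using cont by (simp add: continuous_on_eq_continuous_at)
    ultimately have "((\<lambda>z. F (L z)) \<longlongrightarrow> F (L z0)) (at z0 within T)"
      by (rule isCont_tendsto_compose[rotated])
    then have "((\<lambda>z. F (L z)) \<longlongrightarrow> G z0) (at z0 within T)" using GL[OF z0] by simp
    then show "(G \<longlongrightarrow> G z0) (at z0 within T)"
      by (rule Lim_transform_eventually) (auto simp: eventually_at_filter GL)
  qed
  obtain g where g: "polynomial_function g" "\<And>z. z \<in> T \<Longrightarrow> norm (G z - g z) < \<epsilon>"
    using Stone_Weierstrass_polynomial_function[OF T G \<open>\<epsilon> > 0\<close>] by blast
  have "real_polynomial_function (\<lambda>z. Re (g z))" "real_polynomial_function (\<lambda>z. Im (g z))"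
    using g(1) bounded_linear_Re bounded_linear_Im unfolding polynomial_function_def o_def by blast+
  then have "trig_poly (\<lambda>u. of_real (Re (g (torus_point u))) + \<i> * of_real (Im (g (torus_point u))))"
    by (intro trig_poly.add trig_poly_cmult trig_poly_polynomial)
  then have "trig_poly (\<lambda>u. g (torus_point u))" by (simp add: complex_eq[symmetric])
  moreover have "norm (F u - g (torus_point u)) < \<epsilon>" for u
    using g(2)[of "torus_point u"] by (simp add: GF) (simp add: T_def torus_point_def)
  ultimately show ?thesis by (rule that)
qed

text \<open>\<open>F\<close> is orthogonal to all trigonometric polynomials, and these approximate
  it uniformly; so the integral of |F|^2 over the unit cube vanishes, and continuity and periodicity
  do the rest.\<close>

lemma fourier_uniqueness:
  fixes F :: "real^'n \<Rightarrow> complex"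
  assumes cont: "continuous_on UNIV F" and per: "\<And>u m. m \<in> int_vecs \<Longrightarrow> F (u + m) = F u"
    and coef: "\<And>k. k \<in> int_vecs \<Longrightarrow> integral (cbox 0 1) (\<lambda>u. F u * ephase (k \<bullet> u)) = 0"
  shows "F u = 0"
proof -
  let ?C = "cbox 0 1 :: (real^'n) set"
  have contS: "continuous_on S F" for S using cont continuous_on_subset by blast
  have orth: "integral ?C (\<lambda>u. F u * P u) = 0" if "trig_poly P" for P
    using that
  proof (induction rule: trig_poly.induct)
    case (mono k c)
    have "(\<lambda>u. F u * (c * ephase (k \<bullet> u))) = (\<lambda>u. c * (F u * ephase (k \<bullet> u)))" by (simp add: mult_ac)
    then show ?case using coef[OF mono] by simp
  next
    case (add f g)
    have "(\<lambda>u. F u * f u) integrable_on ?C" "(\<lambda>u. F u * g u) integrable_on ?C"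
      by (intro integrable_continuous continuous_intros contS trig_poly_continuous add.hyps)+
    then show ?case using add.IH by (simp add: distrib_left Henstock_Kurzweil_Integration.integral_add)
  qed
  have "compact (F ` ?C)" by (intro compact_continuous_image contS compact_cbox)
  then obtain B where B: "B > 0" "\<And>u. u \<in> ?C \<Longrightarrow> norm (F u) \<le> B"
    using compact_imp_bounded bounded_pos by (metis imageI)
  define I where "I = integral ?C (\<lambda>u. F u * cnj (F u))"
  have cc: "measure lborel ?C = 1"
  proof -
    have "0 \<in> ?C" by (simp add: mem_box_cart)
    then have "?C \<noteq> {}" by blast
    then show ?thesis by (simp add: content_cbox_cart)
  qed
  have "norm I \<le> e" if e: "e > 0" for e
  proof -
    \<comment> \<open>The accuracy e / B compensates the factor |F| \<le> B in the estimate of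
      \<open>I\<close>.\<close>
    obtain P where P: "trig_poly P" "\<And>u. norm (F u - P u) < e / B"
      using periodic_trig_poly_approx[OF cont per, of "e / B"] e B by (metis divide_pos_pos)
    have int: "(\<lambda>u. F u * cnj (F u)) integrable_on ?C" "(\<lambda>u. F u * cnj (P u)) integrable_on ?C"
      by (intro integrable_continuous continuous_intros contS trig_poly_continuous P)+
    have "I = integral ?C (\<lambda>u. F u * cnj (F u)) - integral ?C (\<lambda>u. F u * cnj (P u))"
      using orth[OF trig_poly_cnj[OF P(1)]] by (simp add: I_def)
    also have "\<dots> = integral ?C (\<lambda>u. F u * cnj (F u) - F u * cnj (P u))"
      using int by (simp add: Henstock_Kurzweil_Integration.integral_diff)
    finally have "((\<lambda>u. F u * cnj (F u) - F u * cnj (P u)) has_integral I) ?C"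
      using int by (simp add: integrable_diff has_integral_iff)
    then have "norm I \<le> (B * (e / B)) * measure lborel ?C"
    proof (rule has_integral_bound[rotated])
      fix u assume u: "u \<in> ?C"
      have "norm (F u * cnj (F u) - F u * cnj (P u)) = norm (F u) * norm (F u - P u)"
        by (metis complex_cnj_diff complex_mod_cnj norm_mult right_diff_distrib)
      also have "\<dots> \<le> B * (e / B)" using B(2)[OF u] P(2)[of u] B(1) by (intro mult_mono) auto
      finally show "norm (F u * cnj (F u) - F u * cnj (P u)) \<le> B * (e / B)" .
    qed (use B e in auto)
    then show ?thesis using B(1) cc by simp
  qed
  then have "I = 0" by (metis field_le_epsilon add_0 norm_le_zero_iff)
  have FF: "F u * cnj (F u) = of_real ((norm (F u))\<^sup>2)" for u
    by (rule complex_norm_square[symmetric])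
  have "((\<lambda>u. complex_of_real ((norm (F u))\<^sup>2)) has_integral 0) ?C"
  proof -
    have "(\<lambda>u. F u * cnj (F u)) integrable_on ?C"
      by (intro integrable_continuous continuous_intros contS)
    then have "((\<lambda>u. F u * cnj (F u)) has_integral 0) ?C"
      using \<open>I = 0\<close> unfolding I_def by (metis integrable_integral)
    then show ?thesis unfolding FF .
  qed
  from has_integral_linear[OF this bounded_linear_Re]
  have hi: "((\<lambda>u. (norm (F u))\<^sup>2) has_integral 0) ?C" by (simp add: o_def)
  have F0: "F v = 0" if "v \<in> ?C" for v
  proof -
    have "(\<chi> j. 1 / 2) \<in> box 0 (1::real^'n)" by (simp add: mem_box_cart)
    then have ne: "box 0 (1::real^'n) \<noteq> {}" by blast
    have "(norm (F v))\<^sup>2 = 0"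
      by (rule has_integral_0_cbox_imp_0[OF _ _ hi ne that]) (auto intro!: continuous_intros contS)
    then show ?thesis by simp
  qed
  define v where "v = (\<chi> j. frac (u $ j))"
  have "F u = F v"
  proof (rule periodic_int_vecs_eq[OF per])
    show "ephase (u $ j) = ephase (v $ j)" for j by (simp add: ephase_eq_iff v_def frac_def)
  qed
  moreover have "v \<in> ?C" by (auto simp: v_def mem_box_cart frac_lt_1 less_imp_le)
  ultimately show ?thesis using F0 by simp
qed

section \<open>Poisson summation by unfolding over the unit cube\<close>

lemma gauss_decay:
  fixes r c a :: real
  assumes "c > 0" "a \<ge> 0" "r \<ge> 0"
  shows "exp (- c * r\<^sup>2) \<le> exp (a\<^sup>2 / (4 * c)) * (1 + r) powr (- a)"
proof -
  have "ln (1 + r) \<le> r" using assms by (intro ln_add_one_self_le_self) auto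
  then have "a * ln (1 + r) \<le> a * r" using assms by (intro mult_left_mono)
  \<comment> \<open>Completing the square in r produces the constant of the statement.\<close>
  also have "a * r \<le> a\<^sup>2 / (4 * c) + c * r\<^sup>2"
  proof -
    have "0 \<le> (a - 2 * c * r)\<^sup>2 / (4 * c)" using assms by simp
    also have "\<dots> = a\<^sup>2 / (4 * c) + c * r\<^sup>2 - a * r"
      using assms by (simp add: power2_eq_square field_simps)
    finally show ?thesis by simp
  qed
  finally have "- c * r\<^sup>2 \<le> a\<^sup>2 / (4 * c) + (- a) * ln (1 + r)" by simp
  then have "exp (- c * r\<^sup>2) \<le> exp (a\<^sup>2 / (4 * c) + (- a) * ln (1 + r))" by simp
  also have "\<dots> = exp (a\<^sup>2 / (4 * c)) * (1 + r) powr (- a)"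
    unfolding exp_add using assms by (simp add: powr_def)
  finally show ?thesis .
qed

text \<open>Half-open, so that the integer translates tile space and their indicators add up to 1 at
  every point. The faces by which it differs from the closed cube are negligible.\<close>

definition half_open_cube :: "(real^'n) set" where
  "half_open_cube = {u. \<forall>j. 0 \<le> u $ j \<and> u $ j < 1}"

lemma half_open_cube_subset: "half_open_cube \<subseteq> cbox 0 1"
  by (auto simp: half_open_cube_def mem_box_cart less_imp_le)

lemma half_open_cube_borel [measurable]: "half_open_cube \<in> sets borel"
proof -
  have "half_open_cube = (\<Inter>j. {u::real^'n. 0 \<le> u $ j} \<inter> {u. u $ j < 1})"
    by (auto simp: half_open_cube_def)
  also have "\<dots> \<in> sets borel"
    by (intro sets.countable_INT'' sets.Int borel_closed borel_open closed_Collect_le open_Collect_less continuous_intros) auto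
  finally show ?thesis .
qed

lemma integral_half_open_cube:
  fixes f :: "real^'n \<Rightarrow> 'b::euclidean_space"
  shows "integral half_open_cube f = integral (cbox 0 1) f"
proof (rule integral_spike_set)
  have neg: "negligible {u \<in> cbox 0 1 - half_open_cube. f u \<noteq> 0}"
  proof (rule negligible_subset)
    show "negligible (\<Union>j. {u::real^'n. u $ j = 1})"
    proof (rule negligible_Union, simp)
      fix S assume "S \<in> range (\<lambda>j. {u::real^'n. u $ j = 1})"
      then obtain j where "S = {u. u \<bullet> axis j 1 = 1}" by (auto simp: inner_axis)
      then show "negligible S" using negligible_standard_hyperplane[of "axis j 1 :: real^'n" 1] by simp
    qed
    show "{u \<in> cbox 0 1 - half_open_cube. f u \<noteq> 0} \<subseteq> (\<Union>j. {u::real^'n. u $ j = 1})"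
      by (auto simp: half_open_cube_def mem_box_cart) (metis order_le_imp_less_or_eq)
  qed
  show "negligible {u \<in> cbox 0 1 - half_open_cube. f u \<noteq> 0}" by (rule neg)
  show "negligible {u \<in> half_open_cube - cbox 0 1. f u \<noteq> 0}"
    using half_open_cube_subset by (auto intro: negligible_subset[of "{}"])
qed

text \<open>The integral over a cell is written over all of space, so that summing the cells is an
  interchange of a sum with one fixed integral.\<close>

lemma cell_integral:
  fixes f :: "real^'n \<Rightarrow> 'b::euclidean_space"
  assumes "continuous_on UNIV f"
  shows "(\<lambda>v. indicator half_open_cube (v - m) *\<^sub>R f v) absolutely_integrable_on UNIV"
    and "integral UNIV (\<lambda>v. indicator half_open_cube (v - m) *\<^sub>R f v) = integral (cbox 0 1) (\<lambda>u. f (u + m))"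
proof -
  let ?g = "\<lambda>v. indicator half_open_cube (v - m) *\<^sub>R f v" and ?h = "\<lambda>u. indicator half_open_cube u *\<^sub>R f (u + m)"
  have c: "continuous_on UNIV (\<lambda>u. f (u + m))"
    using assms by (intro continuous_on_compose2[OF assms] continuous_intros) auto
  have "integrable lborel (\<lambda>u. indicator (cbox 0 1) u *\<^sub>R f (u + m))"
    by (intro borel_integrable_compact compact_cbox continuous_on_subset[OF c]) auto
  then have "integrable lborel (\<lambda>u. indicator half_open_cube u *\<^sub>R (indicator (cbox 0 1) u *\<^sub>R f (u + m)))"
    by (rule integrable_mult_indicator[rotated]) simp
  moreover have "(\<lambda>u. indicator half_open_cube u *\<^sub>R (indicator (cbox 0 1) u *\<^sub>R f (u + m))) = ?h"
    using half_open_cube_subset by (auto simp: fun_eq_iff indicator_def)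
  ultimately have hi: "integrable lborel ?h" by simp
  have fm: "f \<in> borel_measurable borel" using assms by (rule borel_measurable_continuous_onI)
  have cube: "(\<lambda>v. indicator half_open_cube (v - m) :: real) \<in> borel_measurable borel"
    by measurable
  have gm: "?g \<in> borel_measurable borel" using fm cube by (intro borel_measurable_scaleR)
  have tr: "(+) m \<in> measurable lborel borel" by simp
  have gh: "?g (m + u) = ?h u" for u by (simp add: add.commute)
  have gi: "integrable lborel ?g"
    using hi gm tr by (subst lborel_distr_plus[symmetric, of m], subst integrable_distr_eq) (simp_all add: gh add.commute[of m])
  then have "integrable lebesgue ?g" using gm by (subst integrable_completion) auto
  then show "?g absolutely_integrable_on UNIV" by (simp add: set_integrable_def)
  have "integral UNIV ?g = integral\<^sup>L lborel ?g" by (rule integral_lborel[OF gi])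
  also have "\<dots> = integral\<^sup>L lborel ?h"
    using gm tr by (subst lborel_distr_plus[symmetric, of m], subst integral_distr) (simp_all add: gh add.commute[of m])
  also have "\<dots> = integral UNIV ?h" by (rule integral_lborel[OF hi, symmetric])
  also have "?h = (\<lambda>u. if u \<in> half_open_cube then f (u + m) else 0)"
    by (auto simp: fun_eq_iff indicator_def)
  also have "integral UNIV \<dots> = integral half_open_cube (\<lambda>u. f (u + m))"
    by (rule Henstock_Kurzweil_Integration.integral_restrict_UNIV)
  also have "\<dots> = integral (cbox 0 1) (\<lambda>u. f (u + m))" by (rule integral_half_open_cube)
  finally show "integral UNIV ?g = integral (cbox 0 1) (\<lambda>u. f (u + m))" .
qed

lemma measure_unit_cube: "measure lborel (cbox 0 1 :: (real^'n) set) = 1"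
proof -
  have "0 \<in> cbox 0 (1 :: real^'n)" by (simp add: mem_box_cart)
  then have "cbox 0 (1 :: real^'n) \<noteq> {}" by blast
  then show ?thesis by (simp add: content_cbox_cart)
qed

lemma integral_unit_cube_bound:
  fixes f :: "real^'n \<Rightarrow> 'b::euclidean_space"
  assumes "continuous_on (cbox 0 1) f" "B \<ge> 0" "\<And>u. u \<in> cbox 0 1 \<Longrightarrow> norm (f u) \<le> B"
  shows "norm (integral (cbox 0 1) f) \<le> B"
  using has_integral_bound[OF assms(2) integrable_integral[OF integrable_continuous[OF assms(1)]] assms(3)]
  by (simp add: measure_unit_cube)

lemma unit_cube_norm_bound: "u \<in> cbox 0 (1::real^'n) \<Longrightarrow> norm u \<le> real CARD('n)"
proof -
  assume u: "u \<in> cbox 0 1"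
  have "norm u \<le> (\<Sum>j\<in>UNIV. \<bar>u $ j\<bar>)" by (rule norm_le_l1_cart)
  also have "\<dots> \<le> (\<Sum>j\<in>(UNIV::'n set). 1)" using u by (intro sum_mono) (auto simp: mem_box_cart)
  finally show ?thesis by simp
qed

text \<open>For k \<noteq> 0 the integral factorizes over the coordinates, and some factor is the
  integral of a nonconstant character over full periods.\<close>

lemma ephase_orthogonal:
  fixes k :: "real^'n"
  assumes "k \<in> int_vecs"
  shows "integral (cbox 0 1) (\<lambda>u. ephase (k \<bullet> u)) = (if k = 0 then 1 else 0)"
proof (cases "k = 0")
  case True
  then show ?thesis by (simp add: measure_unit_cube)
next
  case False
  define g where "g b s = (indicator {0..1} s *\<^sub>R ephase ((k \<bullet> b) * s) :: complex)" for b :: "real^'n" and s :: real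
  have gi: "integrable lborel (g b)" for b
    unfolding g_def[abs_def] by (intro borel_integrable_compact continuous_intros) auto
  have gv: "integral\<^sup>L lborel (g b) = integral {0..1} (\<lambda>s. ephase ((k \<bullet> b) * s))" for b
  proof -
    have "integral\<^sup>L lborel (g b) = integral UNIV (g b)" by (rule integral_lborel[OF gi, symmetric])
    also have "\<dots> = integral UNIV (\<lambda>s. if s \<in> {0..1} then ephase ((k \<bullet> b) * s) else 0)"
      by (rule arg_cong[where f="integral UNIV"]) (auto simp: g_def fun_eq_iff indicator_def)
    also have "\<dots> = integral {0..1} (\<lambda>s. ephase ((k \<bullet> b) * s))"
      by (rule Henstock_Kurzweil_Integration.integral_restrict_UNIV)
    finally show ?thesis .
  qed
  obtain j where j: "k $ j \<noteq> 0" using False by (auto simp: vec_eq_iff)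
  have g0: "integral {0..1} (\<lambda>s. ephase (k $ j * s)) = 0"
  proof -
    let ?c = "2 * of_real pi * \<i> * of_real (k $ j) :: complex"
    have "((\<lambda>s. ephase (k $ j * s)) has_integral (ephase (k $ j * 1) / ?c - ephase (k $ j * 0) / ?c)) {0..1}"
    proof (rule fundamental_theorem_of_calculus)
      fix x :: real
      have c0: "?c \<noteq> 0" using j by simp
      have "((\<lambda>z. exp (?c * z) / ?c) has_field_derivative exp (?c * of_real x)) (at (of_real x))"
        using c0 by (auto intro!: derivative_eq_intros)
      from has_vector_derivative_real_field[OF this, of "{0..1}"]
      show "((\<lambda>s. ephase (k $ j * s) / ?c) has_vector_derivative ephase (k $ j * x)) (at x within {0..1})"
        by (simp add: ephase_def mult_ac)
    qed simp
    moreover have "ephase (k $ j * 1) = 1" using assms by (simp add: int_vecs_def)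
    ultimately show ?thesis by (simp add: integral_unique)
  qed
  have ind: "indicator (cbox 0 1) u *\<^sub>R ephase (k \<bullet> u) = (\<Prod>b\<in>Basis. g b (u \<bullet> b))" for u :: "real^'n"
  proof -
    have "(\<Prod>b\<in>Basis. g b (u \<bullet> b)) = (\<Prod>b\<in>Basis. indicator {0..1} (u \<bullet> b) *\<^sub>R ephase ((k \<bullet> b) * (u \<bullet> b)))"
      by (simp add: g_def)
    also have "\<dots> = of_real (\<Prod>b\<in>Basis. indicator {0..1} (u \<bullet> b)) * (\<Prod>b\<in>Basis. ephase ((k \<bullet> b) * (u \<bullet> b)))"
      by (simp add: scaleR_conv_of_real prod.distrib)
    also have "(\<Prod>b\<in>Basis. ephase ((k \<bullet> b) * (u \<bullet> b))) = ephase (k \<bullet> u)"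
      by (simp add: ephase_def exp_sum[symmetric] sum_distrib_left[symmetric] euclidean_inner[of k u] flip: of_real_sum of_real_mult)
    also have "(\<Prod>b\<in>Basis. indicator {0..1} (u \<bullet> b)) = (indicator (cbox 0 1) u :: real)"
    proof (cases "u \<in> cbox 0 1")
      case True
      then show ?thesis by (simp add: prod_Basis_vec inner_axis mem_box_cart indicator_def)
    next
      case False
      then obtain i where "\<not> (0 \<le> u $ i \<and> u $ i \<le> 1)" by (auto simp: mem_box_cart)
      then have "indicator {0..1} (u $ i) = (0::real)" unfolding indicator_def by auto
      then have "(\<Prod>i\<in>UNIV. indicator {0..1} (u $ i)) = (0::real)"
        by (intro prod_zero bexI[of _ i]) auto
      then show ?thesis using False by (simp add: prod_Basis_vec inner_axis)
    qed
    finally show ?thesis by (simp add: scaleR_conv_of_real)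
  qed
  have "integral (cbox 0 1) (\<lambda>u. ephase (k \<bullet> u)) = integral UNIV (\<lambda>u. if u \<in> cbox 0 1 then ephase (k \<bullet> u) else 0)"
    by (simp only: Henstock_Kurzweil_Integration.integral_restrict_UNIV)
  also have "(\<lambda>u. if u \<in> cbox 0 1 then ephase (k \<bullet> u) else 0) = (\<lambda>u. \<Prod>b\<in>Basis. g b (u \<bullet> b))"
    unfolding ind[symmetric] by (auto simp: fun_eq_iff indicator_def)
  also have "integral UNIV \<dots> = integral\<^sup>L lborel (\<lambda>u::real^'n. \<Prod>b\<in>Basis. g b (u \<bullet> b))"
    by (rule integral_lborel[OF lborel_prod_Basis(1)[OF gi]])
  also have "\<dots> = (\<Prod>b\<in>Basis. integral {0..1} (\<lambda>s. ephase ((k \<bullet> b) * s)))"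
    using lborel_prod_Basis(2)[OF gi] by (simp add: gv)
  also have "\<dots> = 0"
    unfolding prod_Basis_vec by (rule prod_zero) (use g0 in \<open>auto simp: inner_axis\<close>)
  finally show ?thesis using False by simp
qed

text \<open>Both sides are values at u = -A^(-1) x of continuous functions with integer periods: the
  periodization \<open>F\<close> of the Gaussian and the Fourier series \<open>G\<close>. Their
  Fourier coefficients agree, since unfolding turns those of \<open>F\<close> into a Fourier
  transform over all of space.\<close>

lemma lattice_theta_gauss:
  fixes A :: "real^'n^'n" and x y :: "real^'n"
  assumes A: "invertible A" and t: "t > 0"
  shows "(\<Sum>\<^sub>\<infinity>z\<in>lattice_of A. of_real (exp (- (pi * t * (norm (z - x))\<^sup>2))) * ephase (- (y \<bullet> (z - x))))
    = of_real (t powr (- real CARD('n) / 2) / \<bar>det A\<bar>)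
      * (\<Sum>\<^sub>\<infinity>q\<in>dual_lattice_of A. of_real (exp (- pi * (norm (q + y))\<^sup>2 / t)) * ephase (- (x \<bullet> q)))"
proof -
  define f where "f v = of_real (exp (- (pi * t * (norm v)\<^sup>2))) * ephase (- (y \<bullet> v))" for v :: "real^'n"
  define g where "g u = f (A *v u)" for u
  define F where "F u = (\<Sum>\<^sub>\<infinity>m\<in>int_vecs. g (u + m))" for u
  define A' where "A' = transpose (matrix_inv A)"
  define V where "V = \<bar>det A\<bar>"
  define c where "c k = complex_of_real (t powr (- real CARD('n) / 2) / V * exp (- pi * (norm (A' *v k + y))\<^sup>2 / t))" for k
  define G where "G u = (\<Sum>\<^sub>\<infinity>k\<in>int_vecs. c k * ephase (k \<bullet> u))" for u
  define \<tau> where "\<tau> = real CARD('n) + 1"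
  have \<tau>: "\<tau> > real CARD('n)" "\<tau> \<ge> 0" by (auto simp: \<tau>_def)
  have A': "invertible A'" unfolding A'_def by (rule dual_lattice_invertible[OF A])
  have mvc: "continuous_on S (\<lambda>u. A *v h u)" if "continuous_on S h" for S :: "(real^'n) set" and h
    using that by (intro bounded_linear.continuous_on[OF matrix_vector_mul_bounded_linear])
  have fc: "continuous_on UNIV f" unfolding f_def by (intro continuous_intros)
  have gc: "continuous_on UNIV g"
    unfolding g_def by (intro continuous_on_compose2[OF fc] mvc continuous_intros) auto
  have gmc: "continuous_on S (\<lambda>u. g (u + m))" for S m
    by (intro continuous_on_compose2[OF gc] continuous_intros) auto
  have nf: "norm (f v) = exp (- (pi * t) * (norm v)\<^sup>2)" for v by (simp add: f_def norm_mult)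
  obtain K where K: "K \<ge> 1" "\<And>m. norm m \<le> K * norm (A *v m)" using invertible_norm_bound[OF A] by blast
  define C where "C = exp (\<tau>\<^sup>2 / (4 * (pi * t / K\<^sup>2)))"
  have ng: "norm (g v) \<le> C * (1 + norm v) powr (- \<tau>)" for v
  proof -
    have "(norm v)\<^sup>2 \<le> (K * norm (A *v v))\<^sup>2" using K(2)[of v] by (intro power_mono) auto
    then have "(norm v)\<^sup>2 / K\<^sup>2 \<le> (norm (A *v v))\<^sup>2" using K(1) by (simp add: power_mult_distrib field_simps)
    then have "pi * t * ((norm v)\<^sup>2 / K\<^sup>2) \<le> pi * t * (norm (A *v v))\<^sup>2" using t by (intro mult_left_mono) auto
    then have "norm (g v) \<le> exp (- (pi * t / K\<^sup>2) * (norm v)\<^sup>2)" unfolding g_def nf by simp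
    also have "\<dots> \<le> C * (1 + norm v) powr (- \<tau>)"
      unfolding C_def using K(1) t \<tau> by (intro gauss_decay) auto
    finally show ?thesis .
  qed
  \<comment> \<open>A majorant for |u| \<le> R only, because the cost of shifting by u grows with R;
    continuity is a local matter, so this suffices.\<close>
  define M where "M R m = C * ((1 + R) powr \<tau> * (1 + norm m) powr (- \<tau>))" for R and m :: "real^'n"
  have Msum: "M R summable_on int_vecs" for R
    unfolding M_def[abs_def] by (intro summable_on_cmult_right summable_on_int_vecs_powr \<tau>)
  have C0: "C > 0" by (simp add: C_def)
  have gM: "norm (g (u + m)) \<le> M R m" if "norm u \<le> R" for u m R
  proof -
    have "norm (g (u + m)) \<le> C * (1 + norm (m + u)) powr (- \<tau>)" using ng[of "u + m"] by (simp add: add.commute)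
    also have "(1 + norm (m + u)) powr (- \<tau>) \<le> (1 + norm u) powr \<tau> * (1 + norm m) powr (- \<tau>)"
      by (rule shift_powr_bound[OF \<tau>(2)])
    also have "(1 + norm u) powr \<tau> \<le> (1 + R) powr \<tau>" using that \<tau> by (intro powr_mono2) auto
    finally show ?thesis using C0 unfolding M_def by (simp add: mult_left_mono mult_right_mono)
  qed
  have M0: "M R m \<ge> 0" for R m using C0 by (simp add: M_def)
  have Fcont: "continuous_on UNIV F"
  proof -
    have "continuous_on (ball 0 R) F" for R
      unfolding F_def
    proof (rule continuous_on_infsum[OF _ _ Msum])
      show "norm (g (u + m)) \<le> M R m" if "u \<in> ball 0 R" for u m using that by (intro gM) auto
    qed (rule gmc)
    then have "isCont F u" for u
      using continuous_on_eq_continuous_at[of "ball 0 (norm u + 1)" F] by auto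
    then show ?thesis by (simp add: continuous_on_eq_continuous_at)
  qed
  have Fper: "F (u + m0) = F u" if "m0 \<in> int_vecs" for u m0
  proof -
    have "bij_betw (\<lambda>m. m0 + m) int_vecs int_vecs"
      by (rule bij_betwI[where g="\<lambda>m. m - m0"]) (auto intro: int_vecs_add that int_vecs_diff)
    from infsum_reindex_bij_betw[OF this, of "\<lambda>m. g (u + m)"]
    show ?thesis by (simp add: F_def add.assoc)
  qed
  have csum: "(\<lambda>k. norm (c k)) summable_on int_vecs"
  proof -
    obtain K' where K': "K' \<ge> 1" "\<And>m. norm m \<le> K' * norm (A' *v m)" using invertible_norm_bound[OF A'] by blast
    define B where "B = t powr (- real CARD('n) / 2) / V"
    have B0: "B \<ge> 0" by (simp add: B_def V_def)
    define C' where "C' = exp (\<tau>\<^sup>2 / (4 * (pi / t)))"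
    have "(\<lambda>q. (1 + norm (q + y)) powr (- \<tau>)) summable_on lattice_of A'"
      by (intro summable_on_shifted_lattice_powr A' \<tau>)
    then have "(\<lambda>k. (1 + norm (A' *v k + y)) powr (- \<tau>)) summable_on int_vecs"
      unfolding lattice_of_eq using inj_matrix_vector_mult[OF A']
      by (subst (asm) summable_on_reindex) (auto simp: o_def inj_on_def)
    then have "(\<lambda>k. B * C' * (1 + norm (A' *v k + y)) powr (- \<tau>)) summable_on int_vecs"
      by (rule summable_on_cmult_right)
    then show ?thesis
    proof (rule summable_on_comparison_test)
      fix k
      have "exp (- (pi / t) * (norm (A' *v k + y))\<^sup>2) \<le> C' * (1 + norm (A' *v k + y)) powr (- \<tau>)"
        unfolding C'_def using t \<tau> by (intro gauss_decay) auto
      then have "B * exp (- (pi / t) * (norm (A' *v k + y))\<^sup>2) \<le> B * (C' * (1 + norm (A' *v k + y)) powr (- \<tau>))"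
        using B0 by (rule mult_left_mono)
      moreover have "norm (c k) = B * exp (- (pi / t) * (norm (A' *v k + y))\<^sup>2)"
        unfolding c_def B_def[symmetric] norm_of_real by (simp add: abs_mult B0)
      ultimately show "norm (c k) \<le> B * C' * (1 + norm (A' *v k + y)) powr (- \<tau>)" by (simp add: mult.assoc)
    qed simp
  qed
  have Gcont: "continuous_on UNIV G"
    unfolding G_def by (rule continuous_on_infsum[OF _ _ csum]) (auto intro!: continuous_intros simp: norm_mult)
  have Gsum: "(\<lambda>k. c k * ephase (k \<bullet> u)) summable_on int_vecs" for u
    by (rule summable_on_norm_bound[OF csum]) (simp add: norm_mult)
  have Gper: "G (u + m0) = G u" if "m0 \<in> int_vecs" for u m0
    unfolding G_def by (rule infsum_cong) (use that in \<open>simp add: inner_add_right ephase_add int_vecs_inner\<close>)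
  have cint: "countable (int_vecs :: (real^'n) set)"
    using countable_lattice[of "mat 1 :: real^'n^'n"] by (simp add: lattice_of_eq)
  have eint: "(\<lambda>u. h u) absolutely_integrable_on cbox 0 1" if "continuous_on UNIV h" for h :: "real^'n \<Rightarrow> complex"
    using that by (intro absolutely_integrable_continuous continuous_on_subset[OF that]) auto
  have Gcoef: "integral (cbox 0 1) (\<lambda>u. G u * ephase (l \<bullet> u)) = c (- l)" if l: "l \<in> int_vecs" for l
  proof -
    have "((\<lambda>k. integral (cbox 0 1) (\<lambda>u. c k * ephase (k \<bullet> u) * ephase (l \<bullet> u))) has_sum integral (cbox 0 1) (\<lambda>u. G u * ephase (l \<bullet> u))) int_vecs"
    proof (rule has_sum_integral_swap(2)[OF cint])
      show "(\<lambda>u. c k * ephase (k \<bullet> u) * ephase (l \<bullet> u)) absolutely_integrable_on cbox 0 1" for k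
        by (intro eint continuous_intros)
      have "integral (cbox 0 1) (\<lambda>u::real^'n. norm (c k * ephase (k \<bullet> u) * ephase (l \<bullet> u))) = norm (c k)" for k
        by (simp add: norm_mult measure_unit_cube)
      then show "(\<lambda>k. integral (cbox 0 1) (\<lambda>u::real^'n. norm (c k * ephase (k \<bullet> u) * ephase (l \<bullet> u)))) summable_on int_vecs"
        using csum by simp
      show "((\<lambda>k. c k * ephase (k \<bullet> u) * ephase (l \<bullet> u)) has_sum G u * ephase (l \<bullet> u)) int_vecs" for u
        unfolding G_def by (intro has_sum_cmult_left has_sum_infsum Gsum)
    qed simp
    moreover have "integral (cbox 0 1) (\<lambda>u. c k * ephase (k \<bullet> u) * ephase (l \<bullet> u)) = (if k = - l then c (- l) else 0)" if "k \<in> int_vecs" for k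
    proof -
      have "(\<lambda>u. c k * ephase (k \<bullet> u) * ephase (l \<bullet> u)) = (\<lambda>u. c k * ephase ((k + l) \<bullet> u))"
        by (simp add: fun_eq_iff inner_add_left ephase_add)
      then have "integral (cbox 0 1) (\<lambda>u. c k * ephase (k \<bullet> u) * ephase (l \<bullet> u)) = c k * (if k + l = 0 then 1 else 0)"
        using ephase_orthogonal[OF int_vecs_add[OF that l]] by simp
      moreover have "k + l = 0 \<longleftrightarrow> k = - l" by (simp add: eq_neg_iff_add_eq_0)
      ultimately show ?thesis by auto
    qed
    ultimately have "((\<lambda>k. if k = - l then c (- l) else 0) has_sum integral (cbox 0 1) (\<lambda>u. G u * ephase (l \<bullet> u))) int_vecs"
      by (simp cong: has_sum_cong)
    moreover have "((\<lambda>k. if k = - l then c (- l) else 0) has_sum c (- l)) int_vecs"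
      by (rule has_sum_finite_neutralI[of "{- l}"]) (auto intro: int_vecs_uminus[OF l])
    ultimately show ?thesis by (rule has_sum_unique)
  qed
  have Fcoef: "integral (cbox 0 1) (\<lambda>u. F u * ephase (l \<bullet> u)) = c (- l)" if l: "l \<in> int_vecs" for l
  proof -
    define h where "h v = g v * ephase (l \<bullet> v)" for v
    have hc: "continuous_on UNIV h" unfolding h_def by (intro continuous_intros gc)
    have hcm: "continuous_on S (\<lambda>u. h (u + m))" for S m
      by (intro continuous_on_compose2[OF hc] continuous_intros) auto
    have hg: "h (u + m) = g (u + m) * ephase (l \<bullet> u)" if "m \<in> int_vecs" for u m
      using that l by (simp add: h_def inner_add_right ephase_add int_vecs_inner)
    have nh: "norm (h v) = norm (g v)" for v by (simp add: h_def norm_mult)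
    let ?R = "real CARD('n)"
    have hM: "norm (integral (cbox 0 1) (\<lambda>u. norm (h (u + m)))) \<le> M ?R m" for m
      by (rule integral_unit_cube_bound[OF _ M0]) (auto intro!: continuous_intros hcm gmc simp: nh gM unit_cube_norm_bound)
    have "((\<lambda>m. integral (cbox 0 1) (\<lambda>u. g (u + m) * ephase (l \<bullet> u))) has_sum integral (cbox 0 1) (\<lambda>u. F u * ephase (l \<bullet> u))) int_vecs"
    proof (rule has_sum_integral_swap(2)[OF cint])
      show "(\<lambda>u. g (u + m) * ephase (l \<bullet> u)) absolutely_integrable_on cbox 0 1" for m
        by (intro eint continuous_intros gmc)
      have "(\<lambda>m. integral (cbox 0 1) (\<lambda>u. norm (h (u + m)))) summable_on int_vecs"
        by (rule summable_on_norm_bound[OF Msum[of ?R]]) (rule hM)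
      then show "(\<lambda>m. integral (cbox 0 1) (\<lambda>u. norm (g (u + m) * ephase (l \<bullet> u)))) summable_on int_vecs"
        by (simp add: norm_mult nh)
      have "(\<lambda>m. g (u + m)) summable_on int_vecs" for u
        by (rule summable_on_norm_bound[OF Msum[of "norm u"]]) (rule gM, simp)
      then show "((\<lambda>m. g (u + m) * ephase (l \<bullet> u)) has_sum F u * ephase (l \<bullet> u)) int_vecs" for u
        unfolding F_def by (intro has_sum_cmult_left has_sum_infsum)
    qed simp
    then have 1: "((\<lambda>m. integral (cbox 0 1) (\<lambda>u. h (u + m))) has_sum integral (cbox 0 1) (\<lambda>u. F u * ephase (l \<bullet> u))) int_vecs"
      by (simp add: hg cong: has_sum_cong)
    \<comment> \<open>Tiling: at every v exactly one cell contributes, so the cell integrals sum to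
      the integral of \<open>h\<close> over all of space.\<close>
    have 2: "((\<lambda>m. integral UNIV (\<lambda>v. indicator half_open_cube (v - m) *\<^sub>R h v)) has_sum integral UNIV h) int_vecs"
    proof (rule has_sum_integral_swap(2)[OF cint])
      show "(\<lambda>v. indicator half_open_cube (v - m) *\<^sub>R h v) absolutely_integrable_on UNIV" for m
        by (rule cell_integral(1)[OF hc])
      have "integral UNIV (\<lambda>v. norm (indicator half_open_cube (v - m) *\<^sub>R h v)) = integral (cbox 0 1) (\<lambda>u. norm (h (u + m)))" for m
        using cell_integral(2)[of "\<lambda>v. norm (h v)" m] hc by (simp add: continuous_on_norm indicator_def)
      moreover have "(\<lambda>m. integral (cbox 0 1) (\<lambda>u. norm (h (u + m)))) summable_on int_vecs"
        by (rule summable_on_norm_bound[OF Msum[of ?R]]) (rule hM)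
      ultimately show "(\<lambda>m. integral UNIV (\<lambda>v. norm (indicator half_open_cube (v - m) *\<^sub>R h v))) summable_on int_vecs" by simp
      fix v :: "real^'n"
      define m0 where "m0 = (\<chi> j. real_of_int \<lfloor>v $ j\<rfloor>)"
      have m0: "m0 \<in> int_vecs" by (simp add: m0_def int_vecs_def)
      have iff: "v - m \<in> half_open_cube \<longleftrightarrow> m = m0" if mi: "m \<in> int_vecs" for m
      proof
        assume a: "v - m \<in> half_open_cube"
        have "m $ j = of_int \<lfloor>v $ j\<rfloor>" for j
        proof -
          obtain q where q: "m $ j = of_int q" using mi unfolding int_vecs_def by (blast elim: Ints_cases)
          have "0 \<le> v $ j - m $ j" "v $ j - m $ j < 1" using a by (auto simp: half_open_cube_def)
          then have "\<lfloor>v $ j\<rfloor> = q" unfolding q by linarith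
          then show ?thesis by (simp add: q)
        qed
        then show "m = m0" by (simp add: m0_def vec_eq_iff)
      next
        assume "m = m0"
        then show "v - m \<in> half_open_cube"
          by (auto simp: half_open_cube_def m0_def) linarith
      qed
      show "((\<lambda>m. indicator half_open_cube (v - m) *\<^sub>R h v) has_sum h v) int_vecs"
        by (rule has_sum_finite_neutralI[of "{m0}"]) (auto simp: m0 iff indicator_def)
    qed simp
    have "((\<lambda>m. integral (cbox 0 1) (\<lambda>u. h (u + m))) has_sum integral UNIV h) int_vecs"
      using 2 by (simp add: cell_integral(2)[OF hc])
    from has_sum_unique[OF 1 this] have FI: "integral (cbox 0 1) (\<lambda>u. F u * ephase (l \<bullet> u)) = integral UNIV h" .
    \<comment> \<open>Under v = A u the frequency l turns into A^(-T) l, so the coefficient is the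
      Fourier transform of the Gaussian at y - A^(-T) l.\<close>
    define p where "p = y + A' *v (- l)"
    define \<phi> where "\<phi> v = (exp (of_real (- (pi * t * (norm v)\<^sup>2)) - 2 * of_real pi * \<i> * of_real (p \<bullet> v)) :: complex)" for v :: "real^'n"
    have h\<phi>: "h u = \<phi> (A *v u)" for u
    proof -
      have "(A' *v l) \<bullet> (A *v u) = l \<bullet> (matrix_inv A *v (A *v u))"
        unfolding A'_def by (metis dot_lmul_matrix transpose_matrix_vector)
      also have "\<dots> = l \<bullet> u" using matrix_inv(2)[OF A] by (simp add: matrix_vector_mul_assoc)
      finally have "l \<bullet> u - y \<bullet> (A *v u) = - (p \<bullet> (A *v u))"
        by (simp add: p_def inner_add_left inner_diff_left linear_neg[OF matrix_vector_mul_linear])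
      then have "ephase (- (y \<bullet> (A *v u))) * ephase (l \<bullet> u) = ephase (- (p \<bullet> (A *v u)))"
        unfolding ephase_add[symmetric] by simp
      then have "h u = of_real (exp (- (pi * t * (norm (A *v u))\<^sup>2))) * ephase (- (p \<bullet> (A *v u)))"
        unfolding h_def g_def f_def by (simp add: mult.assoc)
      also have "\<dots> = \<phi> (A *v u)"
        unfolding \<phi>_def ephase_def exp_of_real[symmetric] exp_add[symmetric] by simp
      finally show ?thesis .
    qed
    then have h\<phi>': "h = (\<lambda>u. \<phi> (A *v u))" by blast
    have \<phi>i: "integrable lborel \<phi>" "integral\<^sup>L lborel \<phi> = of_real (t powr (- real DIM(real^'n) / 2) * exp (- pi * (norm p)\<^sup>2 / t))"
      unfolding \<phi>_def[abs_def] by (rule gauss_fourier[OF t])+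
    have \<phi>m: "\<phi> \<in> borel_measurable borel" using \<phi>i(1) by (simp add: borel_measurable_integrable[of lborel, simplified])
    have hi: "integrable lborel h" using lborel_integral_linear(2)[OF A \<phi>m] \<phi>i(1) by (simp add: h\<phi>')
    have "integral UNIV h = integral\<^sup>L lborel h" by (rule integral_lborel[OF hi])
    also have "\<dots> = integral\<^sup>L lborel \<phi> / of_real \<bar>det A\<bar>" using lborel_integral_linear(1)[OF A \<phi>m] by (simp add: h\<phi>')
    also have "\<dots> = c (- l)"
      unfolding \<phi>i(2) c_def V_def p_def by (simp add: add.commute)
    finally show ?thesis using FI by simp
  qed
  have FG: "F u = G u" for u
  proof -
    have "F u - G u = 0"
    proof (rule fourier_uniqueness[of "\<lambda>u. F u - G u"])
      show "continuous_on UNIV (\<lambda>u. F u - G u)" by (intro continuous_intros Fcont Gcont)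
      show "F (u + m) - G (u + m) = F u - G u" if "m \<in> int_vecs" for u m using that by (simp add: Fper Gper)
      fix k :: "real^'n" assume k: "k \<in> int_vecs"
      have "(\<lambda>u. F u * ephase (k \<bullet> u)) integrable_on cbox 0 1" "(\<lambda>u. G u * ephase (k \<bullet> u)) integrable_on cbox 0 1"
        by (intro integrable_continuous continuous_intros continuous_on_subset[OF Fcont] continuous_on_subset[OF Gcont]; simp)+
      then show "integral (cbox 0 1) (\<lambda>u. (F u - G u) * ephase (k \<bullet> u)) = 0"
        using Fcoef[OF k] Gcoef[OF k] by (simp add: left_diff_distrib Henstock_Kurzweil_Integration.integral_diff)
    qed
    then show ?thesis by simp
  qed
  define u0 where "u0 = - (matrix_inv A *v x)"
  have Au0: "A *v u0 = - x"
    using matrix_inv(1)[OF A] by (simp add: u0_def matrix_vector_mul_assoc linear_neg[OF matrix_vector_mul_linear])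
  have ku0: "k \<bullet> u0 = - (x \<bullet> (A' *v k))" for k
  proof -
    have "(A' *v k) \<bullet> x = k \<bullet> (matrix_inv A *v x)"
      unfolding A'_def by (metis dot_lmul_matrix transpose_matrix_vector)
    then show ?thesis by (simp add: u0_def inner_commute)
  qed
  have "F u0 = (\<Sum>\<^sub>\<infinity>m\<in>int_vecs. f (A *v m - x))"
    unfolding F_def g_def by (simp add: matrix_vector_right_distrib Au0)
  also have "\<dots> = (\<Sum>\<^sub>\<infinity>z\<in>lattice_of A. f (z - x))"
    unfolding lattice_of_eq using inj_matrix_vector_mult[OF A]
    by (subst infsum_reindex) (auto simp: o_def inj_on_def)
  finally have 1: "F u0 = (\<Sum>\<^sub>\<infinity>z\<in>lattice_of A. f (z - x))" .
  have "G u0 = (\<Sum>\<^sub>\<infinity>k\<in>int_vecs. of_real (t powr (- real CARD('n) / 2) / V) * (of_real (exp (- pi * (norm (A' *v k + y))\<^sup>2 / t)) * ephase (- (x \<bullet> (A' *v k)))))"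
    unfolding G_def c_def ku0 by (simp add: mult.assoc)
  also have "\<dots> = of_real (t powr (- real CARD('n) / 2) / V) * (\<Sum>\<^sub>\<infinity>k\<in>int_vecs. of_real (exp (- pi * (norm (A' *v k + y))\<^sup>2 / t)) * ephase (- (x \<bullet> (A' *v k))))"
    by (rule infsum_cmult_right')
  also have "(\<Sum>\<^sub>\<infinity>k\<in>int_vecs. of_real (exp (- pi * (norm (A' *v k + y))\<^sup>2 / t)) * ephase (- (x \<bullet> (A' *v k))))
     = (\<Sum>\<^sub>\<infinity>q\<in>dual_lattice_of A. of_real (exp (- pi * (norm (q + y))\<^sup>2 / t)) * ephase (- (x \<bullet> q)))"
    unfolding dual_lattice_of_def A'_def[symmetric] lattice_of_eq using inj_matrix_vector_mult[OF A']
    by (subst infsum_reindex) (auto simp: o_def inj_on_def)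
  finally show ?thesis
    using FG[of u0] 1 by (simp add: f_def V_def)
qed

section \<open>Hecke's identity\<close>

lemma polynomial_growth:
  fixes p :: "real^'n \<Rightarrow> real"
  assumes "real_polynomial_function p"
  shows "\<exists>C\<ge>0. \<exists>N::nat. \<forall>v. \<bar>p v\<bar> \<le> C * (1 + norm v) ^ N"
  using assms
proof induction
  case (linear f)
  then obtain K where K: "\<And>v. norm (f v) \<le> norm v * K" "K > 0" using bounded_linear.pos_bounded by blast
  have "\<bar>f v\<bar> \<le> K * (1 + norm v) ^ 1" for v using K(1)[of v] K(2) by (simp add: algebra_simps)
  then show ?case using K(2) by (intro exI[of _ K] conjI exI[of _ 1]) auto
next
  case (const c)
  then show ?case by (intro exI[of _ "\<bar>c\<bar>"] conjI exI[of _ 0]) auto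
next
  case (add f g)
  then obtain C N C' N' where *: "C \<ge> 0" "\<And>v. \<bar>f v\<bar> \<le> C * (1 + norm v) ^ N" "C' \<ge> 0" "\<And>v. \<bar>g v\<bar> \<le> C' * (1 + norm v) ^ N'"
    by metis
  have "\<bar>f v + g v\<bar> \<le> (C + C') * (1 + norm v) ^ (max N N')" for v
  proof -
    have "C * (1 + norm v) ^ N \<le> C * (1 + norm v) ^ (max N N')" "C' * (1 + norm v) ^ N' \<le> C' * (1 + norm v) ^ (max N N')"
      using * by (intro mult_left_mono power_increasing; simp)+
    then show ?thesis using *(2)[of v] *(4)[of v] by (simp add: distrib_right)
  qed
  then show ?case using * by (intro exI[of _ "C + C'"] conjI exI[of _ "max N N'"]) auto
next
  case (mult f g)
  then obtain C N C' N' where *: "C \<ge> 0" "\<And>v. \<bar>f v\<bar> \<le> C * (1 + norm v) ^ N" "C' \<ge> 0" "\<And>v. \<bar>g v\<bar> \<le> C' * (1 + norm v) ^ N'"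
    by metis
  have "\<bar>f v * g v\<bar> \<le> (C * C') * (1 + norm v) ^ (N + N')" for v
  proof -
    have "\<bar>f v * g v\<bar> \<le> (C * (1 + norm v) ^ N) * (C' * (1 + norm v) ^ N')"
      unfolding abs_mult using * by (intro mult_mono) auto
    then show ?thesis by (simp add: power_add mult_ac)
  qed
  then show ?case using * by (intro exI[of _ "C * C'"] conjI exI[of _ "N + N'"]) auto
qed

lemma polynomial_gauss_decay:
  fixes p :: "real^'n \<Rightarrow> real"
  assumes "real_polynomial_function p" "c > 0" "\<tau> \<ge> 0"
  obtains C where "C \<ge> 0" "\<And>v. \<bar>p v\<bar> * exp (- c * (norm v)\<^sup>2) \<le> C * (1 + norm v) powr (- \<tau>)"
proof -
  obtain C N where C: "C \<ge> 0" "\<And>v. \<bar>p v\<bar> \<le> C * (1 + norm v) ^ N"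
    using polynomial_growth[OF assms(1)] by blast
  define a where "a = \<tau> + real N"
  have a: "a \<ge> 0" using assms by (simp add: a_def)
  define E where "E = exp (a\<^sup>2 / (4 * c))"
  show ?thesis
  proof (rule that[of "C * E"])
    show "C * E \<ge> 0" using C by (simp add: E_def)
    fix v :: "real^'n"
    have "exp (- c * (norm v)\<^sup>2) \<le> E * (1 + norm v) powr (- a)"
      unfolding E_def by (rule gauss_decay[OF assms(2) a]) simp
    then have "\<bar>p v\<bar> * exp (- c * (norm v)\<^sup>2) \<le> (C * (1 + norm v) ^ N) * (E * (1 + norm v) powr (- a))"
      using C by (intro mult_mono) auto
    also have "\<dots> = C * E * ((1 + norm v) powr (real N) * (1 + norm v) powr (- a))"
      by (subst powr_realpow) (auto simp: add_pos_nonneg mult_ac)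
    also have "\<dots> = C * E * (1 + norm v) powr (- \<tau>)"
      by (simp add: powr_add[symmetric] a_def)
    finally show "\<bar>p v\<bar> * exp (- c * (norm v)\<^sup>2) \<le> C * E * (1 + norm v) powr (- \<tau>)" .
  qed
qed

lemma summable_on_theta:
  fixes A :: "real^'n^'n"
  assumes "invertible A" "real_polynomial_function p" "c > 0"
  shows "(\<lambda>z. of_real (p (z + x) * exp (- c * (norm (z + x))\<^sup>2)) * ephase (\<phi> z)) summable_on lattice_of A"
proof -
  obtain C where C: "C \<ge> 0" "\<And>v. \<bar>p v\<bar> * exp (- c * (norm v)\<^sup>2) \<le> C * (1 + norm v) powr (- (real CARD('n) + 1))"
    using polynomial_gauss_decay[OF assms(2,3), of "real CARD('n) + 1"] by auto
  have "(\<lambda>z. C * (1 + norm (z + x)) powr (- (real CARD('n) + 1))) summable_on lattice_of A"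
    by (intro summable_on_cmult_right summable_on_shifted_lattice_powr assms) simp
  then show ?thesis
    by (rule summable_on_norm_bound) (use C in \<open>simp add: norm_mult abs_mult\<close>)
qed

section \<open>Theta series with polynomial weights and their derivatives\<close>

lemma ephase_has_vector_derivative:
  "((\<lambda>s. ephase (\<alpha> + s * \<beta>)) has_vector_derivative (2 * of_real pi * \<i> * of_real \<beta>) * ephase (\<alpha> + s * \<beta>)) (at s within S)"
proof -
  have "((\<lambda>z. exp (2 * of_real pi * \<i> * (of_real \<alpha> + z * of_real \<beta>))) has_field_derivative
     (2 * of_real pi * \<i> * of_real \<beta>) * exp (2 * of_real pi * \<i> * (of_real \<alpha> + of_real s * of_real \<beta>))) (at (of_real s))"
    by (auto intro!: derivative_eq_intros)
  from has_vector_derivative_real_field[OF this, of S] show ?thesis by (simp add: ephase_def)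
qed

lemma polynomial_line_derivative:
  fixes p :: "real^'n \<Rightarrow> real"
  assumes "real_polynomial_function p"
  shows "((\<lambda>s. p (v + s *\<^sub>R axis j 1)) has_real_derivative partial_derivative j p (v + s *\<^sub>R axis j 1)) (at s within S)"
proof -
  let ?w = "v + s *\<^sub>R axis j 1"
  note d = real_polynomial_function_frechet_derivative[OF assms, of ?w]
  have 1: "((\<lambda>s. v + s *\<^sub>R axis j 1) has_derivative (\<lambda>h. h *\<^sub>R axis j (1::real))) (at s within S)"
    by (auto intro!: derivative_eq_intros)
  have "((\<lambda>s. p (v + s *\<^sub>R axis j 1)) has_derivative (\<lambda>h. frechet_derivative p (at ?w) (h *\<^sub>R axis j 1))) (at s within S)"
    by (rule has_derivative_compose[OF 1 d])
  moreover have "(\<lambda>h. frechet_derivative p (at ?w) (h *\<^sub>R axis j 1)) = (*) (partial_derivative j p ?w)"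
    using linear_scale[OF has_derivative_linear[OF d]] partial_derivative_eq[OF d, of j] by (simp add: fun_eq_iff)
  ultimately show ?thesis by (simp add: has_field_derivative_def)
qed

text \<open>The phase carries z - x instead of z, so that a derivative in y_j multiplies each
  summand by a multiple of (z - x)_j, a coordinate of the argument of h.\<close>

definition theta_primal :: "real^'n^'n \<Rightarrow> (real^'n \<Rightarrow> real) \<Rightarrow> real^'n \<Rightarrow> real^'n \<Rightarrow> real \<Rightarrow> complex" where
  "theta_primal A h x y t = (\<Sum>\<^sub>\<infinity>z\<in>lattice_of A.
     of_real (h (z - x) * exp (- (pi * t) * (norm (z - x))\<^sup>2)) * ephase (- (y \<bullet> (z - x))))"

text \<open>Here y occurs only in the shift q + y, so a derivative in y acts on polynomial times
  Gaussian and leaves the phase fixed.\<close>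

definition theta_dual :: "real^'n^'n \<Rightarrow> (real^'n \<Rightarrow> real) \<Rightarrow> real^'n \<Rightarrow> real^'n \<Rightarrow> real \<Rightarrow> complex" where
  "theta_dual A h x y t = (\<Sum>\<^sub>\<infinity>q\<in>dual_lattice_of A.
     of_real (h (q + y) * exp (- (pi / t) * (norm (q + y))\<^sup>2)) * ephase (- (x \<bullet> q)))"

lemma theta_primal_derivative:
  fixes A :: "real^'n^'n"
  assumes A: "invertible A" and g: "real_polynomial_function g" and t: "t > 0"
  shows "((\<lambda>s. theta_primal A g x (y + s *\<^sub>R axis j 1) t) has_vector_derivative
      - 2 * of_real pi * \<i> * theta_primal A (\<lambda>v. v $ j * g v) x y t) (at 0)"
proof -
  define u where "u z = complex_of_real (g (z - x) * exp (- (pi * t) * (norm (z - x))\<^sup>2))" for z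
  define f where "f z s = u z * ephase (- (y \<bullet> (z - x)) + s * (- ((z - x) $ j)))" for z s
  define f' where "f' z s = u z * ((2 * of_real pi * \<i> * of_real (- ((z - x) $ j))) * ephase (- (y \<bullet> (z - x)) + s * (- ((z - x) $ j))))" for z s
  let ?p = "\<lambda>v. v $ j * g v"
  have rp: "real_polynomial_function ?p" using g by (intro rpf_mult) auto
  obtain C where C: "C \<ge> 0" "\<And>v. \<bar>?p v\<bar> * exp (- (pi * t) * (norm v)\<^sup>2) \<le> C * (1 + norm v) powr (- (real CARD('n) + 1))"
    using polynomial_gauss_decay[OF rp, of "pi * t" "real CARD('n) + 1"] t by auto
  have "((\<lambda>s. \<Sum>\<^sub>\<infinity>z\<in>lattice_of A. f z s) has_vector_derivative (\<Sum>\<^sub>\<infinity>z\<in>lattice_of A. f' z 0)) (at 0)"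
  proof (rule has_vector_derivative_infsum)
    show "(f z has_vector_derivative f' z s) (at s within {-1..1})" for z s
      unfolding f_def[abs_def] f'_def
      by (intro has_vector_derivative_mult_right ephase_has_vector_derivative)
    show "norm (f' z s) \<le> 2 * pi * (C * (1 + norm (z - x)) powr (- (real CARD('n) + 1)))" for z s
    proof -
      have "norm (f' z s) = 2 * pi * (\<bar>?p (z - x)\<bar> * exp (- (pi * t) * (norm (z - x))\<^sup>2))"
        by (simp only: f'_def u_def norm_mult norm_of_real norm_ephase)
          (simp add: abs_mult mult_ac abs_minus_commute)
      then show ?thesis using C(2)[of "z - x"] by simp
    qed
    show "(\<lambda>z. 2 * pi * (C * (1 + norm (z - x)) powr (- (real CARD('n) + 1)))) summable_on lattice_of A"
      using summable_on_shifted_lattice_powr[OF A, of "real CARD('n) + 1" "- x"] by (intro summable_on_cmult_right) simp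
    show "(\<lambda>z. f z 0) summable_on lattice_of A"
      using summable_on_theta[OF A g, of "pi * t" "- x"] t by (simp add: f_def u_def)
  qed
  moreover have "(\<Sum>\<^sub>\<infinity>z\<in>lattice_of A. f z s) = theta_primal A g x (y + s *\<^sub>R axis j 1) t" for s
    unfolding theta_primal_def f_def u_def by (simp add: inner_add_left inner_axis' algebra_simps)
  moreover have "(\<Sum>\<^sub>\<infinity>z\<in>lattice_of A. f' z 0) = - 2 * of_real pi * \<i> * theta_primal A ?p x y t"
    unfolding theta_primal_def f'_def u_def infsum_cmult_right'[symmetric]
    by (intro infsum_cong) (simp add: algebra_simps)
  ultimately show ?thesis by simp
qed

lemma theta_dual_derivative:
  fixes A :: "real^'n^'n"
  assumes A: "invertible A" and g: "real_polynomial_function g" and t: "t > 0"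
  shows "((\<lambda>s. theta_dual A g x (y + s *\<^sub>R axis j 1) t) has_vector_derivative
      theta_dual A (\<lambda>v. partial_derivative j g v - 2 * pi / t * (v $ j * g v)) x y t) (at 0)"
proof -
  define E where "E v = exp (- (pi / t) * (norm v)\<^sup>2)" for v :: "real^'n"
  define p where "p v = partial_derivative j g v - 2 * pi / t * (v $ j * g v)" for v
  define f where "f q s = of_real (g (q + y + s *\<^sub>R axis j 1) * E (q + y + s *\<^sub>R axis j 1)) * ephase (- (x \<bullet> q))" for q s
  define f' where "f' q s = of_real (p (q + y + s *\<^sub>R axis j 1) * E (q + y + s *\<^sub>R axis j 1)) * ephase (- (x \<bullet> q))" for q s
  let ?\<tau> = "real CARD('n) + 1"
  have rp: "real_polynomial_function p" unfolding p_def[abs_def]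
    using g by (intro real_polynomial_function_diff real_polynomial_function_cmult rpf_mult) auto
  have t': "pi / t > 0" using t by simp
  obtain C where C: "C \<ge> 0" "\<And>v. \<bar>p v\<bar> * E v \<le> C * (1 + norm v) powr (- ?\<tau>)"
    unfolding E_def using polynomial_gauss_decay[OF rp t', of ?\<tau>] by auto
  have "((\<lambda>s. \<Sum>\<^sub>\<infinity>q\<in>dual_lattice_of A. f q s) has_vector_derivative (\<Sum>\<^sub>\<infinity>q\<in>dual_lattice_of A. f' q 0)) (at 0)"
    unfolding dual_lattice_of_def
  proof (rule has_vector_derivative_infsum)
    fix q s
    let ?v = "q + y + s *\<^sub>R axis j 1"
    have dE: "((\<lambda>s. E (q + y + s *\<^sub>R axis j 1)) has_real_derivative E ?v * (- (pi / t) * (2 * ?v $ j))) (at s within {-1..1})"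
      unfolding E_def
      using DERIV_chain2[OF DERIV_exp DERIV_cmult[OF polynomial_line_derivative[OF real_polynomial_function_norm_sq, of "q + y" j s "{-1..1}"], of "- (pi / t)"]]
      by (simp only: partial_derivative_norm_sq)
    have "((\<lambda>s. g (q + y + s *\<^sub>R axis j 1) * E (q + y + s *\<^sub>R axis j 1)) has_real_derivative
        partial_derivative j g ?v * E ?v + (E ?v * (- (pi / t) * (2 * ?v $ j))) * g ?v) (at s within {-1..1})"
      by (rule DERIV_mult'[OF polynomial_line_derivative[OF g] dE, THEN DERIV_cong]) simp
    then have "((\<lambda>s. g (q + y + s *\<^sub>R axis j 1) * E (q + y + s *\<^sub>R axis j 1)) has_real_derivative p ?v * E ?v) (at s within {-1..1})"
      by (rule DERIV_cong) (simp add: p_def algebra_simps)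
    then have "((\<lambda>s. complex_of_real (g (q + y + s *\<^sub>R axis j 1) * E (q + y + s *\<^sub>R axis j 1))) has_vector_derivative of_real (p ?v * E ?v)) (at s within {-1..1})"
      by (intro has_vector_derivative_of_real) (simp add: has_real_derivative_iff_has_vector_derivative)
    then show "(f q has_vector_derivative f' q s) (at s within {-1..1})"
      unfolding f_def[abs_def] f'_def by (rule has_vector_derivative_mult_left)
  next
    fix q and s :: real assume s: "s \<in> {-1..1}"
    let ?v = "q + y + s *\<^sub>R axis j 1"
    have "norm (f' q s) = \<bar>p ?v\<bar> * E ?v" by (simp add: f'_def norm_mult abs_mult E_def)
    also have "\<dots> \<le> C * (1 + norm ?v) powr (- ?\<tau>)" by (rule C)
    also have "(1 + norm ?v) powr (- ?\<tau>) \<le> (1 + norm (s *\<^sub>R axis j (1::real) :: real^'n)) powr ?\<tau> * (1 + norm (q + y)) powr (- ?\<tau>)"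
      by (rule shift_powr_bound) simp
    also have "(1 + norm (s *\<^sub>R axis j (1::real) :: real^'n)) powr ?\<tau> \<le> 2 powr ?\<tau>"
      using s by (intro powr_mono2) (auto simp: norm_axis_1)
    finally show "norm (f' q s) \<le> C * (2 powr ?\<tau> * (1 + norm (q + y)) powr (- ?\<tau>))"
      using C(1) by (simp add: mult_left_mono mult_right_mono)
  next
    show "(\<lambda>q. C * (2 powr ?\<tau> * (1 + norm (q + y)) powr (- ?\<tau>))) summable_on lattice_of (transpose (matrix_inv A))"
      by (intro summable_on_cmult_right summable_on_shifted_lattice_powr dual_lattice_invertible A) simp
    show "(\<lambda>q. f q 0) summable_on lattice_of (transpose (matrix_inv A))"
      using summable_on_theta[OF dual_lattice_invertible[OF A] g t', of y] by (simp add: f_def E_def)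
  qed
  moreover have "(\<Sum>\<^sub>\<infinity>q\<in>dual_lattice_of A. f q s) = theta_dual A g x (y + s *\<^sub>R axis j 1) t" for s
    unfolding theta_dual_def f_def E_def by (simp add: add.assoc)
  moreover have "(\<Sum>\<^sub>\<infinity>q\<in>dual_lattice_of A. f' q 0) = theta_dual A p x y t"
    unfolding theta_dual_def f'_def E_def by simp
  ultimately show ?thesis by (simp add: p_def[abs_def])
qed

lemma has_sum_sum:
  fixes f :: "'j \<Rightarrow> 'i \<Rightarrow> 'b::topological_comm_monoid_add"
  assumes "\<And>j. j \<in> J \<Longrightarrow> (f j has_sum S j) I"
  shows "((\<lambda>i. \<Sum>j\<in>J. f j i) has_sum (\<Sum>j\<in>J. S j)) I"
  using assms by (induction J rule: infinite_finite_induct) (auto intro: has_sum_add)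

lemma theta_primal_sum:
  assumes "invertible A" "finite J" "\<And>j. j \<in> J \<Longrightarrow> real_polynomial_function (g j)" "t > 0"
  shows "theta_primal A (\<lambda>v. \<Sum>j\<in>J. g j v) x y t = (\<Sum>j\<in>J. theta_primal A (g j) x y t)"
proof -
  have "((\<lambda>z. \<Sum>j\<in>J. of_real (g j (z - x) * exp (- (pi * t) * (norm (z - x))\<^sup>2)) * ephase (- (y \<bullet> (z - x)))) has_sum (\<Sum>j\<in>J. theta_primal A (g j) x y t)) (lattice_of A)"
    unfolding theta_primal_def
    using assms summable_on_theta[OF assms(1) assms(3), of _ "pi * t" "- x"]
    by (intro has_sum_sum has_sum_infsum) auto
  then show ?thesis
    unfolding theta_primal_def by (intro infsumI) (simp add: sum_distrib_right)
qed

lemma theta_dual_sum: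
  assumes "invertible A" "finite J" "\<And>j. j \<in> J \<Longrightarrow> real_polynomial_function (g j)" "t > 0"
  shows "theta_dual A (\<lambda>v. \<Sum>j\<in>J. g j v) x y t = (\<Sum>j\<in>J. theta_dual A (g j) x y t)"
proof -
  have t': "pi / t > 0" using assms by simp
  have "((\<lambda>q. \<Sum>j\<in>J. of_real (g j (q + y) * exp (- (pi / t) * (norm (q + y))\<^sup>2)) * ephase (- (x \<bullet> q))) has_sum (\<Sum>j\<in>J. theta_dual A (g j) x y t)) (dual_lattice_of A)"
    unfolding theta_dual_def dual_lattice_of_def
    using summable_on_theta[OF dual_lattice_invertible[OF assms(1)] assms(3) t']
    by (intro has_sum_sum has_sum_infsum) auto
  then show ?thesis
    unfolding theta_dual_def by (intro infsumI) (simp add: sum_distrib_right)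
qed

lemma theta_primal_cmult: "theta_primal A (\<lambda>v. c * g v) x y t = of_real c * theta_primal A g x y t"
  unfolding theta_primal_def infsum_cmult_right'[symmetric] by (simp add: mult.assoc)

lemma theta_dual_cmult: "theta_dual A (\<lambda>v. c * g v) x y t = of_real c * theta_dual A g x y t"
  unfolding theta_dual_def infsum_cmult_right'[symmetric] by (simp add: mult.assoc)

text \<open>Hecke's identity. By Euler's formula \<open>(m + 1) h = \<Sum>\<^sub>j v\<^sub>j \<partial>\<^sub>j h\<close>; differentiating the identity for the
  harmonic polynomial \<open>\<partial>\<^sub>j h\<close> in \<open>y\<^sub>j\<close> and summing over \<open>j\<close> gives the one for \<open>h\<close>, since \<open>\<Delta> h = 0\<close>.\<close>

lemma theta_harmonic:
  fixes A :: "real^'n^'n" and h :: "real^'n \<Rightarrow> real"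
  assumes A: "invertible A" and t: "t > 0" and "homogeneous_polynomial m h" "harmonic h"
  shows "theta_primal A h x y t = (- \<i>) ^ m * of_real (t powr (- real CARD('n) / 2 - real m) / \<bar>det A\<bar>) * theta_dual A h x y t"
  using assms(3,4)
proof (induction m arbitrary: h y)
  case 0
  then have h: "h = (\<lambda>v. h 0 * 1)" using homogeneous_degree_zero by auto
  have "theta_primal A (\<lambda>v. 1) x y t = of_real (t powr (- real CARD('n) / 2) / \<bar>det A\<bar>) * theta_dual A (\<lambda>v. 1) x y t"
    using lattice_theta_gauss[OF A t, of x y] by (simp add: theta_primal_def theta_dual_def)
  then show ?case by (subst (1 2) h, unfold theta_primal_cmult theta_dual_cmult) simp
next
  case (Suc m)
  note rp = homogeneous_polynomialD(1)[OF Suc.prems(1)]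
  define c where "c = (- \<i>) ^ m * complex_of_real (t powr (- real CARD('n) / 2 - real m) / \<bar>det A\<bar>)"
  let ?g = "\<lambda>j. partial_derivative j h"
  have IH: "theta_primal A (?g j) x y t = c * theta_dual A (?g j) x y t" for j y
    unfolding c_def using Suc.prems rp by (intro Suc.IH homogeneous_partial_derivative harmonic_partial_derivative)
  have rg: "real_polynomial_function (?g j)" for j using rp by auto
  have eq: "- 2 * of_real pi * \<i> * theta_primal A (\<lambda>v. v $ j * ?g j v) x y t
     = c * theta_dual A (\<lambda>v. partial_derivative j (?g j) v - 2 * pi / t * (v $ j * ?g j v)) x y t" for j
  proof -
    have "((\<lambda>s. c * theta_dual A (?g j) x (y + s *\<^sub>R axis j 1) t) has_vector_derivative
      - 2 * of_real pi * \<i> * theta_primal A (\<lambda>v. v $ j * ?g j v) x y t) (at 0)"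
      using theta_primal_derivative[OF A rg t, of j x y j] unfolding IH .
    moreover have "((\<lambda>s. c * theta_dual A (?g j) x (y + s *\<^sub>R axis j 1) t) has_vector_derivative
      c * theta_dual A (\<lambda>v. partial_derivative j (?g j) v - 2 * pi / t * (v $ j * ?g j v)) x y t) (at 0)"
      by (intro has_vector_derivative_mult_right theta_dual_derivative[OF A rg t])
    ultimately show ?thesis by (rule vector_derivative_unique_at)
  qed
  have e: "(\<Sum>j\<in>UNIV. v $ j * ?g j v) = real (Suc m) * h v" for v
    by (rule euler_homogeneous[OF Suc.prems(1)])
  have lap: "(\<Sum>j\<in>UNIV. partial_derivative j (?g j) v) = 0" for v
    using Suc.prems(2) by (simp add: harmonic_def)
  have "- 2 * of_real pi * \<i> * (of_real (real (Suc m)) * theta_primal A h x y t)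
      = (\<Sum>j\<in>UNIV. - 2 * of_real pi * \<i> * theta_primal A (\<lambda>v. v $ j * ?g j v) x y t)"
  proof -
    have "of_real (real (Suc m)) * theta_primal A h x y t = theta_primal A (\<lambda>v. \<Sum>j\<in>UNIV. v $ j * ?g j v) x y t"
      unfolding e theta_primal_cmult ..
    also have "\<dots> = (\<Sum>j\<in>UNIV. theta_primal A (\<lambda>v. v $ j * ?g j v) x y t)"
      using rg by (intro theta_primal_sum[OF A _ _ t] rpf_mult) auto
    finally show ?thesis by (simp add: sum_distrib_left)
  qed
  also have "\<dots> = c * (\<Sum>j\<in>UNIV. theta_dual A (\<lambda>v. partial_derivative j (?g j) v - 2 * pi / t * (v $ j * ?g j v)) x y t)"
    unfolding eq sum_distrib_left ..
  also have "(\<Sum>j\<in>UNIV. theta_dual A (\<lambda>v. partial_derivative j (?g j) v - 2 * pi / t * (v $ j * ?g j v)) x y t)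
     = theta_dual A (\<lambda>v. \<Sum>j\<in>UNIV. partial_derivative j (?g j) v - 2 * pi / t * (v $ j * ?g j v)) x y t"
    using rg by (intro theta_dual_sum[OF A _ _ t, symmetric] real_polynomial_function_diff real_polynomial_function_cmult rpf_mult) auto
  also have "(\<lambda>v. \<Sum>j\<in>UNIV. partial_derivative j (?g j) v - 2 * pi / t * (v $ j * ?g j v)) = (\<lambda>v. (- 2 * pi / t * real (Suc m)) * h v)"
    by (simp only: sum_subtractf sum_distrib_left[symmetric] e lap) (simp add: mult_ac)
  finally have "- 2 * of_real pi * \<i> * (of_real (real (Suc m)) * theta_primal A h x y t)
     = c * (of_real (- 2 * pi / t * real (Suc m)) * theta_dual A h x y t)"
    unfolding theta_dual_cmult .
  \<comment> \<open>The common factor -2 \<pi> (m + 1) is cancelled from both sides; what remains is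
    the factor -i / t by which the constant changes when the degree rises by one.\<close>
  moreover define K where "K = - 2 * complex_of_real pi * of_real (real (Suc m))"
  moreover have "complex_of_real (- 2 * pi / t * real (Suc m)) = K / of_real t"
    by (simp add: K_def del: of_nat_Suc)
  ultimately have "K * (\<i> * theta_primal A h x y t) = K * (c / of_real t * theta_dual A h x y t)"
    by (simp only:) (simp add: mult_ac divide_inverse del: of_nat_Suc)
  moreover have "K \<noteq> 0" by (simp add: K_def del: of_nat_Suc)
  ultimately have "\<i> * theta_primal A h x y t = c / of_real t * theta_dual A h x y t"
    using mult_left_cancel by blast
  then have "- \<i> * (\<i> * theta_primal A h x y t) = - \<i> * (c / of_real t * theta_dual A h x y t)" by simp
  then have "theta_primal A h x y t = (- \<i> * c / of_real t) * theta_dual A h x y t"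
    by (simp add: mult.assoc[symmetric])
  also have "- \<i> * c / of_real t = (- \<i>) ^ Suc m * of_real (t powr (- real CARD('n) / 2 - real (Suc m)) / \<bar>det A\<bar>)"
  proof -
    have "t powr (- real CARD('n) / 2 - real (Suc m)) = t powr (- real CARD('n) / 2 - real m) / t"
    proof -
      have "- real CARD('n) / 2 - real (Suc m) = (- real CARD('n) / 2 - real m) - 1" by simp
      then show ?thesis using t by (simp only: powr_diff) simp
    qed
    then show ?thesis by (simp add: c_def mult_ac)
  qed
  finally show ?case .
qed

section \<open>Continuation of the lattice sums\<close>

text \<open>Scaling to the unit sphere, where the polynomial growth bound is the constant C
  2^N.\<close>

lemma homogeneous_bound:
  fixes h :: "real^'n \<Rightarrow> real"
  assumes "homogeneous_polynomial m h"
  obtains C where "C \<ge> 0" "\<And>v. v \<noteq> 0 \<Longrightarrow> \<bar>h v\<bar> \<le> C * norm v powr real m"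
proof -
  obtain C N where C: "C \<ge> 0" "\<And>v. \<bar>h v\<bar> \<le> C * (1 + norm v) ^ N"
    using polynomial_growth[OF homogeneous_polynomialD(1)[OF assms]] by blast
  show ?thesis
  proof (rule that[of "C * 2 ^ N"])
    fix v :: "real^'n" assume v: "v \<noteq> 0"
    have "h v = norm v ^ m * h ((1 / norm v) *\<^sub>R v)"
      using homogeneous_polynomialD(2)[OF assms, of "norm v" "(1 / norm v) *\<^sub>R v"] v by simp
    then have "\<bar>h v\<bar> = norm v ^ m * \<bar>h ((1 / norm v) *\<^sub>R v)\<bar>" by (simp add: abs_mult)
    also have "\<dots> \<le> norm v ^ m * (C * (1 + norm ((1 / norm v) *\<^sub>R v)) ^ N)"
      by (intro mult_left_mono C) simp
    finally show "\<bar>h v\<bar> \<le> C * 2 ^ N * norm v powr real m"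
      using v by (simp add: powr_realpow mult_ac)
  qed (use C in simp)
qed

lemma lattice_uminus: "z \<in> lattice_of A \<Longrightarrow> - z \<in> lattice_of A"
  unfolding lattice_of_eq using int_vecs_uminus linear_neg[OF matrix_vector_mul_linear, of A]
  by (metis (no_types, lifting) imageE imageI)

lemma dual_shift_nonzero:
  assumes "y \<notin> dual_lattice_of A" "q \<in> dual_lattice_of A"
  shows "q + y \<noteq> 0"
  using assms lattice_uminus unfolding dual_lattice_of_def by (metis add_eq_0_iff)

text \<open>Discreteness keeps the argument c |z + x|^2 away from 0, so a single constant in the
  bound by e^(-r/2) serves all lattice points. The majorant is the same for all s in the half plane,
  which gives summability and holomorphy of the sums together.\<close>

lemma gexp_sum_bound:
  fixes A :: "real^'n^'n"
  assumes A: "invertible A" and p: "real_polynomial_function p" and c: "c > 0"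
  obtains M where "M summable_on lattice_of A"
    "\<And>z s. z \<in> lattice_of A \<Longrightarrow> z + x \<noteq> 0 \<Longrightarrow> Re s \<le> \<sigma> \<Longrightarrow>
       \<bar>p (z + x)\<bar> * norm (gexp_int s (c * (norm (z + x))\<^sup>2)) \<le> M z"
proof -
  let ?\<tau> = "real CARD('n) + 1"
  obtain \<epsilon> where \<epsilon>: "\<epsilon> > 0" "\<And>z. z \<in> lattice_of A \<Longrightarrow> z + x \<noteq> 0 \<Longrightarrow> norm (z + x) \<ge> \<epsilon>"
    using lattice_shift_discrete[OF A] by blast
  have r0: "c * \<epsilon>\<^sup>2 > 0" using c \<epsilon> by simp
  obtain C where C: "C > 0" "\<And>s r. Re s \<le> \<sigma> \<Longrightarrow> r \<ge> c * \<epsilon>\<^sup>2 \<Longrightarrow> norm (gexp_int s r) \<le> C * exp (- r / 2)"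
    using gexp_int_bound[OF r0] by blast
  have c2: "c / 2 > 0" using c by simp
  obtain C' where C': "C' \<ge> 0" "\<And>v. \<bar>p v\<bar> * exp (- (c / 2) * (norm v)\<^sup>2) \<le> C' * (1 + norm v) powr (- ?\<tau>)"
    using polynomial_gauss_decay[OF p c2, of ?\<tau>] by auto
  show ?thesis
  proof (rule that[of "\<lambda>z. C * (C' * (1 + norm (z + x)) powr (- ?\<tau>))"])
    show "(\<lambda>z. C * (C' * (1 + norm (z + x)) powr (- ?\<tau>))) summable_on lattice_of A"
      by (intro summable_on_cmult_right summable_on_shifted_lattice_powr A) simp
    fix z s assume z: "z \<in> lattice_of A" "z + x \<noteq> 0" "Re s \<le> \<sigma>"
    have "c * \<epsilon>\<^sup>2 \<le> c * (norm (z + x))\<^sup>2"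
      using \<epsilon> z c by (intro mult_left_mono power_mono) auto
    then have "norm (gexp_int s (c * (norm (z + x))\<^sup>2)) \<le> C * exp (- (c * (norm (z + x))\<^sup>2) / 2)"
      using C(2) z(3) by blast
    then have "\<bar>p (z + x)\<bar> * norm (gexp_int s (c * (norm (z + x))\<^sup>2)) \<le> \<bar>p (z + x)\<bar> * (C * exp (- (c * (norm (z + x))\<^sup>2) / 2))"
      by (rule mult_left_mono) simp
    also have "\<dots> = C * (\<bar>p (z + x)\<bar> * exp (- (c / 2) * (norm (z + x))\<^sup>2))" by simp
    also have "\<dots> \<le> C * (C' * (1 + norm (z + x)) powr (- ?\<tau>))" using C(1) C'(2) by (intro mult_left_mono) auto
    finally show "\<bar>p (z + x)\<bar> * norm (gexp_int s (c * (norm (z + x))\<^sup>2)) \<le> C * (C' * (1 + norm (z + x)) powr (- ?\<tau>))" .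
  qed
qed

lemma gexp_sum_summable:
  fixes A :: "real^'n^'n"
  assumes A: "invertible A" and p: "real_polynomial_function p" and c: "c > 0"
    and I: "I \<subseteq> lattice_of A" "\<And>z. z \<in> I \<Longrightarrow> z + x \<noteq> 0"
    and \<phi>: "\<And>z. z \<in> I \<Longrightarrow> norm (\<phi> z) = 1"
  shows "(\<lambda>z. of_real (p (z + x)) * \<phi> z * gexp_int s (c * (norm (z + x))\<^sup>2)) summable_on I"
proof -
  obtain M where M: "M summable_on lattice_of A"
    "\<And>z s'. z \<in> lattice_of A \<Longrightarrow> z + x \<noteq> 0 \<Longrightarrow> Re s' \<le> Re s \<Longrightarrow>
       \<bar>p (z + x)\<bar> * norm (gexp_int s' (c * (norm (z + x))\<^sup>2)) \<le> M z"
    using gexp_sum_bound[OF A p c] by blast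
  show ?thesis
    by (rule summable_on_norm_bound[OF summable_on_subset_banach[OF M(1) I(1)]])
      (use M(2)[of _ s] I \<phi> in \<open>auto simp: norm_mult\<close>)
qed

lemma gexp_sum_holomorphic:
  fixes A :: "real^'n^'n"
  assumes A: "invertible A" and p: "real_polynomial_function p" and c: "c > 0"
    and I: "I \<subseteq> lattice_of A" "\<And>z. z \<in> I \<Longrightarrow> z + x \<noteq> 0"
    and \<phi>: "\<And>z. z \<in> I \<Longrightarrow> norm (\<phi> z) = 1"
  shows "(\<lambda>s. \<Sum>\<^sub>\<infinity>z\<in>I. of_real (p (z + x)) * \<phi> z * gexp_int s (c * (norm (z + x))\<^sup>2)) holomorphic_on UNIV"
proof (rule holomorphic_on_infsum)
  fix z assume "z \<in> I"
  then have "c * (norm (z + x))\<^sup>2 > 0" using I c by simp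
  then show "(\<lambda>s. of_real (p (z + x)) * \<phi> z * gexp_int s (c * (norm (z + x))\<^sup>2)) holomorphic_on UNIV"
    by (intro holomorphic_intros gexp_int_holomorphic)
next
  fix s0 :: complex
  obtain M where M: "M summable_on lattice_of A"
    "\<And>z s'. z \<in> lattice_of A \<Longrightarrow> z + x \<noteq> 0 \<Longrightarrow> Re s' \<le> Re s0 + 1 \<Longrightarrow>
       \<bar>p (z + x)\<bar> * norm (gexp_int s' (c * (norm (z + x))\<^sup>2)) \<le> M z"
    using gexp_sum_bound[OF A p c] by blast
  have "norm (of_real (p (z + x)) * \<phi> z * gexp_int s (c * (norm (z + x))\<^sup>2)) \<le> M z" if "z \<in> I" "s \<in> cball s0 1" for z s
  proof -
    have "Re s \<le> Re s0 + 1" using that(2) abs_Re_le_cmod[of "s - s0"] by (auto simp: dist_norm norm_minus_commute)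
    then show ?thesis using M(2)[of z s] I \<phi> that by (auto simp: norm_mult)
  qed
  then show "\<exists>\<epsilon> M. \<epsilon> > 0 \<and> M summable_on I \<and> cball s0 \<epsilon> \<subseteq> UNIV \<and>
      (\<forall>z\<in>I. \<forall>s\<in>cball s0 \<epsilon>. norm (of_real (p (z + x)) * \<phi> z * gexp_int s (c * (norm (z + x))\<^sup>2)) \<le> M z)"
    using summable_on_subset_banach[OF M(1) I(1)] by (intro exI[of _ 1] exI[of _ M]) auto
qed simp

section \<open>The Mellin transform of the theta series\<close>

lemma integral_norm_gamma_kernel_le:
  assumes "Re s > 0" "r > 0"
  shows "integral {0<..a} (\<lambda>t. norm (gamma_kernel s r t)) \<le> exp (- Re s * ln r) * norm (Gamma (complex_of_real (Re s)))"
    "0 \<le> integral {0<..a} (\<lambda>t. norm (gamma_kernel s r t))"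
proof -
  note ai = integral_gamma_kernel_pos(1)[OF assms]
  have ni: "(\<lambda>t. norm (gamma_kernel s r t)) integrable_on {0<..}"
    using ai by (simp add: absolutely_integrable_on_def)
  have nia: "(\<lambda>t. norm (gamma_kernel s r t)) integrable_on {0<..a}"
  proof -
    have "gamma_kernel s r absolutely_integrable_on {0<..a}"
      by (rule set_integrable_subset[OF ai]) auto
    then show ?thesis by (simp add: absolutely_integrable_on_def)
  qed
  then have "integral {0<..a} (\<lambda>t. norm (gamma_kernel s r t)) \<le> integral {0<..} (\<lambda>t. norm (gamma_kernel s r t))"
    using ni by (intro integral_subset_le) auto
  \<comment> \<open>The modulus of the kernel is the kernel at Re s, whose integral is r^(-Re s)
    \<Gamma>(Re s).\<close>
  also have "integral {0<..} (\<lambda>t. norm (gamma_kernel s r t)) \<le> exp (- Re s * ln r) * norm (Gamma (complex_of_real (Re s)))"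
  proof -
    have "complex_of_real (integral {0<..} (\<lambda>t. norm (gamma_kernel s r t))) = integral {0<..} (\<lambda>t. of_real (norm (gamma_kernel s r t)))"
      by (rule integral_linear[OF ni bounded_linear_of_real, unfolded o_def, symmetric])
    also have "\<dots> = exp (- of_real (Re s) * of_real (ln r)) * Gamma (of_real (Re s))"
      unfolding norm_gamma_kernel' using integral_gamma_kernel_pos(2)[of "of_real (Re s)" r] assms by simp
    finally have "norm (complex_of_real (integral {0<..} (\<lambda>t. norm (gamma_kernel s r t)))) = norm (exp (- of_real (Re s) * of_real (ln r)) * Gamma (of_real (Re s) :: complex))"
      by simp
    then show ?thesis by (simp add: norm_mult)
  qed
  finally show "integral {0<..a} (\<lambda>t. norm (gamma_kernel s r t)) \<le> exp (- Re s * ln r) * norm (Gamma (complex_of_real (Re s)))" .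
  show "0 \<le> integral {0<..a} (\<lambda>t. norm (gamma_kernel s r t))"
    by (rule Henstock_Kurzweil_Integration.integral_nonneg[OF nia]) simp
qed

text \<open>The entire function continuing \<open>\<Sum>\<^sub>z h(z - x) |z - x|\<^sup>-\<^sup>2\<^sup>s e(-y(z - x))\<close>: the Mellin integral over \<open>t > a\<close> converges
  for all \<open>s\<close>, and Hecke's identity is used on \<open>0 < t < a\<close>.\<close>

definition hecke_zeta ::
    "real^'n^'n \<Rightarrow> nat \<Rightarrow> (real^'n \<Rightarrow> real) \<Rightarrow> real^'n \<Rightarrow> real^'n \<Rightarrow> real \<Rightarrow> complex \<Rightarrow> complex" where
  "hecke_zeta A m h x y a s = exp (s * of_real (ln pi)) *
     (exp (s * of_real (ln a)) * (rGamma s * (\<Sum>\<^sub>\<infinity>z\<in>lattice_of A - {x}.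
          of_real (h (z - x)) * ephase (- (y \<bullet> (z - x))) * gexp_int s (pi * a * (norm (z - x))\<^sup>2))
        - (if x \<in> lattice_of A then of_real (h 0) else 0) * rGamma (s + 1))
      + rGamma s * ((- \<i>) ^ m / of_real \<bar>det A\<bar>
          * exp ((s - of_nat CARD('n) / 2 - of_nat m) * of_real (ln a))
          * (\<Sum>\<^sub>\<infinity>q\<in>dual_lattice_of A. of_real (h (q + y)) * ephase (- (x \<bullet> q))
              * gexp_int (of_nat CARD('n) / 2 + of_nat m - s) (pi / a * (norm (q + y))\<^sup>2))))"

text \<open>For y outside the dual lattice no point q + y is 0, so each term of the dual sum is
  entire in s.\<close>

lemma hecke_zeta_holomorphic:
  fixes A :: "real^'n^'n"
  assumes A: "invertible A" and y: "y \<notin> dual_lattice_of A" and h: "real_polynomial_function h" and a: "a > 0"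
  shows "hecke_zeta A m h x y a holomorphic_on UNIV"
proof -
  have 1: "(\<lambda>s. \<Sum>\<^sub>\<infinity>z\<in>lattice_of A - {x}. of_real (h (z - x)) * ephase (- (y \<bullet> (z - x))) * gexp_int s (pi * a * (norm (z - x))\<^sup>2)) holomorphic_on UNIV"
    using gexp_sum_holomorphic[OF A h, of "pi * a" "lattice_of A - {x}" "- x" "\<lambda>z. ephase (- (y \<bullet> (z - x)))"] a by simp
  have 2: "(\<lambda>s. \<Sum>\<^sub>\<infinity>q\<in>dual_lattice_of A. of_real (h (q + y)) * ephase (- (x \<bullet> q)) * gexp_int s (pi / a * (norm (q + y))\<^sup>2)) holomorphic_on UNIV"
    using gexp_sum_holomorphic[OF dual_lattice_invertible[OF A] h, of "pi / a" "dual_lattice_of A" y "\<lambda>q. ephase (- (x \<bullet> q))"] a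
      dual_shift_nonzero[OF y] by (auto simp: dual_lattice_of_def)
  have 3: "((\<lambda>s. \<Sum>\<^sub>\<infinity>q\<in>dual_lattice_of A. of_real (h (q + y)) * ephase (- (x \<bullet> q)) * gexp_int s (pi / a * (norm (q + y))\<^sup>2))
      \<circ> (\<lambda>s. of_nat CARD('n) / 2 + of_nat m - s)) holomorphic_on UNIV"
    by (rule holomorphic_on_compose_gen[OF _ 2]) (auto intro!: holomorphic_intros)
  show ?thesis
    unfolding hecke_zeta_def[abs_def]
    by (intro holomorphic_intros 1 3[unfolded o_def])
qed

text \<open>The Mellin integral of a single term is r^(-s) \<Gamma>(s) with r = \<pi> |z - x|^2; it
  is split at t = a. The part over t > a is summed as it stands. The part over t < a is exchanged
  with the sum, rewritten by Hecke's identity and exchanged again with the sum over the dual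
  lattice. The point z = x is missing from the Dirichlet series, so its term is subtracted from the
  theta series; it produces the summand with 1/\<Gamma>(s + 1).\<close>

lemma hecke_zeta_has_sum:
  fixes A :: "real^'n^'n" and h :: "real^'n \<Rightarrow> real"
  assumes A: "invertible A" and y: "y \<notin> dual_lattice_of A" and a: "a > 0"
    and h: "homogeneous_polynomial m h" "harmonic h" and s: "2 * Re s > real CARD('n) + real m"
  shows "((\<lambda>z. of_real (h (z - x)) * ephase (- (y \<bullet> (z - x))) * exp (- (2 * s) * of_real (ln (norm (z - x)))))
      has_sum hecke_zeta A m h x y a s) (lattice_of A - {x})"
proof -
  let ?\<Lambda> = "lattice_of A" and ?S = "{0<..a}"
  define u where "u z = complex_of_real (h (z - x)) * ephase (- (y \<bullet> (z - x)))" for z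
  define v where "v q = complex_of_real (h (q + y)) * ephase (- (x \<bullet> q))" for q
  define r where "r z = pi * (norm (z - x))\<^sup>2" for z
  \<comment> \<open>Hecke's identity multiplies t^(s-1) by t^(-d/2-m), leaving t^(w-1).\<close>
  define w where "w = s - of_nat CARD('n) / 2 - of_nat m"
  define \<kappa> where "\<kappa> = (- \<i>) ^ m / complex_of_real \<bar>det A\<bar>"
  \<comment> \<open>The term z = x of the theta series, which does not depend on t.\<close>
  define \<delta> where "\<delta> = (if x \<in> ?\<Lambda> then complex_of_real (h 0) else 0)"
  note rp = homogeneous_polynomialD(1)[OF h(1)]
  have s0: "Re s > 0" using s by (smt (verit) of_nat_0_le_iff)
  have sn: "s \<notin> \<int>\<^sub>\<le>\<^sub>0" using s0 by (auto elim!: nonpos_Ints_cases)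
  have rpos: "r z > 0" if "z \<in> ?\<Lambda> - {x}" for z using that by (auto simp: r_def)
  have nu: "norm (u z) = \<bar>h (z - x)\<bar>" for z by (simp add: u_def norm_mult)
  have cS: "countable (?\<Lambda> - {x})" using countable_lattice by (rule countable_Diff)
  have SL: "?S \<in> sets lebesgue" by simp
  define g1 where "g1 t = gamma_kernel s 0 t * (theta_primal A h x y t - \<delta>)" for t
  define g2 where "g2 t = gamma_kernel s 0 t * theta_primal A h x y t" for t
  have kern: "gamma_kernel s c t = gamma_kernel s 0 t * of_real (exp (- (c * t)))" for c t
    by (simp add: gamma_kernel_def exp_of_real[symmetric] exp_add[symmetric])
  have sum1: "((\<lambda>z. integral ?S (\<lambda>t. u z * gamma_kernel s (r z) t)) has_sum integral ?S g1) (?\<Lambda> - {x})"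
  proof (rule has_sum_integral_swap(2)[OF cS SL])
    show "(\<lambda>t. u z * gamma_kernel s (r z) t) absolutely_integrable_on ?S" if "z \<in> ?\<Lambda> - {x}" for z
      using integral_gamma_kernel_Ioc(1)[OF s0 rpos[OF that] a] by simp
    show "(\<lambda>z. integral ?S (\<lambda>t. norm (u z * gamma_kernel s (r z) t))) summable_on ?\<Lambda> - {x}"
    proof -
      \<comment> \<open>The weight h grows like |z - x|^m against |z - x|^(-2 Re s), so the
        hypothesis on s says precisely that \<tau> > d.\<close>
      define \<tau> where "\<tau> = 2 * Re s - real m"
      have \<tau>: "\<tau> > real CARD('n)" using s by (simp add: \<tau>_def)
      obtain C where C: "C \<ge> 0" "\<And>v. v \<noteq> 0 \<Longrightarrow> \<bar>h v\<bar> \<le> C * norm v powr real m"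
        using homogeneous_bound[OF h(1)] by blast
      obtain \<epsilon> where \<epsilon>: "\<epsilon> > 0" "\<And>z. z \<in> ?\<Lambda> \<Longrightarrow> z + - x \<noteq> 0 \<Longrightarrow> norm (z + - x) \<ge> \<epsilon>"
        using lattice_shift_discrete[OF A] by blast
      define G where "G = norm (Gamma (complex_of_real (Re s)))"
      define B where "B = C * pi powr (- Re s) * G * (1 + 1 / \<epsilon>) powr \<tau>"
      have "(\<lambda>z. B * (1 + norm (z + - x)) powr (- \<tau>)) summable_on ?\<Lambda> - {x}"
        by (rule summable_on_subset_banach[OF summable_on_cmult_right[OF summable_on_shifted_lattice_powr[OF A \<tau>]]]) auto
      then show ?thesis
      proof (rule summable_on_comparison_test)
        fix z assume z: "z \<in> ?\<Lambda> - {x}"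
        let ?w = "z - x"
        have w: "?w \<noteq> 0" "norm ?w \<ge> \<epsilon>" "norm ?w > 0" using \<epsilon>(2)[of z] z by auto
        have "integral ?S (\<lambda>t. norm (u z * gamma_kernel s (r z) t)) = norm (u z) * integral ?S (\<lambda>t. norm (gamma_kernel s (r z) t))"
          unfolding norm_mult by simp
        also have "\<dots> \<le> norm (u z) * (exp (- Re s * ln (r z)) * G)"
          unfolding G_def using integral_norm_gamma_kernel_le(1)[OF s0 rpos[OF z]] by (intro mult_left_mono) auto
        also have "exp (- Re s * ln (r z)) = pi powr (- Re s) * norm ?w powr (- 2 * Re s)"
          using w by (simp add: r_def powr_def ln_mult ln_realpow exp_add[symmetric] algebra_simps)
        also have "norm (u z) * (pi powr (- Re s) * norm ?w powr (- 2 * Re s) * G) \<le> (C * norm ?w powr real m) * (pi powr (- Re s) * norm ?w powr (- 2 * Re s) * G)"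
          unfolding nu using C(2)[OF w(1)] by (intro mult_right_mono) (auto simp: G_def)
        also have "\<dots> = C * pi powr (- Re s) * G * norm ?w powr (- \<tau>)"
          by (simp add: \<tau>_def powr_add[symmetric] mult_ac)
        also have "norm ?w powr (- \<tau>) \<le> (1 + 1 / \<epsilon>) powr \<tau> * (1 + norm ?w) powr (- \<tau>)"
        proof -
          have e1: "1 + 1 / \<epsilon> > 0" using \<epsilon> by (simp add: add_pos_pos)
          have "1 + norm ?w \<le> (1 + 1 / \<epsilon>) * norm ?w" using w \<epsilon>(1) by (simp add: field_simps)
          then have "((1 + 1 / \<epsilon>) * norm ?w) powr (- \<tau>) \<le> (1 + norm ?w) powr (- \<tau>)"
            using \<tau> by (intro powr_mono2') (auto simp: add_pos_nonneg intro: order_trans[OF of_nat_0_le_iff less_imp_le])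
          then have "(1 + 1 / \<epsilon>) powr (- \<tau>) * norm ?w powr (- \<tau>) \<le> (1 + norm ?w) powr (- \<tau>)"
            using e1 by (simp add: powr_mult)
          then have "(1 + 1 / \<epsilon>) powr \<tau> * ((1 + 1 / \<epsilon>) powr (- \<tau>) * norm ?w powr (- \<tau>)) \<le> (1 + 1 / \<epsilon>) powr \<tau> * (1 + norm ?w) powr (- \<tau>)"
            by (rule mult_left_mono) simp
          moreover have "(1 + 1 / \<epsilon>) powr \<tau> * (1 + 1 / \<epsilon>) powr (- \<tau>) = 1" using e1 by (simp add: powr_add[symmetric])
          ultimately show ?thesis by (simp add: mult.assoc[symmetric])
        qed
        finally show "integral ?S (\<lambda>t. norm (u z * gamma_kernel s (r z) t)) \<le> B * (1 + norm (z + - x)) powr (- \<tau>)"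
          using C(1) by (simp add: B_def G_def mult_left_mono mult.assoc)
      next
        fix z assume "z \<in> ?\<Lambda> - {x}"
        then show "0 \<le> integral ?S (\<lambda>t. norm (u z * gamma_kernel s (r z) t))"
          unfolding norm_mult using integral_norm_gamma_kernel_le(2)[OF s0 rpos] by simp
      qed
    qed
    fix t assume "t \<in> ?S"
    then have t: "t > 0" by simp
    define e where "e z = complex_of_real (h (z - x) * exp (- (pi * t) * (norm (z - x))\<^sup>2)) * ephase (- (y \<bullet> (z - x)))" for z
    have "(e has_sum theta_primal A h x y t) ?\<Lambda>"
      unfolding theta_primal_def e_def using summable_on_theta[OF A rp, of "pi * t" "- x"] t by (intro has_sum_infsum) simp
    then have "(e has_sum (theta_primal A h x y t - \<delta>)) (?\<Lambda> - {x})"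
    proof (cases "x \<in> ?\<Lambda>")
      case True
      have "(e has_sum e x) {x}" by (rule has_sum_finiteI) auto
      with \<open>(e has_sum _) ?\<Lambda>\<close> have "(e has_sum (theta_primal A h x y t - e x)) (?\<Lambda> - {x})"
        using True by (intro has_sum_Diff) auto
      then show ?thesis using True by (simp add: e_def \<delta>_def)
    next
      case False
      then show ?thesis using \<open>(e has_sum _) ?\<Lambda>\<close> by (simp add: \<delta>_def)
    qed
    then have "((\<lambda>z. gamma_kernel s 0 t * e z) has_sum g1 t) (?\<Lambda> - {x})"
      unfolding g1_def by (rule has_sum_cmult_right)
    moreover have "gamma_kernel s 0 t * e z = u z * gamma_kernel s (r z) t" for z
      unfolding kern[of "r z"] by (simp add: e_def u_def r_def mult_ac)
    ultimately show "((\<lambda>z. u z * gamma_kernel s (r z) t) has_sum g1 t) (?\<Lambda> - {x})" by simp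
  qed
  define f2 where "f2 q t = exp ((w - 1) * of_real (ln t) - of_real ((pi * (norm (q + y))\<^sup>2) / t))" for q t
  have qpos: "pi * (norm (q + y))\<^sup>2 > 0" if "q \<in> dual_lattice_of A" for q
    using dual_shift_nonzero[OF y that] by simp
  have f2_abs: "f2 q absolutely_integrable_on ?S" if "q \<in> dual_lattice_of A" for q
    unfolding f2_def using integral_reciprocal_kernel(1)[OF qpos[OF that] a] .
  have f2_int: "integral ?S (f2 q) = exp (w * of_real (ln a)) * gexp_int (- w) (pi / a * (norm (q + y))\<^sup>2)" if "q \<in> dual_lattice_of A" for q
    unfolding f2_def using integral_reciprocal_kernel(2)[OF qpos[OF that] a, of w] by simp
  have cD: "countable (dual_lattice_of A)" unfolding dual_lattice_of_def by (rule countable_lattice)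
    have p1: "(\<lambda>t. \<kappa> * v q * f2 q t) absolutely_integrable_on ?S" if "q \<in> dual_lattice_of A" for q
      using f2_abs[OF that] by simp
    have p2: "(\<lambda>q. integral ?S (\<lambda>t. norm (\<kappa> * v q * f2 q t))) summable_on dual_lattice_of A"
    proof -
      have "pi / a > 0" using a by simp
      then obtain M where M: "M summable_on dual_lattice_of A"
        "\<And>q s'. q \<in> dual_lattice_of A \<Longrightarrow> q + y \<noteq> 0 \<Longrightarrow> Re s' \<le> Re (- w) \<Longrightarrow>
           \<bar>h (q + y)\<bar> * norm (gexp_int s' (pi / a * (norm (q + y))\<^sup>2)) \<le> M q"
        using gexp_sum_bound[OF dual_lattice_invertible[OF A] rp] unfolding dual_lattice_of_def by blast
      have "(\<lambda>q. norm \<kappa> * exp (Re w * ln a) * M q) summable_on dual_lattice_of A"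
        by (rule summable_on_cmult_right[OF M(1)])
      then show ?thesis
      proof (rule summable_on_norm_bound)
        fix q assume q: "q \<in> dual_lattice_of A"
        have ni: "(\<lambda>t. norm (f2 q t)) integrable_on ?S" using f2_abs[OF q] by (simp add: absolutely_integrable_on_def)
        have "complex_of_real (integral ?S (\<lambda>t. norm (f2 q t))) = integral ?S (\<lambda>t. of_real (norm (f2 q t)))"
          by (rule integral_linear[OF ni bounded_linear_of_real, unfolded o_def, symmetric])
        \<comment> \<open>The modulus of the integrand is the integrand with w replaced by Re w, so
          the same formula evaluates its integral.\<close>
        also have "(\<lambda>t. complex_of_real (norm (f2 q t))) = (\<lambda>t. exp ((of_real (Re w) - 1) * of_real (ln t) - of_real ((pi * (norm (q + y))\<^sup>2) / t)))"
          by (simp add: fun_eq_iff f2_def exp_of_real[symmetric])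
        also have "integral ?S \<dots> = exp (of_real (Re w) * of_real (ln a)) * gexp_int (- of_real (Re w)) (pi / a * (norm (q + y))\<^sup>2)"
          using integral_reciprocal_kernel(2)[OF qpos[OF q] a, of "of_real (Re w)"] by simp
        finally have "norm (complex_of_real (integral ?S (\<lambda>t. norm (f2 q t)))) = exp (Re w * ln a) * norm (gexp_int (- of_real (Re w)) (pi / a * (norm (q + y))\<^sup>2))"
          by (simp add: norm_mult)
        then have le: "\<bar>h (q + y)\<bar> * \<bar>integral ?S (\<lambda>t. norm (f2 q t))\<bar> \<le> exp (Re w * ln a) * M q"
          using M(2)[OF q dual_shift_nonzero[OF y q], of "- of_real (Re w)"] by (simp add: mult.left_commute)
        have "integral ?S (\<lambda>t. norm (\<kappa> * v q * f2 q t)) = norm \<kappa> * (\<bar>h (q + y)\<bar> * integral ?S (\<lambda>t. norm (f2 q t)))"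
          unfolding norm_mult by (simp add: v_def norm_mult mult.assoc)
        then have "norm (integral ?S (\<lambda>t. norm (\<kappa> * v q * f2 q t))) = norm \<kappa> * (\<bar>h (q + y)\<bar> * \<bar>integral ?S (\<lambda>t. norm (f2 q t))\<bar>)"
          by (simp add: abs_mult)
        also have "\<dots> \<le> norm \<kappa> * (exp (Re w * ln a) * M q)" by (rule mult_left_mono[OF le]) simp
        finally show "norm (integral ?S (\<lambda>t. norm (\<kappa> * v q * f2 q t))) \<le> norm \<kappa> * exp (Re w * ln a) * M q"
          by (simp add: mult.assoc)
      qed
    qed
    have p3: "((\<lambda>q. \<kappa> * v q * f2 q t) has_sum g2 t) (dual_lattice_of A)" if tS: "t \<in> ?S" for t
    proof -
    have t: "t > 0" using tS by simp
    define e where "e q = complex_of_real (h (q + y) * exp (- (pi / t) * (norm (q + y))\<^sup>2)) * ephase (- (x \<bullet> q))" for q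
    define c where "c = (- \<i>) ^ m * complex_of_real (t powr (- real CARD('n) / 2 - real m) / \<bar>det A\<bar>)"
    have "pi / t > 0" using t by simp
    then have "(e has_sum theta_dual A h x y t) (dual_lattice_of A)"
      unfolding theta_dual_def e_def using summable_on_theta[OF dual_lattice_invertible[OF A] rp, of "pi / t" y]
      unfolding dual_lattice_of_def by (intro has_sum_infsum)
    then have "((\<lambda>q. (gamma_kernel s 0 t * c) * e q) has_sum (gamma_kernel s 0 t * c) * theta_dual A h x y t) (dual_lattice_of A)"
      by (rule has_sum_cmult_right)
    moreover have "(gamma_kernel s 0 t * c) * theta_dual A h x y t = g2 t"
      unfolding g2_def theta_harmonic[OF A t h, of x y] c_def by (simp add: mult.assoc)
    moreover have "(gamma_kernel s 0 t * c) * e q = \<kappa> * v q * f2 q t" for q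
    proof -
      have "complex_of_real (t powr (- real CARD('n) / 2 - real m)) = exp ((- of_nat CARD('n) / 2 - of_nat m) * of_real (ln t))"
        using t by (simp add: powr_def exp_of_real[symmetric] mult.commute)
      then have "gamma_kernel s 0 t * of_real (t powr (- real CARD('n) / 2 - real m)) * of_real (exp (- (pi / t) * (norm (q + y))\<^sup>2))
         = f2 q t"
        by (simp add: gamma_kernel_def f2_def w_def exp_add[symmetric] exp_of_real[symmetric] algebra_simps)
      then have "f2 q t = gamma_kernel s 0 t * of_real (t powr (- real CARD('n) / 2 - real m)) * of_real (exp (- (pi / t) * (norm (q + y))\<^sup>2))" ..
      then show ?thesis by (simp add: c_def e_def \<kappa>_def v_def mult_ac)
    qed
    ultimately show ?thesis by simp
    qed
  \<comment> \<open>Integrability of \<open>g2\<close> near t = 0 comes from the dual side; it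
    allows the integral of \<open>g1\<close> to be split into those of \<open>g2\<close> and of the
    constant term.\<close>
  have swap2: "g2 absolutely_integrable_on ?S"
     "((\<lambda>q. integral ?S (\<lambda>t. \<kappa> * v q * f2 q t)) has_sum integral ?S g2) (dual_lattice_of A)"
    by (rule has_sum_integral_swap(1)[OF cD SL p1 p2 p3], assumption+) (rule has_sum_integral_swap(2)[OF cD SL p1 p2 p3], assumption+)
  define Q where "Q = \<kappa> * exp (w * of_real (ln a)) * (\<Sum>\<^sub>\<infinity>q\<in>dual_lattice_of A. v q * gexp_int (- w) (pi / a * (norm (q + y))\<^sup>2))"
  have intg2: "integral ?S g2 = Q"
  proof -
    have "integral ?S g2 = (\<Sum>\<^sub>\<infinity>q\<in>dual_lattice_of A. integral ?S (\<lambda>t. \<kappa> * v q * f2 q t))"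
      by (rule infsumI[OF swap2(2), symmetric])
    also have "\<dots> = (\<Sum>\<^sub>\<infinity>q\<in>dual_lattice_of A. (\<kappa> * exp (w * of_real (ln a))) * (v q * gexp_int (- w) (pi / a * (norm (q + y))\<^sup>2)))"
      by (rule infsum_cong) (simp add: f2_int mult_ac)
    finally show ?thesis unfolding Q_def infsum_cmult_right' .
  qed
  have intg1: "integral ?S g1 = Q - \<delta> * exp (s * of_real (ln a)) / s"
  proof -
    have "g1 = (\<lambda>t. g2 t - \<delta> * gamma_kernel s 0 t)" by (simp add: g1_def g2_def fun_eq_iff algebra_simps)
    moreover have i2: "g2 integrable_on ?S" using swap2(1) by (simp add: absolutely_integrable_on_def)
    moreover have i1: "(\<lambda>t. \<delta> * gamma_kernel s 0 t) integrable_on ?S"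
      using integral_powr_kernel(1)[OF s0 a] by (intro integrable_on_mult_right) (simp add: absolutely_integrable_on_def)
    ultimately show ?thesis
      using Henstock_Kurzweil_Integration.integral_diff[OF i2 i1] integral_powr_kernel(2)[OF s0 a] intg2 by simp
  qed
  define P where "P = (\<Sum>\<^sub>\<infinity>z\<in>?\<Lambda> - {x}. u z * gexp_int s (pi * a * (norm (z - x))\<^sup>2))"
  have "((\<lambda>z. u z * gexp_int s (pi * a * (norm (z - x))\<^sup>2)) has_sum P) (?\<Lambda> - {x})"
    unfolding P_def u_def
    using gexp_sum_summable[OF A rp, of "pi * a" "?\<Lambda> - {x}" "- x" "\<lambda>z. ephase (- (y \<bullet> (z - x)))" s] a
    by (intro has_sum_infsum) simp
  then have "((\<lambda>z. exp (s * of_real (ln a)) * (u z * gexp_int s (pi * a * (norm (z - x))\<^sup>2))) has_sum exp (s * of_real (ln a)) * P) (?\<Lambda> - {x})"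
    by (rule has_sum_cmult_right)
  from has_sum_add[OF sum1 this]
  have "((\<lambda>z. u z * (exp (- s * of_real (ln (r z))) * Gamma s)) has_sum (integral ?S g1 + exp (s * of_real (ln a)) * P)) (?\<Lambda> - {x})"
  proof (rule has_sum_cong[THEN iffD1, rotated])
    fix z assume z: "z \<in> ?\<Lambda> - {x}"
    have "integral ?S (\<lambda>t. u z * gamma_kernel s (r z) t) = u z * (exp (- s * of_real (ln (r z))) * Gamma s - exp (s * of_real (ln a)) * gexp_int s (r z * a))"
      using integral_gamma_kernel_Ioc(2)[OF s0 rpos[OF z] a] by simp
    then show "integral ?S (\<lambda>t. u z * gamma_kernel s (r z) t) + exp (s * of_real (ln a)) * (u z * gexp_int s (pi * a * (norm (z - x))\<^sup>2))
       = u z * (exp (- s * of_real (ln (r z))) * Gamma s)"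
      by (simp add: r_def algebra_simps)
  qed
  then have hs: "((\<lambda>z. (rGamma s * exp (s * of_real (ln pi))) * (u z * (exp (- s * of_real (ln (r z))) * Gamma s))) has_sum
     (rGamma s * exp (s * of_real (ln pi))) * (integral ?S g1 + exp (s * of_real (ln a)) * P)) (?\<Lambda> - {x})"
    by (rule has_sum_cmult_right)
  have term_eq: "(rGamma s * exp (s * of_real (ln pi))) * (u z * (exp (- s * of_real (ln (r z))) * Gamma s))
     = u z * exp (- (2 * s) * of_real (ln (norm (z - x))))" if "z \<in> ?\<Lambda> - {x}" for z
  proof -
    have G: "rGamma s * Gamma s = 1" using sn by (simp add: Gamma_def rGamma_eq_zero_iff)
    have "ln (r z) = ln pi + 2 * ln (norm (z - x))"
      using that by (simp add: r_def ln_mult ln_realpow)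
    then have "exp (s * of_real (ln pi)) * exp (- s * of_real (ln (r z))) = exp (- (2 * s) * of_real (ln (norm (z - x))))"
      by (simp add: exp_add[symmetric] algebra_simps)
    then have "u z * (rGamma s * Gamma s) * (exp (s * of_real (ln pi)) * exp (- s * of_real (ln (r z)))) = u z * exp (- (2 * s) * of_real (ln (norm (z - x))))"
      unfolding G by simp
    then show ?thesis by (simp add: mult_ac)
  qed
  have val_eq: "(rGamma s * exp (s * of_real (ln pi))) * (integral ?S g1 + exp (s * of_real (ln a)) * P) = hecke_zeta A m h x y a s"
  proof -
    have "s \<noteq> 0" using s0 by auto
    \<comment> \<open>This removes the apparent pole at s = 0 caused by the term z = x.\<close>
    then have "rGamma s / s = rGamma (s + 1)" using rGamma_plus1[of s] by (simp add: field_simps)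
    then have d: "rGamma s * (\<delta> * exp (s * of_real (ln a)) / s) = exp (s * of_real (ln a)) * (\<delta> * rGamma (s + 1))"
      by (metis mult.assoc mult.commute times_divide_eq_right)
    have "hecke_zeta A m h x y a s = exp (s * of_real (ln pi)) * (exp (s * of_real (ln a)) * (rGamma s * P - \<delta> * rGamma (s + 1)) + rGamma s * Q)"
    proof -
      have w: "of_nat CARD('n) / 2 + of_nat m - s = - w" "s - of_nat CARD('n) / 2 - of_nat m = w" by (simp_all add: w_def)
      show ?thesis unfolding hecke_zeta_def w Q_def P_def u_def v_def \<kappa>_def \<delta>_def by simp
    qed
    moreover have "(rGamma s * exp (s * of_real (ln pi))) * (integral ?S g1 + exp (s * of_real (ln a)) * P)
        = exp (s * of_real (ln pi)) * (rGamma s * Q - rGamma s * (\<delta> * exp (s * of_real (ln a)) / s) + exp (s * of_real (ln a)) * (rGamma s * P))"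
      unfolding intg1 by (simp only: right_diff_distrib distrib_left mult_ac)
    ultimately show ?thesis unfolding d by (simp add: right_diff_distrib distrib_left mult_ac)
  qed
  show ?thesis
    unfolding u_def[symmetric] using has_sum_cong[THEN iffD1, OF term_eq hs, unfolded val_eq] .
qed

text \<open>The difference is meromorphic, hence zero or nonzero off a sparse set, and the half
  plane excludes the latter. So F has the finite limit G(s) at each point s, and a nicely
  meromorphic function takes its finite limits as values.\<close>

lemma nicely_meromorphic_on_unique:
  assumes F: "F nicely_meromorphic_on UNIV" and G: "G holomorphic_on UNIV"
    and eq: "\<And>s. Re s > c \<Longrightarrow> F s = G s"
  shows "F = G"
proof
  fix s
  have Ga: "G analytic_on UNIV" using G by (simp add: analytic_on_open)
  have mero: "(\<lambda>s. F s - G s) meromorphic_on UNIV"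
    using F analytic_on_imp_meromorphic_on[OF Ga]
    by (intro meromorphic_intros) (auto simp: nicely_meromorphic_on_def)
  have "(\<forall>\<^sub>\<approx>s\<in>UNIV. F s - G s = 0) \<or> (\<forall>\<^sub>\<approx>s\<in>UNIV. F s - G s \<noteq> 0)"
    by (rule meromorphic_imp_constant_or_avoid[OF mero]) auto
  moreover have "\<not> (\<forall>\<^sub>\<approx>s\<in>UNIV. F s - G s \<noteq> 0)"
  proof
    assume "\<forall>\<^sub>\<approx>s\<in>UNIV. F s - G s \<noteq> 0"
    then have "eventually (\<lambda>s. F s - G s \<noteq> 0) (at (of_real (c + 1)))"
      by (auto simp: eventually_cosparse_open_eq)
    moreover have "eventually (\<lambda>s. s \<in> {s. Re s > c}) (at (complex_of_real (c + 1)))"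
      by (rule eventually_at_in_open') (auto simp: open_halfspace_Re_gt)
    ultimately have "eventually (\<lambda>s. False) (at (complex_of_real (c + 1)))"
      by eventually_elim (use eq in auto)
    then show False by simp
  qed
  ultimately have "\<forall>\<^sub>\<approx>s\<in>UNIV. F s - G s = 0" by blast
  then have ev: "eventually (\<lambda>s. F s = G s) (at s)"
    by (auto simp: eventually_cosparse_open_eq)
  have "G \<midarrow>s\<rightarrow> G s"
    using Ga analytic_at_imp_isCont analytic_on_analytic_at isContD by blast
  then have lim: "F \<midarrow>s\<rightarrow> G s" using tendsto_cong[OF ev] by blast
  then have "\<not> is_pole F s" using not_tendsto_and_filterlim_at_infinity[of "at s" F "G s"] by (auto simp: is_pole_def)
  then have "F \<midarrow>s\<rightarrow> F s" using F by (auto simp: nicely_meromorphic_on_def)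
  then show "F s = G s" using lim tendsto_unique[of "at s"] by auto
qed

text \<open>The factor |z - x|^(2k) beside h_k lowers the exponent \<nu> by 2k, which explains s =
  \<nu>/2 - k. The phase e(-y z) is that of \<open>hecke_zeta\<close> times e(-y x), a factor that
  the regularized function later removes.\<close>

lemma epstein_zeta_eq:
  fixes A :: "real^'n^'n" and \<alpha> :: "nat^'n"
  assumes A: "invertible A" and y: "y \<notin> dual_lattice_of A" and a: "a > 0"
  shows "epstein_zeta (lattice_of A) \<nu> \<alpha> x y = ephase (- (y \<bullet> x)) *
    (\<Sum>k = 0..mi_size \<alpha> div 2. hecke_zeta A (mi_size \<alpha> - 2 * k) (harmonic_part \<alpha> k) x y a (\<nu> / 2 - of_nat k))"
proof -
  let ?n = "mi_size \<alpha>" and ?I = "lattice_of A - {x}"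
  let ?K = "{0..?n div 2}"
  let ?H = "\<lambda>k. hecke_zeta A (?n - 2 * k) (harmonic_part \<alpha> k) x y a"
  define F where "F \<nu> = ephase (- (y \<bullet> x)) * (\<Sum>k\<in>?K. ?H k (\<nu> / 2 - of_nat k))" for \<nu>
  define t where "t \<nu> z = exp (- 2 * of_real pi * \<i> * of_real (y \<bullet> z)) * of_real (mi_power (z - x) \<alpha>)
               * of_real (norm (z - x)) powr (- \<nu>)" for \<nu> z
  have hp: "homogeneous_polynomial (?n - 2 * k) (harmonic_part \<alpha> k)" "harmonic (harmonic_part \<alpha> k)" if "k \<in> ?K" for k
    using harmonic_part_props[of k \<alpha>] that by auto
  have Fhol: "F holomorphic_on UNIV"
  proof -
    have "(\<lambda>\<nu>. ?H k (\<nu> / 2 - of_nat k)) holomorphic_on UNIV" if "k \<in> ?K" for k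
    proof -
      have "(?H k \<circ> (\<lambda>\<nu>. \<nu> / 2 - of_nat k)) holomorphic_on UNIV"
        by (rule holomorphic_on_compose_gen[OF _ hecke_zeta_holomorphic[OF A y homogeneous_polynomialD(1)[OF hp(1)[OF that]] a]])
          (auto intro!: holomorphic_intros)
      then show ?thesis by (simp add: o_def)
    qed
    then show ?thesis unfolding F_def[abs_def] by (intro holomorphic_intros) auto
  qed
  have Fsum: "(t \<nu> has_sum F \<nu>) ?I" if \<nu>: "Re \<nu> > real (CARD('n) + ?n)" for \<nu>
  proof -
    let ?s = "\<lambda>k. \<nu> / 2 - of_nat k"
    have "((\<lambda>z. of_real (harmonic_part \<alpha> k (z - x)) * ephase (- (y \<bullet> (z - x))) * exp (- (2 * ?s k) * of_real (ln (norm (z - x)))))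
      has_sum ?H k (?s k)) ?I" if "k \<in> ?K" for k
      using \<nu> that by (intro hecke_zeta_has_sum[OF A y a hp[OF that]]) (auto simp: field_simps)
    then have "((\<lambda>z. \<Sum>k\<in>?K. of_real (harmonic_part \<alpha> k (z - x)) * ephase (- (y \<bullet> (z - x))) * exp (- (2 * ?s k) * of_real (ln (norm (z - x)))))
      has_sum (\<Sum>k\<in>?K. ?H k (?s k))) ?I"
      by (intro has_sum_sum) auto
    then have "((\<lambda>z. ephase (- (y \<bullet> x)) * (\<Sum>k\<in>?K. of_real (harmonic_part \<alpha> k (z - x)) * ephase (- (y \<bullet> (z - x))) * exp (- (2 * ?s k) * of_real (ln (norm (z - x))))))
      has_sum F \<nu>) ?I"
      unfolding F_def by (rule has_sum_cmult_right)
    moreover have "ephase (- (y \<bullet> x)) * (\<Sum>k\<in>?K. of_real (harmonic_part \<alpha> k (z - x)) * ephase (- (y \<bullet> (z - x))) * exp (- (2 * ?s k) * of_real (ln (norm (z - x)))))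
       = t \<nu> z" if "z \<in> ?I" for z
    proof -
      let ?r = "norm (z - x)"
      have r: "?r > 0" using that by simp
      have e: "ephase (- (y \<bullet> x)) * ephase (- (y \<bullet> (z - x))) = exp (- 2 * of_real pi * \<i> * of_real (y \<bullet> z))"
        by (simp add: ephase_add[symmetric] inner_diff_right) (simp add: ephase_def)
      have p: "exp (- (2 * ?s k) * of_real (ln ?r)) = of_real (?r ^ (2 * k)) * of_real ?r powr (- \<nu>)" for k
      proof -
        have "complex_of_real (?r ^ (2 * k)) = exp (of_real (real (2 * k) * ln ?r))"
          using r by (simp only: exp_of_real exp_of_nat_mult exp_ln)
        moreover have "of_real ?r powr (- \<nu>) = exp (- \<nu> * of_real (ln ?r))"
          using r by (simp add: powr_def Ln_of_real)
        ultimately show ?thesis by (simp add: exp_add[symmetric] algebra_simps)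
      qed
      have "ephase (- (y \<bullet> x)) * (\<Sum>k\<in>?K. of_real (harmonic_part \<alpha> k (z - x)) * ephase (- (y \<bullet> (z - x))) * exp (- (2 * ?s k) * of_real (ln ?r)))
         = (ephase (- (y \<bullet> x)) * ephase (- (y \<bullet> (z - x)))) * of_real (\<Sum>k\<in>?K. ?r ^ (2 * k) * harmonic_part \<alpha> k (z - x)) * of_real ?r powr (- \<nu>)"
        unfolding p of_real_sum sum_distrib_left sum_distrib_right by (rule sum.cong) (simp_all add: mult_ac)
      then show ?thesis unfolding t_def e mi_power_eq_harmonic_parts .
    qed
    ultimately show ?thesis by (rule has_sum_cong[THEN iffD1, rotated])
  qed
  have "epstein_zeta (lattice_of A) \<nu> \<alpha> x y = F \<nu>"
    unfolding epstein_zeta_def t_def[symmetric]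
  proof (rule arg_cong[where f = "\<lambda>F. F \<nu>"], rule the_equality)
    show "F nicely_meromorphic_on UNIV \<and> (\<forall>\<nu>. Re \<nu> > real (CARD('n) + ?n) \<longrightarrow> ((\<lambda>z. t \<nu> z) has_sum F \<nu>) ?I)"
      using Fsum Fhol by (auto intro!: analytic_on_imp_nicely_meromorphic_on simp: analytic_on_open)
  next
    fix F' assume F': "F' nicely_meromorphic_on UNIV \<and> (\<forall>\<nu>. Re \<nu> > real (CARD('n) + ?n) \<longrightarrow> ((\<lambda>z. t \<nu> z) has_sum F' \<nu>) ?I)"
    show "F' = F"
      using F' Fsum by (intro nicely_meromorphic_on_unique[OF _ Fhol, of _ "real (CARD('n) + ?n)"]) (auto dest!: has_sum_unique)
  qed
  then show ?thesis by (simp add: F_def)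
qed

section \<open>Derivatives of the singular part\<close>

text \<open>Up to a constant, the coefficient of \<open>h\<^bsub>k,\<alpha>\<^esub>\<close> in \<open>\<partial>\<^sup>\<alpha> s\<close> as a function of \<open>r = |y|\<^sup>2\<close>, where \<open>n = |\<alpha>|\<close>:
  differentiation lowers the exponent of \<open>r\<close>, and the logarithm of the case \<open>\<nu> = d + 2l\<close> disappears once
  \<open>n > l + k\<close>.\<close>

definition s_hat_profile :: "nat \<Rightarrow> complex \<Rightarrow> nat \<Rightarrow> nat \<Rightarrow> real \<Rightarrow> complex" where
  "s_hat_profile d \<nu> n k r =
     (if \<exists>l::nat. \<nu> = of_nat d + 2 * of_nat l \<and> n \<le> l + k
      then let l = (THE l::nat. \<nu> = of_nat d + 2 * of_nat l) in
        of_real ((- 1) ^ (l + k - n + 1) / fact (l + k - n) * (pi * r) ^ (l + k - n) * (ln (pi * r) + H_const l k n d))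
      else Gamma ((of_nat d - \<nu>) / 2 + of_nat n - of_nat k)
        * of_real (pi * r) powr ((\<nu> - of_nat d) / 2 - of_nat n + of_nat k))"

lemma s_hat_profile_log:
  assumes "n \<le> l + k"
  shows "s_hat_profile d (of_nat d + 2 * of_nat l) n k r =
    of_real ((- 1) ^ (l + k - n + 1) / fact (l + k - n) * (pi * r) ^ (l + k - n) * (ln (pi * r) + H_const l k n d))"
proof -
  have "(THE l'::nat. of_nat d + 2 * of_nat l = (of_nat d + 2 * of_nat l' :: complex)) = l"
    by (rule the_equality) auto
  moreover have "\<exists>l'::nat. of_nat d + 2 * of_nat l = (of_nat d + 2 * of_nat l' :: complex) \<and> n \<le> l' + k" using assms by auto
  ultimately show ?thesis by (simp add: s_hat_profile_def)
qed

lemma s_hat_profile_power: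
  assumes "\<And>l::nat. \<nu> = of_nat d + 2 * of_nat l \<Longrightarrow> l + k < n"
  shows "s_hat_profile d \<nu> n k r = Gamma ((of_nat d - \<nu>) / 2 + of_nat n - of_nat k)
        * of_real (pi * r) powr ((\<nu> - of_nat d) / 2 - of_nat n + of_nat k)"
proof -
  have "\<not> (\<exists>l::nat. \<nu> = of_nat d + 2 * of_nat l \<and> n \<le> l + k)"
  proof
    assume "\<exists>l::nat. \<nu> = of_nat d + 2 * of_nat l \<and> n \<le> l + k"
    then obtain l :: nat where "\<nu> = of_nat d + 2 * of_nat l" "n \<le> l + k" by blast
    with assms[of l] show False by simp
  qed
  then show ?thesis unfolding s_hat_profile_def by (simp only: if_False)
qed

text \<open>In the power branch \<Gamma> is evaluated off its poles: argument -i would mean \<nu> =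
  d + 2l with l = n - k + i, hence l + k \<ge> n, which is the logarithmic branch.\<close>

lemma s_hat_profile_exponent:
  fixes \<nu> :: complex
  assumes "\<And>l::nat. \<nu> = of_nat d + 2 * of_nat l \<Longrightarrow> l + k < n" "k \<le> n"
  shows "(of_nat d - \<nu>) / 2 + of_nat n - of_nat k \<notin> \<int>\<^sub>\<le>\<^sub>0"
proof
  assume "(of_nat d - \<nu>) / 2 + of_nat n - of_nat k \<in> \<int>\<^sub>\<le>\<^sub>0"
  then obtain i :: nat where i: "(of_nat d - \<nu>) / 2 + of_nat n - of_nat k = - of_nat i"
    unfolding range_neg_nat[symmetric] by auto
  have "2 * ((of_nat d - \<nu>) / 2 + of_nat n - of_nat k) = - 2 * of_nat i" unfolding i by simp
  then have "of_nat d - \<nu> + 2 * of_nat n - 2 * of_nat k = - 2 * of_nat i" by (simp add: diff_divide_distrib right_diff_distrib distrib_left)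
  then have "\<nu> = of_nat d + 2 * (of_nat n - of_nat k + of_nat i)" by algebra
  then have "\<nu> = of_nat d + 2 * of_nat (n - k + i)" using assms(2) by (simp add: of_nat_diff)
  from assms(1)[OF this] assms(2) show False by simp
qed

lemma DERIV_power_times_log:
  fixes r :: real
  assumes r: "r > 0"
  shows "((\<lambda>r. c * (pi * r) ^ j * (ln (pi * r) + H)) has_real_derivative
     c * (of_nat j * (pi * r) ^ (j - 1) * pi * (ln (pi * r) + H) + (pi * r) ^ j / r)) (at r)"
proof -
  have p: "((\<lambda>r. pi * r) has_real_derivative pi) (at r)" by (auto intro!: derivative_eq_intros)
  have "((\<lambda>r. (pi * r) ^ j) has_real_derivative of_nat j * (pi * (pi * r) ^ (j - 1))) (at r)"
    using DERIV_power[OF p, of j] by simp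
  moreover have "((\<lambda>r. ln (pi * r) + H) has_real_derivative (1 / (pi * r) * pi + 0)) (at r)"
    using r by (intro DERIV_add DERIV_chain2[OF DERIV_ln_divide p] DERIV_const) simp
  ultimately have "((\<lambda>r. (pi * r) ^ j * (ln (pi * r) + H)) has_real_derivative
     of_nat j * (pi * (pi * r) ^ (j - 1)) * (ln (pi * r) + H) + (1 / (pi * r) * pi + 0) * (pi * r) ^ j) (at r)"
    by (rule DERIV_mult)
  from DERIV_cmult[OF this, of c] show ?thesis using r by (simp add: mult_ac)
qed

text \<open>In the logarithmic branch put j = l + k - n. Differentiating (\<pi> r)^j times the
  logarithm adds 1 / j to the constant beside it, which is the passage from -H_j to -H_(j-1) in
  \<open>H_const\<close>. For j = 0 the derivative is a multiple of 1 / r, and this is the power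
  branch with \<Gamma>(1).\<close>

lemma s_hat_profile_has_vector_derivative:
  assumes r: "r > 0" and k: "k \<le> n"
  shows "(s_hat_profile d \<nu> n k has_vector_derivative - of_real pi * s_hat_profile d \<nu> (Suc n) k r) (at r)"
proof (cases "\<exists>l::nat. \<nu> = of_nat d + 2 * of_nat l \<and> n \<le> l + k")
  case True
  then obtain l :: nat where \<nu>: "\<nu> = of_nat d + 2 * of_nat l" and l: "n \<le> l + k" by blast
  let ?j = "l + k - n" and ?H = "H_const l k n d"
  have P: "s_hat_profile d \<nu> n k = (\<lambda>r. of_real ((- 1) ^ (?j + 1) / fact ?j * (pi * r) ^ ?j * (ln (pi * r) + ?H)))"
    unfolding \<nu> by (rule ext, rule s_hat_profile_log[OF l])
  have D: "((\<lambda>r. (- 1) ^ (?j + 1) / fact ?j * (pi * r) ^ ?j * (ln (pi * r) + ?H)) has_real_derivative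
     (- 1) ^ (?j + 1) / fact ?j * (of_nat ?j * (pi * r) ^ (?j - 1) * pi * (ln (pi * r) + ?H) + (pi * r) ^ ?j / r)) (at r)"
    by (rule DERIV_power_times_log[OF r])
  have E: "- of_real pi * s_hat_profile d \<nu> (Suc n) k r = of_real ((- 1) ^ (?j + 1) / fact ?j * (of_nat ?j * (pi * r) ^ (?j - 1) * pi * (ln (pi * r) + ?H) + (pi * r) ^ ?j / r))"
  proof (cases "?j")
    case 0
    then have nlk: "(of_nat n :: complex) = of_nat l + of_nat k" using l by (simp flip: of_nat_add)
    have "l + k < Suc n" using 0 by simp
    then have "s_hat_profile d \<nu> (Suc n) k r = Gamma ((of_nat d - \<nu>) / 2 + of_nat (Suc n) - of_nat k)
        * of_real (pi * r) powr ((\<nu> - of_nat d) / 2 - of_nat (Suc n) + of_nat k)"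
      by (intro s_hat_profile_power) (simp add: \<nu>)
    also have "(of_nat d - \<nu>) / 2 + of_nat (Suc n) - of_nat k = 1"
      by (simp add: \<nu> nlk)
    also have "(\<nu> - of_nat d) / 2 - of_nat (Suc n) + of_nat k = - 1"
      by (simp add: \<nu> nlk)
    finally show ?thesis using 0 r by (simp add: powr_minus divide_simps mult_ac)
  next
    case (Suc i)
    then have l': "Suc n \<le> l + k" and i: "l + k - Suc n = i" by simp_all
    have H: "H_const l k (Suc n) d = ?H + 1 / real (Suc i)"
      unfolding H_const_def i Suc by (simp add: harm_Suc inverse_eq_divide)
    have "s_hat_profile d \<nu> (Suc n) k r = of_real ((- 1) ^ (i + 1) / fact i * (pi * r) ^ i * (ln (pi * r) + (?H + 1 / real (Suc i))))"
      unfolding \<nu> s_hat_profile_log[OF l'] i H ..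
    moreover have "- pi * ((- 1) ^ (i + 1) / fact i * (pi * r) ^ i * (ln (pi * r) + (?H + 1 / real (Suc i))))
       = (- 1) ^ (Suc i + 1) / fact (Suc i) * (of_nat (Suc i) * (pi * r) ^ (Suc i - 1) * pi * (ln (pi * r) + ?H) + (pi * r) ^ Suc i / r)"
    proof -
      define L where "L = ln (pi * r) + ?H"
      have "- pi * ((- 1) ^ (i + 1) / fact i * (pi * r) ^ i * (L + 1 / real (Suc i)))
       = (- 1) ^ (Suc i + 1) / fact (Suc i) * (of_nat (Suc i) * (pi * r) ^ (Suc i - 1) * pi * L + (pi * r) ^ Suc i / r)"
        using r by (simp add: divide_simps) (simp add: algebra_simps)
      then show ?thesis by (simp add: L_def add.assoc)
    qed
    ultimately show ?thesis unfolding Suc by (simp only: of_real_mult[symmetric] of_real_minus[symmetric])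
  qed
  show ?thesis unfolding E P using has_vector_derivative_of_real[OF D] .
next
  case False
  have c: "l + k < n" if "\<nu> = of_nat d + 2 * of_nat l" for l :: nat using False that by force
  have c': "l + k < Suc n" if "\<nu> = of_nat d + 2 * of_nat l" for l :: nat using c[OF that] by simp
  let ?\<sigma> = "(of_nat d - \<nu>) / 2 + of_nat n - of_nat k"
  have P: "s_hat_profile d \<nu> n k = (\<lambda>r. Gamma ?\<sigma> * of_real (pi * r) powr (- ?\<sigma>))"
    by (rule ext) (simp add: s_hat_profile_power[OF c] algebra_simps diff_divide_distrib)
  have "s_hat_profile d \<nu> (Suc n) k r = Gamma (?\<sigma> + 1) * of_real (pi * r) powr (- ?\<sigma> - 1)"
    by (simp add: s_hat_profile_power[OF c'] algebra_simps diff_divide_distrib)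
  also have "Gamma (?\<sigma> + 1) = ?\<sigma> * Gamma ?\<sigma>"
    by (rule Gamma_plus1) (use s_hat_profile_exponent[OF c k] in auto)
  finally have Q: "- of_real pi * s_hat_profile d \<nu> (Suc n) k r = Gamma ?\<sigma> * (- ?\<sigma> * of_real (pi * r) powr (- ?\<sigma> - 1) * of_real pi)"
    by (simp only: mult_minus_left mult_minus_right mult_ac)
  have "((\<lambda>z. (of_real pi * z) powr (- ?\<sigma>)) has_field_derivative (- ?\<sigma> * (of_real pi * of_real r) powr (- ?\<sigma> - 1) * of_real pi)) (at (of_real r))"
    using mult_pos_pos[OF pi_gt_zero r] by (auto intro!: derivative_eq_intros simp: complex_nonpos_Reals_iff)
  then have "((\<lambda>r. (of_real pi * of_real r) powr (- ?\<sigma>)) has_vector_derivative (- ?\<sigma> * (of_real pi * of_real r) powr (- ?\<sigma> - 1) * of_real pi)) (at r)"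
    by (rule has_vector_derivative_real_field)
  then have "((\<lambda>r. of_real (pi * r) powr (- ?\<sigma>)) has_vector_derivative (- ?\<sigma> * of_real (pi * r) powr (- ?\<sigma> - 1) * of_real pi)) (at r)"
    by simp
  from has_vector_derivative_mult_right[OF this, of "Gamma ?\<sigma>"] show ?thesis unfolding P Q .
qed

text \<open>In the power branch this is the functional equation of \<Gamma>. In the logarithmic
  branch it is the recursion of the digamma function at b = l + d/2 - k - 1 = \<nu>/2 - (k + 1), and
  this dictates the digamma part of \<open>H_const\<close>.\<close>

lemma s_hat_profile_lower:
  assumes r: "r > 0" and k: "2 * k < n" and d: "d > 0"
  shows "2 * (\<nu> / 2 - of_nat (Suc k)) * s_hat_profile d \<nu> (Suc n) (Suc k) r =
     of_real (real d + 2 * real (n - 2 * k) - 2) * s_hat_profile d \<nu> n k r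
     - 2 * of_real (pi * r) * s_hat_profile d \<nu> (Suc n) k r"
proof (cases "\<exists>l::nat. \<nu> = of_nat d + 2 * of_nat l \<and> n \<le> l + k")
  case True
  then obtain l :: nat where \<nu>: "\<nu> = of_nat d + 2 * of_nat l" and l: "n \<le> l + k" by blast
  define j where "j = l + k - n"
  define B where "B = (- 1) ^ (j + 1) / fact j * (pi * r) ^ j"
  define L where "L = ln (pi * r) + H_const l k n d"
  \<comment> \<open>From n \<le> l + k and 2 k < n; it keeps b positive, away from the poles of the
    digamma function.\<close>
  have lk: "l > k" using l k by simp
  have P: "s_hat_profile d \<nu> n k r = of_real (B * L)"
    unfolding \<nu> s_hat_profile_log[OF l] B_def L_def j_def by simp
  have j': "l + Suc k - Suc n = j" by (simp add: j_def)
  define b where "b = real l + real d / 2 - real k - 1"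
  have b: "b > 0" using lk d by (simp add: b_def)
  have "Digamma (b + 1) = Digamma b + 1 / b" using b by (intro Digamma_plus1) simp
  then have H: "H_const l (Suc k) (Suc n) d = H_const l k n d + 1 / b"
    unfolding H_const_def j' j_def by (simp add: b_def algebra_simps)
  have P1: "s_hat_profile d \<nu> (Suc n) (Suc k) r = of_real (B * (L + 1 / b))"
    using l unfolding \<nu> by (subst s_hat_profile_log) (simp_all add: j_def B_def L_def H add.assoc)
  \<comment> \<open>The profile at n + 1 is read off from the derivative of the one at n, which
    covers the change of branch at j = 0 as well.\<close>
  have P2: "- of_real (pi * r) * s_hat_profile d \<nu> (Suc n) k r = of_real (B * (real j * L + 1))"
  proof -
    have D: "(s_hat_profile d \<nu> n k has_vector_derivative - of_real pi * s_hat_profile d \<nu> (Suc n) k r) (at r)"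
      using r k by (intro s_hat_profile_has_vector_derivative) auto
    have "((\<lambda>r. (- 1) ^ (j + 1) / fact j * (pi * r) ^ j * (ln (pi * r) + H_const l k n d)) has_real_derivative
       B * (real j * L + 1) / r) (at r)"
    proof -
      have "real j * (pi * r) ^ (j - 1) * pi = (pi * r) ^ j * real j / r" using r by (cases j) auto
      then have e: "real j * (pi * r) ^ (j - 1) * pi * (ln (pi * r) + H_const l k n d) + (pi * r) ^ j / r = (pi * r) ^ j * (real j * L + 1) / r"
        unfolding L_def[symmetric] by (simp add: add_divide_distrib distrib_left mult_ac)
      show ?thesis
        using DERIV_power_times_log[OF r, of "(- 1) ^ (j + 1) / fact j" j "H_const l k n d"] unfolding e by (simp add: B_def mult.assoc)
    qed
    then have "((\<lambda>r. complex_of_real ((- 1) ^ (j + 1) / fact j * (pi * r) ^ j * (ln (pi * r) + H_const l k n d))) has_vector_derivative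
       of_real (B * (real j * L + 1) / r)) (at r)"
      by (rule has_vector_derivative_of_real)
    moreover have "s_hat_profile d \<nu> n k = (\<lambda>r. complex_of_real ((- 1) ^ (j + 1) / fact j * (pi * r) ^ j * (ln (pi * r) + H_const l k n d)))"
      unfolding \<nu> j_def by (rule ext, rule s_hat_profile_log[OF l])
    ultimately have "- of_real pi * s_hat_profile d \<nu> (Suc n) k r = of_real (B * (real j * L + 1) / r)"
      using D vector_derivative_unique_at by metis
    then have "of_real r * (- of_real pi * s_hat_profile d \<nu> (Suc n) k r) = of_real (r * (B * (real j * L + 1) / r))" by simp
    then show ?thesis using r by (simp add: mult_ac)
  qed
  have "2 * (\<nu> / 2 - of_nat (Suc k)) * s_hat_profile d \<nu> (Suc n) (Suc k) r = of_real (2 * b * (B * (L + 1 / b)))"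
  proof -
    have "2 * (\<nu> / 2 - of_nat (Suc k)) = complex_of_real (2 * b)"
      by (simp add: \<nu> b_def add_divide_distrib algebra_simps)
    then show ?thesis unfolding P1 by (simp only: of_real_mult)
  qed
  also have "2 * b * (B * (L + 1 / b)) = 2 * b * (B * L) + 2 * B" using b by (simp add: field_simps)
  also have "\<dots> = (real d + 2 * real (n - 2 * k) - 2) * (B * L) + 2 * (B * (real j * L + 1))"
    using k l by (simp add: b_def j_def of_nat_diff algebra_simps)
  also have "complex_of_real \<dots> = of_real (real d + 2 * real (n - 2 * k) - 2) * of_real (B * L) + 2 * of_real (B * (real j * L + 1))"
    by simp
  finally show ?thesis unfolding P[symmetric] P2[symmetric] by (simp add: mult.assoc)
next
  case False
  have c: "l + k < n" if "\<nu> = of_nat d + 2 * of_nat l" for l :: nat using False that by force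
  have c': "l + k < Suc n" if "\<nu> = of_nat d + 2 * of_nat l" for l :: nat using c[OF that] by simp
  have c'': "l + Suc k < Suc n" if "\<nu> = of_nat d + 2 * of_nat l" for l :: nat using c[OF that] by simp
  define \<sigma> where "\<sigma> = (of_nat d - \<nu>) / 2 + of_nat n - of_nat k"
  have kn: "k \<le> n" using k by simp
  have P: "s_hat_profile d \<nu> n k r = Gamma \<sigma> * of_real (pi * r) powr (- \<sigma>)"
    by (simp add: s_hat_profile_power[OF c] \<sigma>_def algebra_simps diff_divide_distrib)
  have P1: "s_hat_profile d \<nu> (Suc n) (Suc k) r = Gamma \<sigma> * of_real (pi * r) powr (- \<sigma>)"
    by (simp add: s_hat_profile_power[OF c''] \<sigma>_def algebra_simps diff_divide_distrib)
  have "s_hat_profile d \<nu> (Suc n) k r = Gamma (\<sigma> + 1) * of_real (pi * r) powr (- \<sigma> - 1)"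
    by (simp add: s_hat_profile_power[OF c'] \<sigma>_def algebra_simps diff_divide_distrib)
  also have "Gamma (\<sigma> + 1) = \<sigma> * Gamma \<sigma>"
    unfolding \<sigma>_def by (rule Gamma_plus1) (use s_hat_profile_exponent[OF c kn] in auto)
  also have "complex_of_real (pi * r) powr (- \<sigma> - 1) = of_real (pi * r) powr (- \<sigma>) / of_real (pi * r)"
    using r by (subst powr_diff) auto
  finally have P2: "of_real (pi * r) * s_hat_profile d \<nu> (Suc n) k r = \<sigma> * (Gamma \<sigma> * of_real (pi * r) powr (- \<sigma>))"
    using r by (simp add: field_simps)
  have e: "2 * (\<nu> / 2 - of_nat (Suc k)) = of_real (real d + 2 * real (n - 2 * k) - 2) - 2 * \<sigma>"
    using k by (simp add: \<sigma>_def of_nat_diff field_simps)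
  show ?thesis unfolding P P1 e by (simp only: left_diff_distrib mult.assoc P2)
qed

text \<open>At n = k = 0 the constant \<open>H_const\<close> is 0, so the profile has the bare
  logarithm of \<open>s_hat\<close>.\<close>

lemma s_hat_eq_profile:
  fixes y :: "real^'n"
  shows "s_hat \<nu> y = of_real pi powr (\<nu> / 2) * rGamma (\<nu> / 2) * s_hat_profile CARD('n) \<nu> 0 0 ((norm y)\<^sup>2)"
proof (cases "\<exists>l::nat. \<nu> = of_nat CARD('n) + 2 * of_nat l")
  case True
  then obtain l :: nat where \<nu>: "\<nu> = of_nat CARD('n) + 2 * of_nat l" by blast
  have the: "(THE l'::nat. \<nu> = of_nat CARD('n) + 2 * of_nat l') = l"
    unfolding \<nu> by (rule the_equality) auto
  let ?a = "real l + real CARD('n) / 2"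
  have a: "\<nu> / 2 = of_real ?a" "?a > 0" by (simp_all add: \<nu> add_divide_distrib add_nonneg_pos)
  have "of_real pi powr (\<nu> / 2) * rGamma (\<nu> / 2) = complex_of_real (pi powr ?a / Gamma ?a)"
    unfolding a(1) using a(2) powr_of_real[of pi ?a] by (simp only: rGamma_inverse_Gamma Gamma_complex_of_real inverse_eq_divide of_real_divide pi_ge_zero) simp
  moreover have "s_hat_profile CARD('n) \<nu> 0 0 ((norm y)\<^sup>2)
    = of_real ((- 1) ^ (l + 1) / fact l * (pi * (norm y)\<^sup>2) ^ l * ln (pi * (norm y)\<^sup>2))"
    unfolding \<nu> by (subst s_hat_profile_log) (simp_all add: H_const_def)
  ultimately show ?thesis
    unfolding s_hat_def Let_def the using True by (simp only: if_True mult.assoc of_real_mult)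
next
  case False
  then have "s_hat_profile CARD('n) \<nu> 0 0 ((norm y)\<^sup>2)
     = Gamma ((of_nat CARD('n) - \<nu>) / 2) * of_real (pi * (norm y)\<^sup>2) powr ((\<nu> - of_nat CARD('n)) / 2)"
    by (subst s_hat_profile_power) auto
  with False show ?thesis by (simp add: s_hat_def)
qed

text \<open>The constants \<open>C n k\<close> absorb what the two profile recursions leave over: a
  factor -2 \<pi> for each derivative and, whenever k is raised, a sign and the factor by which
  \<pi>^s / \<Gamma>(s) changes as s drops from \<nu>/2 - k by 1.\<close>

lemma mi_derivative_s_hat:
  fixes y :: "real^'n"
  assumes "y \<noteq> 0"
  shows "mi_derivative \<alpha> (s_hat \<nu>) y = (\<Sum>k = 0..mi_size \<alpha> div 2. of_real (harmonic_part \<alpha> k y) *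
     ((- 2 * of_real pi) ^ mi_size \<alpha> * (- 1) ^ k * of_real pi powr (\<nu> / 2 - of_nat k) * rGamma (\<nu> / 2 - of_nat k)
       * s_hat_profile CARD('n) \<nu> (mi_size \<alpha>) k ((norm y)\<^sup>2)))"
proof -
  let ?d = "CARD('n)" and ?n = "mi_size \<alpha>"
  define js where "js = (SOME js. \<forall>j. count_list js j = \<alpha> $ j)"
  have js: "count_list js j = \<alpha> $ j" for j
    using someI_ex[OF exists_list_counts[of \<alpha>]] by (simp add: js_def)
  define C where "C n k = (- 2 * of_real pi) ^ n * (- 1) ^ k * of_real pi powr (\<nu> / 2 - of_nat k) * rGamma (\<nu> / 2 - of_nat k)" for n k :: nat
  define \<Phi> where "\<Phi> n k r = C n k * s_hat_profile ?d \<nu> n k r" for n k r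
  define \<Phi>' where "\<Phi>' n k r = C n k * (- of_real pi * s_hat_profile ?d \<nu> (Suc n) k r)" for n k r
  have Csuc: "C (Suc n) k = - 2 * of_real pi * C n k" for n k by (simp add: C_def)
  have Csuc2: "C (Suc n) (Suc k) = 2 * (\<nu> / 2 - of_nat (Suc k)) * C n k" for n k
  proof -
    let ?z = "\<nu> / 2 - of_nat (Suc k)"
    have z: "\<nu> / 2 - of_nat k = ?z + 1" by simp
    have p: "complex_of_real pi powr (\<nu> / 2 - of_nat k) = of_real pi powr ?z * of_real pi" unfolding z by (simp only: powr_add) simp
    have g: "rGamma ?z = ?z * rGamma (\<nu> / 2 - of_nat k)" unfolding z by (rule rGamma_plus1[symmetric])
    show ?thesis unfolding C_def g p power_Suc by (simp only: mult_ac) simp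
  qed
  have "mi_derivative \<alpha> (s_hat \<nu>) y = foldr partial_derivative js (\<lambda>y. \<Phi> 0 0 ((norm y)\<^sup>2)) y"
    unfolding mi_derivative_def js_def[symmetric] by (simp add: \<Phi>_def C_def s_hat_eq_profile[abs_def] fun_eq_iff)
  also have "\<dots> = (\<Sum>k\<le>length js. of_real (harm_comp js k y) * \<Phi> (length js) k ((norm y)\<^sup>2))"
  proof (rule iterated_partial_derivative_radial[OF _ _ _ assms])
    fix n k r assume r: "(r::real) > 0"
    show "(\<Phi> n k has_vector_derivative \<Phi>' n k r) (at r)" if k: "2 * k \<le> n"
      unfolding \<Phi>_def[abs_def] \<Phi>'_def using r k by (intro has_vector_derivative_mult_right s_hat_profile_has_vector_derivative) auto
    show "\<Phi> (Suc n) k r = 2 * \<Phi>' n k r" by (simp add: \<Phi>_def \<Phi>'_def Csuc)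
    show "\<Phi> (Suc n) (Suc k) r = of_real (real ?d + 2 * real (n - 2 * k) - 2) * \<Phi> n k r + 2 * of_real r * \<Phi>' n k r" if k: "2 * k < n"
    proof -
      have "\<Phi> (Suc n) (Suc k) r = C n k * (2 * (\<nu> / 2 - of_nat (Suc k)) * s_hat_profile ?d \<nu> (Suc n) (Suc k) r)"
        by (simp only: \<Phi>_def Csuc2 mult_ac)
      also have "2 * (\<nu> / 2 - of_nat (Suc k)) * s_hat_profile ?d \<nu> (Suc n) (Suc k) r = of_real (real ?d + 2 * real (n - 2 * k) - 2) * s_hat_profile ?d \<nu> n k r
     - 2 * of_real (pi * r) * s_hat_profile ?d \<nu> (Suc n) k r"
        by (rule s_hat_profile_lower[OF r k]) simp
      finally show ?thesis by (simp add: \<Phi>_def \<Phi>'_def algebra_simps)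
    qed
  qed
  also have "\<dots> = (\<Sum>k = 0..?n div 2. of_real (harm_comp js k y) * \<Phi> (length js) k ((norm y)\<^sup>2))"
    unfolding length_eq_mi_size[OF js] using harm_comp_props[of _ js] length_eq_mi_size[OF js]
    by (intro sum.mono_neutral_right) (auto simp: not_le)
  finally show ?thesis
    unfolding harmonic_part_eq[OF js] length_eq_mi_size[OF js] \<Phi>_def C_def .
qed

section \<open>The Crandall representation\<close>

lemma of_real_power_eq_exp: "lam > 0 \<Longrightarrow> complex_of_real (lam ^ d) = exp (of_nat d * of_real (ln lam))"
  by (metis exp_ln exp_of_nat_mult exp_of_real of_real_mult of_real_of_nat_eq)

lemma of_real_powi_eq_exp: "lam > 0 \<Longrightarrow> complex_of_real (lam powi i) = exp (of_int i * of_real (ln lam))"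
proof -
  assume l: "lam > 0"
  have "lam powi i = exp (of_int i * ln lam)"
    using l powr_real_of_int'[of lam i] by (simp add: powr_def)
  then show ?thesis by (simp add: exp_of_real[symmetric])
qed

text \<open>The cancellation behind the regularization: up to powers of \<open>lam\<close>, both
  branches of \<open>Crandall_reg\<close> are the term p = y of the dual sum minus the profile of
  \<open>s_hat\<close>. In the generic branch this is \<gamma>(s, x) = \<Gamma>(s) - \<Gamma>(s, x);
  in the other one it is built into the logarithmic form.\<close>

lemma Crandall_reg_nonzero:
  fixes y :: "real^'n"
  assumes y: "y \<noteq> 0" and lam: "lam > 0" and k: "k \<le> n"
  shows "of_real (lam ^ CARD('n)) * Crandall_reg (of_nat CARD('n) - \<nu>) lam k n y
     = of_real (lam ^ CARD('n)) * of_real (lam powi (2 * int n - 4 * int k))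
         * gexp_int ((of_nat CARD('n) - \<nu>) / 2 + of_nat n - of_nat k) (pi * lam\<^sup>2 * (norm y)\<^sup>2)
       - exp ((\<nu> - 2 * of_nat k) * of_real (ln lam)) * s_hat_profile CARD('n) \<nu> n k ((norm y)\<^sup>2)"
proof -
  let ?d = "CARD('n)" and ?i = "2 * int n - 4 * int k"
  let ?x = "pi * lam\<^sup>2 * (norm y)\<^sup>2"
  let ?\<sigma> = "(of_nat ?d - \<nu>) / 2 + of_nat n - of_nat k"
  have ly: "lam *\<^sub>R y \<noteq> 0" "pi * (norm (lam *\<^sub>R y))\<^sup>2 = ?x" using y lam by (simp_all add: power_mult_distrib)
  have r: "(norm y)\<^sup>2 > 0" using y by simp
  have x: "?x > 0" using r lam by simp
  show ?thesis
  proof (cases "\<exists>l::nat. \<nu> = of_nat ?d + 2 * of_nat l \<and> n \<le> l + k")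
    case True
    then obtain l :: nat where \<nu>: "\<nu> = of_nat ?d + 2 * of_nat l" and l: "n \<le> l + k" by blast
    let ?j = "l + k - n"
    have the: "(THE l'::nat. of_nat ?d - \<nu> = - 2 * of_nat l') = l"
      unfolding \<nu> by (rule the_equality) auto
    have ex: "\<exists>l::nat. of_nat ?d - \<nu> = - 2 * of_nat l \<and> n \<le> l + k" using l by (intro exI[of _ l]) (simp add: \<nu>)
    have "Crandall_reg (of_nat ?d - \<nu>) lam k n y = Crandall_reg_log l lam k n y"
      unfolding Crandall_reg_def the Let_def if_P[OF ex] if_not_P[OF y] ..
    also have "\<dots> = of_real (lam powi ?i) * gexp_int ?\<sigma> ?x
       + of_real (lam powi (2 * (int l - int k)) * ((- pi * (norm y)\<^sup>2) ^ ?j / fact ?j) * (ln (pi * (norm y)\<^sup>2) + H_const l k n ?d))"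
    proof -
      have "2 * (of_nat n - of_nat l - of_nat k) / 2 = ?\<sigma>" by (simp add: \<nu>)
      then have "upper_Crandall (2 * (of_nat n - of_nat l - of_nat k)) (lam *\<^sub>R y) = gexp_int ?\<sigma> ?x"
        by (simp only: upper_Crandall_eq[OF ly(1)] ly(2))
      then show ?thesis unfolding Crandall_reg_log_def by (simp only:)
    qed
    finally have C: "Crandall_reg (of_nat ?d - \<nu>) lam k n y = of_real (lam powi ?i) * gexp_int ?\<sigma> ?x
       + of_real (lam powi (2 * (int l - int k)) * ((- pi * (norm y)\<^sup>2) ^ ?j / fact ?j) * (ln (pi * (norm y)\<^sup>2) + H_const l k n ?d))" .
    have "(- pi * (norm y)\<^sup>2) ^ ?j = (- 1) ^ ?j * (pi * (norm y)\<^sup>2) ^ ?j"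
      by (simp add: power_mult_distrib[symmetric])
    then have P: "of_real (lam powi (2 * (int l - int k)) * ((- pi * (norm y)\<^sup>2) ^ ?j / fact ?j) * (ln (pi * (norm y)\<^sup>2) + H_const l k n ?d))
       = - (of_real (lam powi (2 * (int l - int k))) * s_hat_profile ?d \<nu> n k ((norm y)\<^sup>2))"
      unfolding \<nu> s_hat_profile_log[OF l] by simp
    have "exp ((\<nu> - 2 * of_nat k) * of_real (ln lam)) = of_real (lam ^ ?d) * of_real (lam powi (2 * (int l - int k)))"
      unfolding of_real_power_eq_exp[OF lam] of_real_powi_eq_exp[OF lam]
      by (simp add: \<nu> exp_add[symmetric] algebra_simps)
    then show ?thesis unfolding C P by (simp add: algebra_simps)
  next
    case False
    have c: "l + k < n" if "\<nu> = of_nat ?d + 2 * of_nat l" for l :: nat using False that by force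
    have \<sigma>: "?\<sigma> \<notin> \<int>\<^sub>\<le>\<^sub>0" by (rule s_hat_profile_exponent[OF c k])
    have h: "(of_nat ?d - \<nu> + 2 * (of_nat n - of_nat k)) / 2 = ?\<sigma>" by (simp add: field_simps)
    have nex: "\<not> (\<exists>l::nat. of_nat ?d - \<nu> = - 2 * of_nat l \<and> n \<le> l + k)"
    proof
      assume "\<exists>l::nat. of_nat ?d - \<nu> = - 2 * of_nat l \<and> n \<le> l + k"
      then obtain l :: nat where l: "of_nat ?d - \<nu> = - 2 * of_nat l" "n \<le> l + k" by blast
      then have "\<nu> = of_nat ?d + 2 * of_nat l" by (simp add: algebra_simps)
      with c[of l] l show False by simp
    qed
    have ex: "exp (?\<sigma> * of_real (ln ?x)) * exp (- ?\<sigma> * of_real (ln ?x)) = 1" by (simp only: mult_minus_left exp_minus_inverse)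
    have "Crandall_reg (of_nat ?d - \<nu>) lam k n y = - of_real (lam powi ?i) * lower_Crandall (of_nat ?d - \<nu> + 2 * (of_nat n - of_nat k)) (lam *\<^sub>R y)"
      unfolding Crandall_reg_def using nex by (simp only: if_False)
    also have "lower_Crandall (of_nat ?d - \<nu> + 2 * (of_nat n - of_nat k)) (lam *\<^sub>R y) = lower_series UNIV ?\<sigma> ?x"
      by (subst lower_Crandall_eq) (use \<sigma> in \<open>simp_all only: h ly(2) not_False_eq_True\<close>)
    also have "\<dots> = exp (- ?\<sigma> * of_real (ln ?x)) * Gamma ?\<sigma> - gexp_int ?\<sigma> ?x"
    proof -
      have "lower_series UNIV ?\<sigma> ?x = (exp (?\<sigma> * of_real (ln ?x)) * exp (- ?\<sigma> * of_real (ln ?x))) * lower_series UNIV ?\<sigma> ?x"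
        unfolding ex by simp
      also have "\<dots> = exp (- ?\<sigma> * of_real (ln ?x)) * (exp (?\<sigma> * of_real (ln ?x)) * lower_series UNIV ?\<sigma> ?x)" by (simp only: mult_ac)
      also have "\<dots> = exp (- ?\<sigma> * of_real (ln ?x)) * Gamma ?\<sigma> - (exp (?\<sigma> * of_real (ln ?x)) * exp (- ?\<sigma> * of_real (ln ?x))) * gexp_int ?\<sigma> ?x"
        unfolding lower_series_eq[OF x \<sigma>, symmetric] by (simp only: right_diff_distrib mult_ac)
      finally show ?thesis unfolding ex by simp
    qed
    finally have C: "Crandall_reg (of_nat ?d - \<nu>) lam k n y = - of_real (lam powi ?i) * (exp (- ?\<sigma> * of_real (ln ?x)) * Gamma ?\<sigma> - gexp_int ?\<sigma> ?x)" .
    have "pi * (norm y)\<^sup>2 > 0" using r by simp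
    then have "complex_of_real (pi * (norm y)\<^sup>2) powr (- ?\<sigma>) = exp (- ?\<sigma> * of_real (ln (pi * (norm y)\<^sup>2)))"
      by (rule powr_eq_exp)
    moreover have "(\<nu> - of_nat ?d) / 2 - of_nat n + of_nat k = - ?\<sigma>" by (simp add: field_simps)
    ultimately have P: "s_hat_profile ?d \<nu> n k ((norm y)\<^sup>2) = Gamma ?\<sigma> * exp (- ?\<sigma> * of_real (ln (pi * (norm y)\<^sup>2)))"
      by (simp only: s_hat_profile_power[OF c])
    have lnx: "ln ?x = ln (pi * (norm y)\<^sup>2) + 2 * ln lam"
      using r lam y by (simp add: ln_mult ln_realpow)
    have "(of_real (lam ^ ?d) * of_real (lam powi ?i)) * exp (- ?\<sigma> * of_real (ln ?x))
       = exp ((\<nu> - 2 * of_nat k) * of_real (ln lam)) * exp (- ?\<sigma> * of_real (ln (pi * (norm y)\<^sup>2)))"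
      unfolding of_real_power_eq_exp[OF lam] of_real_powi_eq_exp[OF lam] lnx exp_add[symmetric]
      by (rule arg_cong[of _ _ exp]) (simp add: field_simps)
    then have e: "(of_real (lam ^ ?d) * of_real (lam powi ?i)) * (exp (- ?\<sigma> * of_real (ln ?x)) * Gamma ?\<sigma>)
       = exp ((\<nu> - 2 * of_nat k) * of_real (ln lam)) * (Gamma ?\<sigma> * exp (- ?\<sigma> * of_real (ln (pi * (norm y)\<^sup>2))))"
      by (simp only: mult.assoc[symmetric]) (simp only: mult_ac)
    have alg: "a * (- b * (c - d)) = a * b * d - a * b * c" for a b c d :: complex by (simp add: algebra_simps)
    show ?thesis unfolding C P e[symmetric] by (rule alg)
  qed
qed

text \<open>The sums run over the unshifted lattices, so that the index sets do not depend on \<open>y\<close> and the limit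
  \<open>y \<rightarrow> 0\<close> can be taken termwise.\<close>

definition crandall_term ::
    "real^'n^'n \<Rightarrow> nat^'n \<Rightarrow> real \<Rightarrow> complex \<Rightarrow> real^'n \<Rightarrow> nat \<Rightarrow> real^'n \<Rightarrow> complex" where
  "crandall_term A \<alpha> lam \<nu> x k y = of_real (pi / lam\<^sup>2) powr (\<nu> / 2 - of_nat k) *
     ((\<Sum>\<^sub>\<infinity>z\<in>lattice_of A. of_real (harmonic_part \<alpha> k (z - x))
         * upper_Crandall_over_Gamma (\<nu> - 2 * of_nat k) ((z - x) /\<^sub>R lam) * ephase (- (y \<bullet> (z - x))))
      + rGamma (\<nu> / 2 - of_nat k) * (- 1) ^ k
         * (of_real (lam ^ CARD('n)) / (\<i> ^ mi_size \<alpha> * of_real (covolume A)))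
         * (of_real (harmonic_part \<alpha> k y) * Crandall_reg (of_nat CARD('n) - \<nu>) lam k (mi_size \<alpha>) y
            + of_real (lam powi (2 * int (mi_size \<alpha>) - 4 * int k))
              * (\<Sum>\<^sub>\<infinity>q\<in>dual_lattice_of A - {0}. of_real (harmonic_part \<alpha> k (q + y)) * ephase (- (x \<bullet> q))
                   * gexp_int ((of_nat CARD('n) - \<nu>) / 2 + of_nat (mi_size \<alpha>) - of_nat k) (pi * lam\<^sup>2 * (norm (q + y))\<^sup>2))))"

section \<open>The representation for y outside the dual lattice\<close>

lemma zero_in_lattice: "0 \<in> lattice_of A"
  unfolding lattice_of_def by (rule image_eqI[of _ _ 0]) auto

lemma upper_Crandall_over_Gamma_eq:
  fixes z :: "real^'n"
  assumes "lam > 0"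
  shows "upper_Crandall_over_Gamma (\<nu> - 2 * of_nat k) (z /\<^sub>R lam)
    = (if z = 0 then - rGamma (\<nu> / 2 - of_nat k + 1) else rGamma (\<nu> / 2 - of_nat k) * gexp_int (\<nu> / 2 - of_nat k) (pi / lam\<^sup>2 * (norm z)\<^sup>2))"
proof -
  have h: "(\<nu> - 2 * of_nat k) / 2 = \<nu> / 2 - of_nat k" by (simp add: diff_divide_distrib)
  show ?thesis
  proof (cases "z = 0")
    case True
    show ?thesis
    proof (cases "\<nu> - 2 * of_nat k = 0")
      case True
      then have "\<nu> / 2 - of_nat k = 0" using h by simp
      then show ?thesis using True \<open>z = 0\<close> by (simp add: upper_Crandall_over_Gamma_def)
    next
      case False
      let ?s = "\<nu> / 2 - of_nat k"
      have s: "\<nu> - 2 * of_nat k = 2 * ?s" "?s \<noteq> 0" using False h by auto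
      have r: "- 2 / (2 * s) * rGamma s = - rGamma (s + 1)" if "s \<noteq> 0" for s :: complex
        using rGamma_plus1[of s, symmetric] that by (simp add: field_simps)
      have "upper_Crandall_over_Gamma (\<nu> - 2 * of_nat k) (z /\<^sub>R lam) = - 2 / (\<nu> - 2 * of_nat k) * rGamma ((\<nu> - 2 * of_nat k) / 2)"
        using \<open>z = 0\<close> False by (simp add: upper_Crandall_over_Gamma_def upper_Crandall_def)
      also have "\<dots> = - 2 / (2 * ?s) * rGamma ?s" unfolding h unfolding s(1) ..
      finally show ?thesis using \<open>z = 0\<close> unfolding r[OF s(2)] by simp
    qed
  next
    case False
    then have "z /\<^sub>R lam \<noteq> 0" using assms by simp
    then have "upper_Crandall (\<nu> - 2 * of_nat k) (z /\<^sub>R lam) = gexp_int (\<nu> / 2 - of_nat k) (pi * (norm (z /\<^sub>R lam))\<^sup>2)"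
      using upper_Crandall_eq h by metis
    also have "pi * (norm (z /\<^sub>R lam))\<^sup>2 = pi / lam\<^sup>2 * (norm z)\<^sup>2"
      using assms by (simp add: power_mult_distrib field_simps)
    finally show ?thesis using False assms unfolding upper_Crandall_over_Gamma_def h by simp
  qed
qed

text \<open>The convention for G_\<mu>(0) / \<Gamma>(\<mu>/2) gives the term z = x the value -h(0) /
  \<Gamma>(\<mu>/2 + 1), exactly the extra summand in \<open>hecke_zeta\<close>.\<close>

lemma primal_sum_eq:
  fixes A :: "real^'n^'n" and x y :: "real^'n" and \<nu> :: complex and k :: nat
  assumes A: "invertible A" and h: "real_polynomial_function h" and lam: "lam > 0"
  defines "f \<equiv> \<lambda>z. complex_of_real (h (z - x)) * upper_Crandall_over_Gamma (\<nu> - 2 * of_nat k) ((z - x) /\<^sub>R lam) * ephase (- (y \<bullet> (z - x)))"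
  shows "(f has_sum (rGamma (\<nu> / 2 - of_nat k) * (\<Sum>\<^sub>\<infinity>z\<in>lattice_of A - {x}.
        of_real (h (z - x)) * ephase (- (y \<bullet> (z - x))) * gexp_int (\<nu> / 2 - of_nat k) (pi / lam\<^sup>2 * (norm (z - x))\<^sup>2))
      - (if x \<in> lattice_of A then of_real (h 0) else 0) * rGamma (\<nu> / 2 - of_nat k + 1))) (lattice_of A)"
    (is "(f has_sum (?r * ?S - ?\<delta> * _)) _")
proof -
  let ?s = "\<nu> / 2 - of_nat k"
  have "((\<lambda>z. of_real (h (z - x)) * ephase (- (y \<bullet> (z - x))) * gexp_int ?s (pi / lam\<^sup>2 * (norm (z - x))\<^sup>2)) has_sum ?S) (lattice_of A - {x})"
    using gexp_sum_summable[OF A h, of "pi / lam\<^sup>2" "lattice_of A - {x}" "- x" "\<lambda>z. ephase (- (y \<bullet> (z - x)))" ?s] lam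
    by (intro has_sum_infsum) simp
  then have "((\<lambda>z. ?r * (of_real (h (z - x)) * ephase (- (y \<bullet> (z - x))) * gexp_int ?s (pi / lam\<^sup>2 * (norm (z - x))\<^sup>2))) has_sum ?r * ?S) (lattice_of A - {x})"
    by (rule has_sum_cmult_right)
  then have 1: "(f has_sum ?r * ?S) (lattice_of A - {x})"
    by (rule has_sum_cong[THEN iffD1, rotated]) (unfold f_def upper_Crandall_over_Gamma_eq[OF lam], simp add: mult_ac)
  show ?thesis
  proof (cases "x \<in> lattice_of A")
    case True
    have "(f has_sum f x) {x}" by (rule has_sum_finiteI) auto
    moreover have "f x = - (of_real (h 0) * rGamma (?s + 1))"
      unfolding f_def upper_Crandall_over_Gamma_eq[OF lam] by simp
    ultimately show ?thesis
      using has_sum_Un_disjoint[OF 1, of "{x}" "f x"] True by (simp add: insert_absorb)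
  next
    case False
    with 1 show ?thesis by simp
  qed
qed

text \<open>Converts Hecke's factor (-i)^m of degree m = n - 2k into the factor (-1)^k / i^n of the
  representation.\<close>

lemma minus_imaginary_power:
  assumes "2 * k \<le> n"
  shows "(- \<i>) ^ (n - 2 * k) = (- 1) ^ k / \<i> ^ n"
proof -
  let ?a = "(- \<i>) ^ (n - 2 * k)" and ?e = "(- 1) ^ k :: complex"
  have 1: "(- \<i>) ^ (2 * k) = ?e" by (simp add: power_mult)
  have "?a * (- \<i>) ^ (2 * k) = (- \<i>) ^ n"
    by (simp only: power_add[symmetric]) (use assms in simp)
  then have 2: "?a * ?e = (- \<i>) ^ n" unfolding 1 .
  have 3: "(- \<i>) ^ n * \<i> ^ n = 1" by (simp flip: power_mult_distrib)
  have 4: "?e * ?e = 1" by (simp flip: power_mult_distrib)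
  have "?a * \<i> ^ n = (?a * \<i> ^ n) * (?e * ?e)" unfolding 4 by simp
  also have "\<dots> = (?a * ?e) * \<i> ^ n * ?e" by (simp only: mult_ac)
  also have "\<dots> = ?e" unfolding 2 3 by simp
  finally have "?a * \<i> ^ n = ?e" .
  then show ?thesis by (simp add: field_simps)
qed

text \<open>Splitting at a = 1 / \<open>lam\<close>^2 produces the arguments z / \<open>lam\<close>
  and \<open>lam\<close> p of the Crandall functions. The term q = 0 of the dual sum absorbs the
  derivative of \<open>s_hat\<close> and becomes \<open>Crandall_reg\<close>; the remaining work is
  to match powers of \<open>lam\<close>.\<close>

lemma hecke_zeta_diff_eq_crandall_term:
  fixes A :: "real^'n^'n" and \<alpha> :: "nat^'n"
  assumes A: "invertible A" and y: "y \<notin> dual_lattice_of A" and lam: "lam > 0" and k: "k \<le> mi_size \<alpha> div 2"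
  shows "hecke_zeta A (mi_size \<alpha> - 2 * k) (harmonic_part \<alpha> k) x y (1 / lam\<^sup>2) (\<nu> / 2 - of_nat k)
    - of_real (harmonic_part \<alpha> k y) *
     ((- 2 * of_real pi) ^ mi_size \<alpha> * (- 1) ^ k * of_real pi powr (\<nu> / 2 - of_nat k) * rGamma (\<nu> / 2 - of_nat k)
       * s_hat_profile CARD('n) \<nu> (mi_size \<alpha>) k ((norm y)\<^sup>2)) / ((- 2 * of_real pi * \<i>) ^ mi_size \<alpha> * of_real (covolume A))
   = crandall_term A \<alpha> lam \<nu> x k y"
proof -
  let ?d = "CARD('n)" and ?n = "mi_size \<alpha>" and ?h = "harmonic_part \<alpha> k" and ?s = "\<nu> / 2 - of_nat k"
  let ?m = "?n - 2 * k" and ?i = "2 * int (mi_size \<alpha>) - 4 * int k"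
  let ?\<sigma> = "(of_nat ?d - \<nu>) / 2 + of_nat ?n - of_nat k"
  let ?\<Lambda>' = "dual_lattice_of A"
  have k2: "2 * k \<le> ?n" using k by simp
  have rp: "real_polynomial_function ?h" by (rule homogeneous_polynomialD(1)[OF harmonic_part_props(1)[OF k]])
  have y0: "y \<noteq> 0" using y zero_in_lattice by (auto simp: dual_lattice_of_def)
  define W where "W = complex_of_real (pi / lam\<^sup>2) powr ?s"
  define c where "c = (- 1) ^ k / (\<i> ^ ?n * complex_of_real (covolume A))"
  define Z where "Z = (\<Sum>\<^sub>\<infinity>z\<in>lattice_of A. of_real (?h (z - x))
         * upper_Crandall_over_Gamma (\<nu> - 2 * of_nat k) ((z - x) /\<^sub>R lam) * ephase (- (y \<bullet> (z - x))))"
  define e where "e q = of_real (?h (q + y)) * ephase (- (x \<bullet> q)) * gexp_int ?\<sigma> (pi * lam\<^sup>2 * (norm (q + y))\<^sup>2)" for q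
  define D where "D = (\<Sum>\<^sub>\<infinity>q\<in>?\<Lambda>' - {0}. e q)"
  have a: "1 / lam\<^sup>2 > 0" "pi / (1 / lam\<^sup>2) = pi * lam\<^sup>2" "pi * (1 / lam\<^sup>2) = pi / lam\<^sup>2" "ln (1 / lam\<^sup>2) = - 2 * ln lam"
    using lam by (simp_all add: ln_div ln_realpow)
  have W: "exp (?s * of_real (ln pi)) * exp (?s * of_real (ln (1 / lam\<^sup>2))) = W"
  proof -
    have "pi / lam\<^sup>2 > 0" using lam by simp
    then show ?thesis unfolding W_def
      by (subst powr_eq_exp) (use lam in \<open>simp_all add: ln_div ln_realpow exp_add[symmetric] algebra_simps\<close>)
  qed
  \<comment> \<open>Here a^(-d/2-m) equals \<open>lam\<close>^(d+2m), and 2m = 2n - 4k.\<close>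
  have K: "exp (?s * of_real (ln pi)) * exp ((?s - of_nat ?d / 2 - of_nat ?m) * of_real (ln (1 / lam\<^sup>2)))
      = W * (of_real (lam ^ ?d) * of_real (lam powi ?i))"
    unfolding W[symmetric] of_real_power_eq_exp[OF lam] of_real_powi_eq_exp[OF lam] a(4) exp_add[symmetric]
    using k2 by (intro arg_cong[of _ _ exp]) (simp add: of_nat_diff field_simps)
  have Pi: "of_real pi powr ?s = W * exp ((\<nu> - 2 * of_nat k) * of_real (ln lam))"
    unfolding W[symmetric] a(4) powr_eq_exp[OF pi_gt_zero] exp_add[symmetric]
    by (intro arg_cong[of _ _ exp]) (simp add: field_simps)
  have "(\<lambda>q. e q) summable_on ?\<Lambda>'"
    unfolding e_def using gexp_sum_summable[OF dual_lattice_invertible[OF A] rp, of "pi * lam\<^sup>2" ?\<Lambda>' y "\<lambda>q. ephase (- (x \<bullet> q))" ?\<sigma>]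
      dual_shift_nonzero[OF y] lam by (simp add: dual_lattice_of_def)
  then have D: "(\<Sum>\<^sub>\<infinity>q\<in>?\<Lambda>'. e q) = e 0 + D"
  proof -
    have "infsum e (?\<Lambda>' - {0}) = infsum e ?\<Lambda>' - infsum e {0}"
      using \<open>(\<lambda>q. e q) summable_on ?\<Lambda>'\<close> zero_in_lattice by (intro infsum_Diff) (auto simp: dual_lattice_of_def)
    then show ?thesis by (simp add: D_def)
  qed
  have \<sigma>: "of_nat ?d / 2 + of_nat ?m - ?s = ?\<sigma>" using k2 by (simp add: of_nat_diff field_simps)
  have hz: "hecke_zeta A ?m ?h x y (1 / lam\<^sup>2) ?s = W * Z + rGamma ?s * (c * (W * (of_real (lam ^ ?d) * of_real (lam powi ?i))) * (e 0 + D))"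
  proof -
    have Z: "rGamma ?s * (\<Sum>\<^sub>\<infinity>z\<in>lattice_of A - {x}. of_real (?h (z - x)) * ephase (- (y \<bullet> (z - x))) * gexp_int ?s (pi / lam\<^sup>2 * (norm (z - x))\<^sup>2))
        - (if x \<in> lattice_of A then of_real (?h 0) else 0) * rGamma (?s + 1) = Z"
      unfolding Z_def by (rule infsumI[OF primal_sum_eq[OF A rp lam], symmetric])
    have c: "(- \<i>) ^ ?m / of_real \<bar>det A\<bar> = c" unfolding c_def covolume_def minus_imaginary_power[OF k2] by simp
    have "hecke_zeta A ?m ?h x y (1 / lam\<^sup>2) ?s = exp (?s * of_real (ln pi)) * (exp (?s * of_real (ln (1 / lam\<^sup>2))) * Z
        + rGamma ?s * (c * exp ((?s - of_nat ?d / 2 - of_nat ?m) * of_real (ln (1 / lam\<^sup>2))) * (e 0 + D)))"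
      unfolding hecke_zeta_def a(2,3) Z c \<sigma> e_def[symmetric] D ..
    also have "\<dots> = (exp (?s * of_real (ln pi)) * exp (?s * of_real (ln (1 / lam\<^sup>2)))) * Z
        + rGamma ?s * (c * (exp (?s * of_real (ln pi)) * exp ((?s - of_nat ?d / 2 - of_nat ?m) * of_real (ln (1 / lam\<^sup>2)))) * (e 0 + D))"
      by (simp only: distrib_left mult_ac)
    finally show ?thesis unfolding W K .
  qed
  define P where "P = s_hat_profile ?d \<nu> ?n k ((norm y)\<^sup>2)"
  have C: "of_real (lam ^ ?d) * Crandall_reg (of_nat ?d - \<nu>) lam k ?n y
     = of_real (lam ^ ?d) * of_real (lam powi ?i) * gexp_int ?\<sigma> (pi * lam\<^sup>2 * (norm y)\<^sup>2)
       - exp ((\<nu> - 2 * of_nat k) * of_real (ln lam)) * P"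
    unfolding P_def using k2 by (intro Crandall_reg_nonzero[OF y0 lam]) simp
  have sub: "of_real (?h y) * ((- 2 * of_real pi) ^ ?n * (- 1) ^ k * of_real pi powr ?s * rGamma ?s * P) / ((- 2 * of_real pi * \<i>) ^ ?n * of_real (covolume A))
     = rGamma ?s * (c * W * (of_real (?h y) * (exp ((\<nu> - 2 * of_nat k) * of_real (ln lam)) * P)))"
  proof -
    have p: "(- 2 * complex_of_real pi) ^ ?n \<noteq> 0" by simp
    show ?thesis unfolding Pi power_mult_distrib[of "- 2 * complex_of_real pi" \<i>] c_def using p by (simp add: mult_ac)
  qed
  have "crandall_term A \<alpha> lam \<nu> x k y = W * (Z + rGamma ?s * c * (of_real (?h y) * (of_real (lam ^ ?d) * Crandall_reg (of_nat ?d - \<nu>) lam k ?n y)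
       + of_real (lam ^ ?d) * of_real (lam powi ?i) * D))"
    unfolding crandall_term_def W_def[symmetric] Z_def[symmetric] D_def e_def c_def by (simp add: distrib_left mult_ac)
  also have "\<dots> = W * (Z + rGamma ?s * c * (of_real (lam ^ ?d) * of_real (lam powi ?i) * (e 0 + D) - of_real (?h y) * (exp ((\<nu> - 2 * of_nat k) * of_real (ln lam)) * P)))"
    unfolding C by (simp add: e_def algebra_simps)
  also have "\<dots> = (W * Z + rGamma ?s * (c * (W * (of_real (lam ^ ?d) * of_real (lam powi ?i))) * (e 0 + D)))
       - rGamma ?s * (c * W * (of_real (?h y) * (exp ((\<nu> - 2 * of_nat k) * of_real (ln lam)) * P)))"
    by (simp only: distrib_left right_diff_distrib mult_ac) simp
  finally show ?thesis unfolding P_def[symmetric] hz sub by (rule sym)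
qed

lemma epstein_zeta_reg_nz_eq:
  fixes A :: "real^'n^'n" and \<alpha> :: "nat^'n"
  assumes A: "invertible A" and y: "y \<notin> dual_lattice_of A" and lam: "lam > 0"
  shows "epstein_zeta_reg_nz A \<nu> \<alpha> x y = (\<Sum>k = 0..mi_size \<alpha> div 2. crandall_term A \<alpha> lam \<nu> x k y)"
proof -
  have a: "1 / lam\<^sup>2 > 0" using lam by simp
  have y0: "y \<noteq> 0" using y zero_in_lattice by (auto simp: dual_lattice_of_def)
  have "exp (2 * of_real pi * \<i> * of_real (x \<bullet> y)) * epstein_zeta (lattice_of A) \<nu> \<alpha> x y
     = (\<Sum>k = 0..mi_size \<alpha> div 2. hecke_zeta A (mi_size \<alpha> - 2 * k) (harmonic_part \<alpha> k) x y (1 / lam\<^sup>2) (\<nu> / 2 - of_nat k))"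
    unfolding epstein_zeta_eq[OF A y a] ephase_def[of "x \<bullet> y", symmetric]
    by (simp add: ephase_minus inner_commute[of x y])
  then have "epstein_zeta_reg_nz A \<nu> \<alpha> x y =
     (\<Sum>k = 0..mi_size \<alpha> div 2. hecke_zeta A (mi_size \<alpha> - 2 * k) (harmonic_part \<alpha> k) x y (1 / lam\<^sup>2) (\<nu> / 2 - of_nat k))
     - (\<Sum>k = 0..mi_size \<alpha> div 2. of_real (harmonic_part \<alpha> k y) *
     ((- 2 * of_real pi) ^ mi_size \<alpha> * (- 1) ^ k * of_real pi powr (\<nu> / 2 - of_nat k) * rGamma (\<nu> / 2 - of_nat k)
       * s_hat_profile CARD('n) \<nu> (mi_size \<alpha>) k ((norm y)\<^sup>2)) / ((- 2 * of_real pi * \<i>) ^ mi_size \<alpha> * of_real (covolume A)))"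
    unfolding epstein_zeta_reg_nz_def mi_derivative_s_hat[OF y0] sum_divide_distrib by simp
  also have "\<dots> = (\<Sum>k = 0..mi_size \<alpha> div 2. crandall_term A \<alpha> lam \<nu> x k y)"
    unfolding sum_subtractf[symmetric]
    by (rule sum.cong[OF refl], rule hecke_zeta_diff_eq_crandall_term[OF A y lam]) simp
  finally show ?thesis .
qed

section \<open>Continuity at y = 0\<close>

lemma gexp_int_lipschitz:
  assumes r0: "r0 > 0" and r: "r \<ge> r0" "r' \<ge> r0"
  shows "norm (gexp_int s r - gexp_int s r') \<le> \<bar>r - r'\<bar> * norm (gexp_int (of_real (Re s) + 1) r0)"
proof -
  have ker: "gamma_kernel s r integrable_on {1..}" if "r > 0" for s r
    using integral_gamma_kernel_atLeast(1)[of 1 r s] that by (simp add: absolutely_integrable_on_def)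
  have pos: "r > 0" "r' > 0" using r r0 by simp_all
  \<comment> \<open>Varying r brings down one factor t, hence Re s + 1; the kernel at the smallest
    admissible value r0 dominates.\<close>
  let ?s = "complex_of_real (Re s) + 1"
  have nk: "complex_of_real (norm (gamma_kernel ?s r0 t)) = gamma_kernel ?s r0 t" for t
    using norm_gamma_kernel'[of ?s r0 t] by simp
  have ni: "(\<lambda>t. norm (gamma_kernel ?s r0 t)) integrable_on {1..}"
    using integral_gamma_kernel_atLeast(1)[of 1 r0 ?s] r0 by (simp add: absolutely_integrable_on_def)
  have aux: "exp (- a) - exp (- b) \<le> (b - a) * exp (- c)" if "a \<le> b" "c \<le> a" for a b c :: real
  proof -
    have "exp (- a) - exp (- b) = exp (- a) * (1 - exp (- (b - a)))" by (simp add: right_diff_distrib flip: exp_add)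
    also have "\<dots> \<le> exp (- a) * (b - a)"
      using exp_ge_add_one_self[of "- (b - a)"] by (intro mult_left_mono) (linarith, simp)
    also have "\<dots> \<le> exp (- c) * (b - a)" using that by (intro mult_right_mono) auto
    finally show ?thesis by (simp add: mult.commute)
  qed
  have "gexp_int s r - gexp_int s r' = integral {1..} (\<lambda>t. gamma_kernel s r t - gamma_kernel s r' t)"
    unfolding gexp_int_def by (rule Henstock_Kurzweil_Integration.integral_diff[symmetric]) (use ker pos in auto)
  also have "norm \<dots> \<le> integral {1..} (\<lambda>t. \<bar>r - r'\<bar> * norm (gamma_kernel ?s r0 t))"
  proof (rule integral_norm_bound_integral)
    show "(\<lambda>t. gamma_kernel s r t - gamma_kernel s r' t) integrable_on {1..}"
      by (intro integrable_diff ker pos)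
    show "(\<lambda>t. \<bar>r - r'\<bar> * norm (gamma_kernel ?s r0 t)) integrable_on {1..}"
      by (rule integrable_on_mult_right[OF ni])
    fix t :: real assume "t \<in> {1..}"
    then have t: "t \<ge> 1" by simp
    have k: "gamma_kernel s c t = exp ((s - 1) * of_real (ln t)) * of_real (exp (- (c * t)))" for c
      by (simp add: gamma_kernel_def exp_of_real[symmetric] exp_add[symmetric])
    have "norm (gamma_kernel s r t - gamma_kernel s r' t) = exp ((Re s - 1) * ln t) * \<bar>exp (- (r * t)) - exp (- (r' * t))\<bar>"
      unfolding k right_diff_distrib[symmetric] norm_mult by (simp flip: of_real_diff)
    also have "\<bar>exp (- (r * t)) - exp (- (r' * t))\<bar> \<le> \<bar>r * t - r' * t\<bar> * exp (- (r0 * t))"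
    proof (cases "r \<le> r'")
      case True
      then have "r * t \<le> r' * t" "r0 * t \<le> r * t" using t r by (auto intro: mult_right_mono)
      from aux[OF this] this show ?thesis by simp
    next
      case False
      then have "r' * t \<le> r * t" "r0 * t \<le> r' * t" using t r by (auto intro: mult_right_mono)
      from aux[OF this] this show ?thesis by simp
    qed
    also have "\<bar>r * t - r' * t\<bar> = \<bar>r - r'\<bar> * exp (ln t)" using t by (simp add: left_diff_distrib[symmetric] abs_mult)
    also have "exp ((Re s - 1) * ln t) * (\<bar>r - r'\<bar> * exp (ln t) * exp (- (r0 * t))) = \<bar>r - r'\<bar> * norm (gamma_kernel ?s r0 t)"
      by (simp add: norm_gamma_kernel flip: exp_add) (simp add: algebra_simps)
    finally show "norm (gamma_kernel s r t - gamma_kernel s r' t) \<le> \<bar>r - r'\<bar> * norm (gamma_kernel ?s r0 t)"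
      by (simp add: mult_left_mono)
  qed
  also have "\<dots> = \<bar>r - r'\<bar> * integral {1..} (\<lambda>t. norm (gamma_kernel ?s r0 t))" by simp
  also have "complex_of_real (integral {1..} (\<lambda>t. norm (gamma_kernel ?s r0 t))) = integral {1..} (\<lambda>t. of_real (norm (gamma_kernel ?s r0 t)))"
    by (rule integral_linear[OF ni bounded_linear_of_real, unfolded o_def, symmetric])
  then have "integral {1..} (\<lambda>t. norm (gamma_kernel ?s r0 t)) \<le> norm (gexp_int ?s r0)"
    unfolding nk gexp_int_def[symmetric] by (metis abs_ge_self norm_of_real)
  then have "\<bar>r - r'\<bar> * integral {1..} (\<lambda>t. norm (gamma_kernel ?s r0 t)) \<le> \<bar>r - r'\<bar> * norm (gexp_int ?s r0)"
    by (rule mult_left_mono) simp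
  finally show ?thesis .
qed

lemma continuous_on_gexp_int: "continuous_on {0<..} (gexp_int s)"
proof (rule continuous_at_imp_continuous_on, rule ballI)
  fix r :: real assume "r \<in> {0<..}"
  then have r: "r / 2 > 0" by simp
  let ?K = "norm (gexp_int (of_real (Re s) + 1) (r / 2))"
  have "((\<lambda>r'. \<bar>r' - r\<bar> * ?K) \<longlongrightarrow> \<bar>r - r\<bar> * ?K) (at r)" by (intro tendsto_intros)
  then have lim: "((\<lambda>r'. \<bar>r' - r\<bar> * ?K) \<longlongrightarrow> 0) (at r)" by simp
  have "eventually (\<lambda>r'. r' \<in> {r / 2<..}) (at r)" using r by (intro eventually_at_in_open') auto
  then have "eventually (\<lambda>r'. norm (gexp_int s r' - gexp_int s r) \<le> \<bar>r' - r\<bar> * ?K) (at r)"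
  proof eventually_elim
    case (elim r')
    then show ?case using r by (intro gexp_int_lipschitz[OF r]) auto
  qed
  from Lim_null_comparison[OF this lim] have "((\<lambda>r'. gexp_int s r' - gexp_int s r) \<longlongrightarrow> 0) (at r)" .
  then show "isCont (gexp_int s) r" unfolding isCont_def by (rule LIM_zero_cancel)
qed

text \<open>Nonzero lattice vectors have length at least \<epsilon>. For |y| < \<epsilon> / 2 the
  points q + y stay outside the ball of radius \<epsilon> / 2, so one summable majorant serves all y
  near 0.\<close>

lemma dual_sum_tendsto:
  fixes A :: "real^'n^'n"
  assumes A: "invertible A" and h: "real_polynomial_function h" and c: "c > 0" and \<phi>: "\<And>q. norm (\<phi> q) = 1"
  shows "((\<lambda>y. \<Sum>\<^sub>\<infinity>q\<in>lattice_of A - {0}. of_real (h (q + y)) * \<phi> q * gexp_int \<sigma> (c * (norm (q + y))\<^sup>2))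
     \<longlongrightarrow> (\<Sum>\<^sub>\<infinity>q\<in>lattice_of A - {0}. of_real (h (q + 0)) * \<phi> q * gexp_int \<sigma> (c * (norm (q + 0))\<^sup>2))) (at 0)"
proof -
  let ?\<tau> = "real CARD('n) + 1"
  obtain \<epsilon> where \<epsilon>: "\<epsilon> > 0" "\<And>z. z \<in> lattice_of A \<Longrightarrow> z + 0 \<noteq> 0 \<Longrightarrow> norm (z + 0) \<ge> \<epsilon>"
    using lattice_shift_discrete[OF A] by blast
  \<comment> \<open>The bound 1/2 serves the comparison of 1 + |q + y| with (1 + |q|) / 2.\<close>
  define \<delta> where "\<delta> = min (\<epsilon> / 2) (1 / 2)"
  have \<delta>: "\<delta> > 0" "\<delta> \<le> \<epsilon> / 2" "\<delta> \<le> 1 / 2" using \<epsilon>(1) by (auto simp: \<delta>_def)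
  have r0: "c * (\<epsilon> / 2)\<^sup>2 > 0" using c \<epsilon>(1) by simp
  have lb: "norm (q + y) \<ge> \<epsilon> / 2" "1 + norm (q + y) \<ge> (1 + norm q) / 2" if "q \<in> lattice_of A - {0}" "y \<in> ball 0 \<delta>" for q y
  proof -
    have "norm q \<ge> \<epsilon>" using \<epsilon>(2)[of q] that by simp
    moreover have "norm q \<le> norm (q + y) + norm y" using norm_triangle_ineq4[of "q + y" y] by simp
    moreover have "norm y < \<delta>" using that by simp
    ultimately show "norm (q + y) \<ge> \<epsilon> / 2" "1 + norm (q + y) \<ge> (1 + norm q) / 2" using \<delta> by (auto simp: field_simps)
  qed
  obtain C where C: "C > 0" "\<And>s r. Re s \<le> Re \<sigma> \<Longrightarrow> r \<ge> c * (\<epsilon> / 2)\<^sup>2 \<Longrightarrow> norm (gexp_int s r) \<le> C * exp (- r / 2)"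
    using gexp_int_bound[OF r0] by blast
  have c2: "c / 2 > 0" using c by simp
  obtain C' where C': "C' \<ge> 0" "\<And>v. \<bar>h v\<bar> * exp (- (c / 2) * (norm v)\<^sup>2) \<le> C' * (1 + norm v) powr (- ?\<tau>)"
    using polynomial_gauss_decay[OF h c2, of ?\<tau>] by auto
  define M where "M q = C * (C' * (2 powr ?\<tau> * (1 + norm (q + 0)) powr (- ?\<tau>)))" for q :: "real^'n"
  have "continuous_on (ball 0 \<delta>) (\<lambda>y. \<Sum>\<^sub>\<infinity>q\<in>lattice_of A - {0}. of_real (h (q + y)) * \<phi> q * gexp_int \<sigma> (c * (norm (q + y))\<^sup>2))"
  proof (rule continuous_on_infsum)
    show "M summable_on lattice_of A - {0}"
      unfolding M_def
      by (rule summable_on_subset_banach[of _ "lattice_of A"], intro summable_on_cmult_right summable_on_shifted_lattice_powr A) auto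
    fix q assume q: "q \<in> lattice_of A - {0}"
    have "continuous_on (ball 0 \<delta>) (\<lambda>y. gexp_int \<sigma> (c * (norm (q + y))\<^sup>2))"
    proof (rule continuous_on_compose2[OF continuous_on_gexp_int])
      show "(\<lambda>y. c * (norm (q + y))\<^sup>2) ` ball 0 \<delta> \<subseteq> {0<..}"
      proof (rule image_subsetI)
        fix y :: "real^'n" assume "y \<in> ball 0 \<delta>"
        then have "norm (q + y) > 0" using lb(1)[OF q] \<epsilon>(1) by (meson half_gt_zero less_le_trans)
        then show "c * (norm (q + y))\<^sup>2 \<in> {0<..}" using c by simp
      qed
    qed (intro continuous_intros)
    moreover have "continuous_on (ball 0 \<delta>) (\<lambda>y. h (q + y))"
      by (rule continuous_on_compose2[of UNIV h]) (auto intro!: continuous_intros continuous_at_imp_continuous_on continuous_real_polymonial_function h)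
    ultimately show "continuous_on (ball 0 \<delta>) (\<lambda>y. of_real (h (q + y)) * \<phi> q * gexp_int \<sigma> (c * (norm (q + y))\<^sup>2))"
      by (intro continuous_intros)
    fix y :: "real^'n" assume y: "y \<in> ball 0 \<delta>"
    note lb = lb[OF q y]
    have "c * (\<epsilon> / 2)\<^sup>2 \<le> c * (norm (q + y))\<^sup>2"
      using lb(1) \<epsilon>(1) c by (intro mult_left_mono power_mono) auto
    then have "norm (gexp_int \<sigma> (c * (norm (q + y))\<^sup>2)) \<le> C * exp (- (c * (norm (q + y))\<^sup>2) / 2)"
      using C(2) by blast
    then have "\<bar>h (q + y)\<bar> * norm (gexp_int \<sigma> (c * (norm (q + y))\<^sup>2)) \<le> \<bar>h (q + y)\<bar> * (C * exp (- (c * (norm (q + y))\<^sup>2) / 2))"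
      by (rule mult_left_mono) simp
    also have "\<dots> = C * (\<bar>h (q + y)\<bar> * exp (- (c / 2) * (norm (q + y))\<^sup>2))" by simp
    also have "\<dots> \<le> C * (C' * (1 + norm (q + y)) powr (- ?\<tau>))" using C(1) C'(2) by (intro mult_left_mono) auto
    also have "(1 + norm (q + y)) powr (- ?\<tau>) \<le> ((1 + norm q) / 2) powr (- ?\<tau>)"
      using lb(2) by (intro powr_mono2') (auto simp: add_pos_nonneg)
    also have "((1 + norm q) / 2) powr (- ?\<tau>) = 2 powr ?\<tau> * (1 + norm (q + 0)) powr (- ?\<tau>)"
    proof -
      have "((1 + a) / 2) powr (- \<tau>) = 2 powr \<tau> * (1 + a) powr (- \<tau>)" if "a \<ge> 0" for a \<tau> :: real
        using that by (simp add: powr_divide powr_minus field_simps)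
      then show ?thesis by (simp only: add_0_right norm_ge_zero)
    qed
    finally show "norm (of_real (h (q + y)) * \<phi> q * gexp_int \<sigma> (c * (norm (q + y))\<^sup>2)) \<le> M q"
      using C(1) C'(1) by (simp add: norm_mult \<phi> M_def mult_left_mono)
  qed
  then show ?thesis
    unfolding continuous_on_eq_continuous_at[OF open_ball] isCont_def by (rule bspec) (use \<delta>(1) in simp)
qed

text \<open>The series forms \<open>Crandall_reg_eq_series\<close> and
  \<open>lower_Crandall_eq\<close> hold at 0 too, so in either branch one formula covers a whole
  neighbourhood of 0.\<close>

lemma Crandall_reg_tendsto:
  assumes lam: "lam > 0" and k: "k \<le> n"
  shows "(Crandall_reg t lam k n \<longlongrightarrow> Crandall_reg t lam k n (0 :: real^'n)) (at (0 :: real^'n))"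
proof -
  have ser: "((\<lambda>v :: real^'n. lower_series J s (pi * lam\<^sup>2 * (norm v)\<^sup>2)) \<longlongrightarrow> lower_series J s 0) (at 0)"
    if "s \<notin> (\<lambda>j. - of_nat j) ` J" for J s
  proof (rule isCont_tendsto_compose[OF lower_series_continuous[OF that]])
    have "((\<lambda>v :: real^'n. pi * lam\<^sup>2 * (norm v)\<^sup>2) \<longlongrightarrow> pi * lam\<^sup>2 * (norm (0 :: real^'n))\<^sup>2) (at 0)"
      by (intro tendsto_intros)
    then show "((\<lambda>v :: real^'n. pi * lam\<^sup>2 * (norm v)\<^sup>2) \<longlongrightarrow> 0) (at 0)" by simp
  qed
  show ?thesis
  proof (cases "\<exists>l::nat. t = - 2 * of_nat l \<and> n \<le> l + k")
    case True
    then obtain l :: nat where t: "t = - 2 * of_nat l" and l: "n \<le> l + k" by blast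
    let ?j = "l + k - n"
    have "- of_nat ?j \<notin> (\<lambda>j. - of_nat j :: complex) ` (- {?j})" by auto
    note ser = ser[OF this]
    define F where "F v = complex_of_real (lam powi (2 * (int l - int k))
         * ((- pi * (norm v)\<^sup>2) ^ ?j / fact ?j) * H'_const l lam k CARD('n))
       - of_real (lam powi (2 * int n - 4 * int k)) * lower_series (- {?j}) (- of_nat ?j) (pi * lam\<^sup>2 * (norm v)\<^sup>2)" for v :: "real^'n"
    have C: "Crandall_reg t lam k n = F"
      unfolding t F_def fun_eq_iff Crandall_reg_eq_series[OF l lam] Crandall_reg_series_def of_real_diff of_real_mult[of "lam powi (2 * int n - 4 * int k)"]
        Crandall_reg_series_summable(2)[OF l] by simp
    have F0: "F 0 = of_real (lam powi (2 * (int l - int k))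
         * ((- pi * (norm (0 :: real^'n))\<^sup>2) ^ ?j / fact ?j) * H'_const l lam k CARD('n))
       - of_real (lam powi (2 * int n - 4 * int k)) * lower_series (- {?j}) (- of_nat ?j) 0"
      by (simp add: F_def)
    show ?thesis unfolding C F0 unfolding F_def by (intro tendsto_intros ser) auto
  next
    case False
    let ?\<sigma> = "(t + 2 * (of_nat n - of_nat k)) / 2"
    have \<sigma>: "?\<sigma> \<notin> \<int>\<^sub>\<le>\<^sub>0"
    proof
      assume "?\<sigma> \<in> \<int>\<^sub>\<le>\<^sub>0"
      then obtain i :: nat where i: "?\<sigma> = - of_nat i" unfolding range_neg_nat[symmetric] by auto
      have "t = 2 * ?\<sigma> - 2 * (of_nat n - of_nat k)" by (simp add: field_simps)
      then have "t = - 2 * of_nat (n - k + i)" unfolding i using k by (simp add: of_nat_diff algebra_simps)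
      moreover have "n \<le> (n - k + i) + k" using k by simp
      ultimately show False using False by blast
    qed
    then have "?\<sigma> \<notin> (\<lambda>j. - of_nat j) ` UNIV" unfolding range_neg_nat .
    note ser = ser[OF this]
    have sq: "pi * (norm (lam *\<^sub>R v))\<^sup>2 = pi * lam\<^sup>2 * (norm v)\<^sup>2" for v :: "real^'n" by (simp add: power_mult_distrib)
    define F where "F v = - complex_of_real (lam powi (2 * int n - 4 * int k)) * lower_series UNIV ?\<sigma> (pi * lam\<^sup>2 * (norm v)\<^sup>2)" for v :: "real^'n"
    have C: "Crandall_reg t lam k n = F"
      unfolding F_def fun_eq_iff Crandall_reg_def if_not_P[OF False] lower_Crandall_eq[OF \<sigma>] sq by simp
    have F0: "F 0 = - of_real (lam powi (2 * int n - 4 * int k)) * lower_series UNIV ?\<sigma> 0"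
      by (simp add: F_def)
    show ?thesis unfolding C F0 unfolding F_def by (intro tendsto_intros ser)
  qed
qed

lemma crandall_term_tendsto:
  fixes A :: "real^'n^'n" and \<alpha> :: "nat^'n"
  assumes A: "invertible A" and lam: "lam > 0" and k: "k \<le> mi_size \<alpha> div 2"
  shows "(crandall_term A \<alpha> lam \<nu> x k \<longlongrightarrow> crandall_term A \<alpha> lam \<nu> x k 0) (at 0)"
proof -
  let ?h = "harmonic_part \<alpha> k"
  have rp: "real_polynomial_function ?h" by (rule homogeneous_polynomialD(1)[OF harmonic_part_props(1)[OF k]])
  have h: "(?h \<longlongrightarrow> ?h 0) (at 0)"
    using continuous_real_polymonial_function[OF rp, of 0] by (simp add: isCont_def)
  let ?c = "\<lambda>z. complex_of_real (?h (z - x)) * upper_Crandall_over_Gamma (\<nu> - 2 * of_nat k) ((z - x) /\<^sub>R lam)"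
  \<comment> \<open>The phases have modulus 1, so absolute summability at y = 0 provides a majorant
    for every y.\<close>
  have "(\<lambda>z. ?c z * ephase (- (0 \<bullet> (z - x)))) summable_on lattice_of A"
    using primal_sum_eq[OF A rp lam, of x \<nu> k 0] by (auto simp: summable_on_def)
  then have M: "(\<lambda>z. norm (?c z)) summable_on lattice_of A"
    by (simp add: summable_on_iff_abs_summable_on_complex)
  have "continuous_on UNIV (\<lambda>y. \<Sum>\<^sub>\<infinity>z\<in>lattice_of A. ?c z * ephase (- (y \<bullet> (z - x))))"
    by (rule continuous_on_infsum[OF _ _ M]) (intro continuous_intros, simp add: norm_mult)
  then have p: "((\<lambda>y. \<Sum>\<^sub>\<infinity>z\<in>lattice_of A. ?c z * ephase (- (y \<bullet> (z - x)))) \<longlongrightarrow> (\<Sum>\<^sub>\<infinity>z\<in>lattice_of A. ?c z * ephase (- (0 \<bullet> (z - x))))) (at 0)"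
    unfolding continuous_on_eq_continuous_at[OF open_UNIV] isCont_def by (rule bspec) simp
  have c: "pi * lam\<^sup>2 > 0" using lam by simp
  show ?thesis
    unfolding crandall_term_def[abs_def] dual_lattice_of_def
    by (intro tendsto_intros p h Crandall_reg_tendsto[OF lam] dual_sum_tendsto[OF dual_lattice_invertible[OF A] rp c]) (use k in auto)
qed

text \<open>The dual lattice has no other point than 0 near 0. Hence the formula holds on a
  punctured ball, and the limit defining the value at 0 can be computed on its right-hand
  side.\<close>

lemma epstein_zeta_reg_eq:
  fixes A :: "real^'n^'n" and \<alpha> :: "nat^'n"
  assumes A: "invertible A" and y: "y \<in> (UNIV - dual_lattice_of A) \<union> {0}" and lam: "lam > 0"
  shows "epstein_zeta_reg A \<nu> \<alpha> x y = (\<Sum>k = 0..mi_size \<alpha> div 2. crandall_term A \<alpha> lam \<nu> x k y)"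
proof (cases "y = 0")
  case True
  obtain \<epsilon> where \<epsilon>: "\<epsilon> > 0" "\<And>z. z \<in> dual_lattice_of A \<Longrightarrow> z + 0 \<noteq> 0 \<Longrightarrow> norm (z + 0) \<ge> \<epsilon>"
    using lattice_shift_discrete[OF dual_lattice_invertible[OF A]] unfolding dual_lattice_of_def by blast
  have "eventually (\<lambda>y. y \<in> ball 0 \<epsilon> - {0}) (at (0 :: real^'n))"
    using \<epsilon>(1) by (intro eventually_at_in_open) auto
  then have ev: "eventually (\<lambda>y. (\<Sum>k = 0..mi_size \<alpha> div 2. crandall_term A \<alpha> lam \<nu> x k y) = epstein_zeta_reg_nz A \<nu> \<alpha> x y) (at 0)"
  proof eventually_elim
    case (elim y)
    then have "y \<notin> dual_lattice_of A" using \<epsilon>(2)[of y] by auto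
    from epstein_zeta_reg_nz_eq[OF A this lam] show ?case by simp
  qed
  have "((\<lambda>y. \<Sum>k = 0..mi_size \<alpha> div 2. crandall_term A \<alpha> lam \<nu> x k y) \<longlongrightarrow> (\<Sum>k = 0..mi_size \<alpha> div 2. crandall_term A \<alpha> lam \<nu> x k 0)) (at 0)"
    by (intro tendsto_sum crandall_term_tendsto[OF A lam]) auto
  then have "(epstein_zeta_reg_nz A \<nu> \<alpha> x \<longlongrightarrow> (\<Sum>k = 0..mi_size \<alpha> div 2. crandall_term A \<alpha> lam \<nu> x k 0)) (at 0)"
    using tendsto_cong[OF ev] by blast
  then show ?thesis using True by (simp add: epstein_zeta_reg_def tendsto_Lim)
next
  case False
  then show ?thesis using y epstein_zeta_reg_nz_eq[OF A _ lam] by (simp add: epstein_zeta_reg_def)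
qed

section \<open>Passage to sums over shifted lattices\<close>

lemma infsum_lattice_shift: "infsum f ((\<lambda>z. z - x) ` I) = (\<Sum>\<^sub>\<infinity>z\<in>I. f (z - x :: 'a :: ab_group_add))"
  by (subst infsum_reindex) (auto simp: inj_on_def o_def)

lemma summable_lattice_shift: "f summable_on ((\<lambda>z. z - x) ` I) \<longleftrightarrow> (\<lambda>z. f (z - x :: 'a :: ab_group_add)) summable_on I"
  by (subst summable_on_reindex) (auto simp: inj_on_def o_def)

text \<open>Summability is asserted along with the identity because an infinite sum takes the
  default value 0 when it does not converge.\<close>

theorem theorem3p7:
  fixes A :: "real^'n^'n" and x y :: "real^'n" and \<nu> :: complex and \<alpha> :: "nat^'n"
    and lam :: real
  assumes "invertible A"
    and "y \<in> (UNIV - dual_lattice_of A) \<union> {0}"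
    and "lam > 0"
  shows
    "(\<forall>k \<le> mi_size \<alpha> div 2.
        (\<lambda>z. of_real (harmonic_part \<alpha> k z) * upper_Crandall (\<nu> - 2 * of_nat k) (z /\<^sub>R lam)
              * exp (- 2 * of_real pi * \<i> * of_real (y \<bullet> z)))
          summable_on ((\<lambda>z. z - x) ` lattice_of A)
      \<and> (\<lambda>p. of_real (harmonic_part \<alpha> k p)
              * upper_Crandall (of_nat CARD('n) - \<nu> + 2 * (of_nat (mi_size \<alpha>) - of_nat k)) (lam *\<^sub>R p)
              * exp (- 2 * of_real pi * \<i> * of_real (x \<bullet> (p - y))))
          summable_on ((\<lambda>p. p + y) ` dual_lattice_of A - {y}))
   \<and> epstein_zeta_reg A \<nu> \<alpha> x y =
      (\<Sum>k = 0..mi_size \<alpha> div 2.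
        of_real (pi / lam\<^sup>2) powr (\<nu> / 2 - of_nat k) *
        ((\<Sum>\<^sub>\<infinity>z\<in>(\<lambda>z. z - x) ` lattice_of A.
            of_real (harmonic_part \<alpha> k z) * upper_Crandall_over_Gamma (\<nu> - 2 * of_nat k) (z /\<^sub>R lam)
              * exp (- 2 * of_real pi * \<i> * of_real (y \<bullet> z)))
         + rGamma (\<nu> / 2 - of_nat k) * (- 1) ^ k
            * (of_real (lam ^ CARD('n)) / (\<i> ^ mi_size \<alpha> * of_real (covolume A)))
            * (of_real (harmonic_part \<alpha> k y)
                 * Crandall_reg (of_nat CARD('n) - \<nu>) lam k (mi_size \<alpha>) y
               + of_real (lam powi (2 * int (mi_size \<alpha>) - 4 * int k))
                 * (\<Sum>\<^sub>\<infinity>p\<in>(\<lambda>p. p + y) ` dual_lattice_of A - {y}.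
                      of_real (harmonic_part \<alpha> k p)
                      * upper_Crandall (of_nat CARD('n) - \<nu> + 2 * (of_nat (mi_size \<alpha>) - of_nat k))
                          (lam *\<^sub>R p)
                      * exp (- 2 * of_real pi * \<i> * of_real (x \<bullet> (p - y)))))))
   \<and> (\<forall>(l::nat) (k::nat) (n::nat) (v::real^'n). 2 * k \<le> n \<longrightarrow> n \<le> l + k \<longrightarrow>
        (\<lambda>j::nat. (- pi * lam\<^sup>2 * (norm v)\<^sup>2) ^ j
             / ((real j + real n - real l - real k) * fact j)) summable_on (- {l + k - n})
      \<and> Crandall_reg (- 2 * of_nat l) lam k n v = of_real (Crandall_reg_series l lam k n v))"
proof -
  note A = assms(1) and y = assms(2) and lam = assms(3)
  let ?n = "mi_size \<alpha>" and ?D = "dual_lattice_of A - {0}"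
  have e: "exp (- 2 * of_real pi * \<i> * of_real t) = ephase (- t)" for t by (simp add: ephase_def)
  \<comment> \<open>For y = 0 this holds by the choice of index set; otherwise q + y = 0 would put y
    into the dual lattice.\<close>
  have nz: "q + y \<noteq> 0" if "q \<in> ?D" for q
    using y that dual_shift_nonzero[of y A q] by (cases "y = 0") auto
  have img: "(\<lambda>p. p + y) ` dual_lattice_of A - {y} = (\<lambda>p. p - (- y)) ` ?D" by auto
  have U: "upper_Crandall (of_nat CARD('n) - \<nu> + 2 * (of_nat ?n - of_nat k)) (lam *\<^sub>R (q + y))
     = gexp_int ((of_nat CARD('n) - \<nu>) / 2 + of_nat ?n - of_nat k) (pi * lam\<^sup>2 * (norm (q + y))\<^sup>2)" if "q \<in> ?D" for q k
  proof -
    have "lam *\<^sub>R (q + y) \<noteq> 0" using nz[OF that] lam by simp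
    moreover have "(of_nat CARD('n) - \<nu> + 2 * (of_nat ?n - of_nat k)) / 2 = (of_nat CARD('n) - \<nu>) / 2 + of_nat ?n - of_nat k"
      by (simp add: field_simps)
    moreover have "pi * (norm (lam *\<^sub>R (q + y)))\<^sup>2 = pi * lam\<^sup>2 * (norm (q + y))\<^sup>2" by (simp add: power_mult_distrib)
    ultimately show ?thesis using upper_Crandall_eq by metis
  qed
  have D: "of_real (harmonic_part \<alpha> k (q - - y)) * upper_Crandall (of_nat CARD('n) - \<nu> + 2 * (of_nat ?n - of_nat k)) (lam *\<^sub>R (q - - y))
        * ephase (- (x \<bullet> (q - - y - y)))
     = of_real (harmonic_part \<alpha> k (q + y)) * ephase (- (x \<bullet> q))
         * gexp_int ((of_nat CARD('n) - \<nu>) / 2 + of_nat ?n - of_nat k) (pi * lam\<^sup>2 * (norm (q + y))\<^sup>2)" if "q \<in> ?D" for q k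
    using U[OF that] by (simp add: mult_ac)
  have D': "(\<Sum>\<^sub>\<infinity>q\<in>?D. of_real (harmonic_part \<alpha> k (q - - y)) * upper_Crandall (of_nat CARD('n) - \<nu> + 2 * (of_nat ?n - of_nat k)) (lam *\<^sub>R (q - - y))
        * ephase (- (x \<bullet> (q - - y - y))))
     = (\<Sum>\<^sub>\<infinity>q\<in>?D. of_real (harmonic_part \<alpha> k (q + y)) * ephase (- (x \<bullet> q))
         * gexp_int ((of_nat CARD('n) - \<nu>) / 2 + of_nat ?n - of_nat k) (pi * lam\<^sup>2 * (norm (q + y))\<^sup>2))" for k
    by (rule infsum_cong) (rule D)
  have rp: "real_polynomial_function (harmonic_part \<alpha> k)" if "k \<le> ?n div 2" for k
    by (rule homogeneous_polynomialD(1)[OF harmonic_part_props(1)[OF that]])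
  show ?thesis
  proof (intro conjI allI impI Crandall_reg_series_summable(1) Crandall_reg_eq_series[OF _ lam], goal_cases)
    case k: (1 k)
    let ?f = "\<lambda>z. complex_of_real (harmonic_part \<alpha> k (z - x)) * upper_Crandall (\<nu> - 2 * of_nat k) ((z - x) /\<^sub>R lam) * ephase (- (y \<bullet> (z - x)))"
    have c: "pi / lam\<^sup>2 > 0" using lam by simp
    have "(\<lambda>z. of_real (harmonic_part \<alpha> k (z + - x)) * ephase (- (y \<bullet> (z - x))) * gexp_int (\<nu> / 2 - of_nat k) (pi / lam\<^sup>2 * (norm (z + - x))\<^sup>2))
        summable_on (lattice_of A - {x})"
      by (rule gexp_sum_summable[OF A rp[OF k] c]) auto
    then have "?f summable_on (lattice_of A - {x})"
    proof (rule summable_on_cong[THEN iffD1, rotated])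
      fix z assume "z \<in> lattice_of A - {x}"
      then have "(z - x) /\<^sub>R lam \<noteq> 0" using lam by simp
      moreover have "(\<nu> - 2 * of_nat k) / 2 = \<nu> / 2 - of_nat k" by (simp add: diff_divide_distrib)
      moreover have "pi * (norm (w /\<^sub>R lam))\<^sup>2 = pi / lam\<^sup>2 * (norm w)\<^sup>2" for w :: "real^'n"
        using lam by (simp add: power_mult_distrib field_simps)
      ultimately have "upper_Crandall (\<nu> - 2 * of_nat k) ((z - x) /\<^sub>R lam) = gexp_int (\<nu> / 2 - of_nat k) (pi / lam\<^sup>2 * (norm (z - x))\<^sup>2)"
        using upper_Crandall_eq by metis
      then show "of_real (harmonic_part \<alpha> k (z + - x)) * ephase (- (y \<bullet> (z - x))) * gexp_int (\<nu> / 2 - of_nat k) (pi / lam\<^sup>2 * (norm (z + - x))\<^sup>2) = ?f z"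
        by simp
    qed
    \<comment> \<open>Adding the single point z = x preserves summability, whatever the value of the
      term there.\<close>
    then have "?f summable_on ((lattice_of A - {x}) \<union> {x})" by (rule summable_on_Un_disjoint) auto
    then have "?f summable_on lattice_of A" by (rule summable_on_subset_banach) auto
    then show ?case unfolding summable_lattice_shift e .
  next
    case k: (2 k)
    have c: "pi * lam\<^sup>2 > 0" using lam by simp
    have "(\<lambda>q. of_real (harmonic_part \<alpha> k (q + y)) * ephase (- (x \<bullet> q))
         * gexp_int ((of_nat CARD('n) - \<nu>) / 2 + of_nat ?n - of_nat k) (pi * lam\<^sup>2 * (norm (q + y))\<^sup>2)) summable_on ?D"
      by (rule gexp_sum_summable[OF dual_lattice_invertible[OF A] rp[OF k] c]) (use nz in \<open>auto simp: dual_lattice_of_def\<close>)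
    then show ?case unfolding img summable_lattice_shift e by (rule summable_on_cong[THEN iffD1, rotated]) (rule D[symmetric])
  next
    case 3
    show ?case
      unfolding epstein_zeta_reg_eq[OF A y lam] crandall_term_def img infsum_lattice_shift e D' ..
  qed
qed

end
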